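(* Let $\mathfrak{a}=(\mathbf{z}^{\alpha_1},\ldots,\mathbf{z}^{\alpha_k})\subset\mathbb{C}[z_1,\ldots,z_n]$ be a monomial ideal and let $H=\{z_1=0\}\subset \mathbb{C}^n$, with $\mathfrak{a}\nsubseteq(z_1)$. Let $P(\mathfrak a)$ be the Newton polyhedron of $\mathfrak a$, let $F_1$ be the (infinite) face of $P(\mathfrak{a})$ contained in $\{x_1=0\}$, let $\mathrm{ri}(F_1)$ be its relative interior, and set $\widetilde{\mathbf{1}}=(0,1,\ldots,1)\in\mathbb{R}^n$. Then for every real $c>0$, the adjoint ideal $\mathrm{Adj}(\mathfrak{a}^c,H)$ is a monomial ideal, and for every $\beta\in\mathbb{N}^n$, $$\mathbf{z}^{\beta}\in\mathrm{Adj}(\mathfrak{a}^c,H)\quad\Longleftrightarrow\quad \beta+\widetilde{\mathbf{1}}\in c\cdot\operatorname{int}P(\mathfrak{a})\ \cup\ c\cdot\mathrm{ri}(F_1),$$ where $\operatorname{int}$ denotes the interior in $\mathbb{R}^n$.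
   Context: For $\alpha=(a_1,\ldots,a_n)\in\mathbb{N}^n$, $\mathbf{z}^\alpha=z_1^{a_1}\cdots z_n^{a_n}$. The Newton polyhedron $P(\mathfrak{a})$ is the convex hull in $\mathbb{R}^n$ of $\bigcup_i(\alpha_i+\mathbb{R}_+^n)$. The relative interior $\mathrm{ri}(F_1)$ of $F_1=P(\mathfrak{a})\cap\{x_1=0\}$ is its interior as a subset of the hyperplane $\{x_1=0\}$. Adjoint ideal: let $X$ be a smooth complex variety, $\mathfrak{a}\subset\mathcal{O}_X$ a non-zero ideal sheaf, $c>0$ a real number and $D$ a reduced divisor on $X$ such that $\mathfrak{a}$ is not contained in the ideal sheaf of any irreducible component of $D$. Fix a log resolution $\mu:\widetilde X\to X$ of $\mathfrak{a}$, with $\mathfrak{a}\cdot\mathcal{O}_{\widetilde X}=\mathcal{O}_{\widetilde X}(-F)$, such that $F+\mu^*D+K_{\widetilde X/X}+\mathrm{Exc}(\mu)$ is a simple normal crossing divisor. Then $$\mathrm{Adj}(\mathfrak{a}^c,D)=\mu_*\mathcal{O}_{\widetilde X}\big(K_{\widetilde X/X}-[c\cdot F]-\mu^*D+D'\big),$$ where $K_{\widetilde X/X}=K_{\widetilde X}-\mu^*K_X$, $[\,\cdot\,]$ is the integral part (round-down) of a divisor and $D'$ is the strict transform of $D$. Here $X=\mathbb{C}^n$ and $D=H$. *)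

theory Defs
  imports "HOL-Analysis.Analysis" "HOL-Library.Poly_Mapping"
begin

type_synonym 'v mpoly = "('v \<Rightarrow>\<^sub>0 nat) \<Rightarrow>\<^sub>0 complex"

definition peval :: "('v \<Rightarrow> complex) \<Rightarrow> 'v mpoly \<Rightarrow> complex" where
  "peval x P = (\<Sum>m\<in>Poly_Mapping.keys P. Poly_Mapping.lookup P m *
     (\<Prod>v\<in>Poly_Mapping.keys m. x v ^ Poly_Mapping.lookup m v))"

definition mpoly_monom :: "('v \<Rightarrow>\<^sub>0 nat) \<Rightarrow> 'v mpoly" where
  "mpoly_monom m = Poly_Mapping.single m 1"

definition var :: "'v \<Rightarrow> 'v mpoly" where
  "var v = mpoly_monom (Poly_Mapping.single v 1)"

definition ideal_gen :: "'v mpoly set \<Rightarrow> 'v mpoly set" where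
  "ideal_gen S = module.span (*) S"

definition monomial_ideal :: "'v mpoly set \<Rightarrow> bool" where
  "monomial_ideal I \<longleftrightarrow> (\<exists>B. I = ideal_gen (mpoly_monom ` B))"

definition exponent_vec :: "('n::finite \<Rightarrow>\<^sub>0 nat) \<Rightarrow> real ^ 'n" where
  "exponent_vec m = (\<chi> j. real (Poly_Mapping.lookup m j))"

definition newton_polyhedron :: "('n::finite \<Rightarrow>\<^sub>0 nat) set \<Rightarrow> (real ^ 'n) set" where
  "newton_polyhedron A = convex hull (\<Union>m\<in>A. {exponent_vec m + y | y. \<forall>j. 0 \<le> y $ j})"

definition newton_face :: "'n::finite \<Rightarrow> ('n \<Rightarrow>\<^sub>0 nat) set \<Rightarrow> (real ^ 'n) set" where
  "newton_face i A = newton_polyhedron A \<inter> {x. x $ i = 0}"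

definition newton_face_ri :: "'n::finite \<Rightarrow> ('n \<Rightarrow>\<^sub>0 nat) set \<Rightarrow> (real ^ 'n) set" where
  "newton_face_ri i A = top_of_set {x. x $ i = 0} interior_of newton_face i A"

definition one_tilde :: "'n::finite \<Rightarrow> real ^ 'n" where
  "one_tilde i = (\<chi> j. if j = i then 0 else 1)"

text \<open>A projective morphism to the affine variety \<open>\<complex>\<^sup>n\<close> is the same thing as the first projection
  of a Zariski closed subset of \<open>\<complex>\<^sup>n \<times> \<P>\<^sup>N\<close>. Here \<open>\<P>\<^sup>N\<close> is the type \<open>'m proj\<close>
  with \<open>CARD('m) = N + 1\<close>, and the coordinates of \<open>\<complex>\<^sup>n\<close> are indexed by the type \<open>'n\<close>.\<close>

quotient_type 'm proj = "complex ^ ('m::finite)" / partial: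
  "\<lambda>v w. v \<noteq> 0 \<and> w \<noteq> 0 \<and> (\<exists>t. t \<noteq> 0 \<and> w = t *s v)"
proof (rule part_equivpI)
  show "\<exists>x::complex ^ 'm. x \<noteq> 0 \<and> x \<noteq> 0 \<and> (\<exists>t. t \<noteq> 0 \<and> x = t *s x)"
    by (rule exI[of _ 1]) (auto intro!: exI[of _ 1])
  show "symp (\<lambda>v w::complex ^ 'm. v \<noteq> 0 \<and> w \<noteq> 0 \<and> (\<exists>t. t \<noteq> 0 \<and> w = t *s v))"
  proof (rule sympI, elim conjE exE)
    fix v w :: "complex ^ 'm" and t
    assume "v \<noteq> 0" "w \<noteq> 0" "t \<noteq> 0" "w = t *s v"
    then show "w \<noteq> 0 \<and> v \<noteq> 0 \<and> (\<exists>t. t \<noteq> 0 \<and> v = t *s w)"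
      by (auto intro!: exI[of _ "inverse t"] simp: vector_smult_assoc)
  qed
  show "transp (\<lambda>v w::complex ^ 'm. v \<noteq> 0 \<and> w \<noteq> 0 \<and> (\<exists>t. t \<noteq> 0 \<and> w = t *s v))"
  proof (rule transpI, elim conjE exE)
    fix u v w :: "complex ^ 'm" and s t
    assume "u \<noteq> 0" "w \<noteq> 0" "s \<noteq> 0" "t \<noteq> 0" "v = s *s u" "w = t *s v"
    then show "u \<noteq> 0 \<and> w \<noteq> 0 \<and> (\<exists>t. t \<noteq> 0 \<and> w = t *s u)"
      by (auto intro!: exI[of _ "t * s"] simp: vector_smult_assoc)
  qed
qed

type_synonym ('n, 'm) pt = "(complex ^ 'n) \<times> 'm proj"

text \<open>\<open>pval P p\<close> depends on the representative of the point of projective space chosen by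
  \<open>rep_proj\<close>. It is only used for polynomials that are homogeneous in the projective variables
  \<open>Inr j\<close>, and only through its vanishing or through quotients of equal degree.\<close>

definition pval :: "('n + 'm) mpoly \<Rightarrow> ('n::finite, 'm::finite) pt \<Rightarrow> complex" where
  "pval P p = peval (case_sum (\<lambda>i. fst p $ i) (\<lambda>j. rep_proj (snd p) $ j)) P"

definition proj_homogeneous :: "nat \<Rightarrow> ('n + 'm::finite) mpoly \<Rightarrow> bool" where
  "proj_homogeneous d P \<longleftrightarrow>
     (\<forall>m\<in>Poly_Mapping.keys P. (\<Sum>j\<in>UNIV. Poly_Mapping.lookup m (Inr j)) = d)"

definition zclosed :: "('n::finite, 'm::finite) pt set \<Rightarrow> bool" where
  "zclosed S \<longleftrightarrow> (\<exists>Ps. (\<forall>P\<in>Ps. \<exists>d. proj_homogeneous d P) \<and> S = {p. \<forall>P\<in>Ps. pval P p = 0})"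

definition zclosure :: "('n::finite, 'm::finite) pt set \<Rightarrow> ('n, 'm) pt set" where
  "zclosure S = \<Inter>{C. zclosed C \<and> S \<subseteq> C}"

definition zopen_in :: "('n::finite, 'm::finite) pt set \<Rightarrow> ('n, 'm) pt set \<Rightarrow> bool" where
  "zopen_in X U \<longleftrightarrow> (\<exists>C. zclosed C \<and> U = X - C)"

definition irreducible_closed :: "('n::finite, 'm::finite) pt set \<Rightarrow> bool" where
  "irreducible_closed S \<longleftrightarrow> zclosed S \<and> S \<noteq> {} \<and>
     (\<forall>S1 S2. zclosed S1 \<and> zclosed S2 \<and> S \<subseteq> S1 \<union> S2 \<longrightarrow> S \<subseteq> S1 \<or> S \<subseteq> S2)"

definition prime_divisor :: "('n::finite, 'm::finite) pt set \<Rightarrow> ('n, 'm) pt set \<Rightarrow> bool" where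
  "prime_divisor X E \<longleftrightarrow> irreducible_closed E \<and> E \<subset> X \<and>
     \<not> (\<exists>Z. irreducible_closed Z \<and> E \<subset> Z \<and> Z \<subset> X)"

text \<open>The local ring of \<open>X\<close> at \<open>p\<close> consists of the germs at \<open>p\<close> of the functions \<open>f\<close> with
  \<open>regular_at X p f\<close>. Germs are represented by total functions, whose values away from \<open>p\<close>
  or outside \<open>X\<close> are irrelevant, and equality of germs is equality \<open>near X p\<close>.\<close>

definition near :: "('n::finite, 'm::finite) pt set \<Rightarrow> ('n, 'm) pt \<Rightarrow>
    (('n, 'm) pt \<Rightarrow> bool) \<Rightarrow> bool" where
  "near X p R \<longleftrightarrow> (\<exists>U. zopen_in X U \<and> p \<in> U \<and> (\<forall>q\<in>U. R q))"

definition regular_at :: "('n::finite, 'm::finite) pt set \<Rightarrow> ('n, 'm) pt \<Rightarrow>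
    (('n, 'm) pt \<Rightarrow> complex) \<Rightarrow> bool" where
  "regular_at X p f \<longleftrightarrow> (\<exists>d P Q. proj_homogeneous d P \<and> proj_homogeneous d Q \<and>
     near X p (\<lambda>q. pval Q q \<noteq> 0 \<and> f q = pval P q / pval Q q))"

definition divides_at :: "('n::finite, 'm::finite) pt set \<Rightarrow> ('n, 'm) pt \<Rightarrow>
    (('n, 'm) pt \<Rightarrow> complex) \<Rightarrow> (('n, 'm) pt \<Rightarrow> complex) \<Rightarrow> bool" where
  "divides_at X p g f \<longleftrightarrow> (\<exists>h. regular_at X p h \<and> near X p (\<lambda>q. f q = g q * h q))"

definition in_max_ideal_square :: "('n::finite, 'm::finite) pt set \<Rightarrow> ('n, 'm) pt \<Rightarrow>
    (('n, 'm) pt \<Rightarrow> complex) \<Rightarrow> bool" where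
  "in_max_ideal_square X p f \<longleftrightarrow> (\<exists>(N::nat) g h.
     (\<forall>k<N. regular_at X p (g k) \<and> g k p = 0 \<and> regular_at X p (h k) \<and> h k p = 0) \<and>
     near X p (\<lambda>q. f q = (\<Sum>k<N. g k q * h k q)))"

text \<open>A regular system of parameters: \<open>CARD('n)\<close> generators of the maximal ideal at \<open>p\<close>. It is
  only used on varieties that are birational to \<open>\<complex>\<^sup>n\<close>, hence of dimension \<open>CARD('n)\<close>.\<close>

definition local_params :: "('n::finite, 'm::finite) pt set \<Rightarrow> ('n, 'm) pt \<Rightarrow>
    ('n \<Rightarrow> ('n, 'm) pt \<Rightarrow> complex) \<Rightarrow> bool" where
  "local_params X p x \<longleftrightarrow> (\<forall>j. regular_at X p (x j) \<and> x j p = 0) \<and>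
     (\<forall>f. regular_at X p f \<and> f p = 0 \<longrightarrow>
        (\<exists>g. (\<forall>j. regular_at X p (g j)) \<and> near X p (\<lambda>q. f q = (\<Sum>j\<in>UNIV. g j q * x j q))))"

definition smooth_variety :: "('n::finite, 'm::finite) pt set \<Rightarrow> bool" where
  "smooth_variety X \<longleftrightarrow> (\<forall>p\<in>X. \<exists>x. local_params X p x)"

text \<open>\<open>e\<close> generates the ideal of \<open>E\<close> in the local ring at \<open>p\<close>.\<close>

definition local_equation :: "('n::finite, 'm::finite) pt set \<Rightarrow> ('n, 'm) pt set \<Rightarrow> ('n, 'm) pt \<Rightarrow>
    (('n, 'm) pt \<Rightarrow> complex) \<Rightarrow> bool" where
  "local_equation X E p e \<longleftrightarrow> regular_at X p e \<and> near X p (\<lambda>q. q \<in> E \<longrightarrow> e q = 0) \<and>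
     (\<forall>f. regular_at X p f \<and> near X p (\<lambda>q. q \<in> E \<longrightarrow> f q = 0) \<longrightarrow> divides_at X p e f)"

text \<open>The order of vanishing of \<open>f\<close> along the prime divisor \<open>E\<close> of a smooth variety. It is enough
  that \<open>f\<close> is regular and not identically zero near some point of \<open>E\<close>: since \<open>E\<close> is irreducible,
  the order does not depend on the point at which it is computed. It is meaningless for \<open>f = 0\<close>.\<close>

definition ord_along :: "('n::finite, 'm::finite) pt set \<Rightarrow> ('n, 'm) pt set \<Rightarrow>
    (('n, 'm) pt \<Rightarrow> complex) \<Rightarrow> nat" where
  "ord_along X E f = (THE k. \<exists>p\<in>E. \<exists>e h. local_equation X E p e \<and> regular_at X p h \<and>
     \<not> near X p (\<lambda>q. q \<in> E \<longrightarrow> h q = 0) \<and> near X p (\<lambda>q. f q = e q ^ k * h q))"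

text \<open>From here on \<open>X\<close> plays the role of the source of \<open>\<mu> = fst : X \<rightarrow> \<complex>\<^sup>n\<close>.\<close>

definition pullback :: "('n::finite) mpoly \<Rightarrow> ('n, 'm::finite) pt \<Rightarrow> complex" where
  "pullback f p = peval (\<lambda>i. fst p $ i) f"

text \<open>\<open>\<mu>\<close> is an isomorphism over a neighbourhood (namely \<open>f \<noteq> 0\<close>) of the point \<open>z\<close>: the inverse
  is given there by polynomial homogeneous coordinates \<open>G\<close> without common zero.\<close>

definition iso_over :: "('n::finite, 'm::finite) pt set \<Rightarrow> complex ^ 'n \<Rightarrow> bool" where
  "iso_over X z \<longleftrightarrow> (\<exists>f (G :: 'm \<Rightarrow> 'n mpoly). peval (\<lambda>i. z $ i) f \<noteq> 0 \<and>
     (\<forall>y. peval (\<lambda>i. y $ i) f \<noteq> 0 \<longrightarrow>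
        (\<chi> j. peval (\<lambda>i. y $ i) (G j)) \<noteq> 0 \<and>
        {l. (y, l) \<in> X} = {abs_proj (\<chi> j. peval (\<lambda>i. y $ i) (G j))}))"

definition exceptional_locus :: "('n::finite, 'm::finite) pt set \<Rightarrow> ('n, 'm) pt set" where
  "exceptional_locus X = {p \<in> X. \<not> iso_over X (fst p)}"

definition strict_transform :: "('n::finite, 'm::finite) pt set \<Rightarrow> 'n \<Rightarrow> ('n, 'm) pt set" where
  "strict_transform X i = zclosure {p \<in> X. fst p $ i = 0 \<and> iso_over X (fst p)}"

text \<open>\<open>g\<close> generates the extension of the ideal \<open>I\<close> to the local ring at \<open>p\<close>, i.e. it is a local
  equation at \<open>p\<close> of the effective divisor \<open>F\<close> with \<open>I \<cdot> O_X = O_X(-F)\<close>.\<close>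

definition generates_pullback :: "('n::finite, 'm::finite) pt set \<Rightarrow> 'n mpoly set \<Rightarrow> ('n, 'm) pt \<Rightarrow>
    (('n, 'm) pt \<Rightarrow> complex) \<Rightarrow> bool" where
  "generates_pullback X I p g \<longleftrightarrow> regular_at X p g \<and>
     (\<forall>f\<in>I. divides_at X p g (pullback f)) \<and>
     (\<exists>(N::nat) f h. (\<forall>k<N. f k \<in> I \<and> regular_at X p (h k)) \<and>
        near X p (\<lambda>q. g q = (\<Sum>k<N. h k q * pullback (f k) q)))"

definition mult_F :: "('n::finite, 'm::finite) pt set \<Rightarrow> 'n mpoly set \<Rightarrow> ('n, 'm) pt set \<Rightarrow> nat" where
  "mult_F X I E = (THE k. \<exists>p\<in>E. \<exists>g. generates_pullback X I p g \<and> k = ord_along X E g)"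

text \<open>\<open>J\<close> is the Jacobian matrix of \<open>\<mu>\<close> with respect to local coordinates \<open>x\<close> around \<open>p\<close>: at every
  point \<open>q\<close> near \<open>p\<close> the functions \<open>x_j - x_j(q)\<close> generate the maximal ideal and the differential
  of the \<open>i\<close>-th component of \<open>\<mu>\<close>, which is an element of the cotangent space \<open>m_q / m_q\<^sup>2\<close>,
  equals \<open>\<Sum>\<^sub>j J_ij(q) dx_j\<close>.\<close>

definition jacobian_near :: "('n::finite, 'm::finite) pt set \<Rightarrow> ('n, 'm) pt \<Rightarrow>
    ('n \<Rightarrow> ('n, 'm) pt \<Rightarrow> complex) \<Rightarrow> (('n, 'm) pt \<Rightarrow> complex ^ 'n ^ 'n) \<Rightarrow> bool" where
  "jacobian_near X p x J \<longleftrightarrow> near X p (\<lambda>q.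
     local_params X q (\<lambda>j r. x j r - x j q) \<and>
     (\<forall>i. in_max_ideal_square X q (\<lambda>r.
        fst r $ i - fst q $ i - (\<Sum>j\<in>UNIV. J q $ i $ j * (x j r - x j q)))))"

text \<open>The multiplicity of \<open>E\<close> in the relative canonical divisor of \<open>\<mu>\<close>, the zero divisor of the
  pullback of \<open>dz_1 \<and> \<dots> \<and> dz_n\<close>.\<close>

definition mult_K :: "('n::finite, 'm::finite) pt set \<Rightarrow> ('n, 'm) pt set \<Rightarrow> nat" where
  "mult_K X E = (THE k. \<exists>p\<in>E. \<exists>x J. jacobian_near X p x J \<and> k = ord_along X E (\<lambda>q. det (J q)))"

text \<open>The divisor \<open>\<Sum>E\<in>S. E\<close> has simple normal crossings: around every point its components are
  coordinate hyperplanes of one common local coordinate system. Distinct components through a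
  point belong to distinct coordinates because a prime divisor is determined by a local
  equation.\<close>

definition snc :: "('n::finite, 'm::finite) pt set \<Rightarrow> ('n, 'm) pt set set \<Rightarrow> bool" where
  "snc X S \<longleftrightarrow> (\<forall>p\<in>X. \<exists>x. local_params X p x \<and>
     (\<forall>E\<in>S. p \<in> E \<longrightarrow> (\<exists>j. local_equation X E p (x j))))"

text \<open>\<open>fst : X \<rightarrow> \<complex>\<^sup>n\<close> is a log resolution of \<open>I\<close> such that the sum of \<open>F\<close>, the pullback of
  \<open>D = {z_i = 0}\<close>, the relative canonical divisor and the exceptional divisor has simple normal
  crossings.\<close>

definition log_resolution ::
    "'n mpoly set \<Rightarrow> 'n \<Rightarrow> ('n::finite, 'm::finite) pt set \<Rightarrow> bool" where
  "log_resolution I i X \<longleftrightarrow>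
     irreducible_closed X \<and> smooth_variety X \<and> (\<exists>z. iso_over X z) \<and>
     (\<forall>p\<in>X. \<exists>g. generates_pullback X I p g) \<and>
     snc X {E. prime_divisor X E \<and>
       (0 < mult_F X I E \<or> 0 < ord_along X E (pullback (var i)) \<or> 0 < mult_K X E \<or>
        E \<subseteq> exceptional_locus X)}"

text \<open>\<open>Adj(I\<^sup>c, D)\<close> for \<open>D = {z_i = 0}\<close>, computed on the log resolution \<open>X\<close>, as an ideal of the
  polynomial ring: \<open>f\<close> belongs to it iff its pullback is a global section of
  \<open>O_X(K - [c F] - \<mu>\<^sup>*D + D')\<close>, i.e. iff it is zero or the divisor of the pullback plus the
  divisor in parentheses is effective.\<close>

definition Adj :: "('n::finite, 'm::finite) pt set \<Rightarrow> 'n mpoly set \<Rightarrow> real \<Rightarrow> 'n \<Rightarrow> 'n mpoly set" where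
  "Adj X I c i = {f. f = 0 \<or> (\<forall>E. prime_divisor X E \<longrightarrow>
     0 \<le> int (ord_along X E (pullback f))
        + (int (mult_K X E) - \<lfloor>c * real (mult_F X I E)\<rfloor>
           - int (ord_along X E (pullback (var i)))
           + (if E = strict_transform X i then 1 else 0)))}"

end

theory Submission
  imports Defs "HOL-Computational_Algebra.Fraction_Field"
begin

text \<open>Let \<open>v\<close> be the order along a prime divisor \<open>E\<close> of a log resolution. Comparing two Jacobian
  determinants gives \<open>K \<ge> v z\<^sub>1 + \<dots> + v z\<^sub>n - 1\<close> for the coefficient \<open>K\<close> of \<open>E\<close> in the relative
  canonical divisor, and \<open>K \<ge> v z\<^sub>i\<close> if \<open>v\<close> is positive on \<open>z\<^sub>i\<close> only and \<open>E\<close> is not the strict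
  transform. Hence a monomial whose exponent satisfies the condition belongs to the adjoint ideal.

  Conversely, if the exponent \<open>\<beta>\<close> violates the condition, then separation of convex sets yields
  weights \<open>w \<ge> 0\<close> with \<open>w \<bullet> (\<beta> + 1\<^sub>i) \<le> c * min {w \<bullet> \<alpha>}\<close>, and \<open>w\<close> may be taken normal to a
  facet of the Newton polyhedron. Then the monomial valuation with weights \<open>w\<close> is centred on every
  log resolution in a prime divisor: the Laurent monomials with exponents in the facet lattice
  are units along the centre, and \<open>n - 1\<close> of them are algebraically independent in its residue
  field. Here \<open>K = v z\<^sub>1 + \<dots> + v z\<^sub>n - 1\<close>, so that no polynomial containing \<open>z\<^sup>\<beta>\<close> lies in the
  adjoint ideal.\<close>

section \<open>Polynomials\<close>

text \<open>The given log resolution need not be toric, so its divisors cannot be listed. One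
  direction is therefore an inequality for every prime divisor; the other needs a single bad
  divisor, which has to be found on the given model. This is why the weight must be normal to a
  facet: the ideal becomes principal on X, which makes the ratios of the facet monomials invertible
  along the centre and so forces the centre to be large.

  The summand D' and the face F_1 concern valuations positive on z_i alone. For these F has
  coefficient 0, since some generator does not involve z_i, and the coefficient is nonnegative
  either because of D' or because K >= v z_i. Such valuations impose no condition, so a separating
  weight is always required to be positive somewhere apart from i; this also keeps its centre
  different from the strict transform.

  Dimension theory is replaced by two elementary facts: n + 1 rational functions are algebraically
  dependent, and a nonzero set of polynomials stable under partial derivatives contains a nonzero
  constant.\<close>

abbreviation lookup where "lookup \<equiv> Poly_Mapping.lookup"
abbreviation keys where "keys \<equiv> Poly_Mapping.keys"

definition rhom :: "('a::comm_ring_1 \<Rightarrow> 'b::comm_ring_1) \<Rightarrow> bool" where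
  "rhom h \<longleftrightarrow> h 0 = 0 \<and> h 1 = 1 \<and> (\<forall>a b. h (a + b) = h a + h b) \<and> (\<forall>a b. h (a * b) = h a * h b)"

lemma rhomI: "h 0 = 0 \<Longrightarrow> h 1 = 1 \<Longrightarrow> (\<And>a b. h (a + b) = h a + h b) \<Longrightarrow>
    (\<And>a b. h (a * b) = h a * h b) \<Longrightarrow> rhom h"
  by (simp add: rhom_def)

lemma rhom_simps:
  assumes "rhom h"
  shows "h 0 = 0" "h 1 = 1" "h (a + b) = h a + h b" "h (a * b) = h a * h b"
  using assms by (auto simp: rhom_def)

lemma rhom_uminus: "rhom h \<Longrightarrow> h (- a) = - h a"
  using rhom_simps(1)[of h] rhom_simps(3)[of h "- a" a] by (simp add: eq_neg_iff_add_eq_0)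

lemma rhom_diff: "rhom h \<Longrightarrow> h (a - b) = h a - h b"
  using rhom_simps(3)[of h a "- b"] by (simp add: rhom_uminus)

lemma rhom_sum: "rhom h \<Longrightarrow> h (sum f S) = (\<Sum>s\<in>S. h (f s))"
  by (induction S rule: infinite_finite_induct) (auto simp: rhom_simps)

lemma rhom_prod: "rhom h \<Longrightarrow> h (prod f S) = (\<Prod>s\<in>S. h (f s))"
  by (induction S rule: infinite_finite_induct) (auto simp: rhom_simps)

lemma rhom_power: "rhom h \<Longrightarrow> h (a ^ k) = h a ^ k"
  by (induction k) (auto simp: rhom_simps)

lemma rhom_comp: "rhom h \<Longrightarrow> rhom g \<Longrightarrow> rhom (\<lambda>a. h (g a))"
  by (simp add: rhom_def)

lemma rhom_id: "rhom (\<lambda>a. a)"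
  by (simp add: rhom_def)

text \<open>One evaluation map serves for values at points, for restriction to the graph, to lines
  and to the hyperplane, and for polynomial expressions in rational functions; only
  \<open>\<kappa>\<close> and the target ring change.\<close>

definition heval :: "(complex \<Rightarrow> 'a::comm_ring_1) \<Rightarrow> ('v \<Rightarrow> 'a) \<Rightarrow> 'v mpoly \<Rightarrow> 'a" where
  "heval \<kappa> x P = (\<Sum>m\<in>keys P. \<kappa> (lookup P m) * (\<Prod>v\<in>keys m. x v ^ lookup m v))"

lemma peval_heval: "peval x P = heval (\<lambda>c. c) x P"
  by (simp add: peval_def heval_def)

definition Cst :: "complex \<Rightarrow> 'v mpoly" where "Cst c = Poly_Mapping.single 0 c"

lemma mono_eval_add:
  fixes x :: "'v \<Rightarrow> 'a::comm_ring_1"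
  shows "(\<Prod>v\<in>keys (m + m'). x v ^ lookup (m + m') v) =
    (\<Prod>v\<in>keys m. x v ^ lookup m v) * (\<Prod>v\<in>keys m'. x v ^ lookup m' v)"
proof -
  let ?S = "keys m \<union> keys m'"
  have *: "(\<Prod>v\<in>keys k. x v ^ lookup k v) = (\<Prod>v\<in>?S. x v ^ lookup k v)" if "keys k \<subseteq> ?S" for k
    by (rule prod.mono_neutral_left) (use that in \<open>auto simp: in_keys_iff\<close>)
  show ?thesis
    by (subst (1 2 3) *) (auto simp: lookup_add power_add prod.distrib dest: subsetD[OF Poly_Mapping.keys_add])
qed

lemma heval_superset:
  assumes "finite S" "keys P \<subseteq> S" "\<kappa> 0 = 0"
  shows "heval \<kappa> x P = (\<Sum>m\<in>S. \<kappa> (lookup P m) * (\<Prod>v\<in>keys m. x v ^ lookup m v))"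
  unfolding heval_def
  by (rule sum.mono_neutral_left) (use assms in \<open>auto simp: in_keys_iff\<close>)

lemma heval_add:
  assumes "rhom \<kappa>" shows "heval \<kappa> x (P + Q) = heval \<kappa> x P + heval \<kappa> x Q"
proof -
  let ?S = "keys P \<union> keys Q"
  have k: "\<kappa> 0 = 0" using assms by (simp add: rhom_simps)
  have "keys (P + Q) \<subseteq> ?S" by (rule Poly_Mapping.keys_add)
  then show ?thesis
    using heval_superset[of ?S P \<kappa> x, OF _ _ k] heval_superset[of ?S Q \<kappa> x, OF _ _ k]
      heval_superset[of ?S "P + Q" \<kappa> x, OF _ _ k]
    by (simp add: lookup_add rhom_simps[OF assms] algebra_simps sum.distrib)
qed

lemma heval_0 [simp]: "heval \<kappa> x 0 = 0" by (simp add: heval_def)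

lemma heval_sum: "rhom \<kappa> \<Longrightarrow> heval \<kappa> x (sum f S) = (\<Sum>s\<in>S. heval \<kappa> x (f s))"
  by (induction S rule: infinite_finite_induct) (auto simp: heval_add)

lemma heval_single:
  assumes "rhom \<kappa>"
  shows "heval \<kappa> x (Poly_Mapping.single m c) = \<kappa> c * (\<Prod>v\<in>keys m. x v ^ lookup m v)"
  by (cases "c = 0") (auto simp: heval_def rhom_simps[OF assms])

lemma mpoly_sum_singles: "(P :: 'v mpoly) = (\<Sum>m\<in>keys P. Poly_Mapping.single m (lookup P m))"
proof (rule poly_mapping_eqI)
  fix k
  show "lookup P k = lookup (\<Sum>m\<in>keys P. Poly_Mapping.single m (lookup P m)) k"
  proof (cases "k \<in> keys P")
    case True
    then show ?thesis 
      by (simp add: lookup_sum lookup_single when_def)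
  next
    case False
    then show ?thesis 
      by (simp add: lookup_sum lookup_single when_def in_keys_iff)
  qed
qed

lemma heval_mult:
  assumes "rhom \<kappa>" shows "heval \<kappa> x (P * Q) = heval \<kappa> x P * heval \<kappa> x Q"
proof -
  let ?s = "\<lambda>P m. Poly_Mapping.single m (lookup P m)"
  have "P * Q = (\<Sum>m\<in>keys P. \<Sum>m'\<in>keys Q. Poly_Mapping.single (m + m') (lookup P m * lookup Q m'))"
    by (subst mpoly_sum_singles[of P], subst mpoly_sum_singles[of Q])
      (simp add: sum_product mult_single)
  then have "heval \<kappa> x (P * Q) = (\<Sum>m\<in>keys P. \<Sum>m'\<in>keys Q. 
     (\<kappa> (lookup P m) * (\<Prod>v\<in>keys m. x v ^ lookup m v)) * (\<kappa> (lookup Q m') * (\<Prod>v\<in>keys m'. x v ^ lookup m' v)))"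
    by (simp add: heval_sum[OF assms] heval_single[OF assms] mono_eval_add rhom_simps[OF assms] mult_ac)
  also have "\<dots> = heval \<kappa> x P * heval \<kappa> x Q"
    by (simp add: heval_def sum_product)
  finally show ?thesis .
qed

lemma heval_Cst: "rhom \<kappa> \<Longrightarrow> heval \<kappa> x (Cst c) = \<kappa> c"
  by (simp add: Cst_def heval_single)

lemma heval_var: "rhom \<kappa> \<Longrightarrow> heval \<kappa> x (var v) = x v"
  by (simp add: var_def mpoly_monom_def heval_single rhom_simps)

lemma heval_1: "rhom \<kappa> \<Longrightarrow> heval \<kappa> x 1 = 1"
  using heval_Cst[of \<kappa> x 1] by (simp add: Cst_def rhom_simps flip: single_one)

lemma rhom_heval: "rhom \<kappa> \<Longrightarrow> rhom (heval \<kappa> x)"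
  by (intro rhomI) (auto simp: heval_add heval_mult heval_1)

lemma rhom_Cst: "rhom Cst"
  by (intro rhomI) (auto simp: Cst_def single_add mult_single)

lemma heval_finite:
  assumes "rhom \<kappa>"
  shows "heval \<kappa> x P = (\<Sum>m\<in>keys P. \<kappa> (lookup P m) * (\<Prod>v\<in>(UNIV::'v::finite set). x v ^ lookup m v))"
proof -
  have "(\<Prod>v\<in>keys m. x v ^ lookup m v) = (\<Prod>v\<in>UNIV. x v ^ lookup m v)" for m
    by (rule prod.mono_neutral_left) (auto simp: in_keys_iff)
  then show ?thesis by (simp add: heval_def)
qed

lemma mpoly_monom_add: "mpoly_monom (m + m') = mpoly_monom m * mpoly_monom m'"
  by (simp add: mpoly_monom_def mult_single)

lemma mpoly_monom_0 [simp]: "mpoly_monom 0 = 1"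
  by (simp add: mpoly_monom_def)

lemma mpoly_monom_prod: "mpoly_monom (m::'v::finite \<Rightarrow>\<^sub>0 nat) = (\<Prod>v\<in>UNIV. var v ^ lookup m v)"
proof -
  have 1: "mpoly_monom (Poly_Mapping.single v k) = var v ^ k" for v :: 'v and k
  proof (induction k)
    case (Suc k)
    have "Poly_Mapping.single v (Suc k) = Poly_Mapping.single v 1 + Poly_Mapping.single v k"
      by (simp flip: single_add)
    then show ?case by (simp add: mpoly_monom_add Suc var_def)
  qed simp
  have 2: "mpoly_monom (sum g S) = (\<Prod>s\<in>S. mpoly_monom (g s))" for g :: "'v \<Rightarrow> 'v \<Rightarrow>\<^sub>0 nat" and S
    by (induction S rule: infinite_finite_induct) (auto simp: mpoly_monom_add)
  have "m = (\<Sum>v\<in>UNIV. Poly_Mapping.single v (lookup m v))"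
    by (rule poly_mapping_eqI) (simp add: lookup_sum lookup_single when_def)
  then have "mpoly_monom m = mpoly_monom (\<Sum>v\<in>UNIV. Poly_Mapping.single v (lookup m v))"
    by (rule arg_cong)
  then show ?thesis by (simp only: 1 2)
qed

lemma mpoly_induct [case_names Cst var add mult]:
  fixes P :: "'v::finite mpoly"
  assumes c: "\<And>c. R (Cst c)" and v: "\<And>v. R (var v)"
    and a: "\<And>P Q. R P \<Longrightarrow> R Q \<Longrightarrow> R (P + Q)" and m: "\<And>P Q. R P \<Longrightarrow> R Q \<Longrightarrow> R (P * Q)"
  shows "R P"
proof -
  have one: "R 1" using c[of 1] by (simp add: Cst_def)
  have zero: "R 0" using c[of 0] by (simp add: Cst_def)
  have pow: "R (var v ^ k)" for v k by (induction k) (auto simp: one m v)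
  have prod: "R (\<Prod>s\<in>S. g s)" if "\<And>s. R (g s)" for g :: "'v \<Rightarrow> 'v mpoly" and S
    by (induction S rule: infinite_finite_induct) (auto simp: one m that)
  have sum: "R (\<Sum>s\<in>S. g s)" if "\<And>s. R (g s)" for g :: "('v \<Rightarrow>\<^sub>0 nat) \<Rightarrow> 'v mpoly" and S
    by (induction S rule: infinite_finite_induct) (auto simp: zero a that)
  have "R (Poly_Mapping.single k b)" for k b
  proof -
    have "Poly_Mapping.single k b = Cst b * mpoly_monom k"
      by (simp add: Cst_def mpoly_monom_def mult_single)
    then show ?thesis by (simp add: mpoly_monom_prod m c prod pow)
  qed
  then show ?thesis by (subst mpoly_sum_singles) (rule sum)
qed

lemma rhom_heval_comp:
  fixes P :: "'v mpoly"
  assumes "rhom h" 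
  shows "h (heval \<kappa> x P) = heval (\<lambda>c. h (\<kappa> c)) (\<lambda>v. h (x v)) P"
  by (simp add: heval_def rhom_sum[OF assms] rhom_prod[OF assms] rhom_power[OF assms] rhom_simps[OF assms])

lemma heval_Cst_var: "heval Cst var P = (P :: 'v::finite mpoly)"
  by (induction P rule: mpoly_induct)
    (auto simp: heval_Cst[OF rhom_Cst] heval_var[OF rhom_Cst] heval_add[OF rhom_Cst] heval_mult[OF rhom_Cst])

lemmas peval_simps =
  heval_Cst[OF rhom_id, folded peval_heval] heval_var[OF rhom_id, folded peval_heval]
  heval_add[OF rhom_id, folded peval_heval] heval_mult[OF rhom_id, folded peval_heval]
  heval_1[OF rhom_id, folded peval_heval] heval_0[where \<kappa>="\<lambda>c. c", folded peval_heval]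

lemma rhom_peval: "rhom (peval x)"
  by (intro rhomI) (auto simp: peval_simps)

text \<open>The truncated subtraction of exponents does no harm: where it truncates, the coefficient
  is 0.\<close>

definition pd :: "'v \<Rightarrow> 'v mpoly \<Rightarrow> 'v mpoly" where
  "pd j P = (\<Sum>m\<in>keys P. Poly_Mapping.single (m - Poly_Mapping.single j 1) (of_nat (lookup m j) * lookup P m))"

lemma pd_superset:
  assumes "finite S" "keys P \<subseteq> S"
  shows "pd j P = (\<Sum>m\<in>S. Poly_Mapping.single (m - Poly_Mapping.single j 1) (of_nat (lookup m j) * lookup P m))"
  unfolding pd_def by (rule sum.mono_neutral_left) (use assms in \<open>auto simp: in_keys_iff\<close>)

lemma pd_add: "pd j (P + Q) = pd j P + pd j Q"
proof -
  let ?S = "keys P \<union> keys Q"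
  have "keys (P + Q) \<subseteq> ?S" by (rule Poly_Mapping.keys_add)
  then show ?thesis
    using pd_superset[of ?S P j] pd_superset[of ?S Q j] pd_superset[of ?S "P + Q" j]
    by (simp add: lookup_add algebra_simps sum.distrib single_add)
qed

lemma pd_0 [simp]: "pd j 0 = 0" by (simp add: pd_def)

lemma pd_sum: "pd j (sum f S) = (\<Sum>s\<in>S. pd j (f s))"
  by (induction S rule: infinite_finite_induct) (auto simp: pd_add)

lemma pd_single: "pd j (Poly_Mapping.single m c) = Poly_Mapping.single (m - Poly_Mapping.single j 1) (of_nat (lookup m j) * c)"
  by (cases "c = 0") (auto simp: pd_def)

lemma pd_mult: "pd j (P * Q) = pd j P * Q + P * pd j Q"
proof -
  have *: "pd j (Poly_Mapping.single m a * Poly_Mapping.single m' b) = 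
     pd j (Poly_Mapping.single m a) * Poly_Mapping.single m' b + Poly_Mapping.single m a * pd j (Poly_Mapping.single m' b)" for m m' a b
  proof -
    let ?e = "Poly_Mapping.single j (1::nat)"
    have 1: "lookup m j = 0 \<or> m - ?e + m' = m + m' - ?e" 
      by (auto intro!: poly_mapping_eqI simp: lookup_add lookup_minus lookup_single when_def)
    have 2: "lookup m' j = 0 \<or> m + (m' - ?e) = m + m' - ?e" 
      by (auto intro!: poly_mapping_eqI simp: lookup_add lookup_minus lookup_single when_def)
    have "pd j (Poly_Mapping.single m a * Poly_Mapping.single m' b) 
      = Poly_Mapping.single (m + m' - ?e) (of_nat (lookup m j) * a * b) + Poly_Mapping.single (m + m' - ?e) (of_nat (lookup m' j) * a * b)"
      by (simp add: mult_single pd_single lookup_add algebra_simps flip: single_add)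
    also have "Poly_Mapping.single (m + m' - ?e) (of_nat (lookup m j) * a * b) = 
       pd j (Poly_Mapping.single m a) * Poly_Mapping.single m' b" 
      using 1 by (auto simp: pd_single mult_single)
    also have "Poly_Mapping.single (m + m' - ?e) (of_nat (lookup m' j) * a * b) = 
       Poly_Mapping.single m a * pd j (Poly_Mapping.single m' b)" 
      using 2 by (auto simp: pd_single mult_single mult_ac)
    finally show ?thesis .
  qed
  have "P * Q = (\<Sum>m\<in>keys P. \<Sum>m'\<in>keys Q. Poly_Mapping.single m (lookup P m) * Poly_Mapping.single m' (lookup Q m'))"
    by (subst mpoly_sum_singles[of P], subst mpoly_sum_singles[of Q])
      (simp add: sum_product)
  then have "pd j (P * Q) = (\<Sum>m\<in>keys P. \<Sum>m'\<in>keys Q. pd j (Poly_Mapping.single m (lookup P m)) * Poly_Mapping.single m' (lookup Q m')) 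
     + (\<Sum>m\<in>keys P. \<Sum>m'\<in>keys Q. Poly_Mapping.single m (lookup P m) * pd j (Poly_Mapping.single m' (lookup Q m')))"
    by (simp add: pd_sum * sum.distrib)
  also have "\<dots> = pd j (\<Sum>m\<in>keys P. Poly_Mapping.single m (lookup P m)) * (\<Sum>m'\<in>keys Q. Poly_Mapping.single m' (lookup Q m'))
     + (\<Sum>m\<in>keys P. Poly_Mapping.single m (lookup P m)) * pd j (\<Sum>m'\<in>keys Q. Poly_Mapping.single m' (lookup Q m'))"
    by (simp add: pd_sum sum_product)
  finally show ?thesis by (simp only: mpoly_sum_singles[symmetric])
qed

lemma pd_Cst [simp]: "pd j (Cst c) = 0" by (simp add: Cst_def pd_single)

lemma pd_var: "pd j (var v) = (if v = j then 1 else 0)"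
  by (simp add: var_def mpoly_monom_def pd_single lookup_single when_def)

lemma lookup_pd: "lookup (pd j P) m = of_nat (lookup m j + 1) * lookup P (m + Poly_Mapping.single j 1)"
proof -
  let ?e = "Poly_Mapping.single j (1::nat)"
  have "lookup (pd j P) m = (\<Sum>k\<in>insert (m + ?e) (keys P). if k - ?e = m then of_nat (lookup k j) * lookup P k else 0)"
    by (simp only: pd_superset[of "insert (m + ?e) (keys P)" P j, OF finite.insertI[OF finite_keys] subset_insertI]
      lookup_sum lookup_single when_def)
  also have "\<dots> = (\<Sum>k\<in>insert (m + ?e) (keys P). if k = m + ?e then of_nat (lookup m j + 1) * lookup P (m + ?e) else 0)"
  proof (rule sum.cong[OF refl])
    fix k
    have "k = m + ?e" if "k - ?e = m" "lookup k j \<noteq> 0"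
    proof (rule poly_mapping_eqI)
      fix i show "lookup k i = lookup (m + ?e) i"
        using that(2) arg_cong[OF that(1), of "\<lambda>k. lookup k i"]
        by (cases "i = j") (auto simp: lookup_add lookup_minus lookup_single when_def)
    qed
    then show "(if k - ?e = m then of_nat (lookup k j) * lookup P k else 0) = (if k = m + ?e then of_nat (lookup m j + 1) * lookup P (m + ?e) else 0)"
      by (cases "k = m + ?e") (auto simp: lookup_add)
  qed
  also have "\<dots> = of_nat (lookup m j + 1) * lookup P (m + ?e)"
    by (subst sum.delta) auto
  finally show ?thesis .
qed

text \<open>Links the formal to the analytic derivative, so that vanishing along a coordinate line
  passes to the partial derivative.\<close>

lemma peval_line_deriv:
  fixes P :: "'v::finite mpoly"
  shows "((\<lambda>t. peval (\<lambda>v. x v + (if v = j then t else 0)) P) has_field_derivative peval x (pd j P)) (at 0)"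
proof (induction P rule: mpoly_induct)
  case (Cst c) then show ?case by (simp add: peval_simps)
next
  case (var v) then show ?case by (auto simp: peval_simps pd_var intro!: derivative_eq_intros)
next
  case (add P Q) then show ?case by (auto simp: peval_simps pd_add intro!: derivative_eq_intros)
next
  case (mult P Q)
  have [simp]: "(\<lambda>v. x v + (if v = j then 0 else 0)) = x" by auto
  show ?case unfolding peval_simps pd_mult
    by (rule derivative_eq_intros mult refl)+ simp
qed

text \<open>Differentiation lowers the total degree, and in characteristic 0 a polynomial whose
  partial derivatives all vanish is constant. The lemma is applied to sets of polynomials that
  vanish in some sense and so contain no nonzero constant: either such a set is trivial, or some
  member has a partial derivative outside the set.\<close>

lemma pd_closed_const:
  fixes I :: "'v::finite mpoly set"
  assumes cl: "\<And>P j. P \<in> I \<Longrightarrow> pd j P \<in> I" and P: "P \<in> I" "P \<noteq> 0"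
  shows "\<exists>c. c \<noteq> 0 \<and> Cst c \<in> I"
proof -
  have "\<forall>P. P \<in> I \<and> P \<noteq> 0 \<and> (\<forall>m\<in>keys P. (\<Sum>v\<in>UNIV. lookup m v) \<le> d) \<longrightarrow> (\<exists>c. c \<noteq> 0 \<and> Cst c \<in> I)" for d
  proof (induction d)
    case 0
    show ?case
    proof (intro allI impI)
      fix P assume P: "P \<in> I \<and> P \<noteq> 0 \<and> (\<forall>m\<in>keys P. (\<Sum>v\<in>UNIV. lookup m v) \<le> 0)"
      have *: "m = 0" if "m \<in> keys P" for m
        using P that by (auto intro!: poly_mapping_eqI)
      have "P = Cst (lookup P 0)"
        unfolding Cst_def by (rule poly_mapping_eqI) (use * in \<open>auto simp: lookup_single when_def in_keys_iff\<close>)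
      then show "\<exists>c. c \<noteq> 0 \<and> Cst c \<in> I" using P by (metis Cst_def single_zero)
    qed
  next
    case (Suc d)
    show ?case
    proof (intro allI impI)
      fix P assume P: "P \<in> I \<and> P \<noteq> 0 \<and> (\<forall>m\<in>keys P. (\<Sum>v\<in>UNIV. lookup m v) \<le> Suc d)"
      show "\<exists>c. c \<noteq> 0 \<and> Cst c \<in> I"
      proof (cases "\<exists>j. pd j P \<noteq> 0")
        case True
        then obtain j where j: "pd j P \<noteq> 0" by auto
        have "(\<Sum>v\<in>UNIV. lookup m v) \<le> d" if "m \<in> keys (pd j P)" for m
        proof -
          have "m + Poly_Mapping.single j 1 \<in> keys P" using that by (auto simp: in_keys_iff lookup_pd)
          then have "(\<Sum>v\<in>UNIV. lookup (m + Poly_Mapping.single j 1) v) \<le> Suc d" using P by blast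
          then show ?thesis by (simp add: lookup_add lookup_single when_def sum.distrib)
        qed
        then show ?thesis using Suc cl j P by blast
      next
        case False
        have *: "m = 0" if "m \<in> keys P" for m
        proof (rule poly_mapping_eqI)
          fix j
          show "lookup m j = lookup 0 j"
          proof (rule ccontr)
            assume a: "lookup m j \<noteq> lookup 0 j"
            have "m - Poly_Mapping.single j 1 + Poly_Mapping.single j 1 = m"
              by (rule poly_mapping_eqI) (use a in \<open>auto simp: lookup_add lookup_minus lookup_single when_def\<close>)
            then have "lookup (pd j P) (m - Poly_Mapping.single j 1) \<noteq> 0"
              using that by (auto simp: lookup_pd in_keys_iff simp del: of_nat_add of_nat_Suc)
            then show False using False by auto
          qed
        qed
        have "P = Cst (lookup P 0)"
          unfolding Cst_def by (rule poly_mapping_eqI) (use * in \<open>auto simp: lookup_single when_def in_keys_iff\<close>)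
        then show "\<exists>c. c \<noteq> 0 \<and> Cst c \<in> I" using P by (metis Cst_def single_zero)
      qed
    qed
  qed
  moreover have "\<forall>m\<in>keys P. (\<Sum>v\<in>UNIV. lookup m v) \<le> (\<Sum>m\<in>keys P. \<Sum>v\<in>UNIV. lookup m v)"
    by (intro ballI member_le_sum) auto
  ultimately show ?thesis using P by blast
qed

text \<open>The polynomials that vanish at all points are stable under partial derivatives and
  contain no nonzero constant.\<close>

lemma peval_inj:
  fixes P :: "'v::finite mpoly"
  assumes "\<And>x. peval x P = 0" shows "P = 0"
proof (rule ccontr)
  assume "P \<noteq> 0"
  let ?I = "{P. \<forall>x. peval x P = 0} :: 'v mpoly set"
  have "pd j Q \<in> ?I" if "Q \<in> ?I" for j Q
  proof -
    have "peval x (pd j Q) = 0" for x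
    proof -
      have "((\<lambda>t::complex. 0) has_field_derivative peval x (pd j Q)) (at 0)"
      proof -
        have "peval y Q = 0" for y using that by blast
        then have "(\<lambda>t. peval (\<lambda>v. x v + (if v = j then t else 0)) Q) = (\<lambda>t. 0)" by (intro ext) 
        then show ?thesis using peval_line_deriv[of x j Q] by argo
      qed
      then show ?thesis by (metis DERIV_unique DERIV_const)
    qed
    then show ?thesis by simp
  qed
  moreover have "P \<in> ?I" using assms by blast
  ultimately have "\<exists>c. c \<noteq> 0 \<and> Cst c \<in> ?I" using \<open>P \<noteq> 0\<close> by (intro pd_closed_const)
  then obtain c where "c \<noteq> 0" "Cst c \<in> ?I" by blast
  moreover have "peval (\<lambda>_::'v. 0) (Cst c) = c" by (rule peval_simps)
  ultimately show False by auto
qed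

lemma peval_vec_inj:
  fixes P :: "'v::finite mpoly"
  assumes "\<And>y. peval (\<lambda>v. y $ v) P = 0" shows "P = 0"
proof (rule peval_inj)
  fix x :: "'v \<Rightarrow> complex"
  show "peval x P = 0" using assms[of "\<chi> v. x v"] by simp
qed

lemma poly_line_heval:
  "poly (heval (\<lambda>c. [:c:]) (\<lambda>v. [:x v, y v:]) P) t = peval (\<lambda>v. x v + t * y v) P"
proof -
  have "rhom (\<lambda>p. poly p t)" by (simp add: rhom_def)
  from rhom_heval_comp[OF this, of "\<lambda>c. [:c:]" "\<lambda>v. [:x v, y v:]" P] 
  show ?thesis by (simp add: peval_heval)
qed

text \<open>On the line joining a point where \<open>P\<close> is nonzero to a point where
  \<open>Q\<close> is nonzero, both become nonzero polynomials in one variable.\<close>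

lemma mpoly_no_zero_div:
  fixes P Q :: "'v::finite mpoly"
  assumes "P * Q = 0" shows "P = 0 \<or> Q = 0"
proof (rule ccontr)
  assume "\<not> ?thesis"
  then have "P \<noteq> 0" "Q \<noteq> 0" by auto
  obtain x where x: "peval x P \<noteq> 0" using peval_inj[of P] \<open>P \<noteq> 0\<close> by blast
  obtain y where y: "peval y Q \<noteq> 0" using peval_inj[of Q] \<open>Q \<noteq> 0\<close> by blast
  let ?h = "heval (\<lambda>c. [:c:]) (\<lambda>v. [:x v, y v - x v:])"
  have r: "rhom (\<lambda>c::complex. [:c:])" by (simp add: rhom_def one_pCons)
  have 0: "?h P * ?h Q = 0" using assms heval_mult[OF r, of _ P Q] by simp
  have "poly (?h P) 0 \<noteq> 0" using x by (simp add: poly_line_heval)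
  moreover have "poly (?h Q) 1 \<noteq> 0" using y by (simp add: poly_line_heval)
  ultimately show False using 0 by auto
qed

section \<open>Rational functions\<close>

text \<open>A copy of the polynomial ring that can be made an instance of the class of integral domains.\<close>

typedef 'n cpoly = "UNIV :: 'n mpoly set" ..

setup_lifting type_definition_cpoly

instantiation cpoly :: (type) comm_ring_1
begin
lift_definition zero_cpoly :: "'a cpoly" is 0 .
lift_definition one_cpoly :: "'a cpoly" is 1 .
lift_definition plus_cpoly :: "'a cpoly \<Rightarrow> 'a cpoly \<Rightarrow> 'a cpoly" is "(+)" .
lift_definition minus_cpoly :: "'a cpoly \<Rightarrow> 'a cpoly \<Rightarrow> 'a cpoly" is "(-)" .
lift_definition uminus_cpoly :: "'a cpoly \<Rightarrow> 'a cpoly" is "uminus" .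
lift_definition times_cpoly :: "'a cpoly \<Rightarrow> 'a cpoly \<Rightarrow> 'a cpoly" is "(*)" .
instance by (standard; transfer; simp add: algebra_simps)
end

instance cpoly :: (finite) idom
  by (standard; transfer) (use mpoly_no_zero_div in blast)

type_synonym 'n ratfun = "'n cpoly fract"

definition of_mpoly :: "'n::finite mpoly \<Rightarrow> 'n ratfun" where "of_mpoly P = Fract (Abs_cpoly P) 1"

lemma rhom_of_mpoly: "rhom (of_mpoly :: 'n::finite mpoly \<Rightarrow> 'n ratfun)"
proof (rule rhomI)
  show "of_mpoly (a * b) = of_mpoly a * of_mpoly b" for a b :: "'n mpoly"
    by (simp add: of_mpoly_def times_cpoly.abs_eq)
  show "of_mpoly (a + b) = of_mpoly a + of_mpoly b" for a b :: "'n mpoly"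
    by (simp add: of_mpoly_def plus_cpoly.abs_eq)
qed (simp_all add: of_mpoly_def Zero_fract_def One_fract_def zero_cpoly.abs_eq one_cpoly.abs_eq)

lemma of_mpoly_eq_0_iff [simp]: "of_mpoly P = 0 \<longleftrightarrow> P = 0"
proof -
  have "of_mpoly P = 0 \<longleftrightarrow> Abs_cpoly P * 1 = Abs_cpoly 0 * 1"
    unfolding of_mpoly_def Zero_fract_def zero_cpoly.abs_eq by (subst eq_fract(1)) auto
  then show ?thesis by (simp add: Abs_cpoly_inject)
qed

lemmas of_mpoly_simps [simp] = rhom_simps[OF rhom_of_mpoly] rhom_diff[OF rhom_of_mpoly] rhom_uminus[OF rhom_of_mpoly] rhom_power[OF rhom_of_mpoly]

lemma of_mpoly_inj: "of_mpoly P = of_mpoly Q \<longleftrightarrow> P = Q"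
  using of_mpoly_eq_0_iff[of "P - Q"] by simp

lemma ratfun_cases:
  obtains A B where "B \<noteq> 0" "r = of_mpoly A / of_mpoly B"
proof (cases r)
  case (Fract a b)
  have "b = Abs_cpoly (Rep_cpoly b)" "a = Abs_cpoly (Rep_cpoly a)" by (auto simp: Rep_cpoly_inverse)
  moreover have "Rep_cpoly b \<noteq> 0" using Fract by (metis calculation(1) zero_cpoly.abs_eq)
  ultimately show ?thesis using Fract 
    by (intro that[of "Rep_cpoly b" "Rep_cpoly a"]) (simp_all add: of_mpoly_def)
qed

definition of_const :: "complex \<Rightarrow> 'n::finite ratfun" where "of_const c = of_mpoly (Cst c)"
definition coord :: "'n::finite \<Rightarrow> 'n ratfun" where "coord j = of_mpoly (var j)"

lemma rhom_of_const: "rhom of_const" 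
  unfolding of_const_def by (rule rhom_comp[OF rhom_of_mpoly rhom_Cst])

lemmas of_const_simps [simp] = rhom_simps[OF rhom_of_const] rhom_diff[OF rhom_of_const] rhom_uminus[OF rhom_of_const]

lemmas hk_simps = heval_Cst[OF rhom_of_const] heval_var[OF rhom_of_const] heval_add[OF rhom_of_const] heval_mult[OF rhom_of_const] heval_1[OF rhom_of_const]
  rhom_diff[OF rhom_heval[OF rhom_of_const]] rhom_power[OF rhom_heval[OF rhom_of_const]]

lemma of_mpoly_heval: "of_mpoly P = heval of_const coord P"
proof (induction P rule: mpoly_induct)
  case (Cst c) then show ?case unfolding hk_simps by (simp only: of_const_def)
next
  case (var v) then show ?case unfolding hk_simps by (simp only: coord_def)
qed (auto simp: hk_simps)

section \<open>Derivations of the field of rational functions\<close>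

definition is_deriv :: "('n::finite ratfun \<Rightarrow> 'n ratfun) \<Rightarrow> bool" where
  "is_deriv D \<longleftrightarrow> (\<forall>a b. D (a + b) = D a + D b) \<and> (\<forall>a b. D (a * b) = D a * b + a * D b) \<and> (\<forall>c. D (of_const c) = 0)"

lemma is_deriv_simps:
  assumes "is_deriv D"
  shows "D (a + b) = D a + D b" "D (a * b) = D a * b + a * D b" "D (of_const c) = 0" "D 0 = 0" "D 1 = 0"
    "D (- a) = - D a" "D (a - b) = D a - D b"
proof -
  show 1: "D (a + b) = D a + D b" "D (a * b) = D a * b + a * D b" "D (of_const c) = 0" for a b c
    using assms by (auto simp: is_deriv_def)
  show 0: "D 0 = 0" "D 1 = 0" using 1(3)[of 0] 1(3)[of 1] by simp_all
  show 2: "D (- a) = - D a" for a using 1(1)[of "-a" a] 0 by (simp add: eq_neg_iff_add_eq_0)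
  show "D (a - b) = D a - D b" using 1(1)[of a "-b"] 2 by simp
qed

lemma is_deriv_sum:
  assumes "is_deriv D" shows "D (sum f S) = (\<Sum>s\<in>S. D (f s))"
  by (induction S rule: infinite_finite_induct) (auto simp: is_deriv_simps[OF assms])

lemma is_deriv_div:
  assumes "is_deriv D" "b \<noteq> 0" shows "D (a / b) = (D a * b - a * D b) / b\<^sup>2"
proof -
  have "D a = D (a / b * b)" using assms(2) by simp
  also have "\<dots> = D (a / b) * b + a / b * D b" by (simp only: is_deriv_simps[OF assms(1)])
  finally show ?thesis using assms(2) by (simp add: field_simps power2_eq_square)
qed

lemma is_deriv_power:
  assumes "is_deriv D" shows "D (a ^ Suc k) = of_nat (Suc k) * a ^ k * D a"
  by (induction k) (auto simp: is_deriv_simps[OF assms] algebra_simps)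

lemma is_deriv_heval:
  fixes P :: "'v::finite mpoly"
  assumes D: "is_deriv D" 
  shows "D (heval of_const u P) = (\<Sum>v\<in>UNIV. heval of_const u (pd v P) * D (u v))"
proof (induction P rule: mpoly_induct)
  case (var w)
  have "(\<Sum>v\<in>UNIV. heval of_const u (pd v (var w)) * D (u v)) = (\<Sum>v\<in>UNIV. if w = v then D (u v) else 0)"
    by (rule sum.cong) (auto simp: pd_var hk_simps)
  then show ?case by (simp add: hk_simps)
qed (auto simp: hk_simps pd_add pd_mult is_deriv_simps[OF D] sum.distrib algebra_simps sum_distrib_left)

definition pdK :: "'n::finite \<Rightarrow> 'n ratfun \<Rightarrow> 'n ratfun" where
  "pdK k r = (SOME s. \<exists>A B. B \<noteq> 0 \<and> r = of_mpoly A / of_mpoly B \<and> 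
     s = (of_mpoly (pd k A) * of_mpoly B - of_mpoly A * of_mpoly (pd k B)) / (of_mpoly B)\<^sup>2)"

text \<open>Differentiating \<open>A * B' = A' * B\<close> shows that the quotient rule gives the
  same result for all ways of writing the fraction, so the choice made in \<open>pdK\<close> is
  harmless.\<close>

lemma pdK_eq:
  assumes "B \<noteq> 0" 
  shows "pdK k (of_mpoly A / of_mpoly B) = (of_mpoly (pd k A) * of_mpoly B - of_mpoly A * of_mpoly (pd k B)) / (of_mpoly B)\<^sup>2"
proof -
  have *: "(of_mpoly (pd k A) * of_mpoly B - of_mpoly A * of_mpoly (pd k B)) / (of_mpoly B)\<^sup>2 = (of_mpoly (pd k A') * of_mpoly B' - of_mpoly A' * of_mpoly (pd k B')) / (of_mpoly B')\<^sup>2"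
    if "B' \<noteq> 0" "of_mpoly A / of_mpoly B = of_mpoly A' / of_mpoly B'" for A' B'
  proof -
    let ?a = "of_mpoly A" and ?b = "of_mpoly B" and ?a' = "of_mpoly A'" and ?b' = "of_mpoly B'"
    let ?da = "of_mpoly (pd k A)" and ?db = "of_mpoly (pd k B)" and ?da' = "of_mpoly (pd k A')" and ?db' = "of_mpoly (pd k B')"
    have nz: "?b \<noteq> 0" "?b' \<noteq> 0" using assms that by auto
    then have e: "?a * ?b' = ?a' * ?b" using that(2) by (simp add: frac_eq_eq)
    then have "A * B' = A' * B" by (simp flip: of_mpoly_simps(4) add: of_mpoly_inj)
    then have "pd k (A * B') = pd k (A' * B)" by simp
    then have "of_mpoly (pd k (A * B')) = of_mpoly (pd k (A' * B))" by (rule arg_cong)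
    then have d: "?da * ?b' + ?a * ?db' = ?da' * ?b + ?a' * ?db" by (simp add: pd_mult)
    have d': "?da * ?b' = ?da' * ?b + ?a' * ?db - ?a * ?db'" using d by (simp add: algebra_simps)
    have "(?da * ?b - ?a * ?db) * ?b'\<^sup>2 = ?b * ?b' * (?da * ?b') - (?a * ?b') * ?db * ?b'"
      by (simp add: algebra_simps power2_eq_square)
    also have "\<dots> = ?b * ?b' * (?da' * ?b + ?a' * ?db - ?a * ?db') - ?a' * ?b * ?db * ?b'"
      by (simp only: d' e)
    also have "\<dots> = ?b * ?b * ?b' * ?da' - ?b * (?a * ?b') * ?db'"
      by (simp add: algebra_simps)
    also have "\<dots> = (?da' * ?b' - ?a' * ?db') * ?b\<^sup>2"
      by (simp only: e) (simp add: algebra_simps power2_eq_square)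
    finally show ?thesis using nz by (simp add: frac_eq_eq)
  qed
  let ?Q = "\<lambda>s. \<exists>A' B'. B' \<noteq> 0 \<and> of_mpoly A / of_mpoly B = of_mpoly A' / of_mpoly B' \<and> 
     s = (of_mpoly (pd k A') * of_mpoly B' - of_mpoly A' * of_mpoly (pd k B')) / (of_mpoly B')\<^sup>2"
  have "?Q ((of_mpoly (pd k A) * of_mpoly B - of_mpoly A * of_mpoly (pd k B)) / (of_mpoly B)\<^sup>2)" using assms by blast
  then have "?Q (pdK k (of_mpoly A / of_mpoly B))" unfolding pdK_def by (rule someI)
  then obtain A' B' where "B' \<noteq> 0" "of_mpoly A / of_mpoly B = of_mpoly A' / of_mpoly B'"
    "pdK k (of_mpoly A / of_mpoly B) = (of_mpoly (pd k A') * of_mpoly B' - of_mpoly A' * of_mpoly (pd k B')) / (of_mpoly B')\<^sup>2" by blast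
  with *[of B' A'] show ?thesis by simp
qed

lemma is_deriv_pdK: "is_deriv (pdK (k :: 'n::finite))"
  unfolding is_deriv_def
proof (intro conjI allI)
  fix a b :: "'n ratfun" and c
  obtain A B where a: "B \<noteq> 0" "a = of_mpoly A / of_mpoly B" by (rule ratfun_cases)
  obtain A' B' where b: "B' \<noteq> 0" "b = of_mpoly A' / of_mpoly B'" by (rule ratfun_cases)
  have n: "B * B' \<noteq> 0" using a b mpoly_no_zero_div by blast
  have s: "a + b = of_mpoly (A * B' + A' * B) / of_mpoly (B * B')" using a b by (simp add: field_simps)
  have m: "a * b = of_mpoly (A * A') / of_mpoly (B * B')" using a b by simp
  have nz: "of_mpoly B \<noteq> 0" "of_mpoly B' \<noteq> 0" using a b by auto
  show "pdK k (a + b) = pdK k a + pdK k b"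
    unfolding s pdK_eq[OF n] unfolding a b pdK_eq[OF a(1)] pdK_eq[OF b(1)]
    using nz by (simp add: pd_mult pd_add field_simps power2_eq_square)
  show "pdK k (a * b) = pdK k a * b + a * pdK k b"
    unfolding m pdK_eq[OF n] unfolding a b pdK_eq[OF a(1)] pdK_eq[OF b(1)]
    using nz by (simp add: pd_mult pd_add field_simps power2_eq_square)
  have "(1::'n mpoly) \<noteq> 0" by simp
  from pdK_eq[OF this, of k "Cst c"] show "pdK k (of_const c) = 0" 
    using pd_Cst[of k 1] pd_Cst[of k c] by (simp add: of_const_def Cst_def)
qed

lemma pd_1 [simp]: "pd j 1 = 0"
  using pd_Cst[of j 1] by (simp add: Cst_def)

lemma pdK_of_mpoly: "pdK k (of_mpoly P) = of_mpoly (pd k (P :: 'n::finite mpoly))"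
  using pdK_eq[of 1 k P] by simp

lemma pdK_coord: "pdK k (coord j) = (if j = k then 1 else 0)"
  by (simp add: coord_def pdK_of_mpoly pd_var)

section \<open>Algebraic dependence of rational functions\<close>

lemma linear_system:
  fixes a :: "'i \<Rightarrow> 'j \<Rightarrow> complex"
  assumes "finite J" "finite I" "card J < card I"
  shows "\<exists>c. (\<exists>i\<in>I. c i \<noteq> 0) \<and> (\<forall>j\<in>J. (\<Sum>i\<in>I. c i * a i j) = 0)"
  using assms
proof (induction J arbitrary: I a rule: finite_induct)
  case empty
  then have "I \<noteq> {}" by auto
  then have "\<exists>i\<in>I. (1::complex) \<noteq> 0" by auto
  then show ?case by (intro exI[of _ "\<lambda>_. 1::complex"] conjI) auto
next
  case (insert j0 J)
  show ?case
  proof (cases "\<forall>i\<in>I. a i j0 = 0")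
    case True
    have "card J < card I" using insert by simp
    with insert.IH[of I a] insert.prems obtain c where "\<exists>i\<in>I. c i \<noteq> 0" "\<forall>j\<in>J. (\<Sum>i\<in>I. c i * a i j) = 0"
      by blast
    then show ?thesis using True by (intro exI[of _ c]) auto
  next
    case False
    then obtain i0 where i0: "i0 \<in> I" "a i0 j0 \<noteq> 0" by auto
    let ?I = "I - {i0}"
    \<comment> \<open>Gaussian elimination: the equation \<open>j0\<close> is solved for the unknown
      \<open>i0\<close> and substituted into the others.\<close>
    let ?a = "\<lambda>i j. a i j - a i j0 / a i0 j0 * a i0 j"
    have "card J < card ?I" using insert i0 by simp
    with insert.IH[of ?I ?a] insert.prems obtain c where c: "\<exists>i\<in>?I. c i \<noteq> 0" "\<forall>j\<in>J. (\<Sum>i\<in>?I. c i * ?a i j) = 0"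
      by auto
    let ?s = "- (\<Sum>i\<in>?I. c i * a i j0) / a i0 j0"
    let ?c = "c(i0 := ?s)"
    have e: "(\<Sum>i\<in>I. ?c i * a i j) = ?s * a i0 j + (\<Sum>i\<in>?I. c i * a i j)" for j
      using i0 insert.prems by (subst sum.remove[of I i0]) auto
    have "(\<Sum>i\<in>I. ?c i * a i j) = 0" if "j \<in> J" for j
    proof -
      have "(\<Sum>i\<in>?I. c i * ?a i j) = (\<Sum>i\<in>?I. c i * a i j) + ?s * a i0 j"
        by (simp add: algebra_simps sum_subtractf sum_distrib_left sum_divide_distrib sum_negf)
      then show ?thesis using c(2) that e[of j] by simp
    qed
    moreover have "(\<Sum>i\<in>I. ?c i * a i j0) = 0" using i0 by (subst e) simp
    moreover have "\<exists>i\<in>I. ?c i \<noteq> 0" using c(1) by auto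
    ultimately show ?thesis by (intro exI[of _ ?c]) auto
  qed
qed

text \<open>Every exponent is bounded separately, not their sum; the admissible monomials then form
  a box that is easily counted.\<close>

definition tdeg_le :: "'v mpoly \<Rightarrow> nat \<Rightarrow> bool" where
  "tdeg_le P d \<longleftrightarrow> (\<forall>m\<in>keys P. \<forall>j. lookup m j \<le> d)"

lemma tdeg_le_mult: "tdeg_le P d \<Longrightarrow> tdeg_le Q e \<Longrightarrow> tdeg_le (P * Q) (d + e)"
  unfolding tdeg_le_def using keys_mult[of P Q] by (fastforce simp: lookup_add intro: add_mono)

lemma tdeg_le_1: "tdeg_le 1 0" by (simp add: tdeg_le_def)

lemma tdeg_le_power: "tdeg_le P d \<Longrightarrow> tdeg_le (P ^ k) (k * d)"
  by (induction k) (auto simp: tdeg_le_1 intro: tdeg_le_mult)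

lemma tdeg_le_prod: "(\<And>s. s \<in> S \<Longrightarrow> tdeg_le (f s) (d s)) \<Longrightarrow> tdeg_le (prod f S) (sum d S)"
  by (induction S rule: infinite_finite_induct) (auto simp: tdeg_le_1 intro: tdeg_le_mult)

lemma tdeg_le_mono: "tdeg_le P d \<Longrightarrow> d \<le> e \<Longrightarrow> tdeg_le P e"
  unfolding tdeg_le_def by (meson order_trans)

lemma tdeg_le_exists: "\<exists>d. tdeg_le (P :: 'v::finite mpoly) d"
proof -
  have "lookup m j \<le> (\<Sum>m\<in>keys P. \<Sum>j\<in>UNIV. lookup m j)" if "m \<in> keys P" for m j
    by (rule order_trans[OF member_le_sum[of j UNIV "lookup m"] member_le_sum[of m "keys P" "\<lambda>m. sum (lookup m) UNIV"]])
      (use that in auto)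
  then show ?thesis unfolding tdeg_le_def by blast
qed

definition expo :: "('v::finite \<Rightarrow> nat) \<Rightarrow> 'v \<Rightarrow>\<^sub>0 nat" where "expo = Abs_poly_mapping"

lemma lookup_expo [simp]: "lookup (expo f) = f"
  by (simp add: expo_def)

lemma expo_lookup [simp]: "expo (lookup m) = m"
  by (simp add: expo_def)

definition exp_box :: "nat \<Rightarrow> ('v::finite \<Rightarrow>\<^sub>0 nat) set" where "exp_box L = {m. \<forall>v. lookup m v \<le> L}"

lemma exp_box_card: "finite (exp_box L :: ('v::finite \<Rightarrow>\<^sub>0 nat) set)" "card (exp_box L :: ('v::finite \<Rightarrow>\<^sub>0 nat) set) = (L + 1) ^ CARD('v)"
proof -
  have b: "bij_betw expo (Pi\<^sub>E UNIV (\<lambda>_::'v. {..L})) (exp_box L)"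
    by (rule bij_betw_byWitness[where f' = lookup]) (auto simp: exp_box_def PiE_UNIV_domain)
  have "finite (Pi\<^sub>E UNIV (\<lambda>_::'v. {..L}))" by (intro finite_PiE) auto
  with b show "finite (exp_box L :: ('v \<Rightarrow>\<^sub>0 nat) set)" by (metis bij_betw_finite)
  show "card (exp_box L :: ('v \<Rightarrow>\<^sub>0 nat) set) = (L + 1) ^ CARD('v)"
    using bij_betw_same_card[OF b] by (simp add: card_PiE)
qed

text \<open>A count: the \<open>option\<close> type indexes n + 1 functions, so there are
  \<open>(L + 1) ^ (n + 1)\<close> monomials in them with exponents up to \<open>L\<close>. After
  multiplication by a common denominator they lie in a space of dimension
  \<open>(s * L + 1) ^ n\<close>, which is smaller once \<open>L\<close> is large.\<close>

lemma alg_dependent: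
  fixes r :: "'n::finite option \<Rightarrow> 'n ratfun"
  shows "\<exists>R. R \<noteq> 0 \<and> heval of_const r R = 0"
proof -
  have "\<forall>v. \<exists>A B. B \<noteq> 0 \<and> r v = of_mpoly A / of_mpoly B" by (metis ratfun_cases)
  then obtain A B where AB: "\<And>v. B v \<noteq> 0" "\<And>v. r v = of_mpoly (A v) / of_mpoly (B v)" by metis
  define Dn where "Dn = prod B UNIV"
  define N where "N v = A v * prod B (UNIV - {v})" for v
  have iB: "of_mpoly Dn = (\<Prod>v\<in>UNIV. of_mpoly (B v))" unfolding Dn_def by (rule rhom_prod[OF rhom_of_mpoly])
  have Dn: "of_mpoly Dn \<noteq> 0" using AB(1) by (simp add: iB)
  have rN: "r v * of_mpoly Dn = of_mpoly (N v)" for v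
  proof -
    have "of_mpoly Dn = of_mpoly (B v) * of_mpoly (prod B (UNIV - {v}))"
      unfolding iB by (subst prod.remove[of _ v]) (auto simp: rhom_prod[OF rhom_of_mpoly])
    then show ?thesis using AB[of v] by (simp add: N_def)
  qed
  have "\<forall>v. \<exists>d. tdeg_le (N v) d" by (simp add: tdeg_le_exists)
  then obtain d where d: "\<And>v. tdeg_le (N v) (d v)" by metis
  obtain d' where d': "tdeg_le Dn d'" using tdeg_le_exists by blast
  define del where "del = d' + sum d UNIV"
  have del: "tdeg_le (N v) del" "tdeg_le Dn del" for v
    using tdeg_le_mono[OF d[of v], of del] tdeg_le_mono[OF d', of del] member_le_sum[of v UNIV d] by (auto simp: del_def)
  \<comment> \<open>Each of the n + 1 factors of \<open>T m\<close> has degree at most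
    \<open>L * del\<close> in every variable, so \<open>T m\<close> has degree at most
    \<open>s * L\<close>.\<close>
  define s where "s = (CARD('n) + 1) * del"
  \<comment> \<open>With this choice \<open>((s + 1) * (L + 1)) ^ n\<close> equals
    \<open>L * (L + 1) ^ n\<close>, just below \<open>(L + 1) ^ (n + 1)\<close>.\<close>
  define L where "L = (s + 1) ^ CARD('n)"
  \<comment> \<open>The numerator of the monomial with exponent \<open>m\<close> in the
    \<open>r v\<close> over the denominator \<open>Dn ^ (L * (n + 1))\<close>, common to all
    \<open>m\<close>.\<close>
  define T where "T m = (\<Prod>v\<in>UNIV. N v ^ lookup m v * Dn ^ (L - lookup m v))" for m :: "'n option \<Rightarrow>\<^sub>0 nat"
  have Tdg: "keys (T m) \<subseteq> exp_box (s * L)" if "m \<in> exp_box L" for m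
  proof -
    have "tdeg_le (N v ^ lookup m v * Dn ^ (L - lookup m v)) (L * del)" for v
    proof -
      have "tdeg_le (N v ^ lookup m v * Dn ^ (L - lookup m v)) (lookup m v * del + (L - lookup m v) * del)"
        by (intro tdeg_le_mult tdeg_le_power del)
      moreover have "lookup m v * del + (L - lookup m v) * del = L * del"
        using that by (simp add: exp_box_def flip: add_mult_distrib)
      ultimately show ?thesis by simp
    qed
    then have "tdeg_le (T m) (\<Sum>v\<in>(UNIV::'n option set). L * del)" unfolding T_def by (intro tdeg_le_prod)
    moreover have "(\<Sum>v\<in>(UNIV::'n option set). L * del) = s * L" by (simp add: s_def card_UNIV_option algebra_simps)
    ultimately show ?thesis by (auto simp: tdeg_le_def exp_box_def)
  qed
  have "card (exp_box (s * L) :: ('n \<Rightarrow>\<^sub>0 nat) set) < card (exp_box L :: ('n option \<Rightarrow>\<^sub>0 nat) set)"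
  proof -
    have "(s * L + 1) ^ CARD('n) \<le> ((s + 1) * (L + 1)) ^ CARD('n)"
      by (intro power_mono) (auto simp: algebra_simps)
    also have "\<dots> = L * (L + 1) ^ CARD('n)" unfolding power_mult_distrib by (simp add: L_def)
    also have "\<dots> < (L + 1) ^ (CARD('n) + 1)" by simp
    finally show ?thesis by (simp add: exp_box_card card_UNIV_option)
  qed
  from linear_system[OF exp_box_card(1) exp_box_card(1) this, of "\<lambda>m. lookup (T m)"]
  obtain c where c: "\<exists>m\<in>exp_box L. c m \<noteq> 0" 
    and z: "\<And>k. k \<in> exp_box (s * L) \<Longrightarrow> (\<Sum>m\<in>exp_box L. c m * lookup (T m) k) = 0" by auto
  have 0: "(\<Sum>m\<in>exp_box L. Cst (c m) * T m) = 0"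
  proof (rule poly_mapping_eqI)
    fix k
    have *: "lookup (Cst (c m) * T m) k = c m * lookup (T m) k" for m
      by (simp add: Cst_def flip: mult_map_scale_conv_mult) (simp add: Poly_Mapping.map.rep_eq when_def)
    show "lookup (\<Sum>m\<in>exp_box L. Cst (c m) * T m) k = lookup 0 k"
    proof (cases "k \<in> exp_box (s * L)")
      case True
      then show ?thesis by (simp add: lookup_sum * z)
    next
      case False
      then have "lookup (T m) k = 0" if "m \<in> exp_box L" for m using Tdg[OF that] by (auto simp: in_keys_iff)
      then show ?thesis by (simp add: lookup_sum *)
    qed
  qed
  define R where "R = (\<Sum>m\<in>exp_box L. Poly_Mapping.single m (c m))"
  have lR: "lookup R m = (if m \<in> exp_box L then c m else 0)" for m
    by (simp add: R_def lookup_sum lookup_single when_def exp_box_card(1))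
  have "R \<noteq> 0" using c lR by (metis lookup_zero)
  moreover have "heval of_const r R = 0"
  proof -
    have "heval of_const r R * of_mpoly Dn ^ (L * CARD('n option)) = (\<Sum>m\<in>exp_box L. of_const (c m) * of_mpoly (T m))"
    proof -
      have "(\<Prod>v\<in>keys m. r v ^ lookup m v) * of_mpoly Dn ^ (L * CARD('n option)) = of_mpoly (T m)" if "m \<in> exp_box L" for m
      proof -
        have "(\<Prod>v\<in>keys m. r v ^ lookup m v) = (\<Prod>v\<in>UNIV. r v ^ lookup m v)"
          by (rule prod.mono_neutral_left) (auto simp: in_keys_iff)
        moreover have "of_mpoly Dn ^ (L * CARD('n option)) = (\<Prod>v\<in>(UNIV::'n option set). of_mpoly Dn ^ L)"
          by (simp only: prod_constant power_mult)
        moreover have "r v ^ lookup m v * of_mpoly Dn ^ L = of_mpoly (N v) ^ lookup m v * of_mpoly Dn ^ (L - lookup m v)" for v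
        proof -
          have "L = lookup m v + (L - lookup m v)" using that by (simp add: exp_box_def)
          then have "of_mpoly Dn ^ L = of_mpoly Dn ^ lookup m v * of_mpoly Dn ^ (L - lookup m v)" by (metis power_add)
          then show ?thesis by (simp add: power_mult_distrib flip: rN)
        qed
        ultimately show ?thesis
          by (simp only: T_def rhom_prod[OF rhom_of_mpoly] of_mpoly_simps prod.distrib[symmetric])
      qed
      then show ?thesis
        by (simp add: R_def heval_sum[OF rhom_of_const] heval_single[OF rhom_of_const] sum_distrib_right mult.assoc)
    qed
    also have "\<dots> = of_mpoly (\<Sum>m\<in>exp_box L. Cst (c m) * T m)" by (simp add: of_const_def rhom_sum[OF rhom_of_mpoly])
    also have "\<dots> = 0" by (simp add: 0)
    finally show ?thesis using Dn by simp
  qed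
  ultimately show ?thesis by blast
qed

definition novar :: "'v \<Rightarrow> 'v mpoly \<Rightarrow> bool" where
  "novar v R \<longleftrightarrow> (\<forall>m\<in>keys R. lookup m v = 0)"

text \<open>If \<open>R\<close> vanishes when \<open>v\<close> is replaced by a nonzero element,
  then \<open>R1\<close>, which is free of \<open>v\<close>, takes a value divisible by that
  element. So a relation becomes a congruence with one variable less. The last clause allows the
  step to be repeated with a second variable.\<close>

lemma divide_var:
  fixes R :: "'v::finite mpoly"
  assumes "R \<noteq> 0"
  shows "\<exists>k R1 R2. R = var v ^ k * (R1 + var v * R2) \<and> R1 \<noteq> 0 \<and> novar v R1 \<and> (\<forall>w. w \<noteq> v \<and> novar w R \<longrightarrow> novar w R1)"
proof -
  define k where "k = Min ((\<lambda>m. lookup m v) ` keys R)"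
  have ne: "keys R \<noteq> {}" using assms by (metis keys_eq_empty)
  have kle: "k \<le> lookup m v" if "m \<in> keys R" for m
    unfolding k_def by (rule Min_le) (use that in auto)
  have "k \<in> (\<lambda>m. lookup m v) ` keys R" unfolding k_def by (rule Min_in) (use ne in auto)
  then obtain m0 where m0: "m0 \<in> keys R" "lookup m0 v = k" by auto
  let ?e = "\<lambda>k. Poly_Mapping.single v (k::nat)"
  let ?S1 = "{m\<in>keys R. lookup m v = k}" and ?S2 = "{m\<in>keys R. lookup m v > k}"
  define R1 where "R1 = (\<Sum>m\<in>?S1. Poly_Mapping.single (m - ?e k) (lookup R m))"
  define R2 where "R2 = (\<Sum>m\<in>?S2. Poly_Mapping.single (m - ?e (Suc k)) (lookup R m))"
  have pw: "var v ^ k = mpoly_monom (?e k)" for k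
    by (simp add: mpoly_monom_prod lookup_single when_def) 
      (simp add: prod.delta if_distrib[of "\<lambda>x. _ ^ x"] cong: if_cong)
  have a1: "?e k + (m - ?e k) = m" if "m \<in> keys R" for m
    by (rule poly_mapping_eqI) (use kle[OF that] in \<open>auto simp: lookup_add lookup_minus lookup_single when_def\<close>)
  have a2: "?e (Suc k) + (m - ?e (Suc k)) = m" if "m \<in> ?S2" for m
    by (rule poly_mapping_eqI) (use that in \<open>auto simp: lookup_add lookup_minus lookup_single when_def\<close>)
  have "var v ^ k * (R1 + var v * R2) = var v ^ k * R1 + var v ^ Suc k * R2" by (simp add: algebra_simps)
  also have "\<dots> = (\<Sum>m\<in>?S1. Poly_Mapping.single m (lookup R m)) + (\<Sum>m\<in>?S2. Poly_Mapping.single m (lookup R m))"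
    unfolding pw R1_def R2_def sum_distrib_left mpoly_monom_def mult_single
    by (intro arg_cong2[where f="(+)"] sum.cong) (use a1 a2 in auto)
  also have "\<dots> = (\<Sum>m\<in>?S1 \<union> ?S2. Poly_Mapping.single m (lookup R m))"
    by (rule sum.union_disjoint[symmetric]) auto
  also have "?S1 \<union> ?S2 = keys R" using kle by (auto simp: le_less)
  also have "(\<Sum>m\<in>keys R. Poly_Mapping.single m (lookup R m)) = R" by (rule mpoly_sum_singles[symmetric])
  finally have 1: "R = var v ^ k * (R1 + var v * R2)" by simp
  have lk: "lookup R1 m = (if m + ?e k \<in> ?S1 then lookup R (m + ?e k) else 0)" for m
  proof -
    have "(m' - ?e k = m) = (m' = m + ?e k)" if "m' \<in> ?S1" for m'
    proof -
      have "m' = (m' - ?e k) + ?e k" using a1[of m'] that by (simp add: add.commute)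
      then show ?thesis by (metis add_diff_cancel_right')
    qed
    then have "lookup R1 m = (\<Sum>m'\<in>?S1. if m' = m + ?e k then lookup R (m + ?e k) else 0)"
      unfolding R1_def lookup_sum lookup_single when_def by (intro sum.cong) auto
    also have "\<dots> = (if m + ?e k \<in> ?S1 then lookup R (m + ?e k) else 0)"
      by (subst sum.delta) auto
    finally show ?thesis .
  qed
  have "lookup R1 (m0 - ?e k) = lookup R m0" using m0 a1[of m0] by (simp add: lk add.commute)
  then have 2: "R1 \<noteq> 0" using m0 by (auto simp: in_keys_iff)
  have 3: "novar v R1" unfolding novar_def by (auto simp: in_keys_iff lk lookup_add split: if_splits)
  have 4: "novar w R1" if "w \<noteq> v" "novar w R" for w
    unfolding novar_def
  proof
    fix m assume "m \<in> keys R1"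
    then have "m + ?e k \<in> keys R" by (auto simp: in_keys_iff lk split: if_splits)
    then have "lookup (m + ?e k) w = 0" using that by (auto simp: novar_def)
    then show "lookup m w = 0" by (simp add: lookup_add)
  qed
  show ?thesis using 1 2 3 4 by blast
qed

section \<open>Points of projective space and homogeneous polynomials\<close>

lemma proj_rep_nz: "rep_proj l \<noteq> 0"
  using Quotient_rep_reflp[OF Quotient_proj, of l] by simp

lemma proj_abs_rep: "abs_proj (rep_proj l) = l"
  using Quotient_abs_rep[OF Quotient_proj] .

lemma proj_abs_eq:
  assumes "v \<noteq> 0" "w \<noteq> 0"
  shows "abs_proj v = abs_proj w \<longleftrightarrow> (\<exists>t. t \<noteq> 0 \<and> w = t *s v)"
proof -
  have r: "x \<noteq> 0 \<and> x \<noteq> 0 \<and> (\<exists>t. t \<noteq> 0 \<and> x = t *s x)" if "x \<noteq> 0" for x :: "complex ^ 'a"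
    using that by (auto intro!: exI[of _ 1])
  show ?thesis using Quotient_rel[OF Quotient_proj, of v w] r assms by blast
qed

lemma proj_rep_abs:
  assumes "v \<noteq> 0" shows "\<exists>t. t \<noteq> 0 \<and> rep_proj (abs_proj v) = t *s v"
  using proj_abs_eq[OF assms proj_rep_nz, of "abs_proj v"] by (simp add: proj_abs_rep)

abbreviation hom :: "nat \<Rightarrow> ('n + 'm::finite) mpoly \<Rightarrow> bool" where "hom \<equiv> proj_homogeneous"

lemma hom_0 [simp]: "hom d 0" by (simp add: proj_homogeneous_def)

lemma hom_add: "hom d P \<Longrightarrow> hom d Q \<Longrightarrow> hom d (P + Q)"
  unfolding proj_homogeneous_def using Poly_Mapping.keys_add[of P Q] by blast

lemma hom_uminus: "hom d P \<Longrightarrow> hom d (- P)"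
  unfolding proj_homogeneous_def by (simp add: in_keys_iff)

lemma hom_diff: "hom d P \<Longrightarrow> hom d Q \<Longrightarrow> hom d (P - Q)"
  using hom_add[of d P "- Q"] hom_uminus[of d Q] by simp

lemma hom_mult: "hom d P \<Longrightarrow> hom e Q \<Longrightarrow> hom (d + e) (P * Q)"
  unfolding proj_homogeneous_def using keys_mult[of P Q] by (fastforce simp: lookup_add sum.distrib)

lemma hom_Cst: "hom 0 (Cst c)"
  by (auto simp: proj_homogeneous_def Cst_def)

lemma hom_1: "hom 0 1"
  using hom_Cst[of 1] by (simp add: Cst_def)

lemma hom_Inl: "hom 0 (var (Inl i))"
  by (auto simp: proj_homogeneous_def var_def mpoly_monom_def lookup_single when_def)

lemma hom_Inr: "hom 1 (var (Inr j))"
  by (auto simp: proj_homogeneous_def var_def mpoly_monom_def lookup_single when_def)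

lemma hom_power: "hom d P \<Longrightarrow> hom (k * d) (P ^ k)"
  by (induction k) (auto simp: hom_1 intro: hom_mult)

lemma UNIV_sum_prod: "(\<Prod>v\<in>(UNIV :: ('n::finite + 'm::finite) set). h v) = (\<Prod>i\<in>UNIV. h (Inl i)) * (\<Prod>j\<in>UNIV. h (Inr j))"
  unfolding UNIV_Plus_UNIV[symmetric] by (simp add: prod.Plus del: UNIV_Plus_UNIV)

lemma heval_hom:
  fixes P :: "('n::finite + 'm::finite) mpoly"
  assumes "rhom \<kappa>" "hom d P"
  shows "heval \<kappa> (case_sum a (\<lambda>j. t * b j)) P = t ^ d * heval \<kappa> (case_sum a b) P"
  unfolding heval_finite[OF assms(1)] sum_distrib_left
proof (rule sum.cong[OF refl])
  fix m assume "m \<in> keys P"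
  then have "(\<Sum>j\<in>UNIV. lookup m (Inr j)) = d" using assms(2) by (simp add: proj_homogeneous_def)
  then have "(\<Prod>j\<in>UNIV. (t * b j) ^ lookup m (Inr j)) = t ^ d * (\<Prod>j\<in>UNIV. b j ^ lookup m (Inr j))"
    by (simp add: power_mult_distrib prod.distrib flip: power_sum)
  then show "\<kappa> (lookup P m) * (\<Prod>v\<in>UNIV. (case v of Inl x \<Rightarrow> a x | Inr j \<Rightarrow> t * b j) ^ lookup m v) =
         t ^ d * (\<kappa> (lookup P m) * (\<Prod>v\<in>UNIV. (case v of Inl x \<Rightarrow> a x | Inr x \<Rightarrow> b x) ^ lookup m v))"
    by (simp add: UNIV_sum_prod mult_ac)
qed

definition emb :: "'n::finite mpoly \<Rightarrow> ('n + 'm::finite) mpoly" where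
  "emb A = heval Cst (\<lambda>i. var (Inl i)) A"

lemma hom_emb: "hom 0 (emb A :: ('n::finite + 'm::finite) mpoly)"
  unfolding emb_def
proof (induction A rule: mpoly_induct)
  case (mult P Q)
  then show ?case using hom_mult[of 0 _ 0] by (simp add: heval_mult[OF rhom_Cst])
qed (auto simp: heval_Cst[OF rhom_Cst] heval_var[OF rhom_Cst] heval_add[OF rhom_Cst] hom_Cst hom_Inl intro: hom_add)

lemma heval_emb:
  assumes "rhom \<kappa>" shows "heval \<kappa> x (emb A) = heval \<kappa> (\<lambda>i. x (Inl i)) A"
  unfolding emb_def
  by (subst rhom_heval_comp[OF rhom_heval[OF assms]]) (simp add: heval_Cst[OF assms] heval_var[OF assms])

definition ev :: "complex ^ 'n \<Rightarrow> 'n::finite mpoly \<Rightarrow> complex" where "ev y A = peval (\<lambda>i. y $ i) A"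

lemma rhom_ev: "rhom (ev y)" unfolding ev_def by (rule rhom_peval)

lemmas ev_simps = rhom_simps[OF rhom_ev] rhom_diff[OF rhom_ev] rhom_uminus[OF rhom_ev] rhom_power[OF rhom_ev]

lemma ev_Cst: "ev y (Cst c) = c" and ev_var: "ev y (var i) = y $ i"
  by (simp_all add: ev_def peval_simps)

lemma ev_inj: "(\<And>y. ev y A = 0) \<Longrightarrow> A = 0"
  unfolding ev_def by (rule peval_vec_inj)

lemma pval_simps:
  "pval 0 p = 0" "pval 1 p = 1" "pval (P + Q) p = pval P p + pval Q p" "pval (P * Q) p = pval P p * pval Q p"
  "pval (P - Q) p = pval P p - pval Q p" "pval (- P) p = - pval P p" "pval (Cst c) p = c" 
  "pval (var (Inl i)) p = fst p $ i" "pval (var (Inr j)) p = rep_proj (snd p) $ j" "pval (P ^ k) p = pval P p ^ k"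
  unfolding pval_def
  by (simp_all add: peval_simps rhom_diff[OF rhom_peval] rhom_uminus[OF rhom_peval] rhom_power[OF rhom_peval])

lemma pval_emb: "pval (emb A) p = ev (fst p) A"
  by (simp add: pval_def peval_heval heval_emb[OF rhom_id] ev_def)

lemma pullback_ev: "pullback A p = ev (fst p) A"
  by (simp add: pullback_def ev_def)

section \<open>The Zariski topology\<close>

lemma zclosed_hom: "hom d P \<Longrightarrow> zclosed {p. pval P p = 0}"
  unfolding zclosed_def by (rule exI[of _ "{P}"]) auto

lemma zclosed_empty: "zclosed {}"
  using zclosed_hom[OF hom_1] by (simp add: pval_simps)

lemma zclosed_Inter: "(\<And>C. C \<in> F \<Longrightarrow> zclosed C) \<Longrightarrow> zclosed (\<Inter>F)"
proof -
  assume "\<And>C. C \<in> F \<Longrightarrow> zclosed C"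
  then have "\<forall>C\<in>F. \<exists>Ps. (\<forall>P\<in>Ps. \<exists>d. hom d P) \<and> C = {p. \<forall>P\<in>Ps. pval P p = 0}" by (simp add: zclosed_def)
  then obtain Ps where Ps: "\<forall>C\<in>F. (\<forall>P\<in>Ps C. \<exists>d. hom d P) \<and> C = {p. \<forall>P\<in>Ps C. pval P p = 0}"
    unfolding bchoice_iff by blast
  have m: "p \<in> C \<longleftrightarrow> (\<forall>P\<in>Ps C. pval P p = 0)" if "C \<in> F" for C p
  proof -
    have "C = {p. \<forall>P\<in>Ps C. pval P p = 0}" using Ps that by blast
    then have "p \<in> C \<longleftrightarrow> p \<in> {p. \<forall>P\<in>Ps C. pval P p = 0}" by (rule arg_cong)
    then show ?thesis by simp
  qed
  have 1: "\<forall>P\<in>(\<Union>C\<in>F. Ps C). \<exists>d. hom d P" using Ps by simp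
  have 2: "\<Inter>F = {p. \<forall>P\<in>(\<Union>C\<in>F. Ps C). pval P p = 0}"
    by (rule set_eqI) (simp add: m)
  show ?thesis unfolding zclosed_def by (rule exI[of _ "\<Union>C\<in>F. Ps C"]) (use 1 2 in blast)
qed

lemma zclosed_Un: 
  assumes "zclosed A" "zclosed B" shows "zclosed (A \<union> B)"
proof -
  obtain Ps Qs where *: "\<forall>P\<in>Ps. \<exists>d. hom d P" "A = {p. \<forall>P\<in>Ps. pval P p = 0}"
    "\<forall>P\<in>Qs. \<exists>d. hom d P" "B = {p. \<forall>P\<in>Qs. pval P p = 0}" using assms by (auto simp: zclosed_def)
  let ?R = "{P * Q | P Q. P \<in> Ps \<and> Q \<in> Qs}"
  have 1: "\<exists>d. hom d R" if R: "R \<in> ?R" for R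
  proof -
    obtain P Q where "R = P * Q" "P \<in> Ps" "Q \<in> Qs" using R by blast
    moreover obtain d e where "hom d P" "hom e Q" using *(1,3) calculation by blast
    ultimately show ?thesis using hom_mult by blast
  qed
  have 2: "A \<union> B = {p. \<forall>P\<in>?R. pval P p = 0}"
  proof (intro set_eqI iffI)
    fix p assume "p \<in> A \<union> B" then show "p \<in> {p. \<forall>P\<in>?R. pval P p = 0}"
      unfolding *(2,4) by (auto simp: pval_simps)
  next
    fix p assume p: "p \<in> {p. \<forall>P\<in>?R. pval P p = 0}"
    show "p \<in> A \<union> B"
    proof (rule ccontr)
      assume "p \<notin> A \<union> B"
      then obtain P Q where "P \<in> Ps" "pval P p \<noteq> 0" "Q \<in> Qs" "pval Q p \<noteq> 0" unfolding *(2,4) by blast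
      moreover have "pval (P * Q) p = 0" using p calculation by blast
      ultimately show False by (simp add: pval_simps)
    qed
  qed
  show ?thesis unfolding zclosed_def by (rule exI[of _ ?R]) (use 1 2 in blast)
qed

lemma zclosure_closed: "zclosed (zclosure S)" and zclosure_subset: "S \<subseteq> zclosure S"
  and zclosure_min: "zclosed C \<Longrightarrow> S \<subseteq> C \<Longrightarrow> zclosure S \<subseteq> C"
  unfolding zclosure_def by (auto intro!: zclosed_Inter)

lemma zclosed_separate:
  assumes "zclosed C" "p \<notin> C" 
  obtains d P where "hom d P" "pval P p \<noteq> 0" "\<And>q. q \<in> C \<Longrightarrow> pval P q = 0"
proof -
  obtain Ps where Ps: "\<forall>P\<in>Ps. \<exists>d. hom d P" "C = {p. \<forall>P\<in>Ps. pval P p = 0}"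
    using assms(1) unfolding zclosed_def by blast
  then obtain P where P: "P \<in> Ps" "pval P p \<noteq> 0" using assms(2) by blast
  then obtain d where "hom d P" using Ps by blast
  with P show ?thesis using that[of d P] Ps(2) by blast
qed

lemma zclosure_van_iff:
  assumes "hom d P" shows "(\<forall>p\<in>zclosure S. pval P p = 0) \<longleftrightarrow> (\<forall>p\<in>S. pval P p = 0)"
  using zclosure_min[OF zclosed_hom[OF assms], of S] zclosure_subset[of S] by auto

section \<open>Properties that hold near a point\<close>

lemma near_mono: "near X p R \<Longrightarrow> (\<And>q. R q \<Longrightarrow> R' q) \<Longrightarrow> near X p R'"
  unfolding near_def by blast

lemma near_at: "near X p R \<Longrightarrow> R p"
  unfolding near_def by blast

lemma near_conj: 
  assumes "near X p R" "near X p R'" shows "near X p (\<lambda>q. R q \<and> R' q)"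
proof -
  obtain C C' where C: "zclosed C" "p \<in> X - C" "\<forall>q\<in>X - C. R q" "zclosed C'" "p \<in> X - C'" "\<forall>q\<in>X - C'. R' q"
    using assms unfolding near_def zopen_in_def by blast
  have "zclosed (C \<union> C')" "p \<in> X - (C \<union> C')" "\<forall>q\<in>X - (C \<union> C'). R q \<and> R' q"
    using C zclosed_Un by auto
  then show ?thesis unfolding near_def zopen_in_def by (intro exI[of _ "X - (C \<union> C')"]) blast
qed

lemma near_in: "p \<in> X \<Longrightarrow> near X p (\<lambda>q. q \<in> X)"
  unfolding near_def zopen_in_def using zclosed_empty by (intro exI[of _ "X"]) auto

lemma near_hom: "p \<in> X \<Longrightarrow> hom d Q \<Longrightarrow> pval Q p \<noteq> 0 \<Longrightarrow> near X p (\<lambda>q. q \<in> X \<and> pval Q q \<noteq> 0)"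
  unfolding near_def zopen_in_def using zclosed_hom by (intro exI[of _ "X - {q. pval Q q = 0}"]) auto

lemma near_ball:
  assumes "p \<in> X" "finite S" "\<And>s. s \<in> S \<Longrightarrow> near X p (R s)"
  shows "near X p (\<lambda>q. \<forall>s\<in>S. R s q)"
  using assms(2,3) 
  by (induction S rule: finite_induct) 
    (auto intro: near_mono[OF near_in[OF assms(1)]] near_mono[OF near_conj])

lemma near_all_finite:
  fixes R :: "'s::finite \<Rightarrow> _"
  shows "p \<in> X \<Longrightarrow> (\<And>s. near X p (R s)) \<Longrightarrow> near X p (\<lambda>q. \<forall>s. R s q)"
  using near_ball[of p X UNIV R] by simp

lemma near_near: "near X p R \<Longrightarrow> near X p (\<lambda>q. near X q R)"
  unfolding near_def by blast

lemma near_mem: "near X p R \<Longrightarrow> p \<in> X"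
  unfolding near_def zopen_in_def by blast

text \<open>The sets \<open>primeset\<close> are those with irreducible closure; besides the irreducible closed sets they
  include the single points, so that the local rings at points and along subvarieties are treated
  at the same time.\<close>

definition nonvan :: "('n::finite,'m::finite) pt set \<Rightarrow> ('n + 'm) mpoly \<Rightarrow> bool" where
  "nonvan S P \<longleftrightarrow> (\<exists>p\<in>S. pval P p \<noteq> 0)"

definition primeset :: "('n::finite,'m::finite) pt set \<Rightarrow> bool" where
  "primeset S \<longleftrightarrow> S \<noteq> {} \<and> (\<forall>d e P Q. hom d P \<longrightarrow> hom e Q \<longrightarrow> nonvan S P \<longrightarrow> nonvan S Q \<longrightarrow> nonvan S (P * Q))"

lemma primeset_point: "primeset {p}"
  by (simp add: primeset_def nonvan_def pval_simps)

lemma nonvan_point [simp]: "nonvan {p} P \<longleftrightarrow> pval P p \<noteq> 0"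
  by (simp add: nonvan_def)

lemma irreducible_primeset: "irreducible_closed E \<Longrightarrow> primeset E"
  unfolding primeset_def
proof (intro conjI allI impI)
  assume E: "irreducible_closed E"
  then show "E \<noteq> {}" by (simp add: irreducible_closed_def)
  fix d e and P Q :: "('a + 'b) mpoly" assume h: "hom d P" "hom e Q" and n: "nonvan E P" "nonvan E Q"
  show "nonvan E (P * Q)"
  proof (rule ccontr)
    assume "\<not> nonvan E (P * Q)"
    then have "E \<subseteq> {p. pval P p = 0} \<union> {p. pval Q p = 0}" by (auto simp: nonvan_def pval_simps)
    then have "E \<subseteq> {p. pval P p = 0} \<or> E \<subseteq> {p. pval Q p = 0}"
      using E zclosed_hom[OF h(1)] zclosed_hom[OF h(2)] unfolding irreducible_closed_def by blast
    then show False using n by (auto simp: nonvan_def)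
  qed
qed

lemma primeset_closure_irreducible:
  assumes "primeset S" shows "irreducible_closed (zclosure S)"
  unfolding irreducible_closed_def
proof (intro conjI allI impI)
  show "zclosed (zclosure S)" by (rule zclosure_closed)
  show "zclosure S \<noteq> {}" using assms zclosure_subset[of S] by (auto simp: primeset_def)
  fix S1 S2 assume *: "zclosed S1 \<and> zclosed S2 \<and> zclosure S \<subseteq> S1 \<union> S2"
  show "zclosure S \<subseteq> S1 \<or> zclosure S \<subseteq> S2"
  proof (rule ccontr)
    assume "\<not> ?thesis"
    then have "\<not> S \<subseteq> S1" "\<not> S \<subseteq> S2" using * zclosure_min by blast+
    then obtain p1 p2 where p: "p1 \<in> S" "p1 \<notin> S1" "p2 \<in> S" "p2 \<notin> S2" by blast
    obtain d1 P1 where 1: "hom d1 P1" "pval P1 p1 \<noteq> 0" "\<And>q. q \<in> S1 \<Longrightarrow> pval P1 q = 0"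
      using zclosed_separate[of S1 p1] * p by blast
    obtain d2 P2 where 2: "hom d2 P2" "pval P2 p2 \<noteq> 0" "\<And>q. q \<in> S2 \<Longrightarrow> pval P2 q = 0"
      using zclosed_separate[of S2 p2] * p by blast
    have "nonvan S (P1 * P2)" using assms 1 2 p unfolding primeset_def nonvan_def by blast
    then show False using * zclosure_subset[of S] 1(3) 2(3) by (auto simp: nonvan_def pval_simps)
  qed
qed

text \<open>A nonempty open subset of an irreducible set is dense.\<close>

lemma primeset_closed_dense:
  assumes E: "irreducible_closed E" and "p \<in> E" "p \<notin> C" "zclosed C" "hom d P" "\<And>q. q \<in> E \<Longrightarrow> q \<notin> C \<Longrightarrow> pval P q = 0"
  shows "\<not> nonvan E P"
proof -
  have "E \<subseteq> C \<union> {q. pval P q = 0}" using assms(6) by blast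
  then have "E \<subseteq> C \<or> E \<subseteq> {q. pval P q = 0}" using E zclosed_hom[OF assms(5)] assms(4) unfolding irreducible_closed_def by blast
  then show ?thesis using assms(2,3) by (auto simp: nonvan_def)
qed

section \<open>Local rings of a birational model\<close>

text \<open>\<open>X\<close> contains the graph of the rational map \<open>G\<close> as a dense open subset.\<close>

locale bir =
  fixes X :: "('n::finite, 'm::finite) pt set" and f :: "'n mpoly" and G :: "'m \<Rightarrow> 'n mpoly"
  assumes irr: "irreducible_closed X" and f0: "f \<noteq> 0"
    and graph: "\<And>y. ev y f \<noteq> 0 \<Longrightarrow> (\<chi> j. ev y (G j)) \<noteq> 0 \<and> {l. (y, l) \<in> X} = {abs_proj (\<chi> j. ev y (G j))}"
begin

text \<open>\<open>on_graph\<close> restricts a polynomial to the graph. The rational functions on \<open>X\<close> are identified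
  with those on \<open>\<complex>\<^sup>n\<close>, the quotient of \<open>P\<close> and \<open>Q\<close> corresponding to \<open>hat P / hat Q\<close>.\<close>

definition Gv :: "complex ^ 'n \<Rightarrow> complex ^ 'm" where "Gv y = (\<chi> j. ev y (G j))"
definition graph_pt :: "complex ^ 'n \<Rightarrow> ('n, 'm) pt" where "graph_pt y = (y, abs_proj (Gv y))"
definition on_graph :: "('n + 'm) mpoly \<Rightarrow> 'n mpoly" where "on_graph P = heval Cst (case_sum var G) P"
definition hat :: "('n + 'm) mpoly \<Rightarrow> 'n ratfun" where "hat P = of_mpoly (on_graph P)"

lemma rhom_on_graph: "rhom on_graph" unfolding on_graph_def by (rule rhom_heval[OF rhom_Cst])
lemma rhom_hat: "rhom hat" unfolding hat_def by (rule rhom_comp[OF rhom_of_mpoly rhom_on_graph])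

lemmas on_graph_simps [simp] = rhom_simps[OF rhom_on_graph] rhom_diff[OF rhom_on_graph] rhom_uminus[OF rhom_on_graph] rhom_power[OF rhom_on_graph]
lemmas hat_simps [simp] = rhom_simps[OF rhom_hat] rhom_diff[OF rhom_hat] rhom_uminus[OF rhom_hat] rhom_power[OF rhom_hat]

lemma on_graph_var [simp]: "on_graph (var (Inl i)) = var i" "on_graph (var (Inr j)) = G j" "on_graph (Cst c) = Cst c"
  by (simp_all add: on_graph_def heval_var[OF rhom_Cst] heval_Cst[OF rhom_Cst])

lemma on_graph_emb [simp]: "on_graph (emb A) = A"
  by (simp add: on_graph_def heval_emb[OF rhom_Cst] heval_Cst_var)

lemma hat_emb [simp]: "hat (emb A) = of_mpoly A" by (simp add: hat_def)
lemma hat_Cst [simp]: "hat (Cst c) = of_const c" by (simp add: hat_def of_const_def)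
lemma hat_Inl [simp]: "hat (var (Inl i)) = coord i" by (simp add: hat_def coord_def)
lemma hat_0_iff: "hat P = 0 \<longleftrightarrow> on_graph P = 0" by (simp add: hat_def)

lemma hat_heval: "hat P = heval of_const (case_sum coord (\<lambda>j. of_mpoly (G j))) P"
  unfolding hat_def on_graph_def
  by (subst rhom_heval_comp[OF rhom_of_mpoly])
    (auto intro!: arg_cong2[where f = "\<lambda>a b. heval a b P"] simp: of_const_def coord_def split: sum.splits)

lemma ev_on_graph: "ev y (on_graph P) = peval (case_sum (\<lambda>i. y $ i) (\<lambda>j. ev y (G j))) P"
proof -
  have "ev y (on_graph P) = heval (\<lambda>c. ev y (Cst c)) (\<lambda>v. ev y (case_sum var G v)) P"
    unfolding on_graph_def by (rule rhom_heval_comp[OF rhom_ev])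
  also have "(\<lambda>v. ev y (case_sum var G v)) = case_sum (\<lambda>i. y $ i) (\<lambda>j. ev y (G j))"
    by (auto simp: ev_var split: sum.splits)
  finally show ?thesis by (simp add: peval_heval ev_Cst)
qed

text \<open>The representative chosen by \<open>rep_proj\<close> is a multiple of \<open>w\<close>,
  and the factor comes out with the degree as its exponent.\<close>

lemma pval_scale:
  assumes "w \<noteq> 0" "hom d P"
  shows "\<exists>t. t \<noteq> 0 \<and> pval P (y, abs_proj w) = t ^ d * peval (case_sum (\<lambda>i. y $ i) (\<lambda>j. w $ j)) P"
proof -
  obtain t where t: "t \<noteq> 0" "rep_proj (abs_proj w) = t *s w" using proj_rep_abs[OF assms(1)] by auto
  have "pval P (y, abs_proj w) = peval (case_sum (\<lambda>i. y $ i) (\<lambda>j. t * w $ j)) P"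
    by (simp add: pval_def t(2))
  then show ?thesis using heval_hom[OF rhom_id assms(2)] t by (auto simp: peval_heval)
qed

lemma pval_graph_pt:
  assumes "Gv y \<noteq> 0" "hom d P"
  shows "\<exists>t. t \<noteq> 0 \<and> pval P (graph_pt y) = t ^ d * ev y (on_graph P)"
  using pval_scale[OF assms, of y] by (simp add: graph_pt_def ev_on_graph Gv_def)

lemma pval_graph_pt_0_iff:
  assumes "Gv y \<noteq> 0" "hom d P" shows "pval P (graph_pt y) = 0 \<longleftrightarrow> ev y (on_graph P) = 0"
  using pval_graph_pt[OF assms] by auto

lemma fnz: "ev y f \<noteq> 0 \<Longrightarrow> Gv y \<noteq> 0" using graph by (simp add: Gv_def)

lemma graph_pt_in_X: "ev y f \<noteq> 0 \<Longrightarrow> graph_pt y \<in> X" using graph[of y] by (auto simp: graph_pt_def Gv_def)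

lemma X_graph_pt: "p \<in> X \<Longrightarrow> ev (fst p) f \<noteq> 0 \<Longrightarrow> p = graph_pt (fst p)"
  using graph[of "fst p"] by (cases p) (auto simp: graph_pt_def Gv_def)

lemma X_prime: "primeset X" using irr by (rule irreducible_primeset)

text \<open>The graph is dense in \<open>X\<close>. In one direction \<open>f * on_graph P\<close>
  vanishes everywhere and \<open>f\<close> is cancelled; in the other \<open>P * emb f\<close>
  vanishes on the irreducible set \<open>X\<close>, and \<open>emb f\<close> does not.\<close>

lemma X_van_iff:
  assumes "hom d P" shows "\<not> nonvan X P \<longleftrightarrow> on_graph P = 0"
proof
  assume a: "\<not> nonvan X P"
  have "f * on_graph P = 0"
  proof (rule ev_inj)
    fix y show "ev y (f * on_graph P) = 0"
    proof (cases "ev y f = 0")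
      case False
      then have "pval P (graph_pt y) = 0" using a graph_pt_in_X by (auto simp: nonvan_def)
      then show ?thesis using pval_graph_pt_0_iff[OF fnz[OF False] assms] by (simp add: ev_simps)
    qed (simp add: ev_simps)
  qed
  then show "on_graph P = 0" using mpoly_no_zero_div f0 by blast
next
  assume a: "on_graph P = 0"
  obtain y where y: "ev y f \<noteq> 0" using ev_inj f0 by blast
  have "pval P p = 0 \<or> ev (fst p) f = 0" if "p \<in> X" for p
  proof (cases "ev (fst p) f = 0")
    case False
    then have "p = graph_pt (fst p)" using X_graph_pt that by blast
    then show ?thesis using pval_graph_pt_0_iff[OF fnz[OF False] assms] a by (metis ev_simps(1))
  qed simp
  then have "\<not> nonvan X (P * emb f)" by (auto simp: nonvan_def pval_simps pval_emb)
  moreover have "nonvan X (emb f)" unfolding nonvan_def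
    by (rule bexI[OF _ graph_pt_in_X[OF y]]) (use y in \<open>simp add: pval_emb graph_pt_def\<close>)
  ultimately show "\<not> nonvan X P" using X_prime assms hom_emb unfolding primeset_def by blast
qed

text \<open>All local rings are realised inside the one field of rational functions on complex
  n-space, so that they can be compared as sets and their elements multiplied across different
  points.\<close>

definition loc_ring :: "('n, 'm) pt set \<Rightarrow> 'n ratfun set" where
  "loc_ring S = {r. \<exists>d P Q. hom d P \<and> hom d Q \<and> nonvan S Q \<and> r = hat P / hat Q}"

definition max_ideal :: "('n, 'm) pt set \<Rightarrow> 'n ratfun set" where
  "max_ideal S = {r. \<exists>d P Q. hom d P \<and> hom d Q \<and> nonvan S Q \<and> \<not> nonvan S P \<and> r = hat P / hat Q}"

lemma hat_nz: "S \<subseteq> X \<Longrightarrow> hom d Q \<Longrightarrow> nonvan S Q \<Longrightarrow> hat Q \<noteq> 0"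
  using X_van_iff[of d Q] by (auto simp: nonvan_def hat_0_iff)

lemma loc_ring_I: "hom d P \<Longrightarrow> hom d Q \<Longrightarrow> nonvan S Q \<Longrightarrow> hat P / hat Q \<in> loc_ring S"
  unfolding loc_ring_def by blast

lemma loc_ring_E:
  assumes "r \<in> loc_ring S" obtains d P Q where "hom d P" "hom d Q" "nonvan S Q" "r = hat P / hat Q"
  using assms unfolding loc_ring_def by blast

lemma max_ideal_I: "hom d P \<Longrightarrow> hom d Q \<Longrightarrow> nonvan S Q \<Longrightarrow> \<not> nonvan S P \<Longrightarrow> hat P / hat Q \<in> max_ideal S"
  unfolding max_ideal_def by blast

lemma max_ideal_loc_ring: "max_ideal S \<subseteq> loc_ring S" unfolding max_ideal_def loc_ring_def by blast

lemma hat_cross: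
  assumes "S \<subseteq> X" "hom d P" "hom d Q" "nonvan S Q" "hom e P'" "hom e Q'" "nonvan S Q'" "hat P / hat Q = hat P' / hat Q'" "p \<in> X"
  shows "pval P p * pval Q' p = pval P' p * pval Q p"
proof -
  have "hat P * hat Q' = hat P' * hat Q" using assms(8) hat_nz[OF assms(1,3,4)] hat_nz[OF assms(1,6,7)] by (simp add: frac_eq_eq)
  then have "hat (P * Q' - P' * Q) = 0" by simp
  then have "on_graph (P * Q' - P' * Q) = 0" by (simp only: hat_0_iff)
  moreover have "hom (d + e) (P * Q' - P' * Q)" using assms hom_mult[of d P e Q'] hom_mult[of e P' d Q]
    by (intro hom_diff) (simp_all add: add.commute)
  ultimately have "\<not> nonvan X (P * Q' - P' * Q)" using X_van_iff by blast
  then show ?thesis using assms(9) by (auto simp: nonvan_def pval_simps)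
qed

text \<open>Membership does not depend on the fraction chosen: cross multiplication holds on
  \<open>X\<close> by density of the graph, and the denominator is cancelled because
  \<open>S\<close> is prime.\<close>

lemma max_ideal_iff:
  assumes "primeset S" "S \<subseteq> X" "hom d P" "hom d Q" "nonvan S Q"
  shows "hat P / hat Q \<in> max_ideal S \<longleftrightarrow> \<not> nonvan S P"
proof
  assume "hat P / hat Q \<in> max_ideal S"
  then obtain e P' Q' where *: "hom e P'" "hom e Q'" "nonvan S Q'" "\<not> nonvan S P'" "hat P / hat Q = hat P' / hat Q'"
    unfolding max_ideal_def by blast
  have "\<not> nonvan S (P * Q')"
    using hat_cross[OF assms(2-5) *(1-3) *(5)] *(4) assms(2) by (force simp: nonvan_def pval_simps)
  then show "\<not> nonvan S P" using assms(1,3) * unfolding primeset_def by blast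
qed (use max_ideal_I assms in blast)

lemma loc_ring_rules:
  assumes S: "primeset S" "S \<subseteq> X"
  shows "r \<in> loc_ring S \<Longrightarrow> s \<in> loc_ring S \<Longrightarrow> r + s \<in> loc_ring S"
    and "r \<in> loc_ring S \<Longrightarrow> s \<in> loc_ring S \<Longrightarrow> r * s \<in> loc_ring S"
    and "of_const c \<in> loc_ring S" and "coord i \<in> loc_ring S"
    and "r \<in> max_ideal S \<Longrightarrow> s \<in> max_ideal S \<Longrightarrow> r + s \<in> max_ideal S"
    and "r \<in> max_ideal S \<Longrightarrow> s \<in> loc_ring S \<Longrightarrow> r * s \<in> max_ideal S"
    and "r \<in> loc_ring S \<Longrightarrow> r \<notin> max_ideal S \<Longrightarrow> inverse r \<in> loc_ring S"
    and "1 \<notin> max_ideal S"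
    and "r \<in> loc_ring S \<Longrightarrow> s \<in> loc_ring S \<Longrightarrow> r * s \<in> max_ideal S \<Longrightarrow> r \<in> max_ideal S \<or> s \<in> max_ideal S"
proof -
  have n1: "nonvan S 1" using S by (auto simp: primeset_def nonvan_def pval_simps)
  have nm: "nonvan S (Q * Q')" if "hom d Q" "hom e Q'" "nonvan S Q" "nonvan S Q'" for d e Q Q'
    using S that unfolding primeset_def by blast
  show "of_const c \<in> loc_ring S" using loc_ring_I[OF hom_Cst hom_1 n1, of c] by simp
  show "coord i \<in> loc_ring S" using loc_ring_I[OF hom_Inl hom_1 n1, of i] by simp
  show "1 \<notin> max_ideal S" using max_ideal_iff[OF S hom_1 hom_1 n1] n1 by simp
  have add: "\<exists>d P Q. hom d P \<and> hom d Q \<and> nonvan S Q \<and> (\<not> nonvan S P1 \<longrightarrow> \<not> nonvan S P2 \<longrightarrow> \<not> nonvan S P) \<and> hat P1 / hat Q1 + hat P2 / hat Q2 = hat P / hat Q"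
    if 1: "hom d P1" "hom d Q1" "nonvan S Q1" and 2: "hom e P2" "hom e Q2" "nonvan S Q2" for d e P1 P2 Q1 Q2
  proof (intro exI conjI impI)
    show "hom (d + e) (P1 * Q2 + P2 * Q1)" using hom_mult[OF 1(1) 2(2)] hom_mult[OF 2(1) 1(2)]
      by (intro hom_add) (simp_all add: add.commute)
    show "hom (d + e) (Q1 * Q2)" by (rule hom_mult[OF 1(2) 2(2)])
    show "nonvan S (Q1 * Q2)" using nm 1 2 by blast
    show "\<not> nonvan S (P1 * Q2 + P2 * Q1)" if "\<not> nonvan S P1" "\<not> nonvan S P2"
      using that by (auto simp: nonvan_def pval_simps)
    show "hat P1 / hat Q1 + hat P2 / hat Q2 = hat (P1 * Q2 + P2 * Q1) / hat (Q1 * Q2)"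
      using hat_nz[OF S(2) 1(2,3)] hat_nz[OF S(2) 2(2,3)] by (simp add: field_simps)
  qed
  show "r + s \<in> loc_ring S" if "r \<in> loc_ring S" "s \<in> loc_ring S"
    using that add unfolding loc_ring_def by blast
  show "r + s \<in> max_ideal S" if "r \<in> max_ideal S" "s \<in> max_ideal S"
    using that add unfolding max_ideal_def by blast
  have mul: "hom (d + e) (P1 * P2)" "hom (d + e) (Q1 * Q2)" "nonvan S (Q1 * Q2)" "hat P1 / hat Q1 * (hat P2 / hat Q2) = hat (P1 * P2) / hat (Q1 * Q2)"
    if 1: "hom d P1" "hom d Q1" "nonvan S Q1" and 2: "hom e P2" "hom e Q2" "nonvan S Q2" for d e P1 P2 Q1 Q2
    using hom_mult[OF 1(1) 2(1)] hom_mult[OF 1(2) 2(2)] nm 1 2 by auto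
  show "r * s \<in> loc_ring S" if r: "r \<in> loc_ring S" and s: "s \<in> loc_ring S"
  proof -
    obtain d P Q where 1: "hom d P" "hom d Q" "nonvan S Q" "r = hat P / hat Q" using r by (auto elim: loc_ring_E)
    obtain d' P' Q' where 2: "hom d' P'" "hom d' Q'" "nonvan S Q'" "s = hat P' / hat Q'" using s by (auto elim: loc_ring_E)
    show ?thesis unfolding 1 2 mul(4)[OF 1(1-3) 2(1-3)] by (rule loc_ring_I[OF mul(1-3)[OF 1(1-3) 2(1-3)]])
  qed
  show "r * s \<in> max_ideal S" if r: "r \<in> max_ideal S" and s: "s \<in> loc_ring S"
  proof -
    obtain d P Q where 1: "hom d P" "hom d Q" "nonvan S Q" "r = hat P / hat Q" "\<not> nonvan S P" using r by (auto simp: max_ideal_def)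
    obtain d' P' Q' where 2: "hom d' P'" "hom d' Q'" "nonvan S Q'" "s = hat P' / hat Q'" using s by (auto elim: loc_ring_E)
    have "\<not> nonvan S (P * P')" using 1(5) by (auto simp: nonvan_def pval_simps)
    then show ?thesis unfolding 1 2 mul(4)[OF 1(1-3) 2(1-3)] by (intro max_ideal_I[OF mul(1-3)[OF 1(1-3) 2(1-3)]])
  qed
  show "inverse r \<in> loc_ring S" if r: "r \<in> loc_ring S" and nr: "r \<notin> max_ideal S"
  proof -
    obtain d P Q where 1: "hom d P" "hom d Q" "nonvan S Q" "r = hat P / hat Q" using r by (auto elim: loc_ring_E)
    then have "nonvan S P" using nr max_ideal_I by blast
    then show ?thesis using loc_ring_I[of d Q P] 1 by simp
  qed
  show "r \<in> max_ideal S \<or> s \<in> max_ideal S" if r: "r \<in> loc_ring S" and s: "s \<in> loc_ring S" and rs: "r * s \<in> max_ideal S"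
  proof -
    obtain d P Q where 1: "hom d P" "hom d Q" "nonvan S Q" "r = hat P / hat Q" using r by (auto elim: loc_ring_E)
    obtain d' P' Q' where 2: "hom d' P'" "hom d' Q'" "nonvan S Q'" "s = hat P' / hat Q'" using s by (auto elim: loc_ring_E)
    have "\<not> nonvan S (P * P')"
      using rs max_ideal_iff[OF S mul(1-3)[OF 1(1-3) 2(1-3)]] mul(4)[OF 1(1-3) 2(1-3)] 1 2 by simp
    then have "\<not> nonvan S P \<or> \<not> nonvan S P'" using nm 1 2 by blast
    then show ?thesis using max_ideal_I 1 2 by blast
  qed
qed

lemma loc_ring_mono: "S \<subseteq> T \<Longrightarrow> loc_ring S \<subseteq> loc_ring T"
  unfolding loc_ring_def nonvan_def by blast

lemma max_ideal_mono: 
  assumes "primeset S" "primeset T" "S \<subseteq> T" "T \<subseteq> X" "r \<in> loc_ring S" "r \<in> max_ideal T" shows "r \<in> max_ideal S"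
proof -
  obtain d P Q where 1: "hom d P" "hom d Q" "nonvan S Q" "r = hat P / hat Q" using assms by (auto elim: loc_ring_E)
  have "nonvan T Q" using 1 assms by (auto simp: nonvan_def)
  then have "\<not> nonvan T P" using max_ideal_iff[of T d P Q] assms 1 by auto
  then have "\<not> nonvan S P" using assms by (auto simp: nonvan_def)
  then show ?thesis using max_ideal_I 1 by blast
qed

lemma max_ideal_X: "r \<in> max_ideal X \<longleftrightarrow> r = 0"
proof
  assume "r \<in> max_ideal X"
  then show "r = 0" unfolding max_ideal_def using X_van_iff by (auto simp: hat_0_iff)
next
  assume "r = 0"
  moreover have "nonvan X 1" using X_prime by (auto simp: primeset_def nonvan_def pval_simps)
  moreover have "\<not> nonvan X 0" by (auto simp: nonvan_def pval_simps)
  ultimately show "r \<in> max_ideal X" using max_ideal_I[OF hom_0 hom_1, of X] by simp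
qed

end

section \<open>Values of rational functions and germs\<close>

context bir
begin

definition value_at :: "('n, 'm) pt \<Rightarrow> 'n ratfun \<Rightarrow> complex" where
  "value_at p r = (THE c. r - of_const c \<in> max_ideal {p})"

lemmas loc_ring_pt = loc_ring_rules[OF primeset_point]

lemma loc_ring_0: "primeset S \<Longrightarrow> S \<subseteq> X \<Longrightarrow> 0 \<in> loc_ring S" and loc_ring_1: "primeset S \<Longrightarrow> S \<subseteq> X \<Longrightarrow> 1 \<in> loc_ring S"
  using loc_ring_rules(3)[of S 0] loc_ring_rules(3)[of S 1] by simp_all

lemma loc_ring_uminus: "primeset S \<Longrightarrow> S \<subseteq> X \<Longrightarrow> r \<in> loc_ring S \<Longrightarrow> - r \<in> loc_ring S"
  using loc_ring_rules(2)[of S "of_const (-1)" r] loc_ring_rules(3)[of S "-1"] by simp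

lemma loc_ring_diff: "primeset S \<Longrightarrow> S \<subseteq> X \<Longrightarrow> r \<in> loc_ring S \<Longrightarrow> s \<in> loc_ring S \<Longrightarrow> r - s \<in> loc_ring S"
  using loc_ring_rules(1)[of S r "- s"] loc_ring_uminus[of S s] by simp

lemma loc_ring_sum: "primeset S \<Longrightarrow> S \<subseteq> X \<Longrightarrow> (\<And>i. i \<in> I \<Longrightarrow> r i \<in> loc_ring S) \<Longrightarrow> sum r I \<in> loc_ring S"
  by (induction I rule: infinite_finite_induct) (auto simp: loc_ring_0 loc_ring_rules(1-4))

lemma loc_ring_prod: "primeset S \<Longrightarrow> S \<subseteq> X \<Longrightarrow> (\<And>i. i \<in> I \<Longrightarrow> r i \<in> loc_ring S) \<Longrightarrow> prod r I \<in> loc_ring S"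
  by (induction I rule: infinite_finite_induct) (auto simp: loc_ring_1 loc_ring_rules(1-4))

lemma loc_ring_power: "primeset S \<Longrightarrow> S \<subseteq> X \<Longrightarrow> r \<in> loc_ring S \<Longrightarrow> r ^ k \<in> loc_ring S"
  by (induction k) (auto simp: loc_ring_1 loc_ring_rules(1-4))

lemma loc_ring_heval: "primeset S \<Longrightarrow> S \<subseteq> X \<Longrightarrow> (\<And>v. u v \<in> loc_ring S) \<Longrightarrow> heval of_const u P \<in> loc_ring S"
  unfolding heval_def by (rule loc_ring_sum; simp add: loc_ring_rules(2,3) loc_ring_prod loc_ring_power)

lemma loc_ring_of_mpoly: "primeset S \<Longrightarrow> S \<subseteq> X \<Longrightarrow> of_mpoly A \<in> loc_ring S"
  unfolding of_mpoly_heval by (intro loc_ring_heval loc_ring_rules(4))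

lemma max_ideal_0: "primeset S \<Longrightarrow> S \<subseteq> X \<Longrightarrow> 0 \<in> max_ideal S"
  by (rule max_ideal_mono[OF _ X_prime]) (simp_all add: max_ideal_X loc_ring_0)

lemma max_ideal_mult_left: "primeset S \<Longrightarrow> S \<subseteq> X \<Longrightarrow> r \<in> loc_ring S \<Longrightarrow> s \<in> max_ideal S \<Longrightarrow> r * s \<in> max_ideal S"
  using loc_ring_rules(6)[of S s r] by (simp add: mult.commute)

lemma max_ideal_uminus: "primeset S \<Longrightarrow> S \<subseteq> X \<Longrightarrow> r \<in> max_ideal S \<Longrightarrow> - r \<in> max_ideal S"
  using max_ideal_mult_left[of S "of_const (-1)" r] loc_ring_rules(3)[of S "-1"] by simp

lemma max_ideal_diff: "primeset S \<Longrightarrow> S \<subseteq> X \<Longrightarrow> r \<in> max_ideal S \<Longrightarrow> s \<in> max_ideal S \<Longrightarrow> r - s \<in> max_ideal S"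
  using loc_ring_rules(5)[of S r "- s"] max_ideal_uminus[of S s] by simp

lemma max_ideal_sum: "primeset S \<Longrightarrow> S \<subseteq> X \<Longrightarrow> (\<And>i. i \<in> I \<Longrightarrow> r i \<in> max_ideal S) \<Longrightarrow> sum r I \<in> max_ideal S"
  by (induction I rule: infinite_finite_induct) (auto simp: max_ideal_0 loc_ring_rules(5))

lemma max_ideal_loc_ring': "r \<in> max_ideal S \<Longrightarrow> r \<in> loc_ring S" using max_ideal_loc_ring by blast

lemma max_ideal_of_const: "primeset S \<Longrightarrow> S \<subseteq> X \<Longrightarrow> of_const c \<in> max_ideal S \<longleftrightarrow> c = 0"
proof
  assume S: "primeset S" "S \<subseteq> X" and c: "of_const c \<in> max_ideal S"
  show "c = 0"
  proof (rule ccontr)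
    assume "c \<noteq> 0"
    then have "of_const (inverse c) * of_const c = of_const 1" by (simp only: of_const_simps(4)[symmetric]) simp
    then have "of_const (inverse c) * of_const c = 1" by simp
    then show False using max_ideal_mult_left[OF S loc_ring_rules(3)[OF S] c] loc_ring_rules(8)[OF S] by metis
  qed
qed (auto simp: max_ideal_0)

lemma loc_ring_inverse_mult: "primeset S \<Longrightarrow> S \<subseteq> X \<Longrightarrow> r \<in> loc_ring S \<Longrightarrow> s \<in> loc_ring S \<Longrightarrow> s \<notin> max_ideal S \<Longrightarrow> r / s \<in> loc_ring S"
  by (simp add: divide_inverse loc_ring_rules(2,7))

lemma sing: "p \<in> X \<Longrightarrow> {p} \<subseteq> X" by simp

lemma valI:
  assumes "p \<in> X" "r - of_const c \<in> max_ideal {p}" shows "value_at p r = c"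
  unfolding value_at_def
proof (rule the_equality)
  fix c' assume "r - of_const c' \<in> max_ideal {p}"
  then have "(r - of_const c') - (r - of_const c) \<in> max_ideal {p}" using assms max_ideal_diff[OF primeset_point sing] by blast
  then have "of_const (c - c') \<in> max_ideal {p}" by simp
  then have "c - c' = 0" using max_ideal_of_const[OF primeset_point sing[OF assms(1)], of "c - c'"] by blast
  then show "c' = c" by simp
qed (use assms in auto)

lemma val_frac:
  assumes "p \<in> X" "hom d P" "hom d Q" "pval Q p \<noteq> 0"
  shows "hat P / hat Q - of_const (pval P p / pval Q p) \<in> max_ideal {p}" "value_at p (hat P / hat Q) = pval P p / pval Q p"
proof -
  let ?c = "pval P p / pval Q p"
  have nz: "hat Q \<noteq> 0" using hat_nz[of "{p}" d Q] assms by simp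
  have "hom d (P - Cst ?c * Q)" using assms hom_mult[OF hom_Cst assms(3), of ?c] by (intro hom_diff) auto
  moreover have "pval (P - Cst ?c * Q) p = 0" using assms by (simp add: pval_simps)
  moreover have "hat P / hat Q - of_const ?c = hat (P - Cst ?c * Q) / hat Q" using nz by (simp add: field_simps)
  ultimately show "hat P / hat Q - of_const ?c \<in> max_ideal {p}" using max_ideal_I[of d "P - Cst ?c * Q" Q "{p}"] assms by simp
  then show "value_at p (hat P / hat Q) = ?c" by (rule valI[OF assms(1)])
qed

lemma valD: "p \<in> X \<Longrightarrow> r \<in> loc_ring {p} \<Longrightarrow> r - of_const (value_at p r) \<in> max_ideal {p}"
proof -
  assume p: "p \<in> X" and "r \<in> loc_ring {p}"
  then obtain d P Q where 1: "hom d P" "hom d Q" "pval Q p \<noteq> 0" "r = hat P / hat Q" by (auto elim: loc_ring_E)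
  show ?thesis using val_frac[OF p 1(1-3)] 1(4) by simp
qed

lemma val_max_ideal: "p \<in> X \<Longrightarrow> r \<in> loc_ring {p} \<Longrightarrow> r \<in> max_ideal {p} \<longleftrightarrow> value_at p r = 0"
  using valD[of p r] valI[of p r 0] by auto

lemma val_rules:
  assumes p: "p \<in> X"
  shows "value_at p (of_const c) = c"
    and "r \<in> loc_ring {p} \<Longrightarrow> s \<in> loc_ring {p} \<Longrightarrow> value_at p (r + s) = value_at p r + value_at p s"
    and "r \<in> loc_ring {p} \<Longrightarrow> s \<in> loc_ring {p} \<Longrightarrow> value_at p (r * s) = value_at p r * value_at p s"
    and "r \<in> loc_ring {p} \<Longrightarrow> s \<in> loc_ring {p} \<Longrightarrow> value_at p (r - s) = value_at p r - value_at p s"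
    and "value_at p 0 = 0" and "value_at p 1 = 1"
proof -
  have pp: "primeset {p}" "{p} \<subseteq> X" using p by (auto simp: primeset_point)
  show k: "value_at p (of_const c) = c" for c by (rule valI[OF p]) (simp add: max_ideal_0[OF pp])
  from k[of 0] k[of 1] show "value_at p 0 = 0" "value_at p 1 = 1" by simp_all
  show "value_at p (r + s) = value_at p r + value_at p s" if "r \<in> loc_ring {p}" "s \<in> loc_ring {p}"
  proof (rule valI[OF p])
    have "(r - of_const (value_at p r)) + (s - of_const (value_at p s)) \<in> max_ideal {p}" by (intro loc_ring_rules(5)[OF pp] valD[OF p] that)
    then show "r + s - of_const (value_at p r + value_at p s) \<in> max_ideal {p}" by (simp add: algebra_simps)
  qed
  show "value_at p (r - s) = value_at p r - value_at p s" if "r \<in> loc_ring {p}" "s \<in> loc_ring {p}"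
  proof (rule valI[OF p])
    have "(r - of_const (value_at p r)) - (s - of_const (value_at p s)) \<in> max_ideal {p}" by (intro max_ideal_diff[OF pp] valD[OF p] that)
    then show "r - s - of_const (value_at p r - value_at p s) \<in> max_ideal {p}" by (simp add: algebra_simps)
  qed
  show "value_at p (r * s) = value_at p r * value_at p s" if "r \<in> loc_ring {p}" "s \<in> loc_ring {p}"
  proof (rule valI[OF p])
    have "(r - of_const (value_at p r)) * s + of_const (value_at p r) * (s - of_const (value_at p s)) \<in> max_ideal {p}" 
      by (intro loc_ring_rules(5)[OF pp] loc_ring_rules(6)[OF pp] max_ideal_mult_left[OF pp] valD[OF p] loc_ring_rules(3)[OF pp] that)
    then show "r * s - of_const (value_at p r * value_at p s) \<in> max_ideal {p}" by (simp add: algebra_simps)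
  qed
qed

lemma val_sum: "p \<in> X \<Longrightarrow> (\<And>i. i \<in> I \<Longrightarrow> r i \<in> loc_ring {p}) \<Longrightarrow> value_at p (sum r I) = (\<Sum>i\<in>I. value_at p (r i))"
  by (induction I rule: infinite_finite_induct) (auto simp: val_rules loc_ring_sum[OF primeset_point])

lemma val_prod: "p \<in> X \<Longrightarrow> (\<And>i. i \<in> I \<Longrightarrow> r i \<in> loc_ring {p}) \<Longrightarrow> value_at p (prod r I) = (\<Prod>i\<in>I. value_at p (r i))"
  by (induction I rule: infinite_finite_induct) (auto simp: val_rules loc_ring_prod[OF primeset_point])

lemma val_inverse: 
  assumes "p \<in> X" "r \<in> loc_ring {p}" "value_at p r \<noteq> 0" 
  shows "inverse r \<in> loc_ring {p}" "value_at p (inverse r) = inverse (value_at p r)"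
proof -
  have pp: "primeset {p}" "{p} \<subseteq> X" using assms by (auto simp: primeset_point)
  show i: "inverse r \<in> loc_ring {p}" using loc_ring_rules(7)[OF pp assms(2)] assms val_max_ideal by blast
  have "r \<noteq> 0" using assms val_rules(5)[OF assms(1)] by auto
  then have "value_at p r * value_at p (inverse r) = 1" using val_rules(3)[OF assms(1,2) i] val_rules(6)[OF assms(1)] by simp
  then show "value_at p (inverse r) = inverse (value_at p r)" using assms(3) by (simp add: field_simps)
qed

lemma near_frac:
  assumes "p \<in> X" "hom d P" "hom d Q" "pval Q p \<noteq> 0"
  shows "near X p (\<lambda>q. q \<in> X \<and> pval Q q \<noteq> 0 \<and> hat P / hat Q \<in> loc_ring {q} \<and> value_at q (hat P / hat Q) = pval P q / pval Q q)"
  by (rule near_mono[OF near_hom[OF assms(1,3,4)]]) (use assms val_frac loc_ring_I in auto)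

lemma near_loc_ring: "p \<in> X \<Longrightarrow> r \<in> loc_ring {p} \<Longrightarrow> near X p (\<lambda>q. q \<in> X \<and> r \<in> loc_ring {q})"
proof -
  assume p: "p \<in> X" and "r \<in> loc_ring {p}"
  then obtain d P Q where 1: "hom d P" "hom d Q" "pval Q p \<noteq> 0" "r = hat P / hat Q" by (auto elim: loc_ring_E)
  show ?thesis by (rule near_mono[OF near_frac[OF p 1(1-3)]]) (simp add: 1(4))
qed

lemma near_val_nz: "p \<in> X \<Longrightarrow> r \<in> loc_ring {p} \<Longrightarrow> value_at p r \<noteq> 0 \<Longrightarrow> near X p (\<lambda>q. q \<in> X \<and> r \<in> loc_ring {q} \<and> value_at q r \<noteq> 0)"
proof -
  assume p: "p \<in> X" and r: "r \<in> loc_ring {p}" "value_at p r \<noteq> 0"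
  have "near X p (\<lambda>q. (q \<in> X \<and> r \<in> loc_ring {q}) \<and> (q \<in> X \<and> inverse r \<in> loc_ring {q}))"
    by (rule near_conj[OF near_loc_ring[OF p r(1)] near_loc_ring[OF p val_inverse(1)[OF p r]]])
  then show ?thesis
  proof (rule near_mono)
    fix q assume q: "(q \<in> X \<and> r \<in> loc_ring {q}) \<and> (q \<in> X \<and> inverse r \<in> loc_ring {q})"
    have "r \<noteq> 0" using r val_rules(5)[OF p] by auto
    then have "value_at q r * value_at q (inverse r) = 1" using q val_rules(3)[of q r "inverse r"] val_rules(6)[of q] by simp
    then show "q \<in> X \<and> r \<in> loc_ring {q} \<and> value_at q r \<noteq> 0" using q by auto
  qed
qed

text \<open>The bridge from the total functions on which regularity, parameters and orders are
  defined to elements of the function field.\<close>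

definition germ :: "('n, 'm) pt \<Rightarrow> (('n, 'm) pt \<Rightarrow> complex) \<Rightarrow> 'n ratfun \<Rightarrow> bool" where
  "germ p \<phi> r \<longleftrightarrow> near X p (\<lambda>q. r \<in> loc_ring {q} \<and> \<phi> q = value_at q r)"

lemma germD: "germ p \<phi> r \<Longrightarrow> p \<in> X \<and> r \<in> loc_ring {p} \<and> \<phi> p = value_at p r"
  unfolding germ_def using near_at[of X p "\<lambda>q. r \<in> loc_ring {q} \<and> \<phi> q = value_at q r"] near_mem[of X p] by blast

lemma germ_near: "germ p \<phi> r \<Longrightarrow> near X p (\<lambda>q. germ q \<phi> r)"
  unfolding germ_def by (rule near_near)

lemma germ_val: "p \<in> X \<Longrightarrow> r \<in> loc_ring {p} \<Longrightarrow> germ p (\<lambda>q. value_at q r) r"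
  unfolding germ_def by (rule near_mono[OF near_loc_ring]) auto

lemma germ_cong: 
  assumes "germ p \<phi> r" "near X p (\<lambda>q. \<phi> q = \<psi> q)" shows "germ p \<psi> r"
  unfolding germ_def by (rule near_mono[OF near_conj[OF assms[unfolded germ_def]]]) auto

lemma germ_eq: 
  assumes "germ p \<phi> r" "germ p \<psi> r" shows "near X p (\<lambda>q. \<phi> q = \<psi> q)"
  by (rule near_mono[OF near_conj[OF assms[unfolded germ_def]]]) auto

lemma germ_in: "p \<in> X \<Longrightarrow> germ p \<phi> r \<longleftrightarrow> near X p (\<lambda>q. q \<in> X \<and> r \<in> loc_ring {q} \<and> \<phi> q = value_at q r)"
  unfolding germ_def 
  by (rule iffI, rule near_mono[OF near_conj[OF near_in[of p X]]], assumption, assumption, simp)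
    (erule near_mono, simp)

lemma germ_add: "germ p \<phi> r \<Longrightarrow> germ p \<psi> s \<Longrightarrow> germ p (\<lambda>q. \<phi> q + \<psi> q) (r + s)"
  and germ_mult: "germ p \<phi> r \<Longrightarrow> germ p \<psi> s \<Longrightarrow> germ p (\<lambda>q. \<phi> q * \<psi> q) (r * s)"
  and germ_diff: "germ p \<phi> r \<Longrightarrow> germ p \<psi> s \<Longrightarrow> germ p (\<lambda>q. \<phi> q - \<psi> q) (r - s)"
proof -
  assume *: "germ p \<phi> r" "germ p \<psi> s"
  then have p: "p \<in> X" using germD by blast
  have n: "near X p (\<lambda>q. (q \<in> X \<and> r \<in> loc_ring {q} \<and> \<phi> q = value_at q r) \<and> (q \<in> X \<and> s \<in> loc_ring {q} \<and> \<psi> q = value_at q s))"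
    by (rule near_conj[OF *(1)[unfolded germ_in[OF p]] *(2)[unfolded germ_in[OF p]]])
  show "germ p (\<lambda>q. \<phi> q + \<psi> q) (r + s)" "germ p (\<lambda>q. \<phi> q * \<psi> q) (r * s)" "germ p (\<lambda>q. \<phi> q - \<psi> q) (r - s)"
    unfolding germ_in[OF p] 
    by (rule near_mono[OF n]; simp add: loc_ring_pt(1-4) loc_ring_diff[OF primeset_point] val_rules)+
qed

lemma germ_const: "p \<in> X \<Longrightarrow> germ p (\<lambda>q. c) (of_const c)"
  unfolding germ_in by (rule near_mono[OF near_in]) (auto simp: val_rules loc_ring_pt(1-4))

lemma germ_sum: "p \<in> X \<Longrightarrow> (\<And>i. i \<in> I \<Longrightarrow> germ p (\<phi> i) (r i)) \<Longrightarrow> germ p (\<lambda>q. \<Sum>i\<in>I. \<phi> i q) (\<Sum>i\<in>I. r i)"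
  using germ_const[of p 0] by (induction I rule: infinite_finite_induct) (auto simp: germ_add)

lemma germ_prod: "p \<in> X \<Longrightarrow> (\<And>i. i \<in> I \<Longrightarrow> germ p (\<phi> i) (r i)) \<Longrightarrow> germ p (\<lambda>q. \<Prod>i\<in>I. \<phi> i q) (\<Prod>i\<in>I. r i)"
  using germ_const[of p 1] by (induction I rule: infinite_finite_induct) (auto simp: germ_mult)

lemma germ_power: "germ p \<phi> r \<Longrightarrow> germ p (\<lambda>q. \<phi> q ^ k) (r ^ k)"
  using germ_const[of p 1] germD by (induction k) (auto simp: germ_mult)

text \<open>The identity theorem: the two points may differ, because nonempty open subsets of the
  irreducible set \<open>X\<close> meet.\<close>

lemma germ_unique:
  assumes "germ p \<phi> r" "germ p' \<phi> s" shows "r = s"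
proof -
  have p: "p \<in> X" "r \<in> loc_ring {p}" "p' \<in> X" "s \<in> loc_ring {p'}" using assms germD by auto
  obtain d P Q where 1: "hom d P" "hom d Q" "pval Q p \<noteq> 0" "r = hat P / hat Q" using p(2) by (auto elim: loc_ring_E)
  obtain e P' Q' where 2: "hom e P'" "hom e Q'" "pval Q' p' \<noteq> 0" "s = hat P' / hat Q'" using p(4) by (auto elim: loc_ring_E)
  have "near X p (\<lambda>q. (r \<in> loc_ring {q} \<and> \<phi> q = value_at q r) \<and> (q \<in> X \<and> pval Q q \<noteq> 0 \<and> r \<in> loc_ring {q} \<and> value_at q r = pval P q / pval Q q))"
    using near_conj[OF assms(1)[unfolded germ_def] near_frac[OF p(1) 1(1-3)]] 1(4) by simp
  then obtain C where C: "zclosed C" "p \<in> X - C" "\<And>q. q \<in> X - C \<Longrightarrow> pval Q q \<noteq> 0 \<and> \<phi> q = pval P q / pval Q q"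
    unfolding near_def zopen_in_def by auto
  have "near X p' (\<lambda>q. (s \<in> loc_ring {q} \<and> \<phi> q = value_at q s) \<and> (q \<in> X \<and> pval Q' q \<noteq> 0 \<and> s \<in> loc_ring {q} \<and> value_at q s = pval P' q / pval Q' q))"
    using near_conj[OF assms(2)[unfolded germ_def] near_frac[OF p(3) 2(1-3)]] 2(4) by simp
  then obtain C' where C': "zclosed C'" "p' \<in> X - C'" "\<And>q. q \<in> X - C' \<Longrightarrow> pval Q' q \<noteq> 0 \<and> \<phi> q = pval P' q / pval Q' q"
    unfolding near_def zopen_in_def by auto
  \<comment> \<open>\<open>X\<close> is not covered by \<open>C\<close> and \<open>C'\<close>, as
    each of them misses a point of \<open>X\<close>.\<close>
  obtain q0 where q0: "q0 \<in> X" "q0 \<notin> C \<union> C'"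
    using irr C C' unfolding irreducible_closed_def by blast
  let ?R = "P * Q' - P' * Q"
  have hR: "hom (d + e) ?R" using 1 2 hom_mult[of d P e Q'] hom_mult[of e P' d Q]
    by (intro hom_diff) (simp_all add: add.commute)
  have "\<not> nonvan X ?R"
  proof (rule primeset_closed_dense[OF irr q0(1) q0(2) zclosed_Un[OF C(1) C'(1)] hR])
    fix q assume "q \<in> X" "q \<notin> C \<union> C'"
    then have "pval Q q \<noteq> 0" "pval Q' q \<noteq> 0" "pval P q / pval Q q = pval P' q / pval Q' q" using C(3)[of q] C'(3)[of q] by auto
    then show "pval ?R q = 0" by (simp add: pval_simps frac_eq_eq)
  qed
  then have "hat ?R = 0" using X_van_iff[OF hR] by (simp only: hat_0_iff)
  moreover have "hat Q \<noteq> 0" "hat Q' \<noteq> 0" using hat_nz[of "{p}" d Q] hat_nz[of "{p'}" e Q'] 1 2 p by auto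
  ultimately show ?thesis using 1 2 by (simp add: frac_eq_eq)
qed

section \<open>Regularity, parameters and local equations in terms of the function field\<close>

lemma regular_iff: "p \<in> X \<Longrightarrow> regular_at X p \<phi> \<longleftrightarrow> (\<exists>r. germ p \<phi> r)"
proof
  assume p: "p \<in> X" and "regular_at X p \<phi>"
  then obtain d P Q where *: "hom d P" "hom d Q" "near X p (\<lambda>q. pval Q q \<noteq> 0 \<and> \<phi> q = pval P q / pval Q q)"
    unfolding regular_at_def by blast
  then have "pval Q p \<noteq> 0" using near_at[OF *(3)] by simp
  from near_conj[OF near_frac[OF p *(1,2) this] *(3)] have "germ p \<phi> (hat P / hat Q)"
    unfolding germ_def by (rule near_mono) auto
  then show "\<exists>r. germ p \<phi> r" ..
next
  assume p: "p \<in> X" and "\<exists>r. germ p \<phi> r"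
  then obtain r where r: "germ p \<phi> r" by blast
  then have "r \<in> loc_ring {p}" using germD[OF r] by blast
  then obtain d P Q where 1: "hom d P" "hom d Q" "pval Q p \<noteq> 0" "r = hat P / hat Q" by (auto elim: loc_ring_E)
  have "near X p (\<lambda>q. pval Q q \<noteq> 0 \<and> \<phi> q = pval P q / pval Q q)"
    by (rule near_mono[OF near_conj[OF near_frac[OF p 1(1-3)] r[unfolded germ_def]]]) (use 1(4) in auto)
  then show "regular_at X p \<phi>" unfolding regular_at_def using 1 by blast
qed

lemma germ_regular: "germ p \<phi> r \<Longrightarrow> regular_at X p \<phi>"
  using regular_iff germD by blast

lemma divides_iff:
  assumes "germ p g r" "germ p \<phi> s" shows "divides_at X p g \<phi> \<longleftrightarrow> (\<exists>h\<in>loc_ring {p}. s = r * h)"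
proof
  have p: "p \<in> X" using assms germD by blast
  assume "divides_at X p g \<phi>"
  then obtain h where h: "regular_at X p h" "near X p (\<lambda>q. \<phi> q = g q * h q)" unfolding divides_at_def by blast
  then obtain t where t: "germ p h t" using regular_iff p by blast
  have "s = r * t" by (rule germ_unique[OF germ_cong[OF assms(2) h(2)] germ_mult[OF assms(1) t]])
  then show "\<exists>h\<in>loc_ring {p}. s = r * h" using t germD by blast
next
  have p: "p \<in> X" using assms germD by blast
  assume "\<exists>h\<in>loc_ring {p}. s = r * h"
  then obtain h where h: "h \<in> loc_ring {p}" "s = r * h" by blast
  have 1: "germ p (\<lambda>q. value_at q h) h" by (rule germ_val[OF p h(1)])
  have "near X p (\<lambda>q. \<phi> q = g q * value_at q h)" using germ_eq[OF assms(2)] germ_mult[OF assms(1) 1] h(2) by blast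
  then show "divides_at X p g \<phi>" unfolding divides_at_def using germ_regular[OF 1] by blast
qed

definition lparams :: "('n, 'm) pt \<Rightarrow> ('n \<Rightarrow> 'n ratfun) \<Rightarrow> bool" where
  "lparams p a \<longleftrightarrow> (\<forall>j. a j \<in> max_ideal {p}) \<and> (\<forall>r\<in>max_ideal {p}. \<exists>g. (\<forall>j. g j \<in> loc_ring {p}) \<and> r = (\<Sum>j\<in>UNIV. g j * a j))"

lemma lparams_iff:
  assumes a: "\<And>j. germ p (x j) (a j)" shows "local_params X p x \<longleftrightarrow> lparams p a"
proof -
  have p: "p \<in> X" and aL: "a j \<in> loc_ring {p}" and xa: "x j p = value_at p (a j)" for j using a germD by blast+
  have m: "a j \<in> max_ideal {p} \<longleftrightarrow> x j p = 0" for j using val_max_ideal[OF p aL] xa by simp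
  show ?thesis
  proof
    assume L: "local_params X p x"
    show "lparams p a" unfolding lparams_def
    proof (intro conjI allI ballI)
      show "a j \<in> max_ideal {p}" for j using L m unfolding local_params_def by blast
      fix r assume r: "r \<in> max_ideal {p}"
      then have rL: "r \<in> loc_ring {p}" by (rule max_ideal_loc_ring')
      have rr: "germ p (\<lambda>q. value_at q r) r" by (rule germ_val[OF p rL])
      have "value_at p r = 0" using r val_max_ideal[OF p rL] by simp
      then obtain g where g: "\<forall>j. regular_at X p (g j)" "near X p (\<lambda>q. value_at q r = (\<Sum>j\<in>UNIV. g j q * x j q))"
        using L germ_regular[OF rr] unfolding local_params_def by blast
      then have "\<forall>j. \<exists>t. germ p (g j) t" using regular_iff p by blast
      then obtain t where t: "\<And>j. germ p (g j) (t j)" by metis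
      have "germ p (\<lambda>q. \<Sum>j\<in>UNIV. g j q * x j q) (\<Sum>j\<in>UNIV. t j * a j)"
        by (intro germ_sum germ_mult t a p)
      from germ_unique[OF germ_cong[OF rr g(2)] this] 
      show "\<exists>g. (\<forall>j. g j \<in> loc_ring {p}) \<and> r = (\<Sum>j\<in>UNIV. g j * a j)" using germD[OF t] by (intro exI[of _ t]) simp
    qed
  next
    assume L: "lparams p a"
    show "local_params X p x" unfolding local_params_def
    proof (intro conjI allI impI)
      show "regular_at X p (x j)" for j by (rule germ_regular[OF a])
      show "x j p = 0" for j using L m unfolding lparams_def by blast
      fix \<phi> assume "regular_at X p \<phi> \<and> \<phi> p = 0"
      then obtain r where r: "germ p \<phi> r" and "\<phi> p = 0" using regular_iff p by blast
      then have "r \<in> max_ideal {p}" using germD[OF r] val_max_ideal[OF p] by simp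
      then obtain g where g: "\<forall>j. g j \<in> loc_ring {p}" "r = (\<Sum>j\<in>UNIV. g j * a j)" using L unfolding lparams_def by blast
      have t: "germ p (\<lambda>q. value_at q (g j)) (g j)" for j using germ_val[OF p] g(1) by blast
      have "germ p (\<lambda>q. \<Sum>j\<in>UNIV. value_at q (g j) * x j q) r" unfolding g(2)
        by (intro germ_sum germ_mult t a p)
      from germ_eq[OF r this] show "\<exists>g. (\<forall>j. regular_at X p (g j)) \<and> near X p (\<lambda>q. \<phi> q = (\<Sum>j\<in>UNIV. g j q * x j q))"
        using germ_regular[OF t] by (intro exI[of _ "\<lambda>j q. value_at q (g j)"]) simp
    qed
  qed
qed

lemma local_paramsE:
  assumes "local_params X p x" "p \<in> X"
  obtains a where "\<And>j. germ p (x j) (a j)" "lparams p a"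
proof -
  have "\<forall>j. \<exists>r. germ p (x j) r" using assms(1) regular_iff[OF assms(2)] unfolding local_params_def by blast
  then obtain a where a: "\<And>j. germ p (x j) (a j)" by metis
  show ?thesis by (rule that[of a, OF a]) (use lparams_iff[of p x a, OF a] assms(1) in blast)
qed

text \<open>Vanishing on the part of \<open>E\<close> near \<open>p\<close> spreads to all of
  \<open>E\<close> by density, so the condition no longer refers to \<open>p\<close>.\<close>

lemma van_iff:
  assumes E: "irreducible_closed E" "E \<subseteq> X" "p \<in> E" and r: "germ p \<phi> r"
  shows "near X p (\<lambda>q. q \<in> E \<longrightarrow> \<phi> q = 0) \<longleftrightarrow> r \<in> max_ideal E"
proof -
  have p: "p \<in> X" using E by blast
  have "r \<in> loc_ring {p}" using germD[OF r] by blast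
  then obtain d P Q where 1: "hom d P" "hom d Q" "pval Q p \<noteq> 0" "r = hat P / hat Q" by (auto elim: loc_ring_E)
  have nQ: "nonvan E Q" using 1 E by (auto simp: nonvan_def)
  note mi = max_ideal_iff[OF irreducible_primeset[OF E(1)] E(2) 1(1,2) nQ, folded 1(4)]
  have n: "near X p (\<lambda>q. pval Q q \<noteq> 0 \<and> \<phi> q = pval P q / pval Q q)"
    by (rule near_mono[OF near_conj[OF near_frac[OF p 1(1-3)] r[unfolded germ_def]]]) (use 1(4) in auto)
  show ?thesis
  proof
    assume "near X p (\<lambda>q. q \<in> E \<longrightarrow> \<phi> q = 0)"
    from near_conj[OF n this] obtain C where C: "zclosed C" "p \<in> X - C" "\<And>q. q \<in> X - C \<Longrightarrow> pval Q q \<noteq> 0 \<and> \<phi> q = pval P q / pval Q q \<and> (q \<in> E \<longrightarrow> \<phi> q = 0)"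
      unfolding near_def zopen_in_def by auto
    have "\<not> nonvan E P"
      by (rule primeset_closed_dense[OF E(1) E(3) _ C(1) 1(1)]) (use C(2,3) E(2) in fastforce)+
    then show "r \<in> max_ideal E" by (simp add: mi)
  next
    assume "r \<in> max_ideal E"
    then have "\<not> nonvan E P" by (simp add: mi)
    then show "near X p (\<lambda>q. q \<in> E \<longrightarrow> \<phi> q = 0)" 
      by (intro near_mono[OF n]) (auto simp: nonvan_def)
  qed
qed

definition loceq :: "('n, 'm) pt set \<Rightarrow> ('n, 'm) pt \<Rightarrow> 'n ratfun \<Rightarrow> bool" where
  "loceq E p e \<longleftrightarrow> e \<in> loc_ring {p} \<and> e \<in> max_ideal E \<and> (\<forall>s\<in>loc_ring {p}. s \<in> max_ideal E \<longrightarrow> (\<exists>h\<in>loc_ring {p}. s = e * h))"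

lemma loceq_iff:
  assumes E: "irreducible_closed E" "E \<subseteq> X" "p \<in> E" and r: "germ p \<phi> r"
  shows "local_equation X E p \<phi> \<longleftrightarrow> loceq E p r"
proof -
  have p: "p \<in> X" using E by blast
  have "(\<forall>f. regular_at X p f \<and> near X p (\<lambda>q. q \<in> E \<longrightarrow> f q = 0) \<longrightarrow> divides_at X p \<phi> f) \<longleftrightarrow>
    (\<forall>s\<in>loc_ring {p}. s \<in> max_ideal E \<longrightarrow> (\<exists>h\<in>loc_ring {p}. s = r * h))"
  proof (intro iffI ballI impI allI)
    fix s assume *: "\<forall>f. regular_at X p f \<and> near X p (\<lambda>q. q \<in> E \<longrightarrow> f q = 0) \<longrightarrow> divides_at X p \<phi> f"
      and s: "s \<in> loc_ring {p}" "s \<in> max_ideal E"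
    have ss: "germ p (\<lambda>q. value_at q s) s" by (rule germ_val[OF p s(1)])
    show "\<exists>h\<in>loc_ring {p}. s = r * h"
      using * divides_iff[OF r ss] van_iff[OF E ss] germ_regular[OF ss] s(2) by blast
  next
    fix f assume *: "\<forall>s\<in>loc_ring {p}. s \<in> max_ideal E \<longrightarrow> (\<exists>h\<in>loc_ring {p}. s = r * h)" 
      and f: "regular_at X p f \<and> near X p (\<lambda>q. q \<in> E \<longrightarrow> f q = 0)"
    then obtain s where s: "germ p f s" using regular_iff p by blast
    show "divides_at X p \<phi> f" using * divides_iff[OF r s] van_iff[OF E s] f germD[OF s] by blast
  qed
  then show ?thesis unfolding local_equation_def loceq_def
    using van_iff[OF E r] germ_regular[OF r] germD[OF r] by blast
qed

lemma germ_pullback: "p \<in> X \<Longrightarrow> germ p (pullback A) (of_mpoly A)"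
proof -
  assume p: "p \<in> X"
  have n: "near X p (\<lambda>q. q \<in> X \<and> pval 1 q \<noteq> 0 \<and> hat (emb A) / hat 1 \<in> loc_ring {q} \<and> value_at q (hat (emb A) / hat 1) = pval (emb A) q / pval 1 q)"
    by (rule near_frac[OF p hom_emb hom_1]) (simp add: pval_simps)
  show ?thesis unfolding germ_def
    by (rule near_mono[OF n]) (simp add: pval_simps pval_emb pullback_ev)
qed

lemma val_of_mpoly: "p \<in> X \<Longrightarrow> value_at p (of_mpoly A) = ev (fst p) A"
  using germD[OF germ_pullback] by (simp add: pullback_ev)

lemma val_coord: "p \<in> X \<Longrightarrow> value_at p (coord i) = fst p $ i"
  by (simp add: coord_def val_of_mpoly ev_var)

lemma generatesE:
  assumes "generates_pullback X I p g" "p \<in> X"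
  obtains r N A h where "germ p g r" "\<And>B. B \<in> I \<Longrightarrow> \<exists>h\<in>loc_ring {p}. of_mpoly B = r * h"
    "\<And>k. k < N \<Longrightarrow> A k \<in> I \<and> h k \<in> loc_ring {p}" "r = (\<Sum>k<(N::nat). h k * of_mpoly (A k))"
proof -
  obtain r where r: "germ p g r" using assms regular_iff unfolding generates_pullback_def by blast
  obtain N A h where A: "\<forall>k<(N::nat). A k \<in> I \<and> regular_at X p (h k)" and n: "near X p (\<lambda>q. g q = (\<Sum>k<N. h k q * pullback (A k) q))"
    using assms unfolding generates_pullback_def by blast
  have "\<forall>k\<in>{..<N}. \<exists>t. germ p (h k) t" using A regular_iff assms(2) by auto
  then obtain t where t: "\<And>k. k < N \<Longrightarrow> germ p (h k) (t k)" unfolding bchoice_iff by auto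
  have "germ p (\<lambda>q. \<Sum>k<N. h k q * pullback (A k) q) (\<Sum>k<N. t k * of_mpoly (A k))"
    by (intro germ_sum germ_mult germ_pullback assms(2)) (use t in auto)
  then have "r = (\<Sum>k<N. t k * of_mpoly (A k))" using germ_unique[OF germ_cong[OF r n]] by blast
  moreover have "\<exists>h\<in>loc_ring {p}. of_mpoly B = r * h" if "B \<in> I" for B
    using assms(1) that divides_iff[OF r germ_pullback[OF assms(2)]] unfolding generates_pullback_def by blast
  ultimately show ?thesis using that[of r N A t] r t A germD by blast
qed

end

section \<open>Local parameters and Jacobians\<close>

lemma rhom_of_int:
  assumes "rhom h" shows "h (of_int n) = of_int n"
proof -
  have nat: "h (of_nat k) = of_nat k" for k
    by (induction k) (auto simp: rhom_simps[OF assms])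
  show ?thesis by (cases n rule: int_cases2) (simp_all add: nat rhom_uminus[OF assms])
qed

text \<open>Cramer's rule written out, which makes it visible that the solution lies in a local ring
  when the entries do and the determinant is a unit.\<close>

definition cramer_sol :: "('v::finite \<Rightarrow> 'v \<Rightarrow> 'a::field) \<Rightarrow> ('v \<Rightarrow> 'j \<Rightarrow> 'a) \<Rightarrow> 'v \<Rightarrow> 'j \<Rightarrow> 'a" where
  "cramer_sol M g v j = det (\<chi> i w. if w = v then g i j else M i w) / det (\<chi> i w. M i w)"

lemma cramer_sol_solves:
  fixes M :: "'v::finite \<Rightarrow> 'v \<Rightarrow> 'a::field" and g :: "'v \<Rightarrow> 'j::finite \<Rightarrow> 'a"
  assumes d: "det (\<chi> i w. M i w) \<noteq> 0" and e: "\<And>v. (\<Sum>w\<in>UNIV. M v w * U w) = (\<Sum>j\<in>UNIV. g v j * A j)"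
  shows "U v = (\<Sum>j\<in>UNIV. cramer_sol M g v j * A j)"
proof -
  let ?M = "\<chi> i w. M i w"
  have c: "?M *v (\<chi> v. cramer_sol M g v j) = (\<chi> v. g v j)" for j
    unfolding cramer[OF d] cramer_sol_def vec_lambda_beta ..
  have c': "(\<Sum>w\<in>UNIV. M v w * cramer_sol M g w j) = g v j" for v j
    using arg_cong[OF c[of j], of "\<lambda>x. x $ v"] by (simp add: matrix_vector_mult_def)
  let ?b = "\<chi> v. \<Sum>j\<in>UNIV. g v j * A j"
  have "?M *v (\<chi> v. U v) = ?b" by (simp add: matrix_vector_mult_def vec_eq_iff e)
  moreover have "?M *v (\<chi> v. \<Sum>j\<in>UNIV. cramer_sol M g v j * A j) = ?b"
  proof (simp add: matrix_vector_mult_def vec_eq_iff, intro allI)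
    fix v
    have "(\<Sum>w\<in>UNIV. M v w * (\<Sum>j\<in>UNIV. cramer_sol M g w j * A j)) = (\<Sum>w\<in>UNIV. \<Sum>j\<in>UNIV. M v w * cramer_sol M g w j * A j)"
      by (simp add: sum_distrib_left mult.assoc)
    also have "\<dots> = (\<Sum>j\<in>UNIV. \<Sum>w\<in>UNIV. M v w * cramer_sol M g w j * A j)" by (rule sum.swap)
    also have "\<dots> = (\<Sum>j\<in>UNIV. g v j * A j)" by (simp add: c' flip: sum_distrib_right)
    finally show "(\<Sum>w\<in>UNIV. M v w * (\<Sum>j\<in>UNIV. cramer_sol M g w j * A j)) = (\<Sum>j\<in>UNIV. g v j * A j)" .
  qed
  ultimately have "(\<chi> v. U v) = (\<chi> v. \<Sum>j\<in>UNIV. cramer_sol M g v j * A j)"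
    unfolding cramer[OF d] by simp
  then show ?thesis by (simp add: vec_eq_iff)
qed

lemma is_deriv_sumI:
  assumes "\<And>i. is_deriv (D i)" shows "is_deriv (\<lambda>r. \<Sum>i\<in>I. b i * D i r)"
  unfolding is_deriv_def
  using is_deriv_simps[OF assms] by (auto simp: sum.distrib algebra_simps sum_distrib_left)

lemma is_deriv_ratfun:
  assumes D: "is_deriv D" shows "D r = (\<Sum>k\<in>UNIV. D (coord k) * pdK k r)"
proof -
  obtain A B where AB: "B \<noteq> 0" "r = of_mpoly A / of_mpoly B" by (rule ratfun_cases)
  have i: "E (of_mpoly P) = (\<Sum>k\<in>UNIV. of_mpoly (pd k P) * E (coord k))" if "is_deriv E" for E P
    using is_deriv_heval[OF that, of coord P] by (simp add: of_mpoly_heval)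
  have nz: "of_mpoly B \<noteq> 0" using AB by simp
  have "D r = (D (of_mpoly A) * of_mpoly B - of_mpoly A * D (of_mpoly B)) / (of_mpoly B)\<^sup>2"
    unfolding AB(2) by (rule is_deriv_div[OF D nz])
  also have "\<dots> = (\<Sum>k\<in>UNIV. D (coord k) * ((of_mpoly (pd k A) * of_mpoly B - of_mpoly A * of_mpoly (pd k B)) / (of_mpoly B)\<^sup>2))"
    by (simp add: i[OF D] sum_divide_distrib[symmetric] sum_distrib_left sum_distrib_right sum_subtractf[symmetric] algebra_simps)
  also have "\<dots> = (\<Sum>k\<in>UNIV. D (coord k) * pdK k r)" unfolding AB(2) by (simp add: pdK_eq[OF AB(1)])
  finally show ?thesis .
qed

text \<open>\<open>\<Delta> j\<close> is the partial derivative with respect to \<open>a j\<close>.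
  By the last clause these form a basis of all derivations; it is the chain rule from which every
  change of parameters is computed.\<close>

definition dual :: "('n::finite \<Rightarrow> 'n ratfun) \<Rightarrow> ('n \<Rightarrow> 'n ratfun \<Rightarrow> 'n ratfun) \<Rightarrow> bool" where
  "dual a \<Delta> \<longleftrightarrow> (\<forall>j. is_deriv (\<Delta> j)) \<and> (\<forall>j l. \<Delta> j (a l) = (if l = j then 1 else 0)) \<and>
     (\<forall>D r. is_deriv D \<longrightarrow> D r = (\<Sum>j\<in>UNIV. D (a j) * \<Delta> j r))"

text \<open>Subtracting constants from the parameters does not change the derivations. Hence one
  family serves all points \<open>q\<close> near \<open>p\<close>, where the parameters are
  \<open>a j\<close> minus its value at \<open>q\<close>.\<close>

lemma dual_unique:
  assumes "dual a \<Delta>" "dual (\<lambda>j. a j - of_const (c j)) \<Delta>'" shows "\<Delta> = \<Delta>'"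
proof (intro ext)
  fix j r
  have D: "is_deriv (\<Delta>' j)" using assms by (simp add: dual_def)
  have "\<Delta>' j (a l) = (if l = j then 1 else 0)" for l
  proof -
    have "\<Delta>' j (a l - of_const (c l)) = (if l = j then 1 else 0)" using assms(2) by (simp add: dual_def)
    then show ?thesis by (simp add: is_deriv_simps[OF D])
  qed
  moreover have "\<Delta>' j r = (\<Sum>l\<in>UNIV. \<Delta>' j (a l) * \<Delta> l r)" using assms(1) D unfolding dual_def by blast
  ultimately have "\<Delta>' j r = (\<Sum>l\<in>UNIV. (if l = j then 1 else 0) * \<Delta> l r)" by simp
  also have "\<dots> = (\<Sum>l\<in>UNIV. if l = j then \<Delta> l r else 0)" by (rule sum.cong) auto
  finally show "\<Delta> j r = \<Delta>' j r" by simp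
qed

text \<open>Applied to the derivations \<open>pdK k\<close>, the hypothesis says that
  \<open>c\<close> is a left inverse of the Jacobian matrix of \<open>a\<close>. A one-sided inverse
  of a square matrix is two-sided, and the \<open>\<Delta> j\<close> are read off from
  \<open>c\<close>.\<close>

lemma dual_exists:
  assumes c: "\<And>D i. is_deriv D \<Longrightarrow> D (coord i) = (\<Sum>j\<in>UNIV. c i j * D (a j))"
  shows "\<exists>\<Delta>. dual a \<Delta> \<and> (\<forall>i j. \<Delta> j (coord i) = c i j)"
proof -
  define \<Delta> where "\<Delta> j r = (\<Sum>i\<in>UNIV. c i j * pdK i r)" for j r
  let ?C = "\<chi> i j. c i j" and ?N = "\<chi> j k. pdK k (a j)"
  have "?C ** ?N = mat 1"
    by (auto simp: vec_eq_iff matrix_matrix_mult_def mat_def pdK_coord simp flip: c[OF is_deriv_pdK])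
  then have "?N ** ?C = mat 1" by (simp only: matrix_left_right_inverse)
  then have NC: "(\<Sum>i\<in>UNIV. pdK i (a l) * c i j) = (if l = j then 1 else 0)" for l j
    by (auto simp: vec_eq_iff matrix_matrix_mult_def mat_def)
  have 1: "is_deriv (\<Delta> j)" for j unfolding \<Delta>_def by (rule is_deriv_sumI[OF is_deriv_pdK])
  have 2: "\<Delta> j (a l) = (if l = j then 1 else 0)" for j l
    using NC[of l j] by (simp add: \<Delta>_def mult.commute)
  have 3: "D r = (\<Sum>j\<in>UNIV. D (a j) * \<Delta> j r)" if D: "is_deriv D" for D r
  proof -
    have "D r = (\<Sum>k\<in>UNIV. D (coord k) * pdK k r)" by (rule is_deriv_ratfun[OF D])
    also have "\<dots> = (\<Sum>k\<in>UNIV. \<Sum>j\<in>UNIV. D (a j) * (c k j * pdK k r))"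
      unfolding c[OF D] sum_distrib_right by (simp add: mult_ac)
    also have "\<dots> = (\<Sum>j\<in>UNIV. \<Sum>k\<in>UNIV. D (a j) * (c k j * pdK k r))" by (rule sum.swap)
    finally show ?thesis by (simp add: \<Delta>_def sum_distrib_left)
  qed
  have 4: "\<Delta> j (coord i) = c i j" for i j
  proof -
    have "\<Delta> j (coord i) = (\<Sum>k\<in>UNIV. if i = k then c k j else 0)" unfolding \<Delta>_def pdK_coord by (rule sum.cong) auto
    then show ?thesis by simp
  qed
  show ?thesis using 1 2 3 4 unfolding dual_def by blast
qed

section \<open>First-order expansions in affine charts\<close>

context bir
begin

lemma loc_ring_det: "primeset S \<Longrightarrow> S \<subseteq> X \<Longrightarrow> (\<And>i j. M $ i $ j \<in> loc_ring S) \<Longrightarrow> det (M :: 'n ratfun ^ 'v::finite ^ 'v) \<in> loc_ring S"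
proof -
  assume S: "primeset S" "S \<subseteq> X" and M: "\<And>i j. M $ i $ j \<in> loc_ring S"
  have "of_int z \<in> loc_ring S" for z using loc_ring_rules(3)[OF S, of "of_int z"] by (simp add: rhom_of_int[OF rhom_of_const])
  then show ?thesis unfolding det_def by (intro loc_ring_sum[OF S] loc_ring_rules(2)[OF S] loc_ring_prod[OF S] M)
qed

lemma val_det: 
  fixes M :: "'n ratfun ^ 'v::finite ^ 'v"
  assumes p: "p \<in> X" and M: "\<And>i j. M $ i $ j \<in> loc_ring {p}" 
  shows "value_at p (det M) = det (\<chi> i j. value_at p (M $ i $ j))"
proof -
  have S: "primeset {p}" "{p} \<subseteq> X" using p by (auto simp: primeset_point)
  have z: "of_int z \<in> loc_ring {p}" "value_at p (of_int z) = of_int z" for z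
    using loc_ring_rules(3)[OF S, of "of_int z"] val_rules(1)[OF p, of "of_int z"] by (simp_all add: rhom_of_int[OF rhom_of_const])
  show ?thesis unfolding det_def
    by (subst val_sum[OF p])
      (auto intro!: loc_ring_rules(2)[OF S] loc_ring_prod[OF S] M z sum.cong simp: val_rules(3)[OF p] loc_ring_prod[OF S] M z val_prod[OF p])
qed

text \<open>The affine coordinates on the part of \<open>X\<close> where the homogeneous coordinate
  \<open>k\<close> is nonzero, as rational functions.\<close>

definition chart :: "'m \<Rightarrow> 'n + 'm \<Rightarrow> 'n ratfun" where
  "chart k = case_sum coord (\<lambda>j. of_mpoly (G j) / of_mpoly (G k))"

lemma hat_Inr: "hat (var (Inr j)) = of_mpoly (G j)" by (simp add: hat_def)

lemma chart_loc_ring: "p \<in> X \<Longrightarrow> rep_proj (snd p) $ k \<noteq> 0 \<Longrightarrow> chart k v \<in> loc_ring {p}"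
  using loc_ring_I[OF hom_Inr hom_Inr, of "{p}" k] loc_ring_pt(4)[of p] 
  by (cases v) (auto simp: chart_def hat_Inr pval_simps)

lemma hat_chart:
  assumes "p \<in> X" "rep_proj (snd p) $ k \<noteq> 0" "hom d P" 
  shows "hat P = of_mpoly (G k) ^ d * heval of_const (chart k) P" "of_mpoly (G k) \<noteq> 0"
proof -
  have n: "of_mpoly (G k) \<noteq> 0" 
    using hat_nz[of "{p}" 1 "var (Inr k)", OF _ hom_Inr] assms by (simp add: hat_Inr pval_simps)
  then have "(\<lambda>j. of_mpoly (G j)) = (\<lambda>j. of_mpoly (G k) * (of_mpoly (G j) / of_mpoly (G k)))" by auto
  then show "hat P = of_mpoly (G k) ^ d * heval of_const (chart k) P" "of_mpoly (G k) \<noteq> 0"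
    unfolding hat_heval chart_def using heval_hom[OF rhom_of_const assms(3)] n by metis+
qed

text \<open>The coefficients \<open>e\<close> of the exact expansion at \<open>q\<close> depend on
  \<open>q\<close>: for a product they involve the constant value of one factor at \<open>q\<close>.
  Their values at \<open>q\<close> are the values of \<open>d\<close>, and \<open>d\<close> can be
  chosen independently of \<open>q\<close>.\<close>

definition chart_lin :: "'m \<Rightarrow> ('n, 'm) pt \<Rightarrow> 'n ratfun \<Rightarrow> ('n + 'm \<Rightarrow> 'n ratfun) \<Rightarrow> bool" where
  "chart_lin k q r d \<longleftrightarrow> (\<exists>e. (\<forall>v. e v \<in> loc_ring {q} \<and> value_at q (e v) = value_at q (d v)) \<and>
     r - of_const (value_at q r) = (\<Sum>v\<in>UNIV. e v * (chart k v - of_const (value_at q (chart k v)))))"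

text \<open>Says that \<open>dr\<close> is the sum of the \<open>d v\<close> times the differentials
  of the chart coordinates, both for derivations of the function field and for the expansions at all
  points near \<open>p\<close>. The chart coordinates satisfy relations, so \<open>d\<close> is not
  unique.\<close>

definition chart_diff :: "'m \<Rightarrow> ('n, 'm) pt \<Rightarrow> 'n ratfun \<Rightarrow> ('n + 'm \<Rightarrow> 'n ratfun) \<Rightarrow> bool" where
  "chart_diff k p r d \<longleftrightarrow> (\<forall>D. is_deriv D \<longrightarrow> D r = (\<Sum>v\<in>UNIV. d v * D (chart k v))) \<and>
     near X p (\<lambda>q. q \<in> X \<and> r \<in> loc_ring {q} \<and> (\<forall>v. d v \<in> loc_ring {q}) \<and> chart_lin k q r d)"

lemma chart_diff_of_const: "p \<in> X \<Longrightarrow> chart_diff k p (of_const c) (\<lambda>v. 0)"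
  unfolding chart_diff_def
proof
  assume p: "p \<in> X"
  show "near X p (\<lambda>q. q \<in> X \<and> of_const c \<in> loc_ring {q} \<and> (\<forall>v. 0 \<in> loc_ring {q}) \<and> chart_lin k q (of_const c) (\<lambda>v. 0))"
    by (rule near_mono[OF near_in[OF p]]) 
      (auto simp: loc_ring_pt(3) loc_ring_0[OF primeset_point] chart_lin_def val_rules intro!: exI[of _ "\<lambda>_. 0"])
qed (auto simp: is_deriv_simps)

lemma near_chart:
  assumes "p \<in> X" "rep_proj (snd p) $ k \<noteq> 0"
  shows "near X p (\<lambda>q. q \<in> X \<and> rep_proj (snd q) $ k \<noteq> 0)"
  using near_hom[OF assms(1) hom_Inr, of k] assms(2) by (simp add: pval_simps)

lemma chart_diff_chart:
  assumes p: "p \<in> X" "rep_proj (snd p) $ k \<noteq> 0"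
  shows "chart_diff k p (chart k w) (\<lambda>v. if v = w then 1 else 0)"
  unfolding chart_diff_def
proof
  have e: "(\<Sum>v\<in>UNIV. (if v = w then 1 else 0) * f v) = f w" for f :: "_ \<Rightarrow> 'n ratfun"
  proof -
    have "(\<Sum>v\<in>UNIV. (if v = w then 1 else 0) * f v) = (\<Sum>v\<in>UNIV. if v = w then f v else 0)" by (rule sum.cong) auto
    then show ?thesis by simp
  qed
  show "\<forall>D. is_deriv D \<longrightarrow> D (chart k w) = (\<Sum>v\<in>UNIV. (if v = w then 1 else 0) * D (chart k v))" by (simp add: e)
  show "near X p (\<lambda>q. q \<in> X \<and> chart k w \<in> loc_ring {q} \<and> (\<forall>v. (if v = w then 1 else 0) \<in> loc_ring {q}) \<and> chart_lin k q (chart k w) (\<lambda>v. if v = w then 1 else 0))"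
  proof (rule near_mono[OF near_chart[OF p]])
    fix q assume q: "q \<in> X \<and> rep_proj (snd q) $ k \<noteq> 0"
    then have 1: "(if v = w then 1 else 0) \<in> loc_ring {q}" for v using loc_ring_0[OF primeset_point, of q] loc_ring_1[OF primeset_point, of q] by auto
    have "chart_lin k q (chart k w) (\<lambda>v. if v = w then 1 else 0)" unfolding chart_lin_def
      by (rule exI[of _ "\<lambda>v. if v = w then 1 else 0"]) (use 1 e in auto)
    then show "q \<in> X \<and> chart k w \<in> loc_ring {q} \<and> (\<forall>v. (if v = w then 1 else 0) \<in> loc_ring {q}) \<and> chart_lin k q (chart k w) (\<lambda>v. if v = w then 1 else 0)"
      using q 1 chart_loc_ring by blast
  qed
qed

lemma chart_diff_add:
  assumes "chart_diff k p r d" "chart_diff k p s d'" shows "chart_diff k p (r + s) (\<lambda>v. d v + d' v)"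
  unfolding chart_diff_def
proof
  show "\<forall>D. is_deriv D \<longrightarrow> D (r + s) = (\<Sum>v\<in>UNIV. (d v + d' v) * D (chart k v))"
    using assms by (auto simp: chart_diff_def is_deriv_simps algebra_simps sum.distrib)
  have n: "near X p (\<lambda>q. (q \<in> X \<and> r \<in> loc_ring {q} \<and> (\<forall>v. d v \<in> loc_ring {q}) \<and> chart_lin k q r d) \<and> (q \<in> X \<and> s \<in> loc_ring {q} \<and> (\<forall>v. d' v \<in> loc_ring {q}) \<and> chart_lin k q s d'))"
    by (rule near_conj) (use assms in \<open>auto simp: chart_diff_def\<close>)
  show "near X p (\<lambda>q. q \<in> X \<and> r + s \<in> loc_ring {q} \<and> (\<forall>v. d v + d' v \<in> loc_ring {q}) \<and> chart_lin k q (r + s) (\<lambda>v. d v + d' v))"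
  proof (rule near_mono[OF n])
    fix q assume q: "(q \<in> X \<and> r \<in> loc_ring {q} \<and> (\<forall>v. d v \<in> loc_ring {q}) \<and> chart_lin k q r d) \<and> (q \<in> X \<and> s \<in> loc_ring {q} \<and> (\<forall>v. d' v \<in> loc_ring {q}) \<and> chart_lin k q s d')"
    then have qX: "q \<in> X" by blast
    obtain e where e: "\<And>v. e v \<in> loc_ring {q}" "\<And>v. value_at q (e v) = value_at q (d v)" 
       "r - of_const (value_at q r) = (\<Sum>v\<in>UNIV. e v * (chart k v - of_const (value_at q (chart k v))))" using q unfolding chart_lin_def by blast
    obtain e' where e': "\<And>v. e' v \<in> loc_ring {q}" "\<And>v. value_at q (e' v) = value_at q (d' v)" 
       "s - of_const (value_at q s) = (\<Sum>v\<in>UNIV. e' v * (chart k v - of_const (value_at q (chart k v))))" using q unfolding chart_lin_def by blast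
    have "r + s - of_const (value_at q (r + s)) = (r - of_const (value_at q r)) + (s - of_const (value_at q s))"
      using q by (simp add: val_rules(2))
    also have "\<dots> = (\<Sum>v\<in>UNIV. (e v + e' v) * (chart k v - of_const (value_at q (chart k v))))"
      unfolding e(3) e'(3) by (simp add: distrib_right sum.distrib)
    finally have "chart_lin k q (r + s) (\<lambda>v. d v + d' v)" unfolding chart_lin_def
      using e(1,2) e'(1,2) loc_ring_pt(1)[OF sing[OF qX]] q by (intro exI[of _ "\<lambda>v. e v + e' v"]) (simp add: val_rules(2))
    then show "q \<in> X \<and> r + s \<in> loc_ring {q} \<and> (\<forall>v. d v + d' v \<in> loc_ring {q}) \<and> chart_lin k q (r + s) (\<lambda>v. d v + d' v)"
      using q loc_ring_pt(1)[OF sing[OF qX]] by blast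
  qed
qed

lemma chart_diff_mult:
  assumes "chart_diff k p r d" "chart_diff k p s d'" shows "chart_diff k p (r * s) (\<lambda>v. d v * s + r * d' v)"
  unfolding chart_diff_def
proof
  show "\<forall>D. is_deriv D \<longrightarrow> D (r * s) = (\<Sum>v\<in>UNIV. (d v * s + r * d' v) * D (chart k v))"
  proof (intro allI impI)
    fix D :: "'n ratfun \<Rightarrow> 'n ratfun" assume D: "is_deriv D"
    have "D r = (\<Sum>v\<in>UNIV. d v * D (chart k v))" "D s = (\<Sum>v\<in>UNIV. d' v * D (chart k v))" using assms D by (auto simp: chart_diff_def)
    then show "D (r * s) = (\<Sum>v\<in>UNIV. (d v * s + r * d' v) * D (chart k v))"
      by (simp add: is_deriv_simps[OF D] algebra_simps sum.distrib sum_distrib_left)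
  qed
  have n: "near X p (\<lambda>q. (q \<in> X \<and> r \<in> loc_ring {q} \<and> (\<forall>v. d v \<in> loc_ring {q}) \<and> chart_lin k q r d) \<and> (q \<in> X \<and> s \<in> loc_ring {q} \<and> (\<forall>v. d' v \<in> loc_ring {q}) \<and> chart_lin k q s d'))"
    by (rule near_conj) (use assms in \<open>auto simp: chart_diff_def\<close>)
  show "near X p (\<lambda>q. q \<in> X \<and> r * s \<in> loc_ring {q} \<and> (\<forall>v. d v * s + r * d' v \<in> loc_ring {q}) \<and> chart_lin k q (r * s) (\<lambda>v. d v * s + r * d' v))"
  proof (rule near_mono[OF n])
    fix q assume q: "(q \<in> X \<and> r \<in> loc_ring {q} \<and> (\<forall>v. d v \<in> loc_ring {q}) \<and> chart_lin k q r d) \<and> (q \<in> X \<and> s \<in> loc_ring {q} \<and> (\<forall>v. d' v \<in> loc_ring {q}) \<and> chart_lin k q s d')"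
    then have qX: "q \<in> X" by blast
    note L = loc_ring_pt(1-3)[OF sing[OF qX]]
    obtain e where e: "\<And>v. e v \<in> loc_ring {q}" "\<And>v. value_at q (e v) = value_at q (d v)" 
       "r - of_const (value_at q r) = (\<Sum>v\<in>UNIV. e v * (chart k v - of_const (value_at q (chart k v))))" using q unfolding chart_lin_def by blast
    obtain e' where e': "\<And>v. e' v \<in> loc_ring {q}" "\<And>v. value_at q (e' v) = value_at q (d' v)" 
       "s - of_const (value_at q s) = (\<Sum>v\<in>UNIV. e' v * (chart k v - of_const (value_at q (chart k v))))" using q unfolding chart_lin_def by blast
    have "r * s - of_const (value_at q (r * s)) = (r - of_const (value_at q r)) * s + of_const (value_at q r) * (s - of_const (value_at q s))"
      using q by (simp add: val_rules(3) algebra_simps)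
    also have "\<dots> = (\<Sum>v\<in>UNIV. (e v * s + of_const (value_at q r) * e' v) * (chart k v - of_const (value_at q (chart k v))))"
      unfolding e(3) e'(3) sum_distrib_right sum_distrib_left by (simp add: distrib_left distrib_right sum.distrib mult_ac)
    finally have "chart_lin k q (r * s) (\<lambda>v. d v * s + r * d' v)" unfolding chart_lin_def
      using e(1,2) e'(1,2) L q qX by (intro exI[of _ "\<lambda>v. e v * s + of_const (value_at q r) * e' v"]) (simp add: val_rules(1-3))
    then show "q \<in> X \<and> r * s \<in> loc_ring {q} \<and> (\<forall>v. d v * s + r * d' v \<in> loc_ring {q}) \<and> chart_lin k q (r * s) (\<lambda>v. d v * s + r * d' v)"
      using q L by blast
  qed
qed

lemma chart_diff_inverse:
  assumes g: "chart_diff k p r d" and nz: "value_at p r \<noteq> 0" shows "chart_diff k p (inverse r) (\<lambda>v. - (inverse r * inverse r * d v))"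
  unfolding chart_diff_def
proof
  have n0: "near X p (\<lambda>q. q \<in> X \<and> r \<in> loc_ring {q} \<and> (\<forall>v. d v \<in> loc_ring {q}) \<and> chart_lin k q r d)"
    using g by (auto simp: chart_diff_def)
  have p: "p \<in> X" and germ: "r \<in> loc_ring {p}" using near_at[OF n0] by auto
  have r0: "r \<noteq> 0" using nz val_rules(5)[OF p] by auto
  show "\<forall>D. is_deriv D \<longrightarrow> D (inverse r) = (\<Sum>v\<in>UNIV. - (inverse r * inverse r * d v) * D (chart k v))"
  proof (intro allI impI)
    fix D :: "'n ratfun \<Rightarrow> 'n ratfun" assume D: "is_deriv D"
    have "D r = (\<Sum>v\<in>UNIV. d v * D (chart k v))" using g D by (auto simp: chart_diff_def)
    moreover have "D (inverse r) = - (inverse r * inverse r * D r)"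
      using is_deriv_div[OF D r0, of 1] by (simp add: is_deriv_simps[OF D] divide_inverse power2_eq_square)
    ultimately show "D (inverse r) = (\<Sum>v\<in>UNIV. - (inverse r * inverse r * d v) * D (chart k v))"
      by (simp add: sum_distrib_left sum_negf mult.assoc)
  qed
  have n: "near X p (\<lambda>q. (q \<in> X \<and> r \<in> loc_ring {q} \<and> (\<forall>v. d v \<in> loc_ring {q}) \<and> chart_lin k q r d) \<and> (q \<in> X \<and> r \<in> loc_ring {q} \<and> value_at q r \<noteq> 0))"
    by (rule near_conj[OF n0 near_val_nz[OF p germ nz]])
  show "near X p (\<lambda>q. q \<in> X \<and> inverse r \<in> loc_ring {q} \<and> (\<forall>v. - (inverse r * inverse r * d v) \<in> loc_ring {q}) \<and> chart_lin k q (inverse r) (\<lambda>v. - (inverse r * inverse r * d v)))"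
  proof (rule near_mono[OF n])
    fix q assume q: "(q \<in> X \<and> r \<in> loc_ring {q} \<and> (\<forall>v. d v \<in> loc_ring {q}) \<and> chart_lin k q r d) \<and> (q \<in> X \<and> r \<in> loc_ring {q} \<and> value_at q r \<noteq> 0)"
    then have qX: "q \<in> X" and vq: "value_at q r \<noteq> 0" and rq: "r \<in> loc_ring {q}" by blast+
    note L = loc_ring_pt(1-3)[OF sing[OF qX]] loc_ring_uminus[OF primeset_point sing[OF qX]]
    note iv = val_inverse[OF qX rq vq]
    obtain e where e: "\<And>v. e v \<in> loc_ring {q}" "\<And>v. value_at q (e v) = value_at q (d v)" 
       "r - of_const (value_at q r) = (\<Sum>v\<in>UNIV. e v * (chart k v - of_const (value_at q (chart k v))))" using q unfolding chart_lin_def by blast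
    let ?c = "of_const (inverse (value_at q r))"
    have c: "?c * of_const (value_at q r) = 1" using vq by (simp flip: of_const_simps(4) del: of_const_simps(4))
    have "inverse r - ?c = - (inverse r * ?c * (r - of_const (value_at q r)))"
    proof -
      have "inverse r * ?c * (r - of_const (value_at q r)) = (inverse r * r) * ?c - inverse r * (?c * of_const (value_at q r))"
        by (simp only: algebra_simps)
      then show ?thesis using r0 by (simp add: c)
    qed
    also have "\<dots> = (\<Sum>v\<in>UNIV. (- (inverse r * ?c * e v)) * (chart k v - of_const (value_at q (chart k v))))"
      unfolding e(3) by (simp add: sum_distrib_left sum_negf mult.assoc)
    finally have 1: "inverse r - of_const (value_at q (inverse r)) = (\<Sum>v\<in>UNIV. (- (inverse r * ?c * e v)) * (chart k v - of_const (value_at q (chart k v))))"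
      by (simp only: iv(2))
    have v1: "value_at q (- s) = - value_at q s" if "s \<in> loc_ring {q}" for s
      using val_rules(4)[OF qX _ that, of 0] val_rules(5)[OF qX] loc_ring_0[OF primeset_point sing[OF qX]] by simp
    have "chart_lin k q (inverse r) (\<lambda>v. - (inverse r * inverse r * d v))" unfolding chart_lin_def
      using e(1,2) L q qX iv 1 by (intro exI[of _ "\<lambda>v. - (inverse r * ?c * e v)"]) (simp add: val_rules(1-3) v1)
    then show "q \<in> X \<and> inverse r \<in> loc_ring {q} \<and> (\<forall>v. - (inverse r * inverse r * d v) \<in> loc_ring {q}) \<and> chart_lin k q (inverse r) (\<lambda>v. - (inverse r * inverse r * d v))"
      using qX iv(1) q by (auto intro!: L)
  qed
qed

lemma chart_diff_heval:
  assumes p: "p \<in> X" "rep_proj (snd p) $ k \<noteq> 0" shows "\<exists>d. chart_diff k p (heval of_const (chart k) P) d"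
proof (induction P rule: mpoly_induct)
  case (Cst c) show ?case using chart_diff_of_const[OF p(1)] by (auto simp: hk_simps)
next
  case (var v) show ?case using chart_diff_chart[OF p] by (auto simp: hk_simps)
next
  case (add P Q) then show ?case using chart_diff_add by (simp only: hk_simps) blast
next
  case (mult P Q) then show ?case using chart_diff_mult by (simp only: hk_simps) blast
qed

text \<open>Dividing numerator and denominator by a power of the homogeneous coordinate
  \<open>k\<close> turns \<open>r\<close> into a quotient of polynomials in the chart coordinates;
  the product and quotient rules do the rest.\<close>

lemma chart_diff_exists:
  assumes p: "p \<in> X" "rep_proj (snd p) $ k \<noteq> 0" and r: "r \<in> loc_ring {p}" shows "\<exists>d. chart_diff k p r d"
proof -
  obtain e P Q where 1: "hom e P" "hom e Q" "pval Q p \<noteq> 0" "r = hat P / hat Q" using r by (auto elim: loc_ring_E)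
  let ?P = "heval of_const (chart k) P" and ?Q = "heval of_const (chart k) Q"
  have nz: "of_mpoly (G k) \<noteq> 0" by (rule hat_chart(2)[OF p 1(1)])
  have r: "r = ?P * inverse ?Q" unfolding 1(4) hat_chart(1)[OF p 1(1)] hat_chart(1)[OF p 1(2)]
    using nz by (simp add: divide_inverse)
  have hk: "hom e (var (Inr k) ^ e)" using hom_power[OF hom_Inr, of e k] by simp
  have "?Q = hat Q / hat (var (Inr k) ^ e)" unfolding hat_chart(1)[OF p 1(2)] using nz by (simp add: hat_Inr)
  then have "value_at p ?Q = pval Q p / pval (var (Inr k) ^ e) p" 
    using val_frac(2)[OF p(1) 1(2) hk] p(2) by (simp add: pval_simps)
  then have "value_at p ?Q \<noteq> 0" using 1(3) p(2) by (simp add: pval_simps)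
  moreover obtain d where "chart_diff k p ?Q d" using chart_diff_heval[OF p] by blast
  ultimately have g: "chart_diff k p (inverse ?Q) (\<lambda>v. - (inverse ?Q * inverse ?Q * d v))" by (intro chart_diff_inverse)
  moreover obtain d' where "chart_diff k p ?P d'" using chart_diff_heval[OF p] by blast
  ultimately show ?thesis unfolding r using chart_diff_mult by blast
qed

lemma chart_exists: "\<exists>k. rep_proj (snd p) $ k \<noteq> 0"
  using proj_rep_nz[of "snd p"] by (auto simp: vec_eq_iff)

end

section \<open>Dual derivations and Jacobian determinants\<close>

context bir
begin

lemma loc_ring_cramer_sol:
  assumes S: "primeset S" "S \<subseteq> X" and M: "\<And>i w. M i w \<in> loc_ring S" and g: "\<And>i j. g i j \<in> loc_ring S"
    and d: "det (\<chi> i w. M i w) \<notin> max_ideal S"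
  shows "cramer_sol M g (v :: 'v::finite) j \<in> loc_ring S"
  unfolding cramer_sol_def
  by (rule loc_ring_inverse_mult[OF S loc_ring_det[OF S] loc_ring_det[OF S] d]) (use M g in auto)

lemma det_one: "det (\<chi> i j. (if i = j then 1 else (0 :: 'a::comm_ring_1))) = 1"
  using det_I by (simp add: mat_def)

text \<open>Writing \<open>u - u(p) = \<Sum> g * a\<close> for the chart coordinates
  \<open>u\<close> and applying a derivation gives a linear system for the \<open>D u\<close> in
  terms of the \<open>D a\<close>. Its matrix is the identity at \<open>p\<close>, so Cramer's rule
  solves it inside the local ring. This gives the dual derivations and shows that they preserve the
  local ring. The analogous system with the expansions at a nearby point \<open>q\<close> shows that
  the \<open>a\<close>, shifted by their values, generate the maximal ideal at
  \<open>q\<close>.\<close>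

lemma lparams_dual1:
  assumes p: "p \<in> X" and L: "lparams p a"
  shows "\<exists>\<Delta>. dual a \<Delta> \<and> (\<forall>j. \<forall>r\<in>loc_ring {p}. \<Delta> j r \<in> loc_ring {p}) \<and>
     near X p (\<lambda>q. q \<in> X \<and> (\<forall>j. a j \<in> loc_ring {q}) \<and> lparams q (\<lambda>j. a j - of_const (value_at q (a j))))"
proof -
  have pp: "primeset {p}" "{p} \<subseteq> X" using p by (auto simp: primeset_point)
  obtain k where k: "rep_proj (snd p) $ k \<noteq> 0" using chart_exists by blast
  let ?u = "chart k"
  have aM: "a j \<in> max_ideal {p}" for j using L by (auto simp: lparams_def)
  have aL: "a j \<in> loc_ring {p}" for j using aM max_ideal_loc_ring' by blast
  have "\<forall>v. \<exists>g. (\<forall>j. g j \<in> loc_ring {p}) \<and> ?u v - of_const (value_at p (?u v)) = (\<Sum>j\<in>UNIV. g j * a j)"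
    using L valD[OF p chart_loc_ring[OF p k]] unfolding lparams_def by blast
  then obtain g where gL: "\<And>v j. g v j \<in> loc_ring {p}" and ug: "\<And>v. ?u v - of_const (value_at p (?u v)) = (\<Sum>j\<in>UNIV. g v j * a j)"
    unfolding choice_iff by blast
  have "\<forall>v j. \<exists>d. chart_diff k p (g v j) d" using chart_diff_exists[OF p k gL] by blast
  then obtain \<gamma> where \<gamma>: "\<And>v j. chart_diff k p (g v j) (\<gamma> v j)" unfolding choice_iff by blast
  have gn: "near X p (\<lambda>q. q \<in> X \<and> g v j \<in> loc_ring {q} \<and> (\<forall>w. \<gamma> v j w \<in> loc_ring {q}) \<and> chart_lin k q (g v j) (\<gamma> v j))" for v j
    using \<gamma>[of v j] by (simp add: chart_diff_def)
  have \<gamma>L: "\<gamma> v j w \<in> loc_ring {p}" for v j w using near_at[OF gn[of v j]] by blast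
  \<comment> \<open>The terms \<open>D (g v j) * a j\<close> of the product rule are brought to the
    left-hand side. They have coefficients in the maximal ideal, so the determinant has value 1 at
    \<open>p\<close>.\<close>
  define M where "M i w = (if i = w then 1 else 0) - (\<Sum>j\<in>UNIV. a j * \<gamma> i j w)" for i w
  have d01: "(if i = w then 1 else 0) \<in> loc_ring {q}" if "q \<in> X" for i w :: "'n + 'm" and q
    using loc_ring_0[OF primeset_point, of q] loc_ring_1[OF primeset_point, of q] that by auto
  have MinL: "M i w \<in> loc_ring {q}" if "q \<in> X" "\<And>j. a j \<in> loc_ring {q}" "\<And>i j w. \<gamma> i j w \<in> loc_ring {q}" for i w q
    unfolding M_def using that by (intro loc_ring_diff[OF primeset_point sing] d01 loc_ring_sum[OF primeset_point sing] loc_ring_pt(2)[OF sing])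
  have vM: "value_at q (M i w) = (if i = w then 1 else 0) - (\<Sum>j\<in>UNIV. value_at q (a j) * value_at q (\<gamma> i j w))" 
    if "q \<in> X" "\<And>j. a j \<in> loc_ring {q}" "\<And>i j w. \<gamma> i j w \<in> loc_ring {q}" for i w q
  proof -
    have s: "(\<Sum>j\<in>UNIV. a j * \<gamma> i j w) \<in> loc_ring {q}" using that by (intro loc_ring_sum[OF primeset_point sing] loc_ring_pt(2)[OF sing])
    have "value_at q (M i w) = value_at q (if i = w then 1 else 0) - value_at q (\<Sum>j\<in>UNIV. a j * \<gamma> i j w)"
      unfolding M_def by (rule val_rules(4)[OF that(1) d01[OF that(1)] s])
    also have "value_at q (\<Sum>j\<in>UNIV. a j * \<gamma> i j w) = (\<Sum>j\<in>UNIV. value_at q (a j) * value_at q (\<gamma> i j w))"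
      using that by (subst val_sum) (auto intro!: loc_ring_pt(2)[OF sing] sum.cong simp: val_rules(3))
    also have "value_at q (if i = w then 1 else 0) = (if i = w then 1 else 0)" using that(1) by (simp add: val_rules)
    finally show ?thesis .
  qed
  let ?M = "\<chi> i w. M i w"
  have a0: "value_at p (a j) = 0" for j using val_max_ideal[OF p aL] aM by blast
  have dL: "det ?M \<in> loc_ring {p}" using MinL[OF p aL \<gamma>L] by (intro loc_ring_det[OF pp]) simp
  have "value_at p (det ?M) = det (\<chi> i w. value_at p (M i w))"
    using MinL[OF p aL \<gamma>L] by (subst val_det[OF p]) auto
  also have "\<dots> = 1" using vM[OF p aL \<gamma>L] by (simp add: a0 det_one)
  finally have dv: "value_at p (det ?M) \<noteq> 0" by simp
  then have dM: "det ?M \<notin> max_ideal {p}" using val_max_ideal[OF p dL] by simp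
  then have d0: "det ?M \<noteq> 0" using max_ideal_0[OF pp] by auto
  have cl1: "D (?u v) = (\<Sum>j\<in>UNIV. cramer_sol M g v j * D (a j))" if D: "is_deriv D" for D v
  proof (rule cramer_sol_solves[OF d0])
    fix v
    have Dg: "D (g v j) = (\<Sum>w\<in>UNIV. \<gamma> v j w * D (?u w))" for j using \<gamma>[of v j] D by (simp add: chart_diff_def)
    have "D (?u v) = D (?u v - of_const (value_at p (?u v)))" by (simp add: is_deriv_simps[OF D])
    also have "\<dots> = (\<Sum>j\<in>UNIV. D (g v j) * a j) + (\<Sum>j\<in>UNIV. g v j * D (a j))"
      unfolding ug by (simp add: is_deriv_sum[OF D] is_deriv_simps[OF D] sum.distrib)
    also have "(\<Sum>j\<in>UNIV. D (g v j) * a j) = (\<Sum>j\<in>UNIV. \<Sum>w\<in>UNIV. a j * \<gamma> v j w * D (?u w))"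
      unfolding Dg by (simp add: sum_distrib_left sum_distrib_right mult_ac)
    also have "\<dots> = (\<Sum>w\<in>UNIV. \<Sum>j\<in>UNIV. a j * \<gamma> v j w * D (?u w))" by (rule sum.swap)
    finally have 1: "D (?u v) = (\<Sum>w\<in>UNIV. \<Sum>j\<in>UNIV. a j * \<gamma> v j w * D (?u w)) + (\<Sum>j\<in>UNIV. g v j * D (a j))" .
    have "(\<Sum>w\<in>UNIV. M v w * D (?u w)) = (\<Sum>w\<in>UNIV. (if v = w then D (?u w) else 0) - (\<Sum>j\<in>UNIV. a j * \<gamma> v j w * D (?u w)))"
      by (rule sum.cong) (auto simp: M_def algebra_simps sum_distrib_left sum_distrib_right)
    also have "\<dots> = D (?u v) - (\<Sum>w\<in>UNIV. \<Sum>j\<in>UNIV. a j * \<gamma> v j w * D (?u w))" by (simp add: sum_subtractf)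
    finally show "(\<Sum>w\<in>UNIV. M v w * D (?u w)) = (\<Sum>j\<in>UNIV. g v j * D (a j))" using 1 by simp
  qed
  have "D (coord i) = (\<Sum>j\<in>UNIV. cramer_sol M g (Inl i) j * D (a j))" if "is_deriv D" for D i
    using cl1[OF that, of "Inl i"] by (simp add: chart_def)
  then obtain \<Delta> where \<Delta>: "dual a \<Delta>" using dual_exists[of "\<lambda>i j. cramer_sol M g (Inl i) j" a] by blast
  have \<Delta>D: "is_deriv (\<Delta> j)" and \<Delta>a: "\<Delta> j (a l) = (if l = j then 1 else 0)" for j l using \<Delta> by (auto simp: dual_def)
  have \<Delta>u: "\<Delta> j (?u v) = cramer_sol M g v j" for j v
  proof -
    have "\<Delta> j (?u v) = (\<Sum>l\<in>UNIV. if l = j then cramer_sol M g v l else 0)"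
      unfolding cl1[OF \<Delta>D] \<Delta>a by (rule sum.cong) auto
    then show ?thesis by simp
  qed
  have sL: "cramer_sol M g v j \<in> loc_ring {p}" for v j by (rule loc_ring_cramer_sol[OF pp MinL[OF p aL \<gamma>L] gL dM])
  have pres: "\<Delta> j r \<in> loc_ring {p}" if r: "r \<in> loc_ring {p}" for j r
  proof -
    obtain d where d: "chart_diff k p r d" using chart_diff_exists[OF p k r] by blast
    then have "near X p (\<lambda>q. q \<in> X \<and> r \<in> loc_ring {q} \<and> (\<forall>v. d v \<in> loc_ring {q}) \<and> chart_lin k q r d)" by (simp add: chart_diff_def)
    from near_at[OF this] have dL: "d v \<in> loc_ring {p}" for v by blast
    have "\<Delta> j r = (\<Sum>v\<in>UNIV. d v * \<Delta> j (?u v))" using d \<Delta>D by (simp add: chart_diff_def)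
    then show ?thesis unfolding \<Delta>u using dL sL by (simp add: loc_ring_sum[OF pp] loc_ring_rules(2)[OF pp])
  qed
  have n1: "near X p (\<lambda>q. \<forall>v j. q \<in> X \<and> g v j \<in> loc_ring {q} \<and> (\<forall>w. \<gamma> v j w \<in> loc_ring {q}) \<and> chart_lin k q (g v j) (\<gamma> v j))"
    by (intro near_all_finite[OF p] gn)
  have n2: "near X p (\<lambda>q. \<forall>j. q \<in> X \<and> a j \<in> loc_ring {q})" by (intro near_all_finite[OF p] near_loc_ring[OF p aL])
  have n3: "near X p (\<lambda>q. q \<in> X \<and> det ?M \<in> loc_ring {q} \<and> value_at q (det ?M) \<noteq> 0)" by (rule near_val_nz[OF p dL dv])
  note n = near_conj[OF near_conj[OF n1 n2] near_conj[OF n3 near_chart[OF p k]]]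
  have "near X p (\<lambda>q. q \<in> X \<and> (\<forall>j. a j \<in> loc_ring {q}) \<and> lparams q (\<lambda>j. a j - of_const (value_at q (a j))))"
  proof (rule near_mono[OF n])
    fix q assume q: "((\<forall>v j. q \<in> X \<and> g v j \<in> loc_ring {q} \<and> (\<forall>w. \<gamma> v j w \<in> loc_ring {q}) \<and> chart_lin k q (g v j) (\<gamma> v j)) \<and>
       (\<forall>j. q \<in> X \<and> a j \<in> loc_ring {q})) \<and> (q \<in> X \<and> det ?M \<in> loc_ring {q} \<and> value_at q (det ?M) \<noteq> 0) \<and> q \<in> X \<and> rep_proj (snd q) $ k \<noteq> 0"
    then have qX: "q \<in> X" and kq: "rep_proj (snd q) $ k \<noteq> 0" and aq: "\<And>j. a j \<in> loc_ring {q}" and gq: "\<And>v j. g v j \<in> loc_ring {q}" 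
      and \<gamma>q: "\<And>v j w. \<gamma> v j w \<in> loc_ring {q}" and lq: "\<And>v j. chart_lin k q (g v j) (\<gamma> v j)" and dq: "value_at q (det ?M) \<noteq> 0" by blast+
    have qq: "primeset {q}" "{q} \<subseteq> X" using qX by (auto simp: primeset_point)
    have "\<forall>v j. \<exists>e. (\<forall>w. e w \<in> loc_ring {q} \<and> value_at q (e w) = value_at q (\<gamma> v j w)) \<and>
      g v j - of_const (value_at q (g v j)) = (\<Sum>w\<in>UNIV. e w * (?u w - of_const (value_at q (?u w))))" using lq unfolding chart_lin_def by blast
    then obtain e where eL: "\<And>v j w. e v j w \<in> loc_ring {q}" and ev: "\<And>v j w. value_at q (e v j w) = value_at q (\<gamma> v j w)"
      and ge: "\<And>v j. g v j - of_const (value_at q (g v j)) = (\<Sum>w\<in>UNIV. e v j w * (?u w - of_const (value_at q (?u w))))"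
      unfolding choice_iff by blast
    \<comment> \<open>From \<open>g * a - g(q) * a(q) = g * (a - a(q)) + a(q) * (g - g(q))\<close>
      and the expansion of \<open>g - g(q)\<close> one obtains a system for the differences at
      \<open>q\<close>. Its matrix has the same values at \<open>q\<close> as \<open>M\<close>,
      hence an invertible determinant.\<close>
    define M' where "M' i w = (if i = w then 1 else 0) - (\<Sum>j\<in>UNIV. of_const (value_at q (a j)) * e i j w)" for i w
    let ?M' = "\<chi> i w. M' i w"
    have sL: "(\<Sum>j\<in>UNIV. of_const (value_at q (a j)) * e i j w) \<in> loc_ring {q}" for i w
      using eL by (intro loc_ring_sum[OF qq] loc_ring_rules(2,3)[OF qq])
    have M'L: "M' i w \<in> loc_ring {q}" for i w unfolding M'_def by (intro loc_ring_diff[OF qq] sL d01[OF qX])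
    have "value_at q (M' i w) = value_at q (M i w)" for i w
    proof -
      have "value_at q (M' i w) = (if i = w then 1 else 0) - value_at q (\<Sum>j\<in>UNIV. of_const (value_at q (a j)) * e i j w)"
        unfolding M'_def using val_rules(4)[OF qX d01[OF qX] sL] qX by (simp add: val_rules)
      also have "value_at q (\<Sum>j\<in>UNIV. of_const (value_at q (a j)) * e i j w) = (\<Sum>j\<in>UNIV. value_at q (a j) * value_at q (\<gamma> i j w))"
        using eL by (subst val_sum[OF qX]) (auto intro!: loc_ring_rules(2,3)[OF qq] sum.cong simp: val_rules(1,3)[OF qX] loc_ring_rules(3)[OF qq] ev)
      finally show ?thesis using vM[OF qX aq \<gamma>q] by simp
    qed
    then have "value_at q (det ?M') = value_at q (det ?M)"
      using val_det[OF qX, of ?M'] val_det[OF qX, of ?M] M'L MinL[OF qX aq \<gamma>q] by simp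
    moreover have "det ?M' \<in> loc_ring {q}" using M'L by (intro loc_ring_det[OF qq]) simp
    ultimately have dM': "det ?M' \<notin> max_ideal {q}" using dq val_max_ideal[OF qX] by simp
    then have d0': "det ?M' \<noteq> 0" using max_ideal_0[OF qq] by auto
    let ?A = "\<lambda>j. a j - of_const (value_at q (a j))" and ?U = "\<lambda>v. ?u v - of_const (value_at q (?u v))"
    have U: "?U v = (\<Sum>j\<in>UNIV. cramer_sol M' g v j * ?A j)" for v
    proof (rule cramer_sol_solves[OF d0'])
      fix v
      have uq: "?u v \<in> loc_ring {q}" by (rule chart_loc_ring[OF qX kq])
      have "value_at q (?u v - of_const (value_at p (?u v))) = (\<Sum>j\<in>UNIV. value_at q (g v j) * value_at q (a j))"
        unfolding ug using gq aq by (subst val_sum[OF qX]) (auto intro!: loc_ring_rules(2)[OF qq] sum.cong simp: val_rules(3)[OF qX])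
      then have "value_at q (?u v) = value_at p (?u v) + (\<Sum>j\<in>UNIV. value_at q (g v j) * value_at q (a j))"
        using val_rules(4)[OF qX uq loc_ring_rules(3)[OF qq]] val_rules(1)[OF qX] by (simp add: algebra_simps)
      then have "?U v = ?u v - of_const (value_at p (?u v)) - (\<Sum>j\<in>UNIV. of_const (value_at q (g v j)) * of_const (value_at q (a j)))"
        by (simp add: rhom_sum[OF rhom_of_const])
      also have "\<dots> = (\<Sum>j\<in>UNIV. g v j * a j) - (\<Sum>j\<in>UNIV. of_const (value_at q (g v j)) * of_const (value_at q (a j)))" by (simp only: ug)
      finally have Uv: "?U v = (\<Sum>j\<in>UNIV. g v j * a j) - (\<Sum>j\<in>UNIV. of_const (value_at q (g v j)) * of_const (value_at q (a j)))" .
      have "(\<Sum>w\<in>UNIV. M' v w * ?U w) = (\<Sum>w\<in>UNIV. (if v = w then ?U w else 0) - (\<Sum>j\<in>UNIV. of_const (value_at q (a j)) * (e v j w * ?U w)))"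
        by (rule sum.cong) (auto simp: M'_def left_diff_distrib sum_distrib_right mult.assoc)
      also have "\<dots> = ?U v - (\<Sum>w\<in>UNIV. \<Sum>j\<in>UNIV. of_const (value_at q (a j)) * (e v j w * ?U w))" by (simp add: sum_subtractf)
      also have "(\<Sum>w\<in>UNIV. \<Sum>j\<in>UNIV. of_const (value_at q (a j)) * (e v j w * ?U w)) = (\<Sum>j\<in>UNIV. \<Sum>w\<in>UNIV. of_const (value_at q (a j)) * (e v j w * ?U w))"
        by (rule sum.swap)
      also have "\<dots> = (\<Sum>j\<in>UNIV. of_const (value_at q (a j)) * (g v j - of_const (value_at q (g v j))))"
        by (simp only: ge sum_distrib_left)
      also have "?U v - \<dots> = (\<Sum>j\<in>UNIV. g v j * ?A j)"
        unfolding Uv by (simp add: algebra_simps sum_subtractf sum.distrib)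
      finally show "(\<Sum>w\<in>UNIV. M' v w * ?U w) = (\<Sum>j\<in>UNIV. g v j * ?A j)" .
    qed
    have s'L: "cramer_sol M' g v j \<in> loc_ring {q}" for v j by (rule loc_ring_cramer_sol[OF qq M'L gq dM'])
    have "lparams q ?A" unfolding lparams_def
    proof (intro conjI allI ballI)
      show "?A j \<in> max_ideal {q}" for j by (rule valD[OF qX aq])
      fix r assume r: "r \<in> max_ideal {q}"
      then have rL: "r \<in> loc_ring {q}" by (rule max_ideal_loc_ring')
      obtain d where d: "chart_diff k q r d" using chart_diff_exists[OF qX kq rL] by blast
      then have "near X q (\<lambda>q'. q' \<in> X \<and> r \<in> loc_ring {q'} \<and> (\<forall>v. d v \<in> loc_ring {q'}) \<and> chart_lin k q' r d)" by (simp add: chart_diff_def)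
      from near_at[OF this] have "chart_lin k q r d" by blast
      then obtain e' where e': "\<And>v. e' v \<in> loc_ring {q}" "r - of_const (value_at q r) = (\<Sum>v\<in>UNIV. e' v * ?U v)" unfolding chart_lin_def by blast
      have "r = (\<Sum>v\<in>UNIV. e' v * ?U v)" using e'(2) r val_max_ideal[OF qX rL] by simp
      also have "\<dots> = (\<Sum>v\<in>UNIV. \<Sum>j\<in>UNIV. e' v * cramer_sol M' g v j * ?A j)" unfolding U by (simp add: sum_distrib_left mult.assoc)
      also have "\<dots> = (\<Sum>j\<in>UNIV. \<Sum>v\<in>UNIV. e' v * cramer_sol M' g v j * ?A j)" by (rule sum.swap)
      also have "\<dots> = (\<Sum>j\<in>UNIV. (\<Sum>v\<in>UNIV. e' v * cramer_sol M' g v j) * ?A j)" by (simp add: sum_distrib_right)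
      finally show "\<exists>g. (\<forall>j. g j \<in> loc_ring {q}) \<and> r = (\<Sum>j\<in>UNIV. g j * ?A j)"
        using e'(1) s'L by (intro exI[of _ "\<lambda>j. \<Sum>v\<in>UNIV. e' v * cramer_sol M' g v j"]) (simp add: loc_ring_sum[OF qq] loc_ring_rules(2)[OF qq])
    qed
    then show "q \<in> X \<and> (\<forall>j. a j \<in> loc_ring {q}) \<and> lparams q ?A" using qX aq by blast
  qed
  then show ?thesis using \<Delta> pres by blast
qed

definition params_dual :: "('n, 'm) pt \<Rightarrow> ('n \<Rightarrow> 'n ratfun) \<Rightarrow> ('n \<Rightarrow> 'n ratfun \<Rightarrow> 'n ratfun) \<Rightarrow> bool" where
  "params_dual p a \<Delta> \<longleftrightarrow> lparams p a \<and> dual a \<Delta> \<and> (\<forall>j. \<forall>r\<in>loc_ring {p}. \<Delta> j r \<in> loc_ring {p})"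

lemma lparams_dual:
  assumes p: "p \<in> X" and L: "lparams p a"
  obtains \<Delta> where "params_dual p a \<Delta>"
    "near X p (\<lambda>q. q \<in> X \<and> (\<forall>j. a j \<in> loc_ring {q}) \<and> params_dual q (\<lambda>j. a j - of_const (value_at q (a j))) \<Delta>)"
proof -
  obtain \<Delta> where \<Delta>: "dual a \<Delta>" "\<And>j r. r \<in> loc_ring {p} \<Longrightarrow> \<Delta> j r \<in> loc_ring {p}" and
     n: "near X p (\<lambda>q. q \<in> X \<and> (\<forall>j. a j \<in> loc_ring {q}) \<and> lparams q (\<lambda>j. a j - of_const (value_at q (a j))))"
    using lparams_dual1[OF assms] by blast
  have "params_dual q (\<lambda>j. a j - of_const (value_at q (a j))) \<Delta>" if q: "q \<in> X" "lparams q (\<lambda>j. a j - of_const (value_at q (a j)))" for q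
  proof -
    obtain \<Delta>' where \<Delta>': "dual (\<lambda>j. a j - of_const (value_at q (a j))) \<Delta>'" "\<And>j r. r \<in> loc_ring {q} \<Longrightarrow> \<Delta>' j r \<in> loc_ring {q}"
      using lparams_dual1[OF q] by blast
    have "\<Delta> = \<Delta>'" by (rule dual_unique[OF \<Delta>(1) \<Delta>'(1)])
    then show ?thesis using \<Delta>' q(2) by (simp add: params_dual_def)
  qed
  then have "near X p (\<lambda>q. q \<in> X \<and> (\<forall>j. a j \<in> loc_ring {q}) \<and> params_dual q (\<lambda>j. a j - of_const (value_at q (a j))) \<Delta>)"
    by (intro near_mono[OF n]) blast
  moreover have "params_dual p a \<Delta>" using \<Delta> L by (simp add: params_dual_def)
  ultimately show ?thesis using that by blast
qed

lemma germ_det: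
  fixes J :: "('n, 'm) pt \<Rightarrow> complex ^ 'n ^ 'n"
  assumes p: "p \<in> X" and "\<And>i j. germ p (\<lambda>q. J q $ i $ j) (M $ i $ j)" shows "germ p (\<lambda>q. det (J q)) (det M)"
proof -
  have "germ p (\<lambda>q. of_int z) (of_int z)" for z 
    using germ_const[OF p, of "of_int z"] by (simp add: rhom_of_int[OF rhom_of_const])
  then show ?thesis unfolding det_def by (intro germ_sum germ_mult germ_prod p assms(2))
qed

lemma params_dual_deriv_max_ideal:
  assumes p: "p \<in> X" and P: "params_dual p a \<Delta>" and r: "r \<in> max_ideal {p}" "s \<in> max_ideal {p}"
  shows "\<Delta> j (r * s) \<in> max_ideal {p}"
proof -
  have pp: "primeset {p}" "{p} \<subseteq> X" using p by (auto simp: primeset_point)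
  have "is_deriv (\<Delta> j)" "\<Delta> j r \<in> loc_ring {p}" "\<Delta> j s \<in> loc_ring {p}" using P r max_ideal_loc_ring' by (auto simp: params_dual_def dual_def)
  then show ?thesis using r by (simp add: is_deriv_simps loc_ring_rules(5,6)[OF pp] max_ideal_mult_left[OF pp])
qed

text \<open>Supplies the existence half of the description defining \<open>mult_K\<close>: around
  every point with parameters there is some Jacobian matrix.\<close>

lemma jacobian_exists:
  assumes p: "p \<in> X" and L: "lparams p a"
  obtains \<Delta> where "params_dual p a \<Delta>" "jacobian_near X p (\<lambda>j q. value_at q (a j)) (\<lambda>q. \<chi> i j. value_at q (\<Delta> j (coord i)))"
proof -
  obtain \<Delta> where \<Delta>: "params_dual p a \<Delta>" and 
    n: "near X p (\<lambda>q. q \<in> X \<and> (\<forall>j. a j \<in> loc_ring {q}) \<and> params_dual q (\<lambda>j. a j - of_const (value_at q (a j))) \<Delta>)"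
    using lparams_dual[OF assms] by blast
  let ?x = "\<lambda>j q. value_at q (a j)" and ?J = "\<lambda>q. \<chi> i j. value_at q (\<Delta> j (coord i))"
  have "jacobian_near X p ?x ?J" unfolding jacobian_near_def
  proof (rule near_mono[OF n])
    fix q assume "q \<in> X \<and> (\<forall>j. a j \<in> loc_ring {q}) \<and> params_dual q (\<lambda>j. a j - of_const (value_at q (a j))) \<Delta>"
    then have q: "q \<in> X" and aq: "\<And>j. a j \<in> loc_ring {q}" and P: "params_dual q (\<lambda>j. a j - of_const (value_at q (a j))) \<Delta>" by blast+
    let ?A = "\<lambda>j. a j - of_const (value_at q (a j))"
    have qq: "primeset {q}" "{q} \<subseteq> X" using q by (auto simp: primeset_point)
    have rpA: "germ q (\<lambda>r. ?x j r - ?x j q) (?A j)" for j by (intro germ_diff germ_val germ_const q aq)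
    have L: "lparams q ?A" and dA: "dual ?A \<Delta>" and pr: "\<And>j r. r \<in> loc_ring {q} \<Longrightarrow> \<Delta> j r \<in> loc_ring {q}" using P by (auto simp: params_dual_def)
    have 1: "local_params X q (\<lambda>j r. ?x j r - ?x j q)" using lparams_iff[of q "\<lambda>j r. ?x j r - ?x j q" ?A, OF rpA] L by blast
    have AM: "?A j \<in> max_ideal {q}" for j by (rule valD[OF q aq])
    have 2: "in_max_ideal_square X q (\<lambda>r. fst r $ i - fst q $ i - (\<Sum>j\<in>UNIV. ?J q $ i $ j * (?x j r - ?x j q)))" for i
    proof -
      have "coord i - of_const (fst q $ i) \<in> max_ideal {q}" using valD[OF q loc_ring_rules(4)[OF qq]] by (simp add: val_coord[OF q])
      then obtain b where bL: "\<And>j. b j \<in> loc_ring {q}" and b: "coord i - of_const (fst q $ i) = (\<Sum>j\<in>UNIV. b j * ?A j)"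
        using L unfolding lparams_def by blast
      have vb: "value_at q (b l) = value_at q (\<Delta> l (coord i))" for l
      proof -
        have D: "is_deriv (\<Delta> l)" using dA by (simp add: dual_def)
        have \<Delta>A: "\<Delta> l (?A j) = (if j = l then 1 else 0)" for j using dA by (simp add: dual_def)
        have "\<Delta> l (coord i) = \<Delta> l (coord i - of_const (fst q $ i))" by (simp add: is_deriv_simps[OF D])
        also have "\<dots> = (\<Sum>j\<in>UNIV. \<Delta> l (b j) * ?A j + b j * \<Delta> l (?A j))"
          unfolding b by (simp only: is_deriv_sum[OF D] is_deriv_simps[OF D])
        also have "\<dots> = (\<Sum>j\<in>UNIV. \<Delta> l (b j) * ?A j + (if j = l then b j else 0))"
          unfolding \<Delta>A by (rule sum.cong) auto
        also have "\<dots> = (\<Sum>j\<in>UNIV. \<Delta> l (b j) * ?A j) + b l" by (simp add: sum.distrib)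
        finally have "\<Delta> l (coord i) - b l = (\<Sum>j\<in>UNIV. \<Delta> l (b j) * ?A j)" by simp
        moreover have "(\<Sum>j\<in>UNIV. \<Delta> l (b j) * ?A j) \<in> max_ideal {q}" by (intro max_ideal_sum[OF qq] max_ideal_mult_left[OF qq] AM pr bL)
        ultimately have "\<Delta> l (coord i) - b l \<in> max_ideal {q}" by simp
        then have "value_at q (\<Delta> l (coord i) - b l) = 0" using val_max_ideal[OF q loc_ring_diff[OF qq pr[OF loc_ring_rules(4)[OF qq]] bL]] by blast
        then show ?thesis using val_rules(4)[OF q pr[OF loc_ring_rules(4)[OF qq]] bL] by simp
      qed
      obtain enum :: "nat \<Rightarrow> 'n" and N where en: "bij_betw enum {..<N} UNIV"
        using ex_bij_betw_nat_finite[of "UNIV :: 'n set"] by (auto simp: atLeast0LessThan)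
      \<comment> \<open>What remains of the coordinate after its linear part is the sum of the
        \<open>(b j - b j (q)) * ?A j\<close>, with both factors in the maximal ideal.
        \<open>enum\<close> converts it to a sum over an initial segment of the natural
        numbers.\<close>
      let ?g = "\<lambda>k r. value_at r (b (enum k) - of_const (value_at q (b (enum k))))" and ?h = "\<lambda>k r. ?x (enum k) r - ?x (enum k) q"
      have bM: "b j - of_const (value_at q (b j)) \<in> max_ideal {q}" for j by (rule valD[OF q bL])
      have rg: "germ q (?g k) (b (enum k) - of_const (value_at q (b (enum k))))" for k by (rule germ_val[OF q max_ideal_loc_ring'[OF bM]])
      have "germ q (\<lambda>r. \<Sum>k<N. ?g k r * ?h k r) (\<Sum>k<N. (b (enum k) - of_const (value_at q (b (enum k)))) * ?A (enum k))"
        by (intro germ_sum germ_mult q rg rpA)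
      moreover have "(\<Sum>k<N. (b (enum k) - of_const (value_at q (b (enum k)))) * ?A (enum k)) = (\<Sum>j\<in>UNIV. (b j - of_const (value_at q (b j))) * ?A j)"
        by (rule sum.reindex_bij_betw[OF en])
      moreover have "(\<Sum>j\<in>UNIV. (b j - of_const (value_at q (b j))) * ?A j) = coord i - of_const (fst q $ i) - (\<Sum>j\<in>UNIV. of_const (?J q $ i $ j) * ?A j)"
        unfolding b by (simp add: vb left_diff_distrib sum_subtractf)
      ultimately have R1: "germ q (\<lambda>r. \<Sum>k<N. ?g k r * ?h k r) (coord i - of_const (fst q $ i) - (\<Sum>j\<in>UNIV. of_const (?J q $ i $ j) * ?A j))" by simp
      have rz: "germ q (\<lambda>r. fst r $ i) (coord i)" using germ_pullback[OF q, of "var i"] 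
        by (simp add: pullback_ev[abs_def] ev_var coord_def)
      have R2: "germ q (\<lambda>r. fst r $ i - fst q $ i - (\<Sum>j\<in>UNIV. ?J q $ i $ j * (?x j r - ?x j q))) (coord i - of_const (fst q $ i) - (\<Sum>j\<in>UNIV. of_const (?J q $ i $ j) * ?A j))"
        by (intro germ_diff germ_sum germ_mult germ_const rz rpA q)
      have "\<forall>k<N. regular_at X q (?g k) \<and> ?g k q = 0 \<and> regular_at X q (?h k) \<and> ?h k q = 0"
        using germ_regular[OF rg] germ_regular[OF rpA] val_max_ideal[OF q max_ideal_loc_ring'[OF bM]] bM by simp
      then show ?thesis unfolding in_max_ideal_square_def using germ_eq[OF R2 R1]
        by (intro exI[of _ N] exI[of _ ?g] exI[of _ ?h] conjI)
    qed
    show "local_params X q (\<lambda>j r. ?x j r - ?x j q) \<and> (\<forall>i. in_max_ideal_square X q (\<lambda>r. fst r $ i - fst q $ i - (\<Sum>j\<in>UNIV. ?J q $ i $ j * (?x j r - ?x j q))))"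
      using 1 2 by blast
  qed
  then show ?thesis using that \<Delta> by blast
qed

text \<open>A derivation preserving the local ring maps the square of the maximal ideal into the
  maximal ideal. Applied at each \<open>q\<close> near \<open>p\<close> to the congruence that
  defines the Jacobian, this shows that its entries are the values of the
  \<open>\<Delta> j (coord i)\<close>.\<close>

lemma jacobian_det:
  assumes J: "jacobian_near X p x J"
  obtains a \<Delta> where "params_dual p a \<Delta>" "germ p (\<lambda>q. det (J q)) (det (\<chi> i j. \<Delta> j (coord i)))"
proof -
  have p: "p \<in> X" using J near_mem unfolding jacobian_near_def by blast
  have pp: "primeset {p}" "{p} \<subseteq> X" using p by (auto simp: primeset_point)
  have Jn: "near X p (\<lambda>q. local_params X q (\<lambda>j r. x j r - x j q) \<and>
     (\<forall>i. in_max_ideal_square X q (\<lambda>r. fst r $ i - fst q $ i - (\<Sum>j\<in>UNIV. J q $ i $ j * (x j r - x j q)))))"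
    using J unfolding jacobian_near_def .
  obtain b where rb: "\<And>j. germ p (\<lambda>r. x j r - x j p) (b j)" and bL: "lparams p b"
    using local_paramsE[of p "\<lambda>j r. x j r - x j p"] near_at[OF Jn] p by blast
  obtain \<Delta> where \<Delta>: "params_dual p b \<Delta>" using lparams_dual[OF p bL] by blast
  then have db: "dual b \<Delta>" by (simp add: params_dual_def)
  have pr: "\<And>j r. r \<in> loc_ring {p} \<Longrightarrow> \<Delta> j r \<in> loc_ring {p}" using \<Delta> by (simp add: params_dual_def)
  have rx: "germ p (x j) (b j + of_const (x j p))" for j
    using germ_add[OF rb germ_const[OF p, of "x j p"], of j] by simp
  have n1: "near X p (\<lambda>q. \<forall>j. germ q (x j) (b j + of_const (x j p)))" by (intro near_all_finite[OF p] germ_near rx)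
  have zL: "\<Delta> l (coord i) \<in> loc_ring {p}" for l i by (rule pr[OF loc_ring_rules(4)[OF pp]])
  have n2: "near X p (\<lambda>q. \<forall>l i. q \<in> X \<and> \<Delta> l (coord i) \<in> loc_ring {q})" by (intro near_all_finite[OF p] near_loc_ring[OF p zL])
  have n: "near X p (\<lambda>q. \<forall>i l. \<Delta> l (coord i) \<in> loc_ring {q} \<and> J q $ i $ l = value_at q (\<Delta> l (coord i)))"
  proof (rule near_mono[OF near_conj[OF Jn near_conj[OF n1 n2]]])
    fix q assume q: "(local_params X q (\<lambda>j r. x j r - x j q) \<and>
     (\<forall>i. in_max_ideal_square X q (\<lambda>r. fst r $ i - fst q $ i - (\<Sum>j\<in>UNIV. J q $ i $ j * (x j r - x j q))))) \<and>
      (\<forall>j. germ q (x j) (b j + of_const (x j p))) \<and> (\<forall>l i. q \<in> X \<and> \<Delta> l (coord i) \<in> loc_ring {q})"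
    then have qX: "q \<in> X" and rq: "\<And>j. germ q (x j) (b j + of_const (x j p))" and zq: "\<And>l i. \<Delta> l (coord i) \<in> loc_ring {q}" by blast+
    have qq: "primeset {q}" "{q} \<subseteq> X" using qX by (auto simp: primeset_point)
    let ?A = "\<lambda>j. b j - of_const (x j q - x j p)"
    have rA: "germ q (\<lambda>r. x j r - x j q) (?A j)" for j
      using germ_diff[OF rq germ_const[OF qX, of "x j q"], of j] by (simp add: algebra_simps)
    have "lparams q ?A" using lparams_iff[of q "\<lambda>j r. x j r - x j q" ?A, OF rA] q by blast
    then obtain \<Delta>' where \<Delta>': "params_dual q ?A \<Delta>'" using lparams_dual[OF qX] by blast
    then have "dual ?A \<Delta>'" unfolding params_dual_def by blast
    then have "\<Delta> = \<Delta>'" by (rule dual_unique[OF db])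
    then have P: "params_dual q ?A \<Delta>" using \<Delta>' by simp
    have "J q $ i $ l = value_at q (\<Delta> l (coord i))" for i l
    proof -
      have D: "is_deriv (\<Delta> l)" and \<Delta>A: "\<Delta> l (?A j) = (if j = l then 1 else 0)" for j 
        using P by (auto simp: params_dual_def dual_def)
      obtain N g h where gh: "\<forall>k<(N::nat). regular_at X q (g k) \<and> g k q = 0 \<and> regular_at X q (h k) \<and> h k q = 0"
        and eq: "near X q (\<lambda>r. fst r $ i - fst q $ i - (\<Sum>j\<in>UNIV. J q $ i $ j * (x j r - x j q)) = (\<Sum>k<N. g k r * h k r))"
        using q unfolding in_max_ideal_square_def by blast
      have "\<forall>k\<in>{..<N}. \<exists>s t. germ q (g k) s \<and> germ q (h k) t" using gh regular_iff[OF qX] by blast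
      then obtain s t where st: "\<And>k. k < N \<Longrightarrow> germ q (g k) (s k) \<and> germ q (h k) (t k)" unfolding bchoice_iff by auto
      have M: "s k \<in> max_ideal {q}" "t k \<in> max_ideal {q}" if "k < N" for k
        using germD[of q "g k" "s k"] germD[of q "h k" "t k"] st[OF that] val_max_ideal[OF qX] gh that by auto
      have rz: "germ q (\<lambda>r. fst r $ i) (coord i)" using germ_pullback[OF qX, of "var i"] 
        by (simp add: pullback_ev[abs_def] ev_var coord_def)
      have R1: "germ q (\<lambda>r. \<Sum>k<N. g k r * h k r) (\<Sum>k<N. s k * t k)" by (intro germ_sum germ_mult qX) (use st in auto)
      have R2: "germ q (\<lambda>r. fst r $ i - fst q $ i - (\<Sum>j\<in>UNIV. J q $ i $ j * (x j r - x j q))) (coord i - of_const (fst q $ i) - (\<Sum>j\<in>UNIV. of_const (J q $ i $ j) * ?A j))"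
        by (intro germ_diff germ_sum germ_mult germ_const rz rA qX)
      have e: "coord i - of_const (fst q $ i) - (\<Sum>j\<in>UNIV. of_const (J q $ i $ j) * ?A j) = (\<Sum>k<N. s k * t k)"
        by (rule germ_unique[OF germ_cong[OF R2 eq] R1])
      have "\<Delta> l (\<Sum>j\<in>UNIV. of_const (J q $ i $ j) * ?A j) = (\<Sum>j\<in>UNIV. of_const (J q $ i $ j) * \<Delta> l (?A j))"
        by (simp only: is_deriv_sum[OF D] is_deriv_simps[OF D] mult_zero_left add_0)
      also have "\<dots> = (\<Sum>j\<in>UNIV. if j = l then of_const (J q $ i $ j) else 0)" unfolding \<Delta>A by (rule sum.cong) auto
      also have "\<dots> = of_const (J q $ i $ l)" by simp
      finally have "\<Delta> l (coord i) - of_const (J q $ i $ l) = \<Delta> l (coord i - of_const (fst q $ i) - (\<Sum>j\<in>UNIV. of_const (J q $ i $ j) * ?A j))"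
        by (simp add: is_deriv_simps[OF D])
      also have "\<dots> = (\<Sum>k<N. \<Delta> l (s k * t k))" unfolding e by (rule is_deriv_sum[OF D])
      also have "\<dots> \<in> max_ideal {q}" by (intro max_ideal_sum[OF qq] params_dual_deriv_max_ideal[OF qX P] M) auto
      finally show ?thesis using valI[OF qX] by metis
    qed
    then show "\<forall>i l. \<Delta> l (coord i) \<in> loc_ring {q} \<and> J q $ i $ l = value_at q (\<Delta> l (coord i))" using zq by blast
  qed
  have "germ p (\<lambda>q. det (J q)) (det (\<chi> i j. \<Delta> j (coord i)))"
  proof (rule germ_det[OF p])
    fix i j
    have "germ p (\<lambda>q. J q $ i $ j) (\<Delta> j (coord i))" unfolding germ_def by (rule near_mono[OF n]) blast
    then show "germ p (\<lambda>q. J q $ i $ j) ((\<chi> i j. \<Delta> j (coord i)) $ i $ j)" by simp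
  qed
  then show ?thesis using that \<Delta> by blast
qed

text \<open>The local ring along \<open>E\<close> consists of fractions of elements of the local
  ring at \<open>p\<close>, so the quotient rule applies.\<close>

lemma params_dual_loc_ring:
  assumes E: "primeset E" "E \<subseteq> X" "p \<in> E" and P: "params_dual p a \<Delta>" and r: "r \<in> loc_ring E"
  shows "\<Delta> j r \<in> loc_ring E"
proof -
  have p: "p \<in> X" using E by blast
  have D: "is_deriv (\<Delta> j)" and pr: "\<And>r. r \<in> loc_ring {p} \<Longrightarrow> \<Delta> j r \<in> loc_ring {p}" using P by (auto simp: params_dual_def dual_def)
  obtain k where k: "rep_proj (snd p) $ k \<noteq> 0" using chart_exists by blast
  obtain d P Q where 1: "hom d P" "hom d Q" "nonvan E Q" "r = hat P / hat Q" using r by (auto elim: loc_ring_E)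
  \<comment> \<open>A power of a homogeneous coordinate that is nonzero at \<open>p\<close>, of the
    degree of \<open>P\<close> and \<open>Q\<close>; dividing both by it makes them regular at
    \<open>p\<close>.\<close>
  let ?S = "var (Inr k) ^ d"
  have S: "hom d ?S" "pval ?S p \<noteq> 0" using hom_power[OF hom_Inr, of d k] k by (auto simp: pval_simps)
  have "hat ?S \<noteq> 0" by (rule hat_nz[of "{p}" d]) (use S p in auto)
  let ?s = "hat P / hat ?S" and ?t = "hat Q / hat ?S"
  have st: "?s \<in> loc_ring {p}" "?t \<in> loc_ring {p}" using loc_ring_I[of d _ ?S "{p}"] 1 S by auto
  have sub: "loc_ring {p} \<subseteq> loc_ring E" using E by (intro loc_ring_mono) auto
  have nS: "nonvan E ?S" using S E by (auto simp: nonvan_def)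
  have tM: "?t \<notin> max_ideal E" using max_ideal_iff[OF E(1,2) 1(2) S(1) nS] 1(3) by simp
  then have t0: "?t \<noteq> 0" using max_ideal_0[OF E(1,2)] by metis
  have L: "?s \<in> loc_ring E" "?t \<in> loc_ring E" "\<Delta> j ?s \<in> loc_ring E" "\<Delta> j ?t \<in> loc_ring E" using st pr sub by blast+
  have "r = ?s / ?t" using 1(4) \<open>hat ?S \<noteq> 0\<close> by simp
  then have "\<Delta> j r = (\<Delta> j ?s * ?t - ?s * \<Delta> j ?t) / (?t * ?t)"
    using is_deriv_div[OF D t0, of ?s] by (simp only: power2_eq_square)
  moreover have "?t * ?t \<notin> max_ideal E" using loc_ring_rules(9)[OF E(1,2) L(2) L(2)] tM by blast
  ultimately show ?thesis
    using loc_ring_inverse_mult[OF E(1,2) loc_ring_diff[OF E(1,2) loc_ring_rules(2)[OF E(1,2) L(3,2)] loc_ring_rules(2)[OF E(1,2) L(1,4)]] loc_ring_rules(2)[OF E(1,2) L(2,2)]] by simp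
qed

end

section \<open>Orders along prime divisors\<close>

text \<open>At a general point of \<open>E\<close> the divisor is a coordinate hyperplane. The
  exceptional set \<open>C\<close> is merely a proper closed part, so a good point exists inside any
  open set that meets \<open>E\<close>; orders defined at unrelated points are compared
  there.\<close>

definition gooddiv :: "('n::finite, 'm::finite) pt set \<Rightarrow> ('n, 'm) pt set \<Rightarrow> bool" where
  "gooddiv X E \<longleftrightarrow> (\<exists>C. zclosed C \<and> \<not> E \<subseteq> C \<and>
     (\<forall>p\<in>E - C. \<exists>x j. local_params X p x \<and> local_equation X E p (x j)))"

lemma prime_divisorD: "prime_divisor X E \<Longrightarrow> irreducible_closed E" "prime_divisor X E \<Longrightarrow> E \<subseteq> X"
  "prime_divisor X E \<Longrightarrow> E \<noteq> X"
  by (auto simp: prime_divisor_def)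

lemma irreducible_closedD: "irreducible_closed E \<Longrightarrow> zclosed E" "irreducible_closed E \<Longrightarrow> E \<noteq> {}"
  by (auto simp: irreducible_closed_def)

context bir
begin

text \<open>The last clause makes the local ring along \<open>E\<close> a discrete valuation ring with uniformizer \<open>\<pi>\<close>.\<close>

definition unif :: "('n, 'm) pt set \<Rightarrow> 'n ratfun \<Rightarrow> bool" where
  "unif E \<pi> \<longleftrightarrow> \<pi> \<in> max_ideal E \<and> \<pi> \<noteq> 0 \<and> (\<forall>r\<in>max_ideal E. \<exists>h\<in>loc_ring E. r = \<pi> * h) \<and>
     (\<forall>r\<in>loc_ring E. r \<noteq> 0 \<longrightarrow> (\<exists>k h. h \<in> loc_ring E \<and> h \<notin> max_ideal E \<and> r = \<pi> ^ k * h))"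

text \<open>A function vanishing on \<open>E\<close> need not be regular at \<open>p\<close>, but
  becomes so after multiplication by a unit of the local ring along \<open>E\<close>.\<close>

lemma loceq_generates:
  assumes E: "irreducible_closed E" "E \<subseteq> X" "p \<in> E" and e: "loceq E p e" and r: "r \<in> max_ideal E"
  shows "\<exists>h\<in>loc_ring E. r = e * h"
proof -
  note pE = irreducible_primeset[OF E(1)]
  have p: "p \<in> X" using E by blast
  obtain k where k: "rep_proj (snd p) $ k \<noteq> 0" using chart_exists by blast
  obtain d P Q where 1: "hom d P" "hom d Q" "nonvan E Q" "\<not> nonvan E P" "r = hat P / hat Q" using r by (auto simp: max_ideal_def)
  let ?S = "var (Inr k) ^ d"
  have S: "hom d ?S" "pval ?S p \<noteq> 0" using hom_power[OF hom_Inr, of d k] k by (auto simp: pval_simps)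
  have S0: "hat ?S \<noteq> 0" by (rule hat_nz[of "{p}" d]) (use S p in auto)
  have nS: "nonvan E ?S" using S E by (auto simp: nonvan_def)
  have "hat P / hat ?S \<in> loc_ring {p}" "hat P / hat ?S \<in> max_ideal E" using loc_ring_I[of d P ?S "{p}"] max_ideal_I[of d P ?S E] 1 S nS by auto
  then obtain h where h: "h \<in> loc_ring {p}" "hat P / hat ?S = e * h" using e unfolding loceq_def by blast
  have "r = hat P / hat ?S * (hat ?S / hat Q)" using 1(5) S0 by simp
  then have "r = e * (h * (hat ?S / hat Q))" by (simp only: h(2) mult.assoc)
  moreover have "h \<in> loc_ring E" using h(1) loc_ring_mono[of "{p}" E] E by blast
  moreover have "hat ?S / hat Q \<in> loc_ring E" using loc_ring_I[of d ?S Q E] 1 S by blast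
  ultimately show ?thesis using loc_ring_rules(2)[OF pE E(2)] by blast
qed

lemma max_ideal_nontrivial:
  assumes E: "irreducible_closed E" "E \<subseteq> X" "E \<noteq> X" shows "\<exists>r\<in>max_ideal E. r \<noteq> 0"
proof -
  obtain q where q: "q \<in> X" "q \<notin> E" using E by blast
  obtain d P where P: "hom d P" "pval P q \<noteq> 0" "\<And>p. p \<in> E \<Longrightarrow> pval P p = 0"
    using zclosed_separate[OF irreducible_closedD(1)[OF E(1)] q(2)] by blast
  obtain p where p: "p \<in> E" using irreducible_closedD(2)[OF E(1)] by blast
  obtain k where k: "rep_proj (snd p) $ k \<noteq> 0" using chart_exists by blast
  let ?S = "var (Inr k) ^ d"
  have S: "hom d ?S" "pval ?S p \<noteq> 0" using hom_power[OF hom_Inr, of d k] k by (auto simp: pval_simps)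
  have nS: "nonvan E ?S" using S p by (auto simp: nonvan_def)
  have "hat P / hat ?S \<in> max_ideal E" using max_ideal_I[of d P ?S E] P S nS by (auto simp: nonvan_def)
  moreover have "hat P \<noteq> 0" by (rule hat_nz[of "{q}" d]) (use P q in auto)
  moreover have "hat ?S \<noteq> 0" by (rule hat_nz[of "{p}" d]) (use S p E in auto)
  ultimately show ?thesis by (intro bexI[of _ "hat P / hat ?S"]) auto
qed

text \<open>Krull's intersection theorem for the local ring of a divisor: the elements divisible by all
  powers of the uniformizer form an ideal stable under the derivations dual to the local
  parameters, hence it contains no nonzero polynomial in the parameters.\<close>

lemma unif_exists:
  assumes E: "irreducible_closed E" "E \<subseteq> X" "E \<noteq> X" "p \<in> E" and P: "params_dual p a \<Delta>" and e: "loceq E p (a j0)"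
  shows "unif E (a j0)"
proof -
  note pE = irreducible_primeset[OF E(1)]
  let ?\<pi> = "a j0"
  have p: "p \<in> X" using E by blast
  have L: "lparams p a" and db: "dual a \<Delta>" using P by (auto simp: params_dual_def)
  have D: "is_deriv (\<Delta> j)" and \<Delta>a: "\<Delta> j (a l) = (if l = j then 1 else 0)" for j l using db by (auto simp: dual_def)
  have \<pi>M: "?\<pi> \<in> max_ideal E" using e by (simp add: loceq_def)
  then have \<pi>L: "?\<pi> \<in> loc_ring E" by (rule max_ideal_loc_ring')
  have gen: "\<And>r. r \<in> max_ideal E \<Longrightarrow> \<exists>h\<in>loc_ring E. r = ?\<pi> * h" using loceq_generates[OF E(1,2,4) e] by blast
  have \<pi>0: "?\<pi> \<noteq> 0" using gen max_ideal_nontrivial[OF E(1-3)] by force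
  have aL: "a j \<in> loc_ring E" for j
  proof -
    have "a j \<in> loc_ring {p}" using L max_ideal_loc_ring' by (auto simp: lparams_def)
    then show ?thesis using loc_ring_mono[of "{p}" E] E by blast
  qed
  \<comment> \<open>The intersection of the powers of the ideal of \<open>E\<close>, which is to be
    shown zero.\<close>
  define qq where "qq = {r\<in>loc_ring E. \<forall>k. \<exists>h\<in>loc_ring E. r = ?\<pi> ^ k * h}"
  have qq0: "0 \<in> qq" using loc_ring_0[OF pE E(2)] by (auto simp: qq_def)
  have qqm: "r * s \<in> qq" if r: "r \<in> qq" and s: "s \<in> loc_ring E" for r s
  proof -
    have "\<exists>h\<in>loc_ring E. r * s = ?\<pi> ^ k * h" for k
    proof -
      obtain h where h: "h \<in> loc_ring E" "r = ?\<pi> ^ k * h" using r unfolding qq_def by blast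
      have "r * s = ?\<pi> ^ k * (h * s)" by (simp only: h(2) mult.assoc)
      moreover have "h * s \<in> loc_ring E" by (rule loc_ring_rules(2)[OF pE E(2) h(1) s])
      ultimately show ?thesis by blast
    qed
    then show ?thesis using r s loc_ring_rules(2)[OF pE E(2)] by (simp add: qq_def)
  qed
  have qqD: "\<Delta> j r \<in> qq" if r: "r \<in> qq" for r j
  proof -
    have "\<exists>h\<in>loc_ring E. \<Delta> j r = ?\<pi> ^ k * h" for k
    proof -
      \<comment> \<open>Differentiation costs one power of the uniformizer, so divisibility by the
        power \<open>Suc k\<close> is used to get the power \<open>k\<close>.\<close>
      obtain h where h: "h \<in> loc_ring E" "r = ?\<pi> ^ Suc k * h" using r unfolding qq_def by blast
      have "\<Delta> j r = ?\<pi> ^ k * (of_nat (Suc k) * \<Delta> j ?\<pi> * h + ?\<pi> * \<Delta> j h)"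
        unfolding h(2) is_deriv_simps(2)[OF D] is_deriv_power[OF D] by (simp add: algebra_simps)
      moreover have "of_nat (Suc k) \<in> loc_ring E" using loc_ring_rules(3)[OF pE E(2), of "of_int (int (Suc k))"] unfolding rhom_of_int[OF rhom_of_const] by simp
      moreover have "\<Delta> j h \<in> loc_ring E" "\<Delta> j ?\<pi> \<in> loc_ring E" using params_dual_loc_ring[OF pE E(2,4) P] h(1) \<pi>L by blast+
      ultimately show ?thesis 
        by (intro bexI[of _ "of_nat (Suc k) * \<Delta> j ?\<pi> * h + ?\<pi> * \<Delta> j h"] loc_ring_rules(1,2)[OF pE E(2)] h(1) \<pi>L)
    qed
    moreover have "\<Delta> j r \<in> loc_ring E" using params_dual_loc_ring[OF pE E(2,4) P] r by (simp add: qq_def)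
    ultimately show ?thesis by (simp add: qq_def)
  qed
  have qqc: "c = 0" if "of_const c \<in> qq" for c
  proof -
    have "\<forall>k. \<exists>h\<in>loc_ring E. of_const c = ?\<pi> ^ k * h" using that by (simp add: qq_def)
    then obtain h where "h \<in> loc_ring E" "of_const c = ?\<pi> ^ 1 * h" by blast
    then have "of_const c \<in> max_ideal E" using loc_ring_rules(6)[OF pE E(2) \<pi>M] by simp
    then show ?thesis using max_ideal_of_const[OF pE E(2)] by blast
  qed
  have qq_triv: "r = 0" if r: "r \<in> qq" for r
  proof (rule ccontr)
    assume r0: "r \<noteq> 0"
    let ?y = "case_option r a"
    have yL: "?y v \<in> loc_ring E" for v using r aL by (auto simp: qq_def split: option.splits)
    \<comment> \<open>A nonzero \<open>r\<close> in \<open>qq\<close> and the n parameters are n + 1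
      algebraically dependent elements. Cancelling powers of \<open>r\<close> yields a nonzero
      polynomial in the parameters alone whose value is a multiple of \<open>r\<close>, hence lies
      in \<open>qq\<close>.\<close>
    obtain R where R: "R \<noteq> 0" "heval of_const ?y R = 0" using alg_dependent by blast
    obtain k R1 R2 where R12: "R = var None ^ k * (R1 + var None * R2)" "R1 \<noteq> 0" "novar None R1"
      using divide_var[OF R(1), of None] by blast
    have "r ^ k * (heval of_const ?y R1 + r * heval of_const ?y R2) = 0"
      using R(2) unfolding R12(1) by (simp add: hk_simps)
    then have "heval of_const ?y R1 = r * (- heval of_const ?y R2)" using r0 by (simp add: add_eq_0_iff2)
    then have R1q: "heval of_const ?y R1 \<in> qq" using qqm[OF r loc_ring_uminus[OF pE E(2) loc_ring_heval[OF pE E(2) yL]]] by simp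
    \<comment> \<open>Stable under partial derivatives because \<open>\<Delta> j\<close>, applied to
      a polynomial in the parameters, differentiates it formally; so \<open>qq\<close> would contain
      a nonzero constant, although its elements vanish on \<open>E\<close>.\<close>
    define I where "I = {R. novar None R \<and> heval of_const ?y R \<in> qq}"
    have "\<exists>c. c \<noteq> 0 \<and> Cst c \<in> I"
    proof (rule pd_closed_const)
      show "R1 \<in> I" using R12 R1q by (simp add: I_def)
      show "R1 \<noteq> 0" by fact
      fix S v assume S: "S \<in> I"
      have pn: "pd None S = 0"
      proof (rule poly_mapping_eqI)
        fix m
        have "m + Poly_Mapping.single None 1 \<notin> keys S" using S by (auto simp: I_def novar_def lookup_add)
        then show "lookup (pd None S) m = lookup 0 m" by (simp add: lookup_pd in_keys_iff)
      qed
      have "novar None (pd v S)" unfolding novar_def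
      proof
        fix m assume "m \<in> keys (pd v S)"
        then have "m + Poly_Mapping.single v 1 \<in> keys S" by (auto simp: in_keys_iff lookup_pd)
        then have "lookup (m + Poly_Mapping.single v 1) None = 0" using S by (auto simp: I_def novar_def)
        then show "lookup m None = 0" by (simp add: lookup_add)
      qed
      moreover have "heval of_const ?y (pd v S) \<in> qq"
      proof (cases v)
        case None then show ?thesis using pn qq0 by simp
      next
        case (Some j)
        have "\<Delta> j (heval of_const ?y S) = (\<Sum>w\<in>UNIV. heval of_const ?y (pd w S) * \<Delta> j (?y w))" by (rule is_deriv_heval[OF D])
        also have "\<dots> = (\<Sum>w\<in>UNIV. if w = Some j then heval of_const ?y (pd w S) else 0)"
          by (rule sum.cong) (auto simp: pn \<Delta>a split: option.splits)
        finally have "\<Delta> j (heval of_const ?y S) = heval of_const ?y (pd v S)" using Some by simp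
        then show ?thesis using qqD[of "heval of_const ?y S" j] S by (simp add: I_def)
      qed
      ultimately show "pd v S \<in> I" by (simp add: I_def)
    qed
    then obtain c where "c \<noteq> 0" "of_const c \<in> qq" unfolding I_def by (auto simp: hk_simps)
    then show False using qqc by blast
  qed
  have "\<exists>k h. h \<in> loc_ring E \<and> h \<notin> max_ideal E \<and> r = ?\<pi> ^ k * h" if r: "r \<in> loc_ring E" "r \<noteq> 0" for r
  proof -
    have "\<exists>k. \<not> (\<exists>h\<in>loc_ring E. r = ?\<pi> ^ k * h)" using qq_triv[of r] r by (auto simp: qq_def)
    then obtain k where k: "\<not> (\<exists>h\<in>loc_ring E. r = ?\<pi> ^ k * h)" "\<And>l. l < k \<Longrightarrow> \<exists>h\<in>loc_ring E. r = ?\<pi> ^ l * h"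
      using exists_least_iff[of "\<lambda>k. \<not> (\<exists>h\<in>loc_ring E. r = ?\<pi> ^ k * h)"] by blast
    have "k \<noteq> 0" using k(1) r by (intro notI) auto
    then obtain l where l: "k = Suc l" by (cases k) auto
    obtain h where h: "h \<in> loc_ring E" "r = ?\<pi> ^ l * h" using k(2)[of l] l by blast
    have "h \<notin> max_ideal E"
    proof
      assume "h \<in> max_ideal E"
      then obtain h' where "h' \<in> loc_ring E" "h = ?\<pi> * h'" using gen by blast
      then show False using k(1) h l by (auto simp: mult_ac)
    qed
    then show ?thesis using h by blast
  qed
  then show ?thesis using \<pi>M \<pi>0 gen unfolding unif_def by blast
qed

section \<open>Orders of rational functions along a divisor\<close>

definition has_order :: "('n, 'm) pt set \<Rightarrow> nat \<Rightarrow> 'n ratfun \<Rightarrow> bool" where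
  "has_order E k r \<longleftrightarrow> (\<exists>\<pi> h. unif E \<pi> \<and> h \<in> loc_ring E \<and> h \<notin> max_ideal E \<and> r = \<pi> ^ k * h)"

lemma unit_mult: "primeset E \<Longrightarrow> E \<subseteq> X \<Longrightarrow> h \<in> loc_ring E \<Longrightarrow> h \<notin> max_ideal E \<Longrightarrow> h' \<in> loc_ring E \<Longrightarrow> h' \<notin> max_ideal E \<Longrightarrow> h * h' \<notin> max_ideal E"
  using loc_ring_rules(9) by blast

lemma unit_power: "primeset E \<Longrightarrow> E \<subseteq> X \<Longrightarrow> h \<in> loc_ring E \<Longrightarrow> h \<notin> max_ideal E \<Longrightarrow> h ^ k \<notin> max_ideal E"
proof (induction k)
  case (Suc k)
  then show ?case using unit_mult[of E h "h ^ k"] loc_ring_power[of E h k] by simp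
qed (simp add: loc_ring_rules(8))

lemma gen_assoc:
  assumes E: "primeset E" "E \<subseteq> X" and e: "e \<in> max_ideal E" "\<And>r. r \<in> max_ideal E \<Longrightarrow> \<exists>h\<in>loc_ring E. r = e * h"
    and f: "e' \<in> max_ideal E" "\<And>r. r \<in> max_ideal E \<Longrightarrow> \<exists>h\<in>loc_ring E. r = e' * h" and nz: "e \<noteq> 0"
  shows "\<exists>h\<in>loc_ring E. h \<notin> max_ideal E \<and> e' = e * h"
proof -
  obtain h where h: "h \<in> loc_ring E" "e' = e * h" using e(2) f(1) by blast
  obtain h' where h': "h' \<in> loc_ring E" "e = e' * h'" using f(2) e(1) by blast
  have "e * (h * h') = e * 1" using h h' by (simp add: mult.assoc[symmetric])
  then have "h * h' = 1" using nz by (simp only: mult_left_cancel simp_thms)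
  then have "h \<notin> max_ideal E" using loc_ring_rules(6)[OF E, of h h'] loc_ring_rules(8)[OF E] h' by auto
  then show ?thesis using h by blast
qed

lemma order_unique:
  assumes E: "primeset E" "E \<subseteq> X" and e: "e \<in> max_ideal E" "e \<noteq> 0" and h: "h \<in> loc_ring E" "h \<notin> max_ideal E" "h' \<in> loc_ring E" "h' \<notin> max_ideal E"
    and eq: "e ^ k * h = e ^ l * h'"
  shows "k = l"
proof -
  have *: False if "k < l" "h \<notin> max_ideal E" "h' \<in> loc_ring E" "e ^ k * h = e ^ l * h'" for k l h h'
  proof -
    have "\<exists>d. l = k + Suc d" using that(1) by (auto simp: less_iff_Suc_add)
    then obtain d where d: "l = k + Suc d" by blast
    have "e ^ k * h = e ^ k * (e * (e ^ d * h'))" using that(4) by (simp add: d power_add mult_ac)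
    then have "h = e * (e ^ d * h')" using e(2) by simp
    moreover have "e ^ d * h' \<in> loc_ring E" using that(3) loc_ring_power[OF E max_ideal_loc_ring'[OF e(1)]] loc_ring_rules(2)[OF E] by blast
    ultimately show False using that(2) loc_ring_rules(6)[OF E e(1)] by simp
  qed
  show ?thesis using *[of k l h h'] *[of l k h' h] h eq by (metis linorder_neqE_nat)
qed

lemma has_order_unif:
  assumes E: "primeset E" "E \<subseteq> X" and "has_order E k r" and \<pi>: "\<pi> \<in> max_ideal E" "\<pi> \<noteq> 0" "\<And>r. r \<in> max_ideal E \<Longrightarrow> \<exists>h\<in>loc_ring E. r = \<pi> * h" 
  shows "\<exists>h\<in>loc_ring E. h \<notin> max_ideal E \<and> r = \<pi> ^ k * h"
proof -
  obtain \<pi>' h where h: "unif E \<pi>'" "h \<in> loc_ring E" "h \<notin> max_ideal E" "r = \<pi>' ^ k * h" using assms(3) unfolding has_order_def by blast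
  obtain u where u: "u \<in> loc_ring E" "u \<notin> max_ideal E" "\<pi>' = \<pi> * u"
    using gen_assoc[OF E \<pi>(1,3), of \<pi>'] h(1) \<pi>(2) unfolding unif_def by blast
  have "r = \<pi> ^ k * (u ^ k * h)" using h(4) u(3) by (simp add: power_mult_distrib mult_ac)
  moreover have "u ^ k * h \<in> loc_ring E" "u ^ k * h \<notin> max_ideal E"
    using u h loc_ring_rules(2)[OF E] loc_ring_power[OF E] unit_mult[OF E] unit_power[OF E] by auto
  ultimately show ?thesis by blast
qed

lemma has_order_unique:
  assumes E: "primeset E" "E \<subseteq> X" and "has_order E k r" "has_order E l r" shows "k = l"
proof -
  obtain \<pi> h where h: "unif E \<pi>" "h \<in> loc_ring E" "h \<notin> max_ideal E" "r = \<pi> ^ k * h" using assms(3) unfolding has_order_def by blast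
  obtain h' where "h' \<in> loc_ring E" "h' \<notin> max_ideal E" "r = \<pi> ^ l * h'" 
    using has_order_unif[OF E assms(4), of \<pi>] h(1) unfolding unif_def by blast
  then show ?thesis using order_unique[OF E, of \<pi> h h' k l] h unfolding unif_def by auto
qed

lemma has_order_exists: "unif E \<pi> \<Longrightarrow> r \<in> loc_ring E \<Longrightarrow> r \<noteq> 0 \<Longrightarrow> \<exists>k. has_order E k r"
  unfolding has_order_def unif_def by blast

lemma has_order_nz:
  assumes "primeset E" "E \<subseteq> X" "has_order E k r" shows "r \<noteq> 0" "r \<in> loc_ring E"
proof -
  obtain \<pi> h where h: "unif E \<pi>" "h \<in> loc_ring E" "h \<notin> max_ideal E" "r = \<pi> ^ k * h" using assms(3) unfolding has_order_def by blast
  have "h \<noteq> 0" using h max_ideal_0 assms by auto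
  then show "r \<noteq> 0" using h by (auto simp: unif_def)
  show "r \<in> loc_ring E" using h loc_ring_rules(2)[OF assms(1,2)] loc_ring_power[OF assms(1,2)] max_ideal_loc_ring' unfolding unif_def by auto
qed

lemma has_order_mult:
  assumes E: "primeset E" "E \<subseteq> X" and "has_order E k r" "has_order E l s" shows "has_order E (k + l) (r * s)"
proof -
  obtain \<pi> h where h: "unif E \<pi>" "h \<in> loc_ring E" "h \<notin> max_ideal E" "r = \<pi> ^ k * h" using assms(3) unfolding has_order_def by blast
  obtain h' where h': "h' \<in> loc_ring E" "h' \<notin> max_ideal E" "s = \<pi> ^ l * h'" 
    using has_order_unif[OF E assms(4), of \<pi>] h(1) unfolding unif_def by blast
  have "r * s = \<pi> ^ (k + l) * (h * h')" using h h' by (simp add: power_add mult_ac)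
  moreover have "h * h' \<in> loc_ring E" "h * h' \<notin> max_ideal E" using loc_ring_rules(2)[OF E] unit_mult[OF E] h h' by auto
  ultimately show ?thesis using h(1) unfolding has_order_def by blast
qed

lemma has_order_unit: "unif E \<pi> \<Longrightarrow> h \<in> loc_ring E \<Longrightarrow> h \<notin> max_ideal E \<Longrightarrow> has_order E 0 h"
  unfolding has_order_def by (intro exI[of _ \<pi>] exI[of _ h]) auto

lemma has_order_power: 
  assumes E: "primeset E" "E \<subseteq> X" and "has_order E k r" shows "has_order E (n * k) (r ^ n)"
proof (induction n)
  case 0
  obtain \<pi> where "unif E \<pi>" using assms unfolding has_order_def by blast
  then show ?case using has_order_unit[of E \<pi> 1] loc_ring_1[OF E] loc_ring_rules(8)[OF E] by simp
next
  case (Suc n) then show ?case using has_order_mult[OF E assms(3) Suc] by simp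
qed

lemma has_order_prod:
  assumes E: "primeset E" "E \<subseteq> X" and "unif E \<pi>" and "\<And>i. i \<in> I \<Longrightarrow> has_order E (k i) (r i)" shows "has_order E (sum k I) (prod r I)"
  using assms(4)
proof (induction I rule: infinite_finite_induct)
  case (insert x F) then show ?case using has_order_mult[OF E] by simp
qed (use has_order_unit[OF assms(3), of 1] loc_ring_1[OF E] loc_ring_rules(8)[OF E] in auto)

lemma has_order_le:
  assumes E: "primeset E" "E \<subseteq> X" and "has_order E k r" "s \<in> loc_ring E" "has_order E l (r * s)" shows "k \<le> l"
proof -
  obtain \<pi> h where h: "unif E \<pi>" using assms(3) unfolding has_order_def by blast
  have "s \<noteq> 0" using has_order_nz[OF E assms(5)] by auto
  then obtain m where "has_order E m s" using has_order_exists[OF h assms(4)] by blast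
  then have "has_order E (k + m) (r * s)" by (rule has_order_mult[OF E assms(3)])
  then show ?thesis using has_order_unique[OF E assms(5)] by auto
qed

lemma has_order_pos: "primeset E \<Longrightarrow> E \<subseteq> X \<Longrightarrow> has_order E k r \<Longrightarrow> r \<in> max_ideal E \<longleftrightarrow> 0 < k"
proof -
  assume E: "primeset E" "E \<subseteq> X" and k: "has_order E k r"
  obtain \<pi> h where h: "unif E \<pi>" "h \<in> loc_ring E" "h \<notin> max_ideal E" "r = \<pi> ^ k * h" using k unfolding has_order_def by blast
  show ?thesis
  proof (cases k)
    case 0 then show ?thesis using h by simp
  next
    case (Suc l)
    have "\<pi> \<in> max_ideal E" using h by (simp add: unif_def)
    then have "\<pi> * (\<pi> ^ l * h) \<in> max_ideal E" using h loc_ring_rules(2,6)[OF E] loc_ring_power[OF E] max_ideal_loc_ring' by auto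
    then show ?thesis using h(4) Suc by (simp add: mult.assoc)
  qed
qed

lemma has_order_sum_ge:
  assumes E: "primeset E" "E \<subseteq> X" "unif E \<pi>" and "\<And>i. i \<in> I \<Longrightarrow> r i = 0 \<or> (\<exists>l\<ge>k. has_order E l (r i))" 
   and s: "has_order E n (sum r I)"
  shows "k \<le> n"
proof -
  have \<pi>: "\<pi> \<in> max_ideal E" "\<pi> \<noteq> 0" "\<And>r. r \<in> max_ideal E \<Longrightarrow> \<exists>h\<in>loc_ring E. r = \<pi> * h" using E(3) by (auto simp: unif_def)
  have "\<forall>i\<in>I. \<exists>h\<in>loc_ring E. r i = \<pi> ^ k * h"
  proof
    fix i assume "i \<in> I"
    from assms(4)[OF this] show "\<exists>h\<in>loc_ring E. r i = \<pi> ^ k * h"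
    proof
      assume "r i = 0" then show ?thesis using loc_ring_0[OF E(1,2)] by auto
    next
      assume "\<exists>l\<ge>k. has_order E l (r i)"
      then obtain l where l: "l \<ge> k" "has_order E l (r i)" by blast
      obtain h where h: "h \<in> loc_ring E" "r i = \<pi> ^ l * h" using has_order_unif[OF E(1,2) l(2) \<pi>] by blast
      have "r i = \<pi> ^ k * (\<pi> ^ (l - k) * h)" using h(2) l(1) by (simp add: mult.assoc[symmetric] flip: power_add)
      moreover have "\<pi> ^ (l - k) * h \<in> loc_ring E" using h loc_ring_rules(2)[OF E(1,2)] loc_ring_power[OF E(1,2) max_ideal_loc_ring'[OF \<pi>(1)]] by blast
      ultimately show ?thesis by blast
    qed
  qed
  then obtain h where h: "\<And>i. i \<in> I \<Longrightarrow> h i \<in> loc_ring E \<and> r i = \<pi> ^ k * h i" by metis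
  then have "sum r I = \<pi> ^ k * sum h I" by (simp add: sum_distrib_left)
  moreover have "sum h I \<in> loc_ring E" using h by (intro loc_ring_sum[OF E(1,2)]) auto
  moreover have "has_order E k (\<pi> ^ k)" unfolding has_order_def 
    using E(3) loc_ring_1[OF E(1,2)] loc_ring_rules(8)[OF E(1,2)] by (intro exI[of _ \<pi>] exI[of _ 1]) auto
  ultimately show ?thesis using has_order_le[OF E(1,2)] s by metis
qed

section \<open>The multiplicities of the definitions as orders in the local ring along the
  divisor\<close>

lemma gooddivE:
  assumes E: "irreducible_closed E" "E \<subseteq> X" and g: "gooddiv X E" and C': "zclosed C'" "\<not> E \<subseteq> C'"
  obtains p a j where "p \<in> E" "p \<notin> C'" "lparams p a" "loceq E p (a j)"
proof -
  obtain C where C: "zclosed C" "\<not> E \<subseteq> C" "\<And>p. p \<in> E - C \<Longrightarrow> \<exists>x j. local_params X p x \<and> local_equation X E p (x j)"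
    using g unfolding gooddiv_def by blast
  have "\<not> E \<subseteq> C \<union> C'" using E(1) C C' unfolding irreducible_closed_def by blast
  then obtain p where p: "p \<in> E" "p \<notin> C" "p \<notin> C'" by blast
  then obtain x j where x: "local_params X p x" "local_equation X E p (x j)" using C(3) by blast
  have "p \<in> X" using p E by blast
  from local_paramsE[OF x(1) this] obtain a where a: "\<And>j. germ p (x j) (a j)" "lparams p a" by blast
  have "loceq E p (a j)" using loceq_iff[OF E p(1) a(1)] x(2) by blast
  then show ?thesis using that p a(2) by blast
qed

lemma gooddiv_unif:
  assumes E: "irreducible_closed E" "E \<subseteq> X" "E \<noteq> X" and g: "gooddiv X E"
  obtains p a j \<Delta> where "p \<in> E" "params_dual p a \<Delta>" "loceq E p (a j)" "unif E (a j)"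
proof -
  have "\<not> E \<subseteq> {}" using irreducible_closedD[OF E(1)] by blast
  then obtain p a j where 1: "p \<in> E" "lparams p a" "loceq E p (a j)" using gooddivE[OF E(1,2) g zclosed_empty] by blast
  then obtain \<Delta> where 2: "params_dual p a \<Delta>" using lparams_dual[of p a] E by blast
  show ?thesis using that[OF 1(1) 2 1(3) unif_exists[OF E 1(1) 2 1(3)]] .
qed

text \<open>Any local equation of \<open>E\<close> at any of its points generates the maximal ideal
  of the local ring along \<open>E\<close>, so all of them give the same exponent. For existence one
  moves from \<open>p0\<close> to a good point at which the function is still represented by
  \<open>s\<close>.\<close>

lemma ord_along_eq:
  assumes E: "irreducible_closed E" "E \<subseteq> X" "E \<noteq> X" and g: "gooddiv X E" and p0: "p0 \<in> E" and r: "germ p0 \<phi> s"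
    and k: "has_order E k s"
  shows "ord_along X E \<phi> = k"
  unfolding ord_along_def
proof (rule the_equality)
  note pE = irreducible_primeset[OF E(1)]
  have "near X p0 (\<lambda>q. germ q \<phi> s)" by (rule germ_near[OF r])
  then obtain C' where C': "zclosed C'" "p0 \<in> X - C'" "\<And>q. q \<in> X - C' \<Longrightarrow> germ q \<phi> s"
    unfolding near_def zopen_in_def by auto
  obtain p a j where p: "p \<in> E" "p \<notin> C'" "lparams p a" "loceq E p (a j)"
    using gooddivE[OF E(1,2) g C'(1)] C'(2) p0 by blast
  have pX: "p \<in> X" using p E by blast
  have sL: "s \<in> loc_ring {p}" and rs: "germ p \<phi> s" using C'(3)[of p] pX p(2) germD by auto
  let ?e = "a j"
  have eL: "?e \<in> loc_ring {p}" and eM: "?e \<in> max_ideal E" using p(4) by (auto simp: loceq_def)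
  have gen: "\<And>r. r \<in> max_ideal E \<Longrightarrow> \<exists>h\<in>loc_ring E. r = ?e * h" using loceq_generates[OF E(1,2) p(1,4)] .
  have e0: "?e \<noteq> 0" using gen max_ideal_nontrivial[OF E(1-3)] by force
  obtain h where h: "h \<in> loc_ring E" "h \<notin> max_ideal E" "s = ?e ^ k * h" using has_order_unif[OF pE E(2) k eM e0 gen] by blast
  \<comment> \<open>A priori \<open>h\<close> is only regular along \<open>E\<close>. It is regular
    at \<open>p\<close> because an element of the local ring at \<open>p\<close> that vanishes on
    \<open>E\<close> can be divided there by the equation, once for each factor.\<close>
  have "h \<in> loc_ring {p}" if "s \<in> loc_ring {p}" "s = ?e ^ k * h" for s k
    using that
  proof (induction k arbitrary: s)
    case 0 then show ?case by simp
  next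
    case (Suc k)
    have "?e ^ k * h \<in> loc_ring E" using h(1) loc_ring_rules(2)[OF pE E(2)] loc_ring_power[OF pE E(2) max_ideal_loc_ring'[OF eM]] by blast
    then have "s \<in> max_ideal E" using loc_ring_rules(6)[OF pE E(2) eM] Suc.prems(2) by (simp add: mult.assoc)
    then obtain t where t: "t \<in> loc_ring {p}" "s = ?e * t" using p(4) Suc.prems(1) unfolding loceq_def by blast
    then have "t = ?e ^ k * h" using Suc.prems(2) e0 by (simp add: mult.assoc)
    then show ?case using Suc.IH t(1) by blast
  qed
  then have hL: "h \<in> loc_ring {p}" using sL h(3) by blast
  have re: "germ p (\<lambda>q. value_at q ?e) ?e" and rh: "germ p (\<lambda>q. value_at q h) h" using germ_val[OF pX] eL hL by auto
  have "local_equation X E p (\<lambda>q. value_at q ?e)" using loceq_iff[OF E(1,2) p(1) re] p(4) by blast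
  moreover have "regular_at X p (\<lambda>q. value_at q h)" by (rule germ_regular[OF rh])
  moreover have "\<not> near X p (\<lambda>q. q \<in> E \<longrightarrow> value_at q h = 0)" using van_iff[OF E(1,2) p(1) rh] h(2) by blast
  moreover have "near X p (\<lambda>q. \<phi> q = value_at q ?e ^ k * value_at q h)"
  proof -
    have "germ p (\<lambda>q. value_at q ?e ^ k * value_at q h) s" unfolding h(3) by (intro germ_mult germ_power re rh)
    then show ?thesis using germ_eq[OF rs] by blast
  qed
  ultimately show "\<exists>p\<in>E. \<exists>e h. local_equation X E p e \<and> regular_at X p h \<and> \<not> near X p (\<lambda>q. q \<in> E \<longrightarrow> h q = 0) \<and>
    near X p (\<lambda>q. \<phi> q = e q ^ k * h q)" using p(1) by blast
next
  note pE = irreducible_primeset[OF E(1)]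
  fix l assume "\<exists>p\<in>E. \<exists>e h. local_equation X E p e \<and> regular_at X p h \<and> \<not> near X p (\<lambda>q. q \<in> E \<longrightarrow> h q = 0) \<and>
    near X p (\<lambda>q. \<phi> q = e q ^ l * h q)"
  then obtain p e h where *: "p \<in> E" "local_equation X E p e" "regular_at X p h" "\<not> near X p (\<lambda>q. q \<in> E \<longrightarrow> h q = 0)"
    "near X p (\<lambda>q. \<phi> q = e q ^ l * h q)" by blast
  have p: "p \<in> X" using * E by blast
  obtain \<epsilon> where \<epsilon>: "germ p e \<epsilon>" using *(2) regular_iff[OF p] unfolding local_equation_def by blast
  obtain \<eta> where \<eta>: "germ p h \<eta>" using *(3) regular_iff[OF p] by blast
  have le: "loceq E p \<epsilon>" using loceq_iff[OF E(1,2) *(1) \<epsilon>] *(2) by blast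
  have \<epsilon>M: "\<epsilon> \<in> max_ideal E" using le by (simp add: loceq_def)
  have gen: "\<And>r. r \<in> max_ideal E \<Longrightarrow> \<exists>h\<in>loc_ring E. r = \<epsilon> * h" using loceq_generates[OF E(1,2) *(1) le] .
  have e0: "\<epsilon> \<noteq> 0" using gen max_ideal_nontrivial[OF E(1-3)] by force
  have "germ p (\<lambda>q. e q ^ l * h q) (\<epsilon> ^ l * \<eta>)" by (intro germ_mult germ_power \<epsilon> \<eta>)
  then have "germ p \<phi> (\<epsilon> ^ l * \<eta>)" by (rule germ_cong) (rule near_mono[OF *(5)], simp)
  then have s: "s = \<epsilon> ^ l * \<eta>" using germ_unique[OF r] by blast
  have "\<eta> \<in> loc_ring {p}" using germD[OF \<eta>] by blast
  then have \<eta>L: "\<eta> \<in> loc_ring E" using loc_ring_mono[of "{p}" E] *(1) by blast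
  have \<eta>M: "\<eta> \<notin> max_ideal E" using van_iff[OF E(1,2) *(1) \<eta>] *(4) by blast
  obtain u where u: "u \<in> loc_ring E" "u \<notin> max_ideal E" "s = \<epsilon> ^ k * u" using has_order_unif[OF pE E(2) k \<epsilon>M e0 gen] by blast
  show "l = k" using order_unique[OF pE E(2) \<epsilon>M e0 \<eta>L \<eta>M u(1,2)] s u(3) by metis
qed

text \<open>A generator at a point of \<open>E\<close> divides all pullbacks and is a combination of
  them. Two generators, even at different points, therefore divide each other along \<open>E\<close>
  and have equal order.\<close>

lemma mult_F_eq:
  assumes E: "irreducible_closed E" "E \<subseteq> X" "E \<noteq> X" and g: "gooddiv X E" 
    and B: "B \<in> I" "B \<noteq> 0" and gen: "\<And>p. p \<in> X \<Longrightarrow> \<exists>g. generates_pullback X I p g"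
  shows "\<exists>r. has_order E (mult_F X I E) r \<and> (\<forall>B\<in>I. \<exists>h\<in>loc_ring E. of_mpoly B = r * h) \<and> 
    (\<exists>(N::nat) A h. (\<forall>k<N. A k \<in> I \<and> h k \<in> loc_ring E) \<and> r = (\<Sum>k<N. h k * of_mpoly (A k)))"
proof -
  note pE = irreducible_primeset[OF E(1)]
  obtain p1 a1 j1 \<Delta>1 where U: "p1 \<in> E" "unif E (a1 j1)" using gooddiv_unif[OF E g] by blast
  have G: "\<exists>r k. germ p g r \<and> has_order E k r \<and> ord_along X E g = k \<and> (\<forall>B\<in>I. \<exists>h\<in>loc_ring E. of_mpoly B = r * h) \<and> 
    (\<exists>(N::nat) A h. (\<forall>k<N. A k \<in> I \<and> h k \<in> loc_ring E) \<and> r = (\<Sum>k<N. h k * of_mpoly (A k)))"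
    if p: "p \<in> E" and graph_pt: "generates_pullback X I p g" for p g
  proof -
    have pX: "p \<in> X" using p E by blast
    have sub: "loc_ring {p} \<subseteq> loc_ring E" using p by (intro loc_ring_mono) auto
    obtain r N A h where 1: "germ p g r" "\<And>B. B \<in> I \<Longrightarrow> \<exists>h\<in>loc_ring {p}. of_mpoly B = r * h"
      "\<And>k. k < N \<Longrightarrow> A k \<in> I \<and> h k \<in> loc_ring {p}" "r = (\<Sum>k<(N::nat). h k * of_mpoly (A k))"
      by (rule generatesE[OF graph_pt pX]) (rule that)
    have "r \<noteq> 0" using 1(2)[OF B(1)] B(2) by auto
    moreover have "r \<in> loc_ring E" using germD[OF 1(1)] sub by blast
    ultimately obtain k where k: "has_order E k r" using has_order_exists[OF U(2)] by blast
    have "ord_along X E g = k" by (rule ord_along_eq[OF E g p 1(1) k])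
    moreover have "\<forall>B\<in>I. \<exists>h\<in>loc_ring E. of_mpoly B = r * h" using 1(2) sub by blast
    moreover have "\<exists>(N::nat) A h. (\<forall>k<N. A k \<in> I \<and> h k \<in> loc_ring E) \<and> r = (\<Sum>k<N. h k * of_mpoly (A k))"
      by (rule exI[of _ N], rule exI[of _ A], rule exI[of _ h]) (use 1(3,4) sub in blast)
    ultimately show ?thesis using 1(1) k by (intro exI[of _ r], intro exI[of _ k]) simp
  qed
  obtain g where g1: "generates_pullback X I p1 g" using gen[of p1] U E by blast
  obtain r k N A h where 1: "has_order E k r" "ord_along X E g = k" "\<forall>B\<in>I. \<exists>h\<in>loc_ring E. of_mpoly B = r * h"
    "\<forall>k<N. A k \<in> I \<and> h k \<in> loc_ring E" "r = (\<Sum>k<(N::nat). h k * of_mpoly (A k))" using G[OF U(1) g1] by blast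
  have le: "k \<le> k'" if k': "has_order E k' r'" and kk: "has_order E k r" and d: "\<forall>B\<in>I. \<exists>h\<in>loc_ring E. of_mpoly B = r * h" and
     e: "\<exists>(N::nat) A h. (\<forall>k<N. A k \<in> I \<and> h k \<in> loc_ring E) \<and> r' = (\<Sum>k<N. h k * of_mpoly (A k))" for k k' r r'
  proof -
    obtain N A h where e': "\<forall>k<(N::nat). A k \<in> I \<and> h k \<in> loc_ring E" "r' = (\<Sum>k<N. h k * of_mpoly (A k))" using e by blast
    have "\<forall>k\<in>{..<N}. \<exists>t. t \<in> loc_ring E \<and> of_mpoly (A k) = r * t" using d e' by blast
    then obtain t where t: "\<And>k. k < N \<Longrightarrow> t k \<in> loc_ring E \<and> of_mpoly (A k) = r * t k" unfolding bchoice_iff by auto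
    have "r' = (\<Sum>k<N. r * (h k * t k))" unfolding e'(2) by (rule sum.cong) (use t in \<open>auto simp: mult_ac\<close>)
    then have r': "r' = r * (\<Sum>k<N. h k * t k)" by (simp only: sum_distrib_left)
    have "(\<Sum>k<N. h k * t k) \<in> loc_ring E" using t e' by (intro loc_ring_sum[OF pE E(2)] loc_ring_rules(2)[OF pE E(2)]) auto
    then show ?thesis using has_order_le[OF pE E(2) kk] k' r' by blast
  qed
  have "mult_F X I E = k" unfolding mult_F_def
  proof (rule the_equality)
    show "\<exists>p\<in>E. \<exists>g. generates_pullback X I p g \<and> k = ord_along X E g" using U(1) g1 1(2) by blast
    fix l assume "\<exists>p\<in>E. \<exists>g. generates_pullback X I p g \<and> l = ord_along X E g"
    then obtain p' g' where "p' \<in> E" "generates_pullback X I p' g'" "l = ord_along X E g'" by blast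
    with G[of p' g'] obtain r' where 2: "has_order E l r'" "\<forall>B\<in>I. \<exists>h\<in>loc_ring E. of_mpoly B = r' * h"
      "\<exists>(N::nat) A h. (\<forall>k<N. A k \<in> I \<and> h k \<in> loc_ring E) \<and> r' = (\<Sum>k<N. h k * of_mpoly (A k))" by blast
    show "l = k"
    proof (rule antisym)
      show "k \<le> l" by (rule le[OF 2(1) 1(1,3) 2(3)])
      show "l \<le> k" by (rule le[OF 1(1) 2(1,2)], rule exI[of _ N], rule exI[of _ A], rule exI[of _ h]) (use 1(4,5) in blast)
    qed
  qed
  moreover have "\<exists>(N::nat) A h. (\<forall>k<N. A k \<in> I \<and> h k \<in> loc_ring E) \<and> r = (\<Sum>k<N. h k * of_mpoly (A k))"
    by (rule exI[of _ N], rule exI[of _ A], rule exI[of _ h]) (use 1(4,5) in blast)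
  ultimately show ?thesis using 1(1,3) by (intro exI[of _ r]) simp
qed

lemma dual_det_nz: "dual a \<Delta> \<Longrightarrow> det (\<chi> i j. \<Delta> j (coord i)) * det (\<chi> j k. pdK k (a j)) = 1"
proof -
  assume d: "dual a \<Delta>"
  have "pdK k (coord i) = (\<Sum>j\<in>UNIV. pdK k (a j) * \<Delta> j (coord i))" for i k using d is_deriv_pdK unfolding dual_def by blast
  then have "(\<chi> i j. \<Delta> j (coord i)) ** (\<chi> j k. pdK k (a j)) = mat 1"
    by (auto simp: matrix_matrix_mult_def mat_def vec_eq_iff pdK_coord mult.commute)
  then show ?thesis by (simp flip: det_mul)
qed

text \<open>Jacobian determinants at different points of \<open>E\<close> differ by the determinant
  of a change of parameters that is regular along \<open>E\<close> in both directions, hence by a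
  unit.\<close>

lemma mult_K_eq:
  assumes E: "irreducible_closed E" "E \<subseteq> X" "E \<noteq> X" and g: "gooddiv X E" and p: "p \<in> E" and P: "params_dual p a \<Delta>"
  shows "has_order E (mult_K X E) (det (\<chi> i j. \<Delta> j (coord i)))"
proof -
  note pE = irreducible_primeset[OF E(1)]
  obtain p1 a1 j1 \<Delta>1 where U: "p1 \<in> E" "unif E (a1 j1)" using gooddiv_unif[OF E g] by blast
  let ?J = "\<lambda>\<Delta>. \<chi> i j. \<Delta> j (coord i)"
  have JL: "det (?J \<Delta>) \<in> loc_ring E" if "p \<in> E" "params_dual p a \<Delta>" for p a and \<Delta> :: "'n \<Rightarrow> 'n ratfun \<Rightarrow> 'n ratfun"
    using params_dual_loc_ring[OF pE E(2) that loc_ring_rules(4)[OF pE E(2)]] by (intro loc_ring_det[OF pE E(2)]) simp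
  have J0: "det (?J \<Delta>) \<noteq> 0" if "params_dual p a \<Delta>" for p a and \<Delta> :: "'n \<Rightarrow> 'n ratfun \<Rightarrow> 'n ratfun"
    using dual_det_nz[of a \<Delta>] that by (auto simp: params_dual_def)
  have T: "\<exists>t\<in>loc_ring E. det (?J \<Delta>') = det (?J \<Delta>) * t" if P: "p \<in> E" "params_dual p a \<Delta>" and P': "p' \<in> E" "params_dual p' a' \<Delta>'" 
    for p p' a a' and \<Delta> \<Delta>' :: "'n \<Rightarrow> 'n ratfun \<Rightarrow> 'n ratfun"
  proof -
    have D: "is_deriv (\<Delta>' j)" for j using P' by (simp add: params_dual_def dual_def)
    have e: "\<Delta>' j r = (\<Sum>l\<in>UNIV. \<Delta>' j (a l) * \<Delta> l r)" for j r using P D by (auto simp: params_dual_def dual_def)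
    \<comment> \<open>The chain rule. With the roles exchanged it gives the opposite divisibility,
      so the two orders agree.\<close>
    have "?J \<Delta>' = ?J \<Delta> ** (\<chi> l j. \<Delta>' j (a l))"
      by (simp add: matrix_matrix_mult_def vec_eq_iff) (auto simp: e[of _ "coord _"] mult.commute)
    then have "det (?J \<Delta>') = det (?J \<Delta>) * det (\<chi> l j. \<Delta>' j (a l))" by (simp only: det_mul)
    moreover have "a l \<in> loc_ring E" for l
    proof -
      have "a l \<in> loc_ring {p}" using P max_ideal_loc_ring' by (auto simp: params_dual_def lparams_def)
      then show ?thesis using loc_ring_mono[of "{p}" E] P(1) by blast
    qed
    then have "det (\<chi> l j. \<Delta>' j (a l)) \<in> loc_ring E" 
      using params_dual_loc_ring[OF pE E(2) P'] by (intro loc_ring_det[OF pE E(2)]) simp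
    ultimately show ?thesis by blast
  qed
  have pX: "p \<in> X" using p E by blast
  have L: "lparams p a" using P by (simp add: params_dual_def)
  obtain \<Delta>2 where 2: "params_dual p a \<Delta>2" "jacobian_near X p (\<lambda>j q. value_at q (a j)) (\<lambda>q. \<chi> i j. value_at q (\<Delta>2 j (coord i)))"
    using jacobian_exists[OF pX L] by blast
  obtain k where k: "has_order E k (det (?J \<Delta>))" using has_order_exists[OF U(2) JL[OF p P] J0[OF P]] by blast
  have K: "ord_along X E (\<lambda>q. det (J' q)) = k" if p': "p' \<in> E" and J': "jacobian_near X p' x' J'" for p' x' J'
  proof -
    obtain a' \<Delta>' where 3: "params_dual p' a' \<Delta>'" "germ p' (\<lambda>q. det (J' q)) (det (?J \<Delta>'))" using jacobian_det[OF J'] by blast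
    obtain k' where k': "has_order E k' (det (?J \<Delta>'))" using has_order_exists[OF U(2) JL[OF p' 3(1)] J0[OF 3(1)]] by blast
    obtain t where t: "t \<in> loc_ring E" "det (?J \<Delta>') = det (?J \<Delta>) * t" using T[OF p P p' 3(1)] by blast
    obtain t' where t': "t' \<in> loc_ring E" "det (?J \<Delta>) = det (?J \<Delta>') * t'" using T[OF p' 3(1) p P] by blast
    have "k \<le> k'" by (rule has_order_le[OF pE E(2) k t(1)]) (use k' t(2) in metis)
    moreover have "k' \<le> k" by (rule has_order_le[OF pE E(2) k' t'(1)]) (use k t'(2) in metis)
    ultimately show ?thesis using ord_along_eq[OF E g p' 3(2) k'] by simp
  qed
  have "mult_K X E = k" unfolding mult_K_def
  proof (rule the_equality)
    show "\<exists>p\<in>E. \<exists>x J. jacobian_near X p x J \<and> k = ord_along X E (\<lambda>q. det (J q))" using K[OF p 2(2)] p 2(2) by metis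
    fix l assume "\<exists>p\<in>E. \<exists>x J. jacobian_near X p x J \<and> l = ord_along X E (\<lambda>q. det (J q))"
    then show "l = k" using K by blast
  qed
  then show ?thesis using k by simp
qed

end

section \<open>Lines parallel to a coordinate axis and the degree in one variable\<close>

definition shift_pt :: "complex ^ 'n \<Rightarrow> 'n \<Rightarrow> complex \<Rightarrow> complex ^ 'n" where
  "shift_pt y j t = (\<chi> v. y $ v + (if v = j then t else 0))"

lemma shift_pt_0: "shift_pt y j 0 = y" by (simp add: shift_pt_def vec_eq_iff)

definition line_poly :: "complex ^ 'n \<Rightarrow> 'n \<Rightarrow> 'n::finite mpoly \<Rightarrow> complex poly" where
  "line_poly y j A = heval (\<lambda>c. [:c:]) (\<lambda>v. [:y $ v, if v = j then 1 else 0:]) A"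

lemma poly_line_poly: "poly (line_poly y j A) t = ev (shift_pt y j t) A"
  unfolding line_poly_def poly_line_heval ev_def shift_pt_def
  by (rule arg_cong[of _ _ "\<lambda>x. peval x A"]) auto

lemma line_poly_mult: "line_poly y j (A * B) = line_poly y j A * line_poly y j B"
  unfolding line_poly_def by (rule heval_mult) (simp add: rhom_def one_pCons)

lemma line_poly_0_iff: "line_poly y j A = 0 \<longleftrightarrow> (\<forall>t. ev (shift_pt y j t) A = 0)"
  using poly_all_0_iff_0[of "line_poly y j A"] by (simp add: poly_line_poly)

lemma ev_pd_0:
  assumes "\<And>t. ev (shift_pt y j t) A = 0" shows "ev y (pd j A) = 0"
proof -
  have "((\<lambda>t::complex. 0) has_field_derivative peval (\<lambda>i. y $ i) (pd j A)) (at 0)"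
    using peval_line_deriv[of "\<lambda>i. y $ i" j A] assms by (simp add: ev_def shift_pt_def)
  then have "peval (\<lambda>i. y $ i) (pd j A) = 0" by (metis DERIV_unique DERIV_const)
  then show ?thesis by (simp add: ev_def)
qed

definition shift_poly :: "'n \<Rightarrow> complex \<Rightarrow> 'n::finite mpoly \<Rightarrow> 'n mpoly" where
  "shift_poly j t A = heval Cst (\<lambda>v. var v + (if v = j then Cst t else 0)) A"

lemma ev_shift_poly: "ev y (shift_poly j t A) = ev (shift_pt y j t) A"
proof -
  have "ev y (shift_poly j t A) = heval (\<lambda>c. ev y (Cst c)) (\<lambda>v. ev y (var v + (if v = j then Cst t else 0))) A"
    unfolding shift_poly_def by (rule rhom_heval_comp[OF rhom_ev])
  also have "(\<lambda>v. ev y (var v + (if v = j then Cst t else 0))) = (\<lambda>v. shift_pt y j t $ v)"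
    by (auto simp: ev_simps ev_var ev_Cst shift_pt_def)
  finally have "ev y (shift_poly j t A) = heval (\<lambda>c. c) (\<lambda>v. shift_pt y j t $ v) A" by (simp only: ev_Cst)
  then show ?thesis by (simp only: ev_def[of "shift_pt y j t"] peval_heval)
qed

definition deg_le :: "'v \<Rightarrow> nat \<Rightarrow> 'v mpoly \<Rightarrow> bool" where
  "deg_le j d A \<longleftrightarrow> (\<forall>m\<in>keys A. lookup m j \<le> d)"

lemma deg_le_mono: "deg_le j d A \<Longrightarrow> d \<le> e \<Longrightarrow> deg_le j e A" unfolding deg_le_def by (meson order_trans)

lemma deg_le_add: "deg_le j d A \<Longrightarrow> deg_le j d B \<Longrightarrow> deg_le j d (A + B)"
  unfolding deg_le_def using Poly_Mapping.keys_add[of A B] by blast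

lemma deg_le_uminus: "deg_le j d A \<Longrightarrow> deg_le j d (- A)" by (simp add: deg_le_def in_keys_iff)

lemma deg_le_diff: "deg_le j d A \<Longrightarrow> deg_le j d B \<Longrightarrow> deg_le j d (A - B)"
  using deg_le_add[of j d A "- B"] deg_le_uminus[of j d B] by simp

lemma deg_le_mult: "deg_le j d A \<Longrightarrow> deg_le j e B \<Longrightarrow> deg_le j (d + e) (A * B)"
  unfolding deg_le_def using keys_mult[of A B] by (fastforce simp: lookup_add intro: add_mono)

lemma deg_le_var_power: "deg_le j d (var j ^ d)"
proof (induction d)
  case 0 then show ?case by (simp add: deg_le_def)
next
  case (Suc d)
  have "deg_le j 1 (var j)" by (simp add: deg_le_def var_def mpoly_monom_def)
  from deg_le_mult[OF this Suc] show ?case by simp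
qed

lemma deg_le_0_novar: "deg_le j 0 A \<longleftrightarrow> novar j A" by (simp add: deg_le_def novar_def)

lemma deg_le_exists: "\<exists>d. deg_le j d (A :: 'v::finite mpoly)"
  using tdeg_le_exists[of A] unfolding tdeg_le_def deg_le_def by blast

lemma deg_le_pd: "deg_le j (Suc d) A \<Longrightarrow> deg_le j d (pd j A)"
  unfolding deg_le_def
proof
  fix m assume A: "\<forall>m\<in>keys A. lookup m j \<le> Suc d" and "m \<in> keys (pd j A)"
  then have "m + Poly_Mapping.single j 1 \<in> keys A" by (auto simp: in_keys_iff lookup_pd)
  then have "lookup (m + Poly_Mapping.single j 1) j \<le> Suc d" using A by blast
  then show "lookup m j \<le> d" by (simp add: lookup_add)
qed

lemma pd_0_novar: "pd j A = 0 \<Longrightarrow> novar j A"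
  unfolding novar_def
proof (rule ballI, rule ccontr)
  fix m assume A: "pd j A = 0" "m \<in> keys A" "lookup m j \<noteq> 0"
  have "m - Poly_Mapping.single j 1 + Poly_Mapping.single j 1 = m"
    by (rule poly_mapping_eqI) (use A(3) in \<open>auto simp: lookup_add lookup_minus lookup_single when_def\<close>)
  then have "lookup (pd j A) (m - Poly_Mapping.single j 1) \<noteq> 0"
    using A(2,3) by (auto simp: lookup_pd in_keys_iff simp del: of_nat_add of_nat_Suc)
  then show False using A(1) by simp
qed

lemma deg_le_lead:
  fixes A :: "'v::finite mpoly"
  assumes "deg_le j d A"
  shows "\<exists>L A'. A = L * var j ^ d + A' \<and> novar j L \<and> (if d = 0 then A' = 0 else deg_le j (d - 1) A')"
proof -
  let ?e = "Poly_Mapping.single j (d::nat)"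
  let ?S = "{m\<in>keys A. lookup m j = d}" and ?T = "{m\<in>keys A. lookup m j \<noteq> d}"
  define L where "L = (\<Sum>m\<in>?S. Poly_Mapping.single (m - ?e) (lookup A m))"
  define A' where "A' = (\<Sum>m\<in>?T. Poly_Mapping.single m (lookup A m))"
  have pw: "var j ^ d = mpoly_monom ?e"
    by (simp add: mpoly_monom_prod lookup_single when_def) 
      (simp add: prod.delta if_distrib[of "\<lambda>x. _ ^ x"] cong: if_cong)
  have a1: "m - ?e + ?e = m" if "m \<in> ?S" for m
    by (rule poly_mapping_eqI) (use that in \<open>auto simp: lookup_add lookup_minus lookup_single when_def\<close>)
  have "L * var j ^ d = (\<Sum>m\<in>?S. Poly_Mapping.single m (lookup A m))"
    unfolding pw L_def sum_distrib_right mpoly_monom_def mult_single by (rule sum.cong) (use a1 in auto)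
  then have "L * var j ^ d + A' = (\<Sum>m\<in>?S \<union> ?T. Poly_Mapping.single m (lookup A m))"
    unfolding A'_def by (subst sum.union_disjoint) auto
  also have "?S \<union> ?T = keys A" by auto
  finally have 1: "A = L * var j ^ d + A'" by (simp flip: mpoly_sum_singles)
  have 2: "novar j L" unfolding novar_def
  proof
    fix m assume "m \<in> keys L"
    then have "m \<in> (\<Union>m'\<in>?S. keys (Poly_Mapping.single (m' - ?e) (lookup A m')))"
      unfolding L_def by (rule subsetD[OF Poly_Mapping.keys_sum])
    then obtain m' where "lookup m' j = d" "m \<in> keys (Poly_Mapping.single (m' - ?e) (lookup A m'))" by blast
    then show "lookup m j = 0" by (simp add: lookup_minus split: if_splits)
  qed
  have 3: "lookup m j < d" if "m \<in> keys A'" for m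
  proof -
    have "m \<in> (\<Union>m'\<in>?T. keys (Poly_Mapping.single m' (lookup A m')))"
      using that unfolding A'_def by (rule subsetD[OF Poly_Mapping.keys_sum])
    then obtain m' where "m' \<in> ?T" "m \<in> keys (Poly_Mapping.single m' (lookup A m'))" by blast
    then have "m \<in> ?T" by (auto split: if_splits)
    then show ?thesis using assms by (auto simp: deg_le_def le_less)
  qed
  have "if d = 0 then A' = 0 else deg_le j (d - 1) A'"
  proof (cases "d = 0")
    case True
    then have "keys A' = {}" using 3 by blast
    then have "A' = 0" by (simp only: keys_eq_empty)
    then show ?thesis using True by simp
  next
    case False
    then show ?thesis using 3 unfolding deg_le_def by fastforce
  qed
  then show ?thesis using 1 2 by blast
qed

lemma novar_ev: "novar j A \<Longrightarrow> ev (shift_pt y j t) A = ev y A"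
  for A :: "'n::finite mpoly"
  unfolding ev_def peval_heval heval_finite[OF rhom_id]
  by (intro sum.cong prod.cong arg_cong2[where f="(*)"] refl) (auto simp: shift_pt_def novar_def)

text \<open>Hadamard's form of the first-order Taylor expansion at \<open>y\<close>, obtained by
  induction from the product rule.\<close>

lemma hadamard:
  fixes A :: "'n::finite mpoly"
  shows "\<exists>H. A = Cst (ev y A) + (\<Sum>l\<in>UNIV. H l * (var l - Cst (y $ l))) \<and> (\<forall>l. ev y (H l) = ev y (pd l A))"
proof (induction A rule: mpoly_induct)
  case (Cst c)
  show ?case by (rule exI[of _ "\<lambda>_. 0"]) (simp add: ev_Cst ev_simps)
next
  case (var v)
  have "(\<Sum>l\<in>UNIV. (if l = v then 1 else 0) * (var l - Cst (y $ l))) = (\<Sum>l\<in>UNIV. if l = v then var l - Cst (y $ l) else 0)"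
    by (rule sum.cong) auto
  then show ?case by (intro exI[of _ "\<lambda>l. if l = v then 1 else 0"]) (auto simp: ev_var pd_var ev_simps)
next
  case (add P Q)
  then obtain H H' where H: "P = Cst (ev y P) + (\<Sum>l\<in>UNIV. H l * (var l - Cst (y $ l)))" "\<And>l. ev y (H l) = ev y (pd l P)"
    "Q = Cst (ev y Q) + (\<Sum>l\<in>UNIV. H' l * (var l - Cst (y $ l)))" "\<And>l. ev y (H' l) = ev y (pd l Q)" by blast
  have "P + Q = Cst (ev y (P + Q)) + (\<Sum>l\<in>UNIV. (H l + H' l) * (var l - Cst (y $ l)))"
    by (subst H(1), subst H(3)) (simp add: ev_simps distrib_right sum.distrib rhom_simps[OF rhom_Cst])
  moreover have "\<forall>l. ev y (H l + H' l) = ev y (pd l (P + Q))" by (simp add: H(2,4) ev_simps pd_add)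
  ultimately show ?case by (intro exI[of _ "\<lambda>l. H l + H' l"] conjI)
next
  case (mult P Q)
  then obtain H H' where H: "P = Cst (ev y P) + (\<Sum>l\<in>UNIV. H l * (var l - Cst (y $ l)))" "\<And>l. ev y (H l) = ev y (pd l P)"
    "Q = Cst (ev y Q) + (\<Sum>l\<in>UNIV. H' l * (var l - Cst (y $ l)))" "\<And>l. ev y (H' l) = ev y (pd l Q)" by blast
  have "P * Q = Cst (ev y P) * Q + (\<Sum>l\<in>UNIV. H l * (var l - Cst (y $ l))) * Q"
    by (subst H(1)) (simp add: distrib_right)
  also have "Cst (ev y P) * Q = Cst (ev y P) * Cst (ev y Q) + Cst (ev y P) * (\<Sum>l\<in>UNIV. H' l * (var l - Cst (y $ l)))"
    by (subst H(3)) (simp add: distrib_left)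
  also have "Cst (ev y P) * Cst (ev y Q) + Cst (ev y P) * (\<Sum>l\<in>UNIV. H' l * (var l - Cst (y $ l))) + (\<Sum>l\<in>UNIV. H l * (var l - Cst (y $ l))) * Q
    = Cst (ev y (P * Q)) + (\<Sum>l\<in>UNIV. (H l * Q + Cst (ev y P) * H' l) * (var l - Cst (y $ l)))"
    unfolding ev_simps(4) rhom_simps(4)[OF rhom_Cst] sum_distrib_left sum_distrib_right
    by (simp add: distrib_right distrib_left sum.distrib mult_ac)
  finally have "P * Q = Cst (ev y (P * Q)) + (\<Sum>l\<in>UNIV. (H l * Q + Cst (ev y P) * H' l) * (var l - Cst (y $ l)))" .
  moreover have "\<forall>l. ev y (H l * Q + Cst (ev y P) * H' l) = ev y (pd l (P * Q))" by (simp add: H(2,4) ev_simps pd_mult ev_Cst)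
  ultimately show ?case by (intro exI[of _ "\<lambda>l. H l * Q + Cst (ev y P) * H' l"] conjI)
qed

section \<open>Local equations of non-exceptional divisors\<close>

context bir
begin

lemma closure_contains:
  assumes E: "irreducible_closed E" and C: "zclosed C" "\<not> E \<subseteq> C" and S: "\<And>p. p \<in> E \<Longrightarrow> p \<notin> C \<Longrightarrow> p \<in> S"
  shows "E \<subseteq> zclosure S"
proof
  fix p assume p: "p \<in> E"
  obtain p0 where p0: "p0 \<in> E" "p0 \<notin> C" using C by blast
  show "p \<in> zclosure S"
  proof (rule ccontr)
    assume "p \<notin> zclosure S"
    then obtain d P where P: "hom d P" "pval P p \<noteq> 0" "\<And>q. q \<in> zclosure S \<Longrightarrow> pval P q = 0"
      using zclosed_separate[OF zclosure_closed] by blast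
    have "\<not> nonvan E P"
      by (rule primeset_closed_dense[OF E p0 C(1) P(1)]) (use P(3) S zclosure_subset[of S] in blast)
    then show False using P(2) p by (auto simp: nonvan_def)
  qed
qed

text \<open>Where \<open>f\<close> is nonzero, \<open>E\<close> lives in an open part of complex
  n-space, and only its maximality among irreducible proper subsets is known. Choose
  \<open>B\<close> in its ideal \<open>I\<close> with \<open>pd j B\<close> outside
  \<open>I\<close>. Sweeping \<open>E\<close> in direction \<open>j\<close> gives a larger
  irreducible set, hence all of \<open>X\<close>, so \<open>I\<close> contains no nonzero polynomial
  free of z_j. Then an element of \<open>I\<close> of least degree in z_j divides all of
  \<open>I\<close> up to powers of its leading coefficient, and is a local equation wherever that
  coefficient, \<open>f\<close> and its own derivative by z_j are nonzero.\<close>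

lemma gooddiv_nonexceptional:
  assumes pdv: "prime_divisor X E" and p1: "p1 \<in> E" "ev (fst p1) f \<noteq> 0"
  shows "gooddiv X E"
proof -
  note E = prime_divisorD[OF pdv]
  note pE = irreducible_primeset[OF E(1)]
  define I where "I = {A. \<not> nonvan E (emb A)}"
  have Iiff: "A \<in> I \<longleftrightarrow> (\<forall>p\<in>E. ev (fst p) A = 0)" for A by (auto simp: I_def nonvan_def pval_emb)
  have prime: "A * B \<in> I \<longleftrightarrow> A \<in> I \<or> B \<in> I" for A B
  proof
    assume "A * B \<in> I"
    then have "\<not> nonvan E (emb A * emb B)" by (auto simp: I_def nonvan_def pval_simps pval_emb ev_simps)
    then show "A \<in> I \<or> B \<in> I" using pE hom_emb unfolding primeset_def I_def by blast
  qed (auto simp: Iiff ev_simps)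
  have fI: "f \<notin> I" using p1 by (auto simp: Iiff)
  have Eg: "p = graph_pt (fst p)" if "p \<in> E" "ev (fst p) f \<noteq> 0" for p using X_graph_pt that E(2) by blast
  have IE0: "A \<in> I" if "\<And>p. p \<in> E \<Longrightarrow> ev (fst p) f \<noteq> 0 \<Longrightarrow> ev (fst p) A = 0" for A
  proof -
    have "f * A \<in> I" using that by (auto simp: Iiff ev_simps)
    then show ?thesis using prime fI by blast
  qed
  have "\<exists>A\<in>I. A \<noteq> 0"
  proof -
    obtain q where q: "q \<in> X" "q \<notin> E" using E by blast
    obtain d P where P: "hom d P" "pval P q \<noteq> 0" "\<And>p. p \<in> E \<Longrightarrow> pval P p = 0"
      using zclosed_separate[OF irreducible_closedD(1)[OF E(1)] q(2)] by blast
    have "on_graph P \<noteq> 0" using X_van_iff[OF P(1)] P(2) q(1) by (auto simp: nonvan_def)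
    moreover have "on_graph P \<in> I"
    proof (rule IE0)
      fix p assume p: "p \<in> E" "ev (fst p) f \<noteq> 0"
      have "pval P (graph_pt (fst p)) = 0" using Eg[OF p] P(3)[OF p(1)] by simp
      then show "ev (fst p) (on_graph P) = 0" using pval_graph_pt_0_iff[OF fnz[OF p(2)] P(1)] by blast
    qed
    ultimately show ?thesis by blast
  qed
  then obtain A0 where A0: "A0 \<in> I" "A0 \<noteq> 0" by blast
  have "\<exists>B j. B \<in> I \<and> pd j B \<notin> I"
  proof (rule ccontr)
    assume "\<not> ?thesis"
    then obtain c where "c \<noteq> 0" "Cst c \<in> I" using pd_closed_const[of I A0] A0 by blast
    then have "ev (fst p1) (Cst c) = 0" using p1 Iiff by blast
    then show False using \<open>c \<noteq> 0\<close> by (simp add: ev_Cst)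
  qed
  then obtain B j where B: "B \<in> I" "pd j B \<notin> I" by blast
  \<comment> \<open>The union of the lines in direction \<open>j\<close> through the points of
    \<open>E\<close>, restricted to the part where \<open>f\<close> is nonzero.\<close>
  define S where "S = {graph_pt (shift_pt (fst p) j t) | p t. p \<in> E \<and> ev (fst p) f \<noteq> 0 \<and> ev (shift_pt (fst p) j t) f \<noteq> 0}"
  have SE: "p \<in> S" if "p \<in> E" "ev (fst p) f \<noteq> 0" for p
  proof -
    have "p = graph_pt (shift_pt (fst p) j 0)" using Eg[OF that] by (simp add: shift_pt_0)
    moreover have "ev (shift_pt (fst p) j 0) f \<noteq> 0" using that by (simp add: shift_pt_0)
    ultimately show ?thesis unfolding S_def using that by blast
  qed
  have SX: "S \<subseteq> X" unfolding S_def using graph_pt_in_X by blast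
  have Snz: "\<exists>p t. p \<in> E \<and> ev (fst p) f \<noteq> 0 \<and> ev (shift_pt (fst p) j t) f \<noteq> 0 \<and> ev (shift_pt (fst p) j t) (on_graph P) \<noteq> 0"
    if "nonvan S P" "hom d P" for d P
  proof -
    obtain p t where "p \<in> E" "ev (fst p) f \<noteq> 0" and f: "ev (shift_pt (fst p) j t) f \<noteq> 0" and "pval P (graph_pt (shift_pt (fst p) j t)) \<noteq> 0"
      using \<open>nonvan S P\<close> unfolding nonvan_def S_def by blast
    then show ?thesis using pval_graph_pt_0_iff[OF fnz[OF f] that(2)] by blast
  qed
  have "primeset S" unfolding primeset_def
  proof (intro conjI allI impI)
    show "S \<noteq> {}" using SE p1 by blast
    fix d e P Q assume h: "hom d P" "hom e Q" and n: "nonvan S P" "nonvan S Q"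
    obtain q1 t1 where 1: "q1 \<in> E" "ev (shift_pt (fst q1) j t1) (on_graph P) \<noteq> 0" using Snz[OF n(1) h(1)] by blast
    obtain q2 t2 where 2: "q2 \<in> E" "ev (shift_pt (fst q2) j t2) (on_graph Q) \<noteq> 0" using Snz[OF n(2) h(2)] by blast
    \<comment> \<open>The shifts move both conditions to polynomials on \<open>E\<close>, where
      primality of \<open>I\<close> provides one point \<open>q\<close> suitable for both.\<close>
    have "shift_poly j t1 (on_graph P) \<notin> I" "shift_poly j t2 (on_graph Q) \<notin> I" using 1 2 by (auto simp: Iiff ev_shift_poly)
    then have "shift_poly j t1 (on_graph P) * shift_poly j t2 (on_graph Q) * f \<notin> I" using prime fI by blast
    then obtain q where q: "q \<in> E" "ev (shift_pt (fst q) j t1) (on_graph P) \<noteq> 0" "ev (shift_pt (fst q) j t2) (on_graph Q) \<noteq> 0" "ev (fst q) f \<noteq> 0"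
      by (auto simp: Iiff ev_shift_poly ev_simps)
    \<comment> \<open>On the line through \<open>q\<close> all three restrictions are nonzero
      polynomials in one variable, so their product is nonzero somewhere on that line.\<close>
    let ?y = "fst q"
    have "ev (shift_pt ?y j 0) f \<noteq> 0" using q(4) by (simp add: shift_pt_0)
    then have "line_poly ?y j (on_graph P) \<noteq> 0" "line_poly ?y j (on_graph Q) \<noteq> 0" "line_poly ?y j f \<noteq> 0" unfolding line_poly_0_iff using q(2,3) by blast+
    then have "line_poly ?y j (on_graph P * on_graph Q * f) \<noteq> 0" by (simp add: line_poly_mult)
    then obtain t where t: "ev (shift_pt ?y j t) (on_graph P * on_graph Q * f) \<noteq> 0" by (auto simp: line_poly_0_iff)
    then have f: "ev (shift_pt ?y j t) f \<noteq> 0" by (auto simp: ev_simps)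
    then have "graph_pt (shift_pt ?y j t) \<in> S" unfolding S_def using q by blast
    moreover have "pval P (graph_pt (shift_pt ?y j t)) \<noteq> 0" "pval Q (graph_pt (shift_pt ?y j t)) \<noteq> 0"
      using pval_graph_pt_0_iff[OF fnz[OF f] h(1)] pval_graph_pt_0_iff[OF fnz[OF f] h(2)] t by (auto simp: ev_simps)
    ultimately show "nonvan S (P * Q)" unfolding nonvan_def by (intro bexI[of _ "graph_pt (shift_pt ?y j t)"]) (simp_all add: pval_simps)
  qed
  then have Zi: "irreducible_closed (zclosure S)" by (rule primeset_closure_irreducible)
  have Cf: "zclosed {p :: ('n, 'm) pt. pval (emb f) p = 0}" by (rule zclosed_hom[OF hom_emb])
  have EZ: "E \<subseteq> zclosure S"
    by (rule closure_contains[OF E(1) Cf]) (use p1 SE in \<open>auto simp: pval_emb\<close>)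
  have ZX: "zclosure S \<subseteq> X" by (rule zclosure_min[OF irreducible_closedD(1)[OF irr] SX])
  \<comment> \<open>Otherwise \<open>B\<close> would vanish along the lines through the points of
    \<open>E\<close>, and so would \<open>pd j B\<close> on \<open>E\<close>.\<close>
  have "zclosure S \<noteq> E"
  proof
    assume ZE: "zclosure S = E"
    have "pd j B \<in> I"
    proof (rule IE0)
      fix p assume p: "p \<in> E" "ev (fst p) f \<noteq> 0"
      have "ev (shift_pt (fst p) j t) (f * B) = 0" for t
      proof (cases "ev (shift_pt (fst p) j t) f = 0")
        case False
        then have "graph_pt (shift_pt (fst p) j t) \<in> S" using p unfolding S_def by blast
        then have "graph_pt (shift_pt (fst p) j t) \<in> E" using ZE zclosure_subset[of S] by blast
        then have "ev (fst (graph_pt (shift_pt (fst p) j t))) B = 0" using B(1) Iiff by blast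
        then show ?thesis by (simp add: graph_pt_def ev_simps)
      qed (simp add: ev_simps)
      then have "line_poly (fst p) j f * line_poly (fst p) j B = 0" by (simp add: line_poly_0_iff flip: line_poly_mult)
      moreover have "ev (shift_pt (fst p) j 0) f \<noteq> 0" using p(2) by (simp add: shift_pt_0)
      then have "line_poly (fst p) j f \<noteq> 0" unfolding line_poly_0_iff by blast
      ultimately have "line_poly (fst p) j B = 0" by simp
      then show "ev (fst p) (pd j B) = 0" by (intro ev_pd_0) (simp add: line_poly_0_iff)
    qed
    then show False using B by blast
  qed
  then have ZX': "zclosure S = X" using pdv Zi EZ ZX unfolding prime_divisor_def by blast
  \<comment> \<open>A polynomial free of z_j that vanishes on \<open>E\<close> vanishes on the swept
    set, which is dense in \<open>X\<close>.\<close>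
  have nov: "A = 0" if "A \<in> I" "novar j A" for A
  proof -
    have "pval (emb A) q = 0" if "q \<in> S" for q
    proof -
      obtain p t where "p \<in> E" "q = graph_pt (shift_pt (fst p) j t)" using \<open>q \<in> S\<close> unfolding S_def by blast
      then show ?thesis using \<open>A \<in> I\<close> novar_ev[OF \<open>novar j A\<close>] by (simp add: graph_pt_def pval_emb Iiff)
    qed
    then have "\<not> nonvan X (emb A)" using zclosure_van_iff[OF hom_emb, of S A] ZX' by (auto simp: nonvan_def)
    then show ?thesis using X_van_iff[OF hom_emb, of A] by simp
  qed
  define d where "d = (LEAST d. \<exists>A\<in>I. A \<noteq> 0 \<and> deg_le j d A)"
  have "\<exists>d. \<exists>A\<in>I. A \<noteq> 0 \<and> deg_le j d A" using A0 deg_le_exists by blast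
  then have "\<exists>A\<in>I. A \<noteq> 0 \<and> deg_le j d A" unfolding d_def by (rule LeastI_ex)
  then obtain f0 where f0: "f0 \<in> I" "f0 \<noteq> 0" "deg_le j d f0" by blast
  have dmin: "A = 0" if "A \<in> I" "deg_le j e A" "e < d" for A e
    using not_less_Least[of e "\<lambda>d. \<exists>A\<in>I. A \<noteq> 0 \<and> deg_le j d A"] that unfolding d_def by blast
  have d0: "d \<noteq> 0" using f0 nov deg_le_0_novar by metis
  obtain a f0' where a: "f0 = a * var j ^ d + f0'" "novar j a" "deg_le j (d - 1) f0'"
    using deg_le_lead[OF f0(3)] d0 by auto
  have a0: "a \<noteq> 0"
  proof
    assume "a = 0"
    then have "f0 = f0'" using a(1) by simp
    then show False using dmin[OF f0(1), of "d - 1"] a(3) d0 f0(2) by simp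
  qed
  have aI: "a \<notin> I" using nov a(2) a0 by blast
  \<comment> \<open>Pseudo-division by \<open>f0\<close> as a polynomial in z_j: a remainder of
    degree below \<open>d\<close> that lies in \<open>I\<close> is zero.\<close>
  have pdiv: "\<exists>k q. a ^ k * A = f0 * q" if "A \<in> I" "deg_le j e A" for A e
    using that
  proof (induction e arbitrary: A)
    case 0
    then have "A = 0" using dmin[of A 0] d0 by simp
    then show ?case by (intro exI[of _ 0]) simp
  next
    case (Suc e)
    show ?case
    proof (cases "Suc e < d")
      case True
      then have "A = 0" using dmin Suc.prems by blast
      then show ?thesis by (intro exI[of _ 0]) simp
    next
      case False
      obtain L A' where L: "A = L * var j ^ Suc e + A'" "novar j L" "deg_le j e A'" using deg_le_lead[OF Suc.prems(2)] by auto
      let ?q = "L * var j ^ (Suc e - d)"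
      let ?B = "a * A - ?q * f0"
      have pw: "var j ^ (Suc e - d) * var j ^ d = var j ^ Suc e" using False by (simp flip: power_add)
      have "?q * f0 = a * L * (var j ^ (Suc e - d) * var j ^ d) + ?q * f0'" unfolding a(1) by (simp add: algebra_simps)
      then have "?q * f0 = a * L * var j ^ Suc e + ?q * f0'" unfolding pw .
      then have B': "?B = a * A' - ?q * f0'" unfolding L(1) by (simp add: algebra_simps)
      have "deg_le j e (a * A')" using deg_le_mult[of j 0 a e A'] a(2) L(3) by (simp add: deg_le_0_novar[symmetric])
      moreover have "deg_le j e (?q * f0')"
      proof -
        have "deg_le j (0 + (Suc e - d) + (d - 1)) (?q * f0')" using a(3) L(2) deg_le_var_power by (intro deg_le_mult) (auto simp: deg_le_0_novar)
        then show ?thesis using False d0 by (elim deg_le_mono) auto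
      qed
      ultimately have "deg_le j e ?B" unfolding B' by (rule deg_le_diff)
      moreover have "?B \<in> I" using Suc.prems(1) f0(1) by (auto simp: Iiff ev_simps)
      ultimately obtain k q where "a ^ k * ?B = f0 * q" using Suc.IH by blast
      then have "a ^ Suc k * A = f0 * (q + a ^ k * ?q)" by (simp add: algebra_simps)
      then show ?thesis by blast
    qed
  qed
  \<comment> \<open>The derivative has degree below \<open>d\<close>, so in \<open>I\<close> it
    would be zero, and \<open>f0\<close> would be free of z_j.\<close>
  have dfI: "pd j f0 \<notin> I"
  proof
    assume i: "pd j f0 \<in> I"
    have "deg_le j (d - 1) (pd j f0)" using deg_le_pd[of j "d - 1" f0] f0(3) d0 by simp
    then have "pd j f0 = 0" using dmin[OF i, of "d - 1"] d0 by simp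
    then show False using nov[OF f0(1) pd_0_novar] f0(2) by blast
  qed
  define D where "D = f * a * pd j f0"
  have DI: "D \<notin> I" using prime fI aI dfI unfolding D_def by blast
  show ?thesis unfolding gooddiv_def
  proof (intro exI[of _ "{p. pval (emb D) p = 0}"] conjI ballI)
    show "zclosed {p :: ('n, 'm) pt. pval (emb D) p = 0}" by (rule zclosed_hom[OF hom_emb])
    show "\<not> E \<subseteq> {p. pval (emb D) p = 0}" using DI by (auto simp: I_def nonvan_def)
    fix p assume "p \<in> E - {p. pval (emb D) p = 0}"
    then have pE': "p \<in> E" and nz: "ev (fst p) f \<noteq> 0" "ev (fst p) a \<noteq> 0" "ev (fst p) (pd j f0) \<noteq> 0"
      by (auto simp: pval_emb D_def ev_simps)
    let ?y = "fst p"
    have pX: "p \<in> X" using pE' E by blast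
    have pg: "p = graph_pt ?y" by (rule X_graph_pt[OF pX nz(1)])
    have LRfrac: "of_mpoly A / of_mpoly B \<in> loc_ring {p}" if "ev ?y B \<noteq> 0" for A B
      using loc_ring_I[OF hom_emb hom_emb, of "{p}" B A] that by (simp add: pval_emb)
    have LRE: "\<exists>A B. ev ?y B \<noteq> 0 \<and> r = of_mpoly A / of_mpoly B" if r: "r \<in> loc_ring {p}" for r
    proof -
      obtain d P Q where 1: "hom d P" "hom d Q" "pval Q p \<noteq> 0" "r = hat P / hat Q" using r by (auto elim: loc_ring_E)
      have "ev ?y (on_graph Q) \<noteq> 0" using pval_graph_pt_0_iff[OF fnz[OF nz(1)] 1(2)] 1(3) pg by simp
      then show ?thesis using 1(4) by (auto simp: hat_def)
    qed
    have inz: "of_mpoly B \<noteq> 0" if "ev ?y B \<noteq> 0" for B using that by (auto simp: ev_simps)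
    have pp: "primeset {p}" "{p} \<subseteq> X" using pX by (auto simp: primeset_point)
    have iL: "of_mpoly A \<in> loc_ring {p}" for A by (rule loc_ring_of_mpoly[OF pp])
    \<comment> \<open>The coordinates centred at \<open>?y\<close>, with the one in direction
      \<open>j\<close> replaced by the equation of \<open>E\<close>.\<close>
    define x where "x l = (if l = j then of_mpoly f0 else coord l - of_const (?y $ l))" for l
    have ziot: "coord l - of_const (?y $ l) = of_mpoly (var l - Cst (?y $ l))" for l by (simp add: coord_def of_const_def)
    have xL: "x l \<in> loc_ring {p}" for l unfolding x_def ziot by (cases "l = j") (simp_all only: if_True if_False simp_thms iL)
    have xM: "x l \<in> max_ideal {p}" for l
    proof -
      have "value_at p (x l) = 0"
      proof (cases "l = j")
        case True
        then show ?thesis using f0(1) pE' by (simp add: x_def val_of_mpoly[OF pX] Iiff)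
      next
        case False
        then have "x l = of_mpoly (var l - Cst (?y $ l))" by (simp only: x_def ziot if_False)
        then show ?thesis by (simp only: val_of_mpoly[OF pX]) (simp add: ev_simps ev_var ev_Cst)
      qed
      then show ?thesis using val_max_ideal[OF pX xL] by blast
    qed
    obtain F where F: "f0 = Cst (ev ?y f0) + (\<Sum>l\<in>UNIV. F l * (var l - Cst (?y $ l)))" "\<And>l. ev ?y (F l) = ev ?y (pd l f0)"
      using hadamard[of f0 ?y] by blast
    have f00: "ev ?y f0 = 0" using f0(1) pE' by (simp add: Iiff)
    have Fj: "ev ?y (F j) \<noteq> 0" using F(2) nz(3) by simp
    have iF: "of_mpoly f0 = (\<Sum>l\<in>UNIV. of_mpoly (F l) * (coord l - of_const (?y $ l)))"
      unfolding ziot by (subst F(1)) (simp add: f00 rhom_sum[OF rhom_of_mpoly] rhom_simps[OF rhom_Cst])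
    then have iF': "of_mpoly f0 = of_mpoly (F j) * (coord j - of_const (?y $ j)) + (\<Sum>l\<in>UNIV - {j}. of_mpoly (F l) * x l)"
      by (subst (asm) sum.remove[of _ j]) (auto simp: x_def intro!: sum.cong)
    \<comment> \<open>Solves the expansion of \<open>f0\<close> for the replaced coordinate; the
      divisor \<open>F j\<close> has the nonzero value of \<open>pd j f0\<close> at
      \<open>?y\<close>.\<close>
    have zj: "coord j - of_const (?y $ j) = (of_mpoly f0 - (\<Sum>l\<in>UNIV - {j}. of_mpoly (F l) * x l)) / of_mpoly (F j)"
      unfolding iF' using inz[OF Fj] by simp
    have "lparams p x" unfolding lparams_def
    proof (intro conjI allI ballI)
      show "x l \<in> max_ideal {p}" for l by (rule xM)
      fix r assume r: "r \<in> max_ideal {p}"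
      then obtain A B where AB: "ev ?y B \<noteq> 0" "r = of_mpoly A / of_mpoly B" using LRE max_ideal_loc_ring' by blast
      have iB: "of_mpoly B \<noteq> 0" by (rule inz[OF AB(1)])
      have "r * of_mpoly B \<in> max_ideal {p}" using loc_ring_rules(6)[OF pp r iL] .
      then have "of_mpoly A \<in> max_ideal {p}" using AB iB by simp
      then have A0: "ev ?y A = 0" using val_max_ideal[OF pX iL] by (simp add: val_of_mpoly[OF pX])
      obtain H where H: "A = Cst (ev ?y A) + (\<Sum>l\<in>UNIV. H l * (var l - Cst (?y $ l)))" using hadamard[of A ?y] by blast
      have iA: "of_mpoly A = (\<Sum>l\<in>UNIV. of_mpoly (H l) * (coord l - of_const (?y $ l)))"
        unfolding ziot by (subst H(1)) (simp add: A0 rhom_sum[OF rhom_of_mpoly] rhom_simps[OF rhom_Cst])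
      then have iA': "of_mpoly A = of_mpoly (H j) * (coord j - of_const (?y $ j)) + (\<Sum>l\<in>UNIV - {j}. of_mpoly (H l) * x l)"
        by (subst (asm) sum.remove[of _ j]) (auto simp: x_def intro!: sum.cong)
      let ?u = "1 / of_mpoly B" and ?w = "of_mpoly (H j) / of_mpoly (F j)"
      define g where "g l = (if l = j then ?u * ?w else ?u * (of_mpoly (H l) - ?w * of_mpoly (F l)))" for l
      have "r = ?u * of_mpoly A" using AB by simp
      also have "\<dots> = ?u * (?w * (of_mpoly f0 - (\<Sum>l\<in>UNIV - {j}. of_mpoly (F l) * x l)) + (\<Sum>l\<in>UNIV - {j}. of_mpoly (H l) * x l))"
        unfolding iA' zj by simp
      also have "\<dots> = ?u * ?w * of_mpoly f0 + (\<Sum>l\<in>UNIV - {j}. ?u * (of_mpoly (H l) - ?w * of_mpoly (F l)) * x l)"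
        by (simp only: right_diff_distrib left_diff_distrib distrib_left sum_distrib_left sum_subtractf mult.assoc) simp
      also have "\<dots> = (\<Sum>l\<in>UNIV. g l * x l)"
        by (subst sum.remove[of UNIV j]) (auto simp: g_def x_def intro!: sum.cong)
      finally have "r = (\<Sum>l\<in>UNIV. g l * x l)" .
      moreover have "g l \<in> loc_ring {p}" for l
      proof -
        have uw: "?u \<in> loc_ring {p}" "?w \<in> loc_ring {p}" using LRfrac[OF AB(1), of 1] LRfrac[OF Fj] by auto
        have "?u * (of_mpoly (H l) - ?w * of_mpoly (F l)) \<in> loc_ring {p}" 
          by (rule loc_ring_rules(2)[OF pp uw(1) loc_ring_diff[OF pp iL loc_ring_rules(2)[OF pp uw(2) iL]]])
        then show ?thesis unfolding g_def using loc_ring_rules(2)[OF pp uw] by (cases "l = j") (simp_all only: if_True if_False simp_thms)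
      qed
      ultimately show "\<exists>g. (\<forall>j. g j \<in> loc_ring {p}) \<and> r = (\<Sum>j\<in>UNIV. g j * x j)" by blast
    qed
    moreover have "loceq E p (x j)" unfolding loceq_def
    proof (intro conjI ballI impI)
      show "x j \<in> loc_ring {p}" by (rule xL)
      have n1: "nonvan E 1" unfolding nonvan_def by (rule bexI[OF _ pE']) (simp add: pval_simps)
      have "hat (emb f0) / hat 1 \<in> max_ideal E" using max_ideal_iff[OF pE E(2) hom_emb hom_1 n1] f0(1) by (auto simp: I_def)
      then show "x j \<in> max_ideal E" by (simp add: x_def)
      fix s assume s: "s \<in> loc_ring {p}" "s \<in> max_ideal E"
      obtain A B where AB: "ev ?y B \<noteq> 0" "s = of_mpoly A / of_mpoly B" using LRE[OF s(1)] by blast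
      have "nonvan E (emb B)" using AB(1) pE' by (auto simp: nonvan_def pval_emb)
      then have "A \<in> I" using max_ideal_iff[OF pE E(2) hom_emb[of A] hom_emb[of B]] s(2) AB(2) by (simp add: I_def)
      moreover obtain e where "deg_le j e A" using deg_le_exists by blast
      ultimately obtain k q where kq: "a ^ k * A = f0 * q" using pdiv by blast
      have "of_mpoly (a ^ k * A) = of_mpoly (f0 * q)" using kq by (rule arg_cong)
      then have "of_mpoly A = of_mpoly f0 * (of_mpoly q / of_mpoly (a ^ k))" using inz[of "a ^ k"] nz(2) 
        by (simp add: ev_simps field_simps)
      then have "s = x j * (of_mpoly q / of_mpoly (a ^ k * B))" using AB(2) by (simp add: x_def)
      moreover have "of_mpoly q / of_mpoly (a ^ k * B) \<in> loc_ring {p}" by (rule LRfrac) (use nz(2) AB(1) in \<open>simp add: ev_simps\<close>)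
      ultimately show "\<exists>h\<in>loc_ring {p}. s = x j * h" by blast
    qed
    ultimately have L: "lparams p x" "loceq E p (x j)" by auto
    have rx: "germ p (\<lambda>q. value_at q (x l)) (x l)" for l by (rule germ_val[OF pX xL])
    have "local_params X p (\<lambda>l q. value_at q (x l))" using lparams_iff[of p "\<lambda>l q. value_at q (x l)" x, OF rx] L(1) by blast
    moreover have "local_equation X E p (\<lambda>q. value_at q (x j))" using loceq_iff[OF E(1,2) pE' rx] L(2) by blast
    ultimately show "\<exists>x j. local_params X p x \<and> local_equation X E p (x j)"
      by (intro exI[of _ "\<lambda>l q. value_at q (x l)"] exI[of _ j]) simp
  qed
qed

end

section \<open>The relative canonical divisor\<close>

definition restr :: "'n \<Rightarrow> 'n::finite mpoly \<Rightarrow> 'n mpoly" where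
  "restr i A = heval Cst (\<lambda>v. if v = i then 0 else var v) A"

definition zero_coord :: "complex ^ 'n \<Rightarrow> 'n \<Rightarrow> complex ^ 'n" where
  "zero_coord y i = (\<chi> v. if v = i then 0 else y $ v)"

lemma zero_coord_nth [simp]: "zero_coord y i $ i = 0" by (simp add: zero_coord_def)

lemma zero_coord_id: "y $ i = 0 \<Longrightarrow> zero_coord y i = y" by (auto simp: zero_coord_def vec_eq_iff)

lemma rhom_restr: "rhom (restr i)" unfolding restr_def by (rule rhom_heval[OF rhom_Cst])

lemma ev_restr: "ev y (restr i A) = ev (zero_coord y i) A"
proof -
  have "ev y (restr i A) = heval (\<lambda>c. ev y (Cst c)) (\<lambda>v. ev y (if v = i then 0 else var v)) A"
    unfolding restr_def by (rule rhom_heval_comp[OF rhom_ev])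
  also have "(\<lambda>v. ev y (if v = i then 0 else var v)) = (\<lambda>v. zero_coord y i $ v)"
    by (auto simp: ev_simps ev_var zero_coord_def)
  finally have "ev y (restr i A) = heval (\<lambda>c. c) (\<lambda>v. zero_coord y i $ v) A" by (simp only: ev_Cst)
  then show ?thesis by (simp only: ev_def[of "zero_coord y i"] peval_heval)
qed

lemma restr_0_iff: "restr i A = 0 \<longleftrightarrow> (\<forall>y. y $ i = 0 \<longrightarrow> ev y A = 0)"
proof
  assume "restr i A = 0"
  then show "\<forall>y. y $ i = 0 \<longrightarrow> ev y A = 0" using ev_restr[of _ i A] zero_coord_id by (metis ev_simps(1))
next
  assume "\<forall>y. y $ i = 0 \<longrightarrow> ev y A = 0"
  then show "restr i A = 0" by (intro ev_inj) (simp add: ev_restr)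
qed

lemma novar_Cst: "novar i (Cst c)" by (auto simp: novar_def Cst_def)
lemma novar_var: "v \<noteq> i \<Longrightarrow> novar i (var v)" by (auto simp: novar_def var_def mpoly_monom_def lookup_single when_def)
lemma novar_add: "novar i A \<Longrightarrow> novar i B \<Longrightarrow> novar i (A + B)"
  using deg_le_add[of i 0 A B] by (simp add: deg_le_0_novar)
lemma novar_mult: "novar i A \<Longrightarrow> novar i B \<Longrightarrow> novar i (A * B)"
  using deg_le_mult[of i 0 A 0 B] by (simp add: deg_le_0_novar)

lemma novar_pd: "novar i A \<Longrightarrow> novar i (pd v A)"
  unfolding novar_def
proof
  fix m assume A: "\<forall>m\<in>keys A. lookup m i = 0" and "m \<in> keys (pd v A)"
  then have "m + Poly_Mapping.single v 1 \<in> keys A" by (auto simp: in_keys_iff lookup_pd)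
  then have "lookup (m + Poly_Mapping.single v 1) i = 0" using A by blast
  then show "lookup m i = 0" by (simp add: lookup_add)
qed

lemma novar_pd_0: "novar i A \<Longrightarrow> pd i A = 0"
proof (rule poly_mapping_eqI)
  fix m assume A: "novar i A"
  have "m + Poly_Mapping.single i 1 \<notin> keys A"
  proof
    assume "m + Poly_Mapping.single i 1 \<in> keys A"
    then have "lookup (m + Poly_Mapping.single i 1) i = 0" using A unfolding novar_def by blast
    then show False by (simp add: lookup_add)
  qed
  then show "lookup (pd i A) m = lookup 0 m" by (simp add: lookup_pd in_keys_iff)
qed

lemma novar_restr: "novar i (restr i A)"
proof (induction A rule: mpoly_induct)
  case (Cst c) show ?case by (simp add: restr_def heval_Cst[OF rhom_Cst] novar_Cst)
next
  case (var v)
  have "novar i 0" by (simp add: novar_def)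
  then show ?case by (simp add: restr_def heval_var[OF rhom_Cst] novar_var)
next
  case (add P Q) then show ?case by (simp add: rhom_simps[OF rhom_restr] novar_add)
next
  case (mult P Q) then show ?case by (simp add: rhom_simps[OF rhom_restr] novar_mult)
qed

lemma novar_restr_id: "novar i A \<Longrightarrow> restr i A = A"
proof -
  assume A: "novar i A"
  have "restr i A - A = 0"
  proof (rule ev_inj)
    fix y
    have "zero_coord y i = shift_pt y i (- y $ i)" by (auto simp: zero_coord_def shift_pt_def vec_eq_iff)
    then show "ev y (restr i A - A) = 0" using novar_ev[OF A] by (simp add: ev_simps ev_restr)
  qed
  then show ?thesis by simp
qed

lemma restr_mult_nz: "restr i A \<noteq> 0 \<Longrightarrow> restr i B \<noteq> 0 \<Longrightarrow> restr i (A * B) \<noteq> 0"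
  using mpoly_no_zero_div[of "restr i A" "restr i B"] by (auto simp: rhom_simps[OF rhom_restr])

lemma restr_split: "\<exists>B. A = restr i A + var i * B"
proof (induction A rule: mpoly_induct)
  case (Cst c) show ?case by (rule exI[of _ 0]) (simp add: restr_def heval_Cst[OF rhom_Cst])
next
  case (var v) show ?case by (rule exI[of _ "if v = i then 1 else 0"]) (simp add: restr_def heval_var[OF rhom_Cst])
next
  case (add P Q)
  then obtain B C where B: "P = restr i P + var i * B" and C: "Q = restr i Q + var i * C" by blast
  have "P + Q = restr i (P + Q) + var i * (B + C)" unfolding rhom_simps(3)[OF rhom_restr] 
    by (subst B, subst C) (simp add: algebra_simps)
  then show ?case by blast
next
  case (mult P Q)
  then obtain B C where B: "P = restr i P + var i * B" and C: "Q = restr i Q + var i * C" by blast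
  have "P * Q = restr i P * Q + var i * (B * Q)" by (subst B) (simp add: algebra_simps)
  also have "restr i P * Q = restr i P * restr i Q + var i * (restr i P * C)" by (subst C) (simp add: algebra_simps)
  finally have "P * Q = restr i (P * Q) + var i * (B * Q + restr i P * C)" unfolding rhom_simps(4)[OF rhom_restr] 
    by (simp add: algebra_simps)
  then show ?case by blast
qed

lemma deg_le_var_mult: "deg_le i (Suc d) (var i * B) \<Longrightarrow> deg_le i d B" for B :: "'n::finite mpoly"
  unfolding deg_le_def
proof
  fix m assume A: "\<forall>m\<in>keys (var i * B). lookup m i \<le> Suc d" and m: "m \<in> keys B"
  let ?e = "Poly_Mapping.single i (1::nat)"
  have "var i * B = (\<Sum>k\<in>keys B. Poly_Mapping.single (?e + k) (lookup B k))"
    by (subst mpoly_sum_singles[of B]) (simp add: var_def mpoly_monom_def mult_single sum_distrib_left)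
  then have "lookup (var i * B) (?e + m) = (\<Sum>k\<in>keys B. if k = m then lookup B k else 0)"
    by (simp add: lookup_sum lookup_single when_def)
  then have "?e + m \<in> keys (var i * B)" using m by (simp add: in_keys_iff)
  then have "lookup (?e + m) i \<le> Suc d" using A by blast
  then show "lookup m i \<le> d" by (simp add: lookup_add)
qed

lemma deriv_power_zero:
  assumes D: "is_deriv D" and "D b = 0" shows "D (b ^ w * h) = b ^ w * D h"
proof -
  have "D (b ^ w) = 0" using assms(2) is_deriv_power[OF D, of b] by (cases w) (simp_all add: is_deriv_simps[OF D])
  then show ?thesis by (simp add: is_deriv_simps[OF D])
qed

text \<open>For \<open>b\<close> the uniformizer, the derivative with respect to it lowers the order
  by one, which the factor \<open>b\<close> repairs; by \<open>deriv_power_zero\<close> the other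
  parameters lower nothing.\<close>

lemma deriv_power_one:
  assumes D: "is_deriv D" and "D b = 1" shows "b * D (b ^ w * h) = b ^ w * (of_nat w * h + b * D h)"
proof -
  have "b * D (b ^ w) = of_nat w * b ^ w" using assms(2) is_deriv_power[OF D, of b]
    by (cases w) (simp_all add: is_deriv_simps[OF D] mult_ac)
  then have "b * D (b ^ w * h) = of_nat w * b ^ w * h + b ^ w * (b * D h)"
    unfolding is_deriv_simps(2)[OF D] distrib_left by (simp only: mult.assoc[symmetric]) (simp only: mult_ac)
  then show ?thesis by (simp add: algebra_simps)
qed

lemma det_row_scale: "det (\<chi> i j. c i * M i j) = prod c UNIV * det (\<chi> i j. M i j)"
  for M :: "'n::finite \<Rightarrow> 'n \<Rightarrow> 'a::comm_ring_1"
  using det_rows_mul[of c "\<lambda>i. \<chi> j. M i j"] by (simp add: vector_scalar_mult_def)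

lemma det_col_scale: "det (\<chi> i j. c j * M i j) = prod c UNIV * det (\<chi> i j. M i j)"
  for M :: "'n::finite \<Rightarrow> 'n \<Rightarrow> 'a::comm_ring_1"
proof -
  have "det (\<chi> i j. c j * M i j) = det (transpose (\<chi> i j. c j * M i j))" by simp
  also have "transpose (\<chi> i j. c j * M i j) = (\<chi> i j. c i * M j i)" by (simp add: transpose_def)
  also have "det \<dots> = prod c UNIV * det (\<chi> i j. M j i)" by (rule det_row_scale)
  also have "(\<chi> i j. M j i) = transpose (\<chi> i j. M i j)" by (simp add: transpose_def)
  finally show ?thesis by simp
qed

context bir
begin

text \<open>Only one column of the Jacobian matrix, that of the uniformizer, loses a power. One
  factor \<open>a j0\<close> makes up for it, and then each row \<open>r\<close> releases
  \<open>a j0 ^ c r\<close>.\<close>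

lemma det_scaled:
  assumes E: "primeset E" "E \<subseteq> X" "p \<in> E" and P: "params_dual p a \<Delta>" and \<pi>: "a j0 \<in> loc_ring E"
    and h: "\<And>r. h r \<in> loc_ring E" and s: "\<And>r. s r = a j0 ^ c r * h r"
  shows "\<exists>t\<in>loc_ring E. a j0 * det (\<chi> r j. \<Delta> j (s r)) = a j0 ^ sum c UNIV * t"
proof -
  let ?\<pi> = "a j0"
  have D: "is_deriv (\<Delta> j)" and \<Delta>a: "\<Delta> j (a l) = (if l = j then 1 else 0)" for j l using P by (auto simp: params_dual_def dual_def)
  have \<Delta>L: "\<And>j r. r \<in> loc_ring E \<Longrightarrow> \<Delta> j r \<in> loc_ring E" using params_dual_loc_ring[OF E P] .
  \<comment> \<open>The entries after the column \<open>j0\<close> is multiplied by the uniformizer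
    and the power \<open>c r\<close> is taken out of the row \<open>r\<close>.\<close>
  define H where "H r j = (if j = j0 then of_nat (c r) * h r + ?\<pi> * \<Delta> j (h r) else \<Delta> j (h r))" for r j
  have natL: "of_nat k \<in> loc_ring E" for k using loc_ring_rules(3)[OF E(1,2), of "of_int (int k)"] unfolding rhom_of_int[OF rhom_of_const] by simp
  have HL: "H r j \<in> loc_ring E" for r j unfolding H_def
    by (cases "j = j0") (simp_all only: if_True if_False simp_thms natL h \<Delta>L \<pi> loc_ring_rules(1,2)[OF E(1,2)])
  have e: "(if j = j0 then ?\<pi> else 1) * \<Delta> j (s r) = ?\<pi> ^ c r * H r j" for r j
  proof (cases "j = j0")
    case True
    have "\<Delta> j ?\<pi> = 1" using True by (simp add: \<Delta>a)
    from deriv_power_one[OF D this, of "c r" "h r"] show ?thesis using True by (simp only: s H_def if_True simp_thms)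
  next
    case False
    have "\<Delta> j ?\<pi> = 0" using False by (simp add: \<Delta>a)
    from deriv_power_zero[OF D this, of "c r" "h r"] show ?thesis using False by (simp only: s H_def if_False mult_1_left)
  qed
  have "(\<Prod>j\<in>UNIV. if j = j0 then ?\<pi> else 1) * det (\<chi> r j. \<Delta> j (s r)) = det (\<chi> r j. (if j = j0 then ?\<pi> else 1) * \<Delta> j (s r))"
    by (rule det_col_scale[of "\<lambda>j. if j = j0 then ?\<pi> else 1" "\<lambda>r j. \<Delta> j (s r)", symmetric])
  also have "\<dots> = (\<Prod>r\<in>UNIV. ?\<pi> ^ c r) * det (\<chi> r j. H r j)" unfolding e by (rule det_row_scale[of "\<lambda>r. ?\<pi> ^ c r" H])
  also have "(\<Prod>r\<in>UNIV. ?\<pi> ^ c r) = ?\<pi> ^ sum c UNIV" by (rule power_sum[symmetric])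
  also have "(\<Prod>j\<in>UNIV. if j = j0 then ?\<pi> else 1) = ?\<pi>" by simp
  finally have "?\<pi> * det (\<chi> r j. \<Delta> j (s r)) = ?\<pi> ^ sum c UNIV * det (\<chi> r j. H r j)" .
  moreover have "det (\<chi> r j. H r j) \<in> loc_ring E" using HL by (intro loc_ring_det[OF E(1,2)]) simp
  ultimately show ?thesis by blast
qed

text \<open>The form dz_1/z_1 ... dz_n/z_n has at most a simple pole along \<open>E\<close>, that
  is, complex n-space with its coordinate hyperplanes is log canonical.\<close>

lemma K_lower:
  assumes E: "irreducible_closed E" "E \<subseteq> X" "E \<noteq> X" and g: "gooddiv X E" and w: "\<And>k. has_order E (w k) (coord k)"
  shows "sum w UNIV \<le> mult_K X E + 1"
proof -
  note pE = irreducible_primeset[OF E(1)]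
  obtain p a j0 \<Delta> where 1: "p \<in> E" "params_dual p a \<Delta>" "loceq E p (a j0)" "unif E (a j0)"
    by (rule gooddiv_unif[OF E g]) (rule that)
  let ?\<pi> = "a j0"
  have \<pi>: "?\<pi> \<in> max_ideal E" "?\<pi> \<noteq> 0" "\<And>r. r \<in> max_ideal E \<Longrightarrow> \<exists>h\<in>loc_ring E. r = ?\<pi> * h" using 1(4) by (auto simp: unif_def)
  have "\<forall>k. \<exists>h. h \<in> loc_ring E \<and> coord k = ?\<pi> ^ w k * h" using has_order_unif[OF pE E(2) w \<pi>] by blast
  then obtain h where h: "\<And>k. h k \<in> loc_ring E" "\<And>k. coord k = ?\<pi> ^ w k * h k" unfolding choice_iff by blast
  from det_scaled[where h = h and s = coord and c = w, OF pE E(2) 1(1,2) max_ideal_loc_ring'[OF \<pi>(1)] h]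
  obtain t where t: "t \<in> loc_ring E" "?\<pi> * det (\<chi> r j. \<Delta> j (coord r)) = ?\<pi> ^ sum w UNIV * t" by (elim bexE)
  have o1: "has_order E 1 ?\<pi>" unfolding has_order_def using 1(4) loc_ring_1[OF pE E(2)] loc_ring_rules(8)[OF pE E(2)]
    by (intro exI[of _ ?\<pi>] exI[of _ 1]) auto
  have "has_order E (1 + mult_K X E) (?\<pi> * det (\<chi> r j. \<Delta> j (coord r)))"
    by (rule has_order_mult[OF pE E(2) o1 mult_K_eq[OF E g 1(1,2)]])
  moreover have "has_order E (sum w UNIV * 1) (?\<pi> ^ sum w UNIV)" by (rule has_order_power[OF pE E(2) o1])
  ultimately have "sum w UNIV * 1 \<le> 1 + mult_K X E" unfolding t(2) by (intro has_order_le[OF pE E(2) _ t(1)])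
  then show ?thesis by simp
qed

text \<open>Compared with \<open>K_lower\<close>, the function \<open>R\<close>, which vanishes on
  \<open>E\<close>, takes the place of the coordinate \<open>k\<close>. It contributes one extra
  power of the uniformizer, which cancels the pole, while the exchange changes the Jacobian
  determinant only by the unit \<open>pd k R\<close>.\<close>

lemma K_lower_plt:
  assumes E: "irreducible_closed E" "E \<subseteq> X" "E \<noteq> X" and g: "gooddiv X E" and w: "has_order E m (coord i)"
    and R: "of_mpoly R \<in> max_ideal E" "novar i R" "of_mpoly (pd k R) \<notin> max_ideal E" "k \<noteq> i"
  shows "m \<le> mult_K X E"
proof -
  note pE = irreducible_primeset[OF E(1)]
  obtain p a j0 \<Delta> where 1: "p \<in> E" "params_dual p a \<Delta>" "loceq E p (a j0)" "unif E (a j0)"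
    by (rule gooddiv_unif[OF E g]) (rule that)
  let ?\<pi> = "a j0"
  have \<pi>: "?\<pi> \<in> max_ideal E" "?\<pi> \<noteq> 0" "\<And>r. r \<in> max_ideal E \<Longrightarrow> \<exists>h\<in>loc_ring E. r = ?\<pi> * h" using 1(4) by (auto simp: unif_def)
  have D: "is_deriv (\<Delta> j)" for j using 1(2) by (auto simp: params_dual_def dual_def)
  obtain hi where hi: "hi \<in> loc_ring E" "coord i = ?\<pi> ^ m * hi" using has_order_unif[OF pE E(2) w \<pi>] by blast
  obtain hR where hR: "hR \<in> loc_ring E" "of_mpoly R = ?\<pi> * hR" using \<pi>(3)[OF R(1)] by blast
  define s where "s r = (if r = k then of_mpoly R else coord r)" for r
  define c where "c r = (if r = k then 1 else if r = i then m else 0)" for r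
  define h where "h r = (if r = k then hR else if r = i then hi else coord r)" for r
  have shift_poly: "h r \<in> loc_ring E" "s r = ?\<pi> ^ c r * h r" for r
    using hi hR loc_ring_rules(4)[OF pE E(2)] by (auto simp: s_def c_def h_def)
  from det_scaled[where h = h and s = s and c = c, OF pE E(2) 1(1,2) max_ideal_loc_ring'[OF \<pi>(1)] shift_poly]
  obtain t where t: "t \<in> loc_ring E" "?\<pi> * det (\<chi> r j. \<Delta> j (s r)) = ?\<pi> ^ sum c UNIV * t" by (elim bexE)
  have "sum c UNIV = (\<Sum>r\<in>{k, i}. c r)" by (rule sum.mono_neutral_right) (auto simp: c_def)
  then have sc: "sum c UNIV = 1 + m" using R(4) by (simp add: c_def)
  let ?J = "\<chi> r j. \<Delta> j (coord r)"
  let ?x = "\<chi> l. of_mpoly (pd l R)"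
  have dR: "\<Delta> j (of_mpoly R) = (\<Sum>l\<in>UNIV. of_mpoly (pd l R) * \<Delta> j (coord l))" for j
    using is_deriv_heval[OF D, of j coord R] by (simp add: of_mpoly_heval)
  \<comment> \<open>By the chain rule the row of \<open>R\<close> is a combination of the rows of
    the Jacobian matrix, in which row \<open>k\<close> has coefficient
    \<open>pd k R\<close>.\<close>
  have "(\<chi> r. if r = k then \<Sum>l\<in>UNIV. ?x $ l *s row l ?J else row r ?J) = (\<chi> r j. \<Delta> j (s r))"
    by (auto simp: vec_eq_iff s_def row_def dR)
  then have "det (\<chi> r j. \<Delta> j (s r)) = of_mpoly (pd k R) * det ?J"
    using cramer_lemma_transpose[of k ?x ?J] by simp
  then have eq: "?\<pi> ^ (1 + m) * t = ?\<pi> * (of_mpoly (pd k R) * det ?J)" using t(2) by (simp only: sc)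
  have o1: "has_order E 1 ?\<pi>" unfolding has_order_def using 1(4) loc_ring_1[OF pE E(2)] loc_ring_rules(8)[OF pE E(2)]
    by (intro exI[of _ ?\<pi>] exI[of _ 1]) auto
  have o0: "has_order E 0 (of_mpoly (pd k R))" by (rule has_order_unit[OF 1(4) loc_ring_of_mpoly[OF pE E(2)] R(3)])
  have "has_order E (1 + (0 + mult_K X E)) (?\<pi> * (of_mpoly (pd k R) * det ?J))"
    by (intro has_order_mult[OF pE E(2)] o1 o0 mult_K_eq[OF E g 1(1,2)])
  moreover have "has_order E ((1 + m) * 1) (?\<pi> ^ (1 + m))" by (rule has_order_power[OF pE E(2) o1])
  ultimately have "(1 + m) * 1 \<le> 1 + (0 + mult_K X E)" unfolding eq[symmetric] by (intro has_order_le[OF pE E(2) _ t(1)])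
  then show ?thesis by simp
qed

text \<open>The description of \<open>X\<close> as a graph extends from the set where
  \<open>f\<close> is nonzero to all points where some \<open>G j\<close> is nonzero, because
  \<open>X\<close> is closed and satisfies the proportionality relations between its homogeneous
  coordinates and the \<open>G j\<close>.\<close>

lemma fibre:
  assumes "Gv y \<noteq> 0" shows "graph_pt y \<in> X" "{l. (y, l) \<in> X} = {abs_proj (Gv y)}"
proof -
  have zc: "zclosed X" using irreducible_closedD(1)[OF irr] .
  show gX: "graph_pt y \<in> X"
  proof (rule ccontr)
    assume "graph_pt y \<notin> X"
    then obtain d P where P: "hom d P" "pval P (graph_pt y) \<noteq> 0" "\<And>q. q \<in> X \<Longrightarrow> pval P q = 0"
      using zclosed_separate[OF zc] by blast
    have "on_graph P = 0" using X_van_iff[OF P(1)] P(3) by (auto simp: nonvan_def)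
    then show False using pval_graph_pt_0_iff[OF assms P(1)] P(2) by (simp add: ev_simps)
  qed
  have "l = abs_proj (Gv y)" if l: "(y, l) \<in> X" for l
  proof -
    obtain k where k: "Gv y $ k \<noteq> 0" using assms by (auto simp: vec_eq_iff)
    have e: "rep_proj l $ j * Gv y $ k = rep_proj l $ k * Gv y $ j" for j
    proof -
      let ?P = "var (Inr j) * emb (G k) - var (Inr k) * emb (G j)"
      have "hom (1 + 0) ?P" by (intro hom_diff hom_mult hom_Inr hom_emb)
      moreover have "on_graph ?P = 0" by simp
      ultimately have "pval ?P (y, l) = 0" using X_van_iff[of 1 ?P] l by (auto simp: nonvan_def)
      then show ?thesis by (simp add: pval_simps pval_emb Gv_def)
    qed
    have "rep_proj l $ k \<noteq> 0"
    proof
      assume "rep_proj l $ k = 0"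
      then have "rep_proj l $ j = 0" for j using e[of j] k by simp
      then have "rep_proj l = 0" by (simp add: vec_eq_iff)
      then show False using proj_rep_nz by blast
    qed
    have "rep_proj l $ j = rep_proj l $ k / Gv y $ k * Gv y $ j" for j
      using e[of j] k by (simp add: field_simps)
    then have "rep_proj l = (rep_proj l $ k / Gv y $ k) *s Gv y"
      unfolding vec_eq_iff vector_smult_component by blast
    moreover have "rep_proj l $ k / Gv y $ k \<noteq> 0" using k \<open>rep_proj l $ k \<noteq> 0\<close> by simp
    ultimately have "abs_proj (Gv y) = abs_proj (rep_proj l)" using proj_abs_eq[OF assms proj_rep_nz] by blast
    then show ?thesis by (simp add: proj_abs_rep)
  qed
  then show "{l. (y, l) \<in> X} = {abs_proj (Gv y)}" using gX unfolding graph_pt_def by blast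
qed

lemma iso_over_G:
  assumes "Gv y \<noteq> 0" shows "iso_over X y"
proof -
  obtain k where k: "Gv y $ k \<noteq> 0" using assms by (auto simp: vec_eq_iff)
  show ?thesis unfolding iso_over_def
  proof (intro exI[of _ "G k"] exI[of _ G] conjI allI impI)
    show "peval (($) y) (G k) \<noteq> 0" using k by (simp add: Gv_def ev_def)
    fix y' assume "peval (($) y') (G k) \<noteq> 0"
    then have "Gv y' $ k \<noteq> 0" by (simp add: Gv_def ev_def)
    then have "Gv y' \<noteq> 0" by auto
    then show "(\<chi> j. peval (($) y') (G j)) \<noteq> 0" "{l. (y', l) \<in> X} = {abs_proj (\<chi> j. peval (($) y') (G j))}"
      using fibre(2)[of y'] by (simp_all add: Gv_def ev_def)
  qed
qed

text \<open>The strict transform is the closure of the graph over \<open>z\<^sub>i = 0\<close> once the \<open>G j\<close> are not all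
  divisible by \<open>z\<^sub>i\<close>.\<close>

lemma strict_transform_nonvan:
  assumes k: "restr i (G k) \<noteq> 0" and P: "hom d P"
  shows "nonvan {p \<in> X. fst p $ i = 0 \<and> iso_over X (fst p)} P \<longleftrightarrow> restr i (on_graph P) \<noteq> 0" (is "nonvan ?T P \<longleftrightarrow> _")
proof
  assume "restr i (on_graph P) \<noteq> 0"
  then have "restr i (on_graph P * G k) \<noteq> 0" by (rule restr_mult_nz[OF _ k])
  then obtain y where y: "y $ i = 0" "ev y (on_graph P * G k) \<noteq> 0" unfolding restr_0_iff by blast
  then have "Gv y $ k \<noteq> 0" by (simp add: Gv_def ev_simps)
  then have G: "Gv y \<noteq> 0" by auto
  have "graph_pt y \<in> ?T" using fibre(1)[OF G] iso_over_G[OF G] y(1) by (simp add: graph_pt_def)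
  moreover have "pval P (graph_pt y) \<noteq> 0" using pval_graph_pt_0_iff[OF G P] y(2) by (simp add: ev_simps)
  ultimately show "nonvan ?T P" unfolding nonvan_def by blast
next
  assume "nonvan ?T P"
  then obtain p where p: "p \<in> X" "fst p $ i = 0" "iso_over X (fst p)" "pval P p \<noteq> 0" unfolding nonvan_def by blast
  then obtain f' G' where f': "peval (($) (fst p)) f' \<noteq> 0" and 
    G': "\<And>y. peval (($) y) f' \<noteq> 0 \<Longrightarrow> (\<chi> j. peval (($) y) (G' j)) \<noteq> 0 \<and> {l. (y, l) \<in> X} = {abs_proj (\<chi> j. peval (($) y) (G' j))}"
    unfolding iso_over_def by blast
  \<comment> \<open>Over a neighbourhood of \<open>fst p\<close> the inverse of the map may be given
    by other polynomials \<open>G'\<close>. Where both are defined the two graphs coincide, since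
    each is the whole fibre; this transfers vanishing on z_i = 0 from one to the other.\<close>
  interpret B: bir X f' G'
  proof
    show "irreducible_closed X" by (rule irr)
    show "f' \<noteq> 0" using f' by (auto simp: peval_def)
    fix y assume "ev y f' \<noteq> 0"
    then show "(\<chi> j. ev y (G' j)) \<noteq> 0 \<and> {l. (y, l) \<in> X} = {abs_proj (\<chi> j. ev y (G' j))}" using G'[of y] by (simp add: ev_def)
  qed
  have fp: "ev (fst p) f' \<noteq> 0" using f' by (simp add: ev_def)
  show "restr i (on_graph P) \<noteq> 0"
  proof
    assume z: "restr i (on_graph P) = 0"
    have "restr i (f' * G k * B.on_graph P) = 0" unfolding restr_0_iff
    proof (intro allI impI)
      fix y :: "complex ^ 'n" assume y: "y $ i = 0"
      show "ev y (f' * G k * B.on_graph P) = 0"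
      proof (cases "ev y f' = 0 \<or> ev y (G k) = 0")
        case False
        then have "Gv y $ k \<noteq> 0" by (simp add: Gv_def)
        then have G: "Gv y \<noteq> 0" by auto
        have F: "B.Gv y \<noteq> 0" using B.fnz False by blast
        have "B.graph_pt y = graph_pt y" using fibre(2)[OF G] B.fibre(2)[OF F] by (simp add: graph_pt_def B.graph_pt_def)
        moreover have "ev y (on_graph P) = 0" using z y by (simp add: restr_0_iff)
        ultimately have "ev y (B.on_graph P) = 0" using pval_graph_pt_0_iff[OF G P] B.pval_graph_pt_0_iff[OF F P] by simp
        then show ?thesis by (simp add: ev_simps)
      qed (auto simp: ev_simps)
    qed
    moreover have "restr i f' \<noteq> 0" using fp p(2) by (auto simp: restr_0_iff)
    ultimately have "restr i (B.on_graph P) = 0"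
      using restr_mult_nz[OF restr_mult_nz[of i f' "G k"], of "B.on_graph P"] k by blast
    then have "ev (fst p) (B.on_graph P) = 0" using p(2) by (simp add: restr_0_iff)
    then have "pval P (B.graph_pt (fst p)) = 0" using B.pval_graph_pt_0_iff[OF B.fnz[OF fp] P] by simp
    then show False using p(4) B.X_graph_pt[OF p(1) fp] by simp
  qed
qed

lemma strict_transform_props:
  assumes k: "restr i (G k) \<noteq> 0"
  shows "irreducible_closed (strict_transform X i)" "strict_transform X i \<subseteq> X" "strict_transform X i \<noteq> X"
proof -
  let ?T = "{p \<in> X. fst p $ i = 0 \<and> iso_over X (fst p)}"
  note nv = strict_transform_nonvan[OF k]
  have "primeset ?T" unfolding primeset_def
  proof (intro conjI allI impI)
    have "nonvan ?T 1" using nv[OF hom_1] by (simp add: rhom_simps[OF rhom_restr])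
    then show "?T \<noteq> {}" unfolding nonvan_def by blast
    fix d e P Q assume h: "hom d P" "hom e Q" and n: "nonvan ?T P" "nonvan ?T Q"
    have "restr i (on_graph (P * Q)) \<noteq> 0" using n nv[OF h(1)] nv[OF h(2)] restr_mult_nz[of i "on_graph P" "on_graph Q"] by simp
    then show "nonvan ?T (P * Q)" using nv[OF hom_mult[OF h]] by simp
  qed
  then show "irreducible_closed (strict_transform X i)" unfolding strict_transform_def by (rule primeset_closure_irreducible)
  have TX: "?T \<subseteq> X" by blast
  show "strict_transform X i \<subseteq> X" unfolding strict_transform_def by (rule zclosure_min[OF irreducible_closedD(1)[OF irr] TX])
  show "strict_transform X i \<noteq> X"
  proof
    assume e: "strict_transform X i = X"
    have "\<not> nonvan ?T (var (Inl i))" using nv[OF hom_Inl, of i] by (simp add: restr_0_iff ev_var)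
    then have "\<forall>p\<in>?T. pval (var (Inl i)) p = 0" unfolding nonvan_def by blast
    then have "\<forall>p\<in>strict_transform X i. pval (var (Inl i)) p = 0"
      unfolding strict_transform_def using zclosure_van_iff[OF hom_Inl] by blast
    then have "\<not> nonvan X (var (Inl i))" unfolding e nonvan_def by blast
    then have "var i = 0" using X_van_iff[OF hom_Inl, of i] by simp
    then have "ev (\<chi> v. 1) (var i) = 0" by (simp only: ev_simps(1))
    then show False by (simp add: ev_var)
  qed
qed

text \<open>Tells the strict transform apart from the centres of weights that are positive at some
  \<open>j\<close> other than \<open>i\<close>.\<close>

lemma strict_transform_notin:
  assumes k: "restr i (G k) \<noteq> 0" and j: "j \<noteq> i"
  shows "\<exists>p\<in>strict_transform X i. fst p $ j \<noteq> 0"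
proof -
  have "restr i (on_graph (var (Inl j))) \<noteq> 0"
  proof -
    define y :: "complex ^ 'n" where "y = (\<chi> v. if v = j then 1 else 0)"
    have "y $ i = 0" "ev y (var j) \<noteq> 0" using j by (simp_all add: ev_var y_def)
    then have "\<not> (\<forall>y. y $ i = 0 \<longrightarrow> ev y (var j) = 0)" by blast
    then show ?thesis by (simp only: restr_0_iff on_graph_var simp_thms)
  qed
  then have "nonvan {p \<in> X. fst p $ i = 0 \<and> iso_over X (fst p)} (var (Inl j))" using strict_transform_nonvan[OF k hom_Inl] by blast
  then obtain p where p: "p \<in> {p \<in> X. fst p $ i = 0 \<and> iso_over X (fst p)}" "pval (var (Inl j)) p \<noteq> 0"
    unfolding nonvan_def by blast
  have "p \<in> strict_transform X i" using subsetD[OF zclosure_subset p(1)] by (simp only: strict_transform_def)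
  then show ?thesis by (rule bexI[rotated]) (use p(2) in \<open>simp add: pval_simps\<close>)
qed

text \<open>This says that the pair \<open>(\<complex>\<^sup>n, H)\<close> is purely log terminal.\<close>

lemma K_plt:
  assumes pdv: "prime_divisor X E" and g: "gooddiv X E" and k: "restr i (G k) \<noteq> 0" and w: "has_order E m (coord i)" "0 < m"
    and ne: "E \<noteq> strict_transform X i"
  shows "m \<le> mult_K X E"
proof -
  note E = prime_divisorD[OF pdv]
  note pE = irreducible_primeset[OF E(1)]
  obtain p1 where p1: "p1 \<in> E" using irreducible_closedD(2)[OF E(1)] by blast
  have n1: "nonvan E 1" unfolding nonvan_def by (rule bexI[OF _ p1]) (simp add: pval_simps)
  have MXi: "of_mpoly A \<in> max_ideal E \<longleftrightarrow> (\<forall>p\<in>E. ev (fst p) A = 0)" for A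
    using max_ideal_iff[OF pE E(2) hom_emb hom_1 n1, of A] by (simp add: nonvan_def pval_emb)
  have zM: "coord i \<in> max_ideal E" using has_order_pos[OF pE E(2) w(1)] w(2) by simp
  then have Ei: "fst p $ i = 0" if "p \<in> E" for p using MXi[of "var i"] that by (simp add: coord_def ev_var)
  \<comment> \<open>Otherwise a dense part of \<open>E\<close> lies over points of z_i = 0 at which
    the map is an isomorphism. Then \<open>E\<close> is contained in the strict transform and equals
    it by maximality.\<close>
  have "\<forall>p\<in>E. Gv (fst p) = 0"
  proof (rule ccontr)
    assume "\<not> ?thesis"
    then obtain p0 where p0: "p0 \<in> E" "Gv (fst p0) \<noteq> 0" by blast
    then obtain l where l: "Gv (fst p0) $ l \<noteq> 0" by (auto simp: vec_eq_iff)
    let ?C = "{p :: ('n, 'm) pt. pval (emb (G l)) p = 0}"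
    have "zclosed ?C" by (rule zclosed_hom[OF hom_emb])
    moreover have "\<not> E \<subseteq> ?C" using p0(1) l by (auto simp: pval_emb Gv_def)
    moreover have "p \<in> {p \<in> X. fst p $ i = 0 \<and> iso_over X (fst p)}" if "p \<in> E" "p \<notin> ?C" for p
    proof -
      have "Gv (fst p) $ l \<noteq> 0" using that(2) by (simp add: pval_emb Gv_def)
      then have "Gv (fst p) \<noteq> 0" by auto
      then show ?thesis using iso_over_G Ei that(1) E(2) by blast
    qed
    ultimately have "E \<subseteq> strict_transform X i" unfolding strict_transform_def by (rule closure_contains[OF E(1)])
    then show False using pdv ne strict_transform_props[OF k] unfolding prime_divisor_def by blast
  qed
  then have "\<forall>p\<in>E. ev (fst p) (restr i (G k)) = 0" using Ei by (auto simp: ev_restr zero_coord_id Gv_def vec_eq_iff)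
  then have R0: "of_mpoly (restr i (G k)) \<in> max_ideal E" by (simp add: MXi)
  \<comment> \<open>Contains the nonzero polynomial \<open>restr i (G k)\<close> but no nonzero
    constant, hence is not stable under partial derivatives. This yields the \<open>R\<close> that
    \<open>K_lower_plt\<close> asks for.\<close>
  define I where "I = {R. novar i R \<and> of_mpoly R \<in> max_ideal E}"
  have "\<exists>R v. R \<in> I \<and> pd v R \<notin> I"
  proof (rule ccontr)
    assume "\<not> ?thesis"
    then have cl: "\<And>R v. R \<in> I \<Longrightarrow> pd v R \<in> I" by blast
    have "restr i (G k) \<in> I" using R0 novar_restr by (simp add: I_def)
    then obtain c where c: "c \<noteq> 0" "Cst c \<in> I" using pd_closed_const[of I "restr i (G k)", OF cl] k by blast
    then have "of_const c \<in> max_ideal E" by (simp add: I_def of_const_def)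
    then show False using c(1) max_ideal_of_const[OF pE E(2)] by blast
  qed
  then obtain R v where R: "R \<in> I" "pd v R \<notin> I" by blast
  then have 1: "of_mpoly R \<in> max_ideal E" "novar i R" by (auto simp: I_def)
  have 2: "of_mpoly (pd v R) \<notin> max_ideal E" using R(2) novar_pd[OF 1(2)] by (auto simp: I_def)
  have "v \<noteq> i"
  proof
    assume "v = i"
    then have "pd v R = 0" using novar_pd_0[OF 1(2)] by simp
    then show False using 2 max_ideal_0[OF pE E(2)] by simp
  qed
  then show ?thesis by (rule K_lower_plt[OF E g w(1) 1 2])
qed

end

text \<open>Dividing all \<open>G k\<close> by a common factor z_i leaves the projective point
  unchanged where z_i is nonzero, at the price of a factor z_i in \<open>f\<close>. The degree of
  one nonzero \<open>G k\<close> in z_i bounds the number of divisions.\<close>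

lemma bir_normalise:
  assumes "bir X f G" "deg_le i d (G k)" "G k \<noteq> 0"
  shows "\<exists>f G k. bir X f G \<and> restr i (G k) \<noteq> 0"
  using assms
proof (induction d arbitrary: f G)
  case 0
  then have "restr i (G k) = G k" by (simp add: deg_le_0_novar novar_restr_id)
  then show ?case using 0 by metis
next
  case (Suc d)
  show ?case
  proof (cases "\<exists>k. restr i (G k) \<noteq> 0")
    case True then show ?thesis using Suc by blast
  next
    case False
    then have "\<forall>k. \<exists>B. G k = var i * B" using restr_split[of "G _" i] by (metis add_0)
    then obtain G' where G': "\<And>k. G k = var i * G' k" by metis
    interpret B: bir X f G by fact
    have v0: "var i \<noteq> (0 :: 'a mpoly)" using Suc.prems(3) G' by auto
    have "bir X (f * var i) G'"
    proof
      show "irreducible_closed X" by (rule B.irr)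
      show "f * var i \<noteq> 0" using B.f0 v0 mpoly_no_zero_div by blast
      fix y assume y: "ev y (f * var i) \<noteq> 0"
      then have f: "ev y f \<noteq> 0" "y $ i \<noteq> 0" by (auto simp: ev_simps ev_var)
      have e: "(\<chi> j. ev y (G j)) = (y $ i) *s (\<chi> j. ev y (G' j))" by (simp add: vec_eq_iff G' ev_simps ev_var)
      have 1: "(\<chi> j. ev y (G' j)) \<noteq> 0" using B.graph[OF f(1)] e by auto
      have "abs_proj (\<chi> j. ev y (G' j)) = abs_proj (\<chi> j. ev y (G j))"
        using proj_abs_eq[OF 1, of "\<chi> j. ev y (G j)"] B.graph[OF f(1)] e f(2) by blast
      then show "(\<chi> j. ev y (G' j)) \<noteq> 0 \<and> {l. (y, l) \<in> X} = {abs_proj (\<chi> j. ev y (G' j))}"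
        using 1 B.graph[OF f(1)] by simp
    qed
    moreover have "deg_le i d (G' k)" using Suc.prems(2) unfolding G' by (rule deg_le_var_mult)
    moreover have "G' k \<noteq> 0" using Suc.prems(3) G' by auto
    ultimately show ?thesis using Suc.IH by blast
  qed
qed

lemma bir_of_iso:
  assumes "irreducible_closed X" "iso_over X z"
  obtains f G where "bir X f G" "ev z f \<noteq> 0"
proof -
  obtain f G where f: "peval (($) z) f \<noteq> 0" and 
    G: "\<And>y. peval (($) y) f \<noteq> 0 \<Longrightarrow> (\<chi> j. peval (($) y) (G j)) \<noteq> 0 \<and> {l. (y, l) \<in> X} = {abs_proj (\<chi> j. peval (($) y) (G j))}"
    using assms(2) unfolding iso_over_def by blast
  have "bir X f G"
  proof
    show "irreducible_closed X" by (rule assms(1))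
    show "f \<noteq> 0" using f by (auto simp: peval_def)
    fix y assume "ev y f \<noteq> 0"
    then show "(\<chi> j. ev y (G j)) \<noteq> 0 \<and> {l. (y, l) \<in> X} = {abs_proj (\<chi> j. ev y (G j))}" using G[of y] by (simp add: ev_def)
  qed
  then show ?thesis using that f by (simp add: ev_def)
qed

lemma bir_exists:
  assumes "irreducible_closed X" "iso_over X z"
  obtains f G k where "bir X f G" "restr i (G k) \<noteq> 0"
proof -
  obtain f G where B: "bir X f G" "ev z f \<noteq> 0" using bir_of_iso[OF assms] by blast
  interpret bir X f G by (rule B(1))
  have "\<exists>k. G k \<noteq> 0"
  proof (rule ccontr)
    assume "\<not> ?thesis"
    then have "Gv z = 0" by (simp add: Gv_def vec_eq_iff ev_simps)
    then show False using fnz[OF B(2)] by blast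
  qed
  then obtain k where k: "G k \<noteq> 0" by blast
  obtain d where "deg_le i d (G k)" using deg_le_exists by blast
  then show ?thesis using bir_normalise[OF B(1) _ k] that by blast
qed

text \<open>A divisor inside the exceptional locus is one of the components in the normal crossing
  condition, which gives the equation at each of its points. Any other divisor has a point over
  which the map is an isomorphism, and is then treated as a hypersurface in complex n-space.\<close>

lemma gooddiv_all:
  assumes L: "log_resolution I i X" and pdv: "prime_divisor X E" shows "gooddiv X E"
proof (cases "E \<subseteq> exceptional_locus X")
  case True
  note E = prime_divisorD[OF pdv]
  have "\<exists>x j. local_params X p x \<and> local_equation X E p (x j)" if p: "p \<in> E" for p
  proof -
    have "p \<in> X" using p E by blast
    then obtain x where "local_params X p x" "\<forall>E'\<in>{E. prime_divisor X E \<and>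
       (0 < mult_F X I E \<or> 0 < ord_along X E (pullback (var i)) \<or> 0 < mult_K X E \<or>
        E \<subseteq> exceptional_locus X)}. p \<in> E' \<longrightarrow> (\<exists>j. local_equation X E' p (x j))"
      using L unfolding log_resolution_def snc_def by blast
    then show ?thesis using True pdv p by blast
  qed
  then show ?thesis unfolding gooddiv_def using zclosed_empty irreducible_closedD(2)[OF E(1)] by (intro exI[of _ "{}"]) auto
next
  case False
  note E = prime_divisorD[OF pdv]
  obtain p where p: "p \<in> E" "iso_over X (fst p)" using False E unfolding exceptional_locus_def by blast
  obtain f G where B: "bir X f G" "ev (fst p) f \<noteq> 0" 
    using bir_of_iso[OF _ p(2)] L unfolding log_resolution_def by blast
  show ?thesis by (rule bir.gooddiv_nonexceptional[OF B(1) pdv p(1) B(2)])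
qed

section \<open>Monomial valuations\<close>

definition wt :: "('n \<Rightarrow> real) \<Rightarrow> ('n::finite \<Rightarrow>\<^sub>0 nat) \<Rightarrow> real" where
  "wt w m = (\<Sum>j\<in>UNIV. w j * real (lookup m j))"

lemma wt_add: "wt w (m + m') = wt w m + wt w m'"
  by (simp add: wt_def lookup_add algebra_simps sum.distrib)

lemma wt_0 [simp]: "wt w 0 = 0" by (simp add: wt_def)

lemma wt_nonneg: "(\<And>j. 0 \<le> w j) \<Longrightarrow> 0 \<le> wt w m"
  unfolding wt_def by (intro sum_nonneg) auto

lemma wt_single: "wt w (Poly_Mapping.single j k) = w j * real k"
proof -
  have "wt w (Poly_Mapping.single j k) = (\<Sum>i\<in>UNIV. if i = j then w j * real k else 0)"
    unfolding wt_def by (rule sum.cong) (auto simp: lookup_single when_def)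
  then show ?thesis by simp
qed

definition wt_ge :: "('n \<Rightarrow> real) \<Rightarrow> real \<Rightarrow> 'n::finite mpoly \<Rightarrow> bool" where
  "wt_ge w s A \<longleftrightarrow> (\<forall>m\<in>keys A. s \<le> wt w m)"

text \<open>The part of weight exactly \<open>s\<close>: the initial form if \<open>s\<close> is the
  least weight occurring, and 0 if \<open>s\<close> is smaller. The parameter makes it additive and,
  under \<open>wt_ge\<close>, multiplicative without case distinctions.\<close>

definition ini :: "('n \<Rightarrow> real) \<Rightarrow> real \<Rightarrow> 'n::finite mpoly \<Rightarrow> 'n mpoly" where
  "ini w s A = (\<Sum>m\<in>{m\<in>keys A. wt w m = s}. Poly_Mapping.single m (lookup A m))"

lemma lookup_ini: "lookup (ini w s A) m = (if wt w m = s then lookup A m else 0)"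
proof -
  have "lookup (ini w s A) m = (\<Sum>m'\<in>{m\<in>keys A. wt w m = s}. if m' = m then lookup A m' else 0)"
    unfolding ini_def lookup_sum lookup_single when_def ..
  also have "\<dots> = (if wt w m = s then lookup A m else 0)"
    by (subst sum.delta) (auto simp: in_keys_iff)
  finally show ?thesis .
qed

lemma wt_ge_add: "wt_ge w s A \<Longrightarrow> wt_ge w s B \<Longrightarrow> wt_ge w s (A + B)"
  unfolding wt_ge_def using Poly_Mapping.keys_add[of A B] by blast

lemma wt_ge_0 [simp]: "wt_ge w s 0" by (simp add: wt_ge_def)

lemma wt_ge_sum: "(\<And>i. i \<in> I \<Longrightarrow> wt_ge w s (A i)) \<Longrightarrow> wt_ge w s (sum A I)"
  by (induction I rule: infinite_finite_induct) (auto intro: wt_ge_add)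

lemma ini_add: "ini w s (A + B) = ini w s A + ini w s B"
  by (rule poly_mapping_eqI) (simp add: lookup_ini lookup_add)

lemma ini_0 [simp]: "ini w s 0 = 0"
  by (rule poly_mapping_eqI) (simp add: lookup_ini)

lemma ini_sum: "ini w s (sum A I) = (\<Sum>i\<in>I. ini w s (A i))"
  by (induction I rule: infinite_finite_induct) (auto simp: ini_add)

lemma wt_ge_mult: "wt_ge w s A \<Longrightarrow> wt_ge w t B \<Longrightarrow> wt_ge w (s + t) (A * B)"
  unfolding wt_ge_def using keys_mult[of A B] by (fastforce simp: wt_add intro: add_mono)

lemma ini_mult:
  assumes "wt_ge w s A" "wt_ge w t B" shows "ini w (s + t) (A * B) = ini w s A * ini w t B"
proof -
  let ?A = "A - ini w s A" and ?B = "B - ini w t B"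
  have gA: "s < wt w m" if "m \<in> keys ?A" for m
    using that assms(1) by (auto simp: in_keys_iff lookup_minus lookup_ini wt_ge_def le_less split: if_splits)
  have gB: "t < wt w m" if "m \<in> keys ?B" for m
    using that assms(2) by (auto simp: in_keys_iff lookup_minus lookup_ini wt_ge_def le_less split: if_splits)
  have iA: "wt w m = s" if "m \<in> keys (ini w s A)" for m using that by (auto simp: in_keys_iff lookup_ini split: if_splits)
  have iB: "wt w m = t" if "m \<in> keys (ini w t B)" for m using that by (auto simp: in_keys_iff lookup_ini split: if_splits)
  have z: "ini w (s + t) (U * V) = 0" if z: "\<And>m n. m \<in> keys U \<Longrightarrow> n \<in> keys V \<Longrightarrow> s + t < wt w m + wt w n" for U V
  proof (rule poly_mapping_eqI)
    fix m
    have "m \<notin> keys (U * V)" if wm: "wt w m = s + t"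
    proof
      assume "m \<in> keys (U * V)"
      then obtain a b where "m = a + b" "a \<in> keys U" "b \<in> keys V" using keys_mult[of U V] by blast
      then show False using z[of a b] wm by (simp add: wt_add)
    qed
    then show "lookup (ini w (s + t) (U * V)) m = lookup 0 m" by (auto simp: lookup_ini in_keys_iff)
  qed
  have "ini w (s + t) (ini w s A * ini w t B) = ini w s A * ini w t B"
  proof (rule poly_mapping_eqI)
    fix m
    have "wt w m = s + t" if mk: "m \<in> keys (ini w s A * ini w t B)"
    proof -
      obtain a b where "m = a + b" "a \<in> keys (ini w s A)" "b \<in> keys (ini w t B)" using keys_mult mk by blast
      then show ?thesis using iA iB by (simp add: wt_add)
    qed
    then show "lookup (ini w (s + t) (ini w s A * ini w t B)) m = lookup (ini w s A * ini w t B) m"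
      by (auto simp: lookup_ini in_keys_iff)
  qed
  moreover have "A * B = ini w s A * ini w t B + (ini w s A * ?B + (?A * ini w t B + ?A * ?B))" by (simp add: algebra_simps)
  moreover have "ini w (s + t) (ini w s A * ?B) = 0" "ini w (s + t) (?A * ini w t B) = 0" "ini w (s + t) (?A * ?B) = 0"
    by (rule z; use gA gB iA iB in fastforce)+
  ultimately show ?thesis by (metis ini_add add.right_neutral)
qed

lemma wt_ge_ini_prod:
  assumes "\<And>i. i \<in> I \<Longrightarrow> wt_ge w (s i) (A i)"
  shows "wt_ge w (sum s I) (prod A I) \<and> ini w (sum s I) (prod A I) = (\<Prod>i\<in>I. ini w (s i) (A i))"
proof -
  have one: "wt_ge w 0 1" "ini w 0 1 = 1" 
    by (simp_all add: wt_ge_def) (rule poly_mapping_eqI, simp add: lookup_ini lookup_one when_def)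
  show ?thesis using assms
    by (induction I rule: infinite_finite_induct) (auto simp: one ini_mult intro: wt_ge_mult)
qed

lemma wt_ge_ini_power:
  assumes "wt_ge w s A" shows "wt_ge w (real k * s) (A ^ k) \<and> ini w (real k * s) (A ^ k) = ini w s A ^ k"
  using wt_ge_ini_prod[of "{..<k}" w "\<lambda>_. s" "\<lambda>_. A"] assms by simp

lemma wt_ge_Cst: "wt_ge w 0 (Cst c)" "ini w 0 (Cst c) = Cst c"
  by (auto simp: wt_ge_def Cst_def) (rule poly_mapping_eqI, simp add: lookup_ini lookup_single when_def)

lemma wt_ge_nonneg: "(\<And>j. 0 \<le> w j) \<Longrightarrow> wt_ge w 0 A"
  by (simp add: wt_ge_def wt_nonneg)

definition wmin :: "('n \<Rightarrow> real) \<Rightarrow> 'n::finite mpoly \<Rightarrow> real" where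
  "wmin w A = Min (wt w ` keys A)"

lemma wmin_wt_ge: "A \<noteq> 0 \<Longrightarrow> wt_ge w s A \<longleftrightarrow> s \<le> wmin w A"
proof -
  assume "A \<noteq> 0"
  then have "keys A \<noteq> {}" by (metis keys_eq_empty)
  then show ?thesis by (simp add: wt_ge_def wmin_def)
qed

lemma wmin_ini: 
  assumes "A \<noteq> 0" shows "ini w (wmin w A) A \<noteq> 0"
proof -
  have "keys A \<noteq> {}" using assms by (metis keys_eq_empty)
  then have "wmin w A \<in> wt w ` keys A" unfolding wmin_def by (intro Min_in) auto
  then obtain m where "m \<in> keys A" "wt w m = wmin w A" by auto
  then have "lookup (ini w (wmin w A) A) m \<noteq> 0" by (simp add: lookup_ini in_keys_iff)
  then show ?thesis by auto
qed

lemma wmin_eqI: assumes "wt_ge w s A" "ini w s A \<noteq> 0" shows "wmin w A = s" "A \<noteq> 0"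
proof -
  show A: "A \<noteq> 0" using assms by auto
  have "\<exists>m. lookup (ini w s A) m \<noteq> 0" using assms(2) by (metis poly_mapping_eqI lookup_zero)
  then obtain m where m: "m \<in> keys A" "wt w m = s" by (auto simp: lookup_ini in_keys_iff split: if_splits)
  then have "wmin w A \<le> s" unfolding wmin_def by (intro Min_le) auto
  then show "wmin w A = s" using wmin_wt_ge[OF A, of w s] assms(1) by simp
qed

lemma wmin_mult: 
  assumes "A \<noteq> 0" "B \<noteq> 0" shows "wmin w (A * B) = wmin w A + wmin w B"
proof (rule wmin_eqI)
  have f: "wt_ge w (wmin w A) A" "wt_ge w (wmin w B) B" using wmin_wt_ge assms by auto
  show "wt_ge w (wmin w A + wmin w B) (A * B)" by (rule wt_ge_mult[OF f])
  show "ini w (wmin w A + wmin w B) (A * B) \<noteq> 0" unfolding ini_mult[OF f] using wmin_ini assms mpoly_no_zero_div by blast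
qed

lemma wmin_monom: "wmin w (mpoly_monom m) = wt w m"
  by (simp add: wmin_def mpoly_monom_def)

lemma mpoly_monom_nz [simp]: "mpoly_monom m \<noteq> 0"
proof
  assume "mpoly_monom m = 0"
  then have "lookup (mpoly_monom m) m = 0" by simp
  then show False by (simp add: mpoly_monom_def)
qed

section \<open>Monomial valuations of rational functions\<close>

definition wval :: "('n \<Rightarrow> real) \<Rightarrow> 'n::finite ratfun \<Rightarrow> real" where
  "wval w r = (SOME s. \<exists>A B. A \<noteq> 0 \<and> B \<noteq> 0 \<and> r = of_mpoly A / of_mpoly B \<and> s = wmin w A - wmin w B)"

lemma wval_frac: assumes "A \<noteq> 0" "B \<noteq> 0" shows "wval w (of_mpoly A / of_mpoly B) = wmin w A - wmin w B"
proof -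
  let ?Q = "\<lambda>s. \<exists>A' B'. A' \<noteq> 0 \<and> B' \<noteq> 0 \<and> of_mpoly A / of_mpoly B = of_mpoly A' / of_mpoly B' \<and> s = wmin w A' - wmin w B'"
  have "?Q (wmin w A - wmin w B)" using assms by blast
  then have "?Q (wval w (of_mpoly A / of_mpoly B))" unfolding wval_def by (rule someI)
  then obtain A' B' where *: "A' \<noteq> 0" "B' \<noteq> 0" "of_mpoly A / of_mpoly B = of_mpoly A' / of_mpoly B'" "wval w (of_mpoly A / of_mpoly B) = wmin w A' - wmin w B'" by blast
  have "of_mpoly B \<noteq> 0" "of_mpoly B' \<noteq> 0" using assms * by auto
  then have "of_mpoly A * of_mpoly B' = of_mpoly A' * of_mpoly B" using *(3) by (simp add: frac_eq_eq)
  then have "of_mpoly (A * B') = of_mpoly (A' * B)" by simp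
  then have "A * B' = A' * B" by (simp only: of_mpoly_inj)
  then have "wmin w A + wmin w B' = wmin w A' + wmin w B" using wmin_mult assms * by metis
  then show ?thesis using *(4) by simp
qed

lemma ratfun_cases_nz:
  assumes "r \<noteq> 0" obtains A B where "A \<noteq> 0" "B \<noteq> 0" "r = of_mpoly A / of_mpoly B"
proof -
  obtain A B where "B \<noteq> 0" "r = of_mpoly A / of_mpoly B" by (rule ratfun_cases)
  moreover then have "A \<noteq> 0" using assms by auto
  ultimately show ?thesis using that by blast
qed

lemma wval_of_mpoly: "A \<noteq> 0 \<Longrightarrow> wval w (of_mpoly A) = wmin w A"
  using wval_frac[of A 1 w] wmin_monom[of w 0] by simp

lemma wval_mult:
  assumes "r \<noteq> 0" "s \<noteq> 0" shows "wval w (r * s) = wval w r + wval w s"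
proof -
  obtain A B where 1: "A \<noteq> 0" "B \<noteq> 0" "r = of_mpoly A / of_mpoly B" by (rule ratfun_cases_nz[OF assms(1)])
  obtain A' B' where 2: "A' \<noteq> 0" "B' \<noteq> 0" "s = of_mpoly A' / of_mpoly B'" by (rule ratfun_cases_nz[OF assms(2)])
  have "A * A' \<noteq> 0" "B * B' \<noteq> 0" using 1 2 mpoly_no_zero_div by blast+
  then have "wval w (of_mpoly (A * A') / of_mpoly (B * B')) = wmin w (A * A') - wmin w (B * B')" by (rule wval_frac)
  moreover have "r * s = of_mpoly (A * A') / of_mpoly (B * B')" using 1 2 by simp
  ultimately show ?thesis using 1 2 by (simp add: wmin_mult wval_frac)
qed

lemma wval_1: "wval w 1 = 0" using wval_of_mpoly[of 1 w] wmin_monom[of w 0] by simp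

lemma wval_power: "r \<noteq> 0 \<Longrightarrow> wval w (r ^ k) = real k * wval w r"
  by (induction k) (auto simp: wval_1 wval_mult algebra_simps)

definition wval_ge :: "('n \<Rightarrow> real) \<Rightarrow> real \<Rightarrow> 'n::finite ratfun \<Rightarrow> bool" where
  "wval_ge w s r \<longleftrightarrow> r = 0 \<or> s \<le> wval w r"

lemma wval_ge_frac: "B \<noteq> 0 \<Longrightarrow> wval_ge w s (of_mpoly A / of_mpoly B) \<longleftrightarrow> wt_ge w (s + wmin w B) A"
  by (cases "A = 0") (auto simp: wval_ge_def wval_frac wmin_wt_ge)

lemma wval_ge_of_mpoly: "wval_ge w s (of_mpoly A) \<longleftrightarrow> wt_ge w s A"
  using wval_ge_frac[of 1 w s A] wmin_monom[of w 0] by simp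

lemma wval_ge_0 [simp]: "wval_ge w s 0" by (simp add: wval_ge_def)

lemma wval_ge_add:
  assumes "wval_ge w s r" "wval_ge w s t" shows "wval_ge w s (r + t)"
proof -
  obtain A B where 1: "B \<noteq> 0" "r = of_mpoly A / of_mpoly B" by (rule ratfun_cases)
  obtain A' B' where 2: "B' \<noteq> 0" "t = of_mpoly A' / of_mpoly B'" by (rule ratfun_cases)
  have n: "B * B' \<noteq> 0" using 1 2 mpoly_no_zero_div by blast
  have "r + t = of_mpoly (A * B' + A' * B) / of_mpoly (B * B')" using 1 2 by (simp add: field_simps)
  moreover have "wt_ge w (s + wmin w (B * B')) (A * B' + A' * B)"
  proof (rule wt_ge_add)
    have f: "wt_ge w (s + wmin w B) A" "wt_ge w (s + wmin w B') A'" using assms 1 2 wval_ge_frac by auto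
    have g: "wt_ge w (wmin w B) B" "wt_ge w (wmin w B') B'" using wmin_wt_ge 1 2 by auto
    show "wt_ge w (s + wmin w (B * B')) (A * B')" unfolding wmin_mult[OF 1(1) 2(1)] using wt_ge_mult[OF f(1) g(2)] by (simp only: ac_simps)
    show "wt_ge w (s + wmin w (B * B')) (A' * B)" unfolding wmin_mult[OF 1(1) 2(1)] using wt_ge_mult[OF f(2) g(1)] by (simp only: ac_simps)
  qed
  ultimately show ?thesis by (simp only: wval_ge_frac[OF n])
qed

lemma wval_ge_mult: "wval_ge w s r \<Longrightarrow> wval_ge w t u \<Longrightarrow> wval_ge w (s + t) (r * u)"
  by (cases "r = 0"; cases "u = 0"; simp add: wval_ge_def wval_mult)

lemma wval_ge_sum: "(\<And>i. i \<in> I \<Longrightarrow> wval_ge w s (r i)) \<Longrightarrow> wval_ge w s (sum r I)"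
  by (induction I rule: infinite_finite_induct) (auto intro: wval_ge_add)

lemma wval_ge_prod: "(\<And>i. i \<in> I \<Longrightarrow> wval_ge w (s i) (r i)) \<Longrightarrow> wval_ge w (sum s I) (prod r I)"
proof (induction I rule: infinite_finite_induct)
  case (insert x F) then show ?case using wval_ge_mult[of w "s x" "r x" "sum s F" "prod r F"] by simp
qed (auto simp: wval_ge_def wval_1)

lemma wval_ge_of_const: "wval_ge w 0 (of_const c)"
  unfolding of_const_def wval_ge_of_mpoly by (rule wt_ge_Cst)

text \<open>Each term of the Leibniz expansion meets every row and every column once, so all terms
  have the same lower bound.\<close>

lemma wval_ge_det:
  fixes M :: "'n::finite ratfun ^ 'n ^ 'n"
  assumes "\<And>j k. wval_ge w (t j - s k) (M $ j $ k)" shows "wval_ge w (sum t UNIV - sum s UNIV) (det M)"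
  unfolding det_def
proof (rule wval_ge_sum)
  fix p assume "p \<in> {p. p permutes (UNIV :: 'n set)}"
  then have p: "p permutes UNIV" by simp
  have "wval_ge w (\<Sum>j\<in>UNIV. t j - s (p j)) (\<Prod>j\<in>UNIV. M $ j $ p j)" by (rule wval_ge_prod) (rule assms)
  moreover have "(\<Sum>j\<in>UNIV. t j - s (p j)) = sum t UNIV - sum s UNIV"
    using sum.permute[OF p, of s] by (simp add: sum_subtractf o_def)
  moreover have "wval_ge w 0 (of_int (sign p))" using wval_ge_of_const[of w "of_int (sign p)"] by (simp add: rhom_of_int[OF rhom_of_const])
  ultimately show "wval_ge w (sum t UNIV - sum s UNIV) (of_int (sign p) * (\<Prod>i\<in>UNIV. M $ i $ p i))"
    using wval_ge_mult[of w 0 "of_int (sign p)"] by fastforce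
qed

lemma wt_ge_pd: "wt_ge w s A \<Longrightarrow> wt_ge w (s - w k) (pd k A)"
  unfolding wt_ge_def
proof
  fix m assume A: "\<forall>m\<in>keys A. s \<le> wt w m" and "m \<in> keys (pd k A)"
  then have "m + Poly_Mapping.single k 1 \<in> keys A" by (auto simp: in_keys_iff lookup_pd)
  then have "s \<le> wt w (m + Poly_Mapping.single k 1)" using A by blast
  then show "s - w k \<le> wt w m" by (simp add: wt_add wt_single)
qed

lemma wt_ge_uminus: "wt_ge w s A \<Longrightarrow> wt_ge w s (- A)" by (simp add: wt_ge_def in_keys_iff)

lemma wval_ge_pdK:
  assumes "wval_ge w s r" shows "wval_ge w (s - w k) (pdK k r)"
proof -
  obtain A B where 1: "B \<noteq> 0" "r = of_mpoly A / of_mpoly B" by (rule ratfun_cases)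
  have f: "wt_ge w (s + wmin w B) A" using assms 1 wval_ge_frac by auto
  have g: "wt_ge w (wmin w B) B" using wmin_wt_ge 1 by auto
  have BB: "B * B \<noteq> 0" using 1 mpoly_no_zero_div by blast
  have "wt_ge w (s - w k + wmin w (B * B)) (pd k A * B + - (A * pd k B))"
  proof (rule wt_ge_add)
    show "wt_ge w (s - w k + wmin w (B * B)) (pd k A * B)" using wt_ge_mult[OF wt_ge_pd[OF f, of k] g] by (simp add: wmin_mult[OF 1(1) 1(1)] algebra_simps)
    have "wt_ge w (s - w k + wmin w (B * B)) (A * pd k B)" using wt_ge_mult[OF f wt_ge_pd[OF g, of k]] by (simp add: wmin_mult[OF 1(1) 1(1)] algebra_simps)
    then show "wt_ge w (s - w k + wmin w (B * B)) (- (A * pd k B))" by (rule wt_ge_uminus)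
  qed
  moreover have "pdK k r = of_mpoly (pd k A * B + - (A * pd k B)) / of_mpoly (B * B)"
    unfolding 1(2) pdK_eq[OF 1(1)] by (simp add: power2_eq_square)
  ultimately show ?thesis by (simp only: wval_ge_frac[OF BB])
qed

section \<open>The centre of a monomial valuation\<close>

context bir
begin

context
  fixes w :: "'n \<Rightarrow> real"
  assumes w0: "\<And>j. 0 \<le> w j" and w1: "\<exists>j. 0 < w j"
begin

text \<open>Scaling the coordinates of a point \<open>a\<close> by positive \<open>t\<close> to the
  powers \<open>w j\<close> and letting \<open>t\<close> tend to 0, the graph point tends to the
  point with coordinates \<open>z0\<close> and homogeneous coordinates \<open>G0\<close> at
  \<open>a\<close>; \<open>gmin\<close> is the power of \<open>t\<close> to be removed. The closure
  \<open>Z\<close> of these limits is the centre of the valuation on \<open>X\<close>.\<close>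

definition gmin :: real where "gmin = Min ((\<lambda>j. wmin w (G j)) ` {j. G j \<noteq> 0})"
definition G0 :: "'m \<Rightarrow> 'n mpoly" where "G0 j = ini w gmin (G j)"
definition z0 :: "'n \<Rightarrow> 'n mpoly" where "z0 j = ini w 0 (var j)"
definition tz :: "('n + 'm) mpoly \<Rightarrow> 'n mpoly" where "tz P = heval Cst (case_sum z0 G0) P"
definition Zs :: "('n, 'm) pt set" where
  "Zs = {((\<chi> j. ev a (z0 j)), abs_proj (\<chi> j. ev a (G0 j))) | a. (\<chi> j. ev a (G0 j)) \<noteq> 0}"
definition Z :: "('n, 'm) pt set" where "Z = zclosure Zs"

lemma G_nz: "\<exists>k. G k \<noteq> 0"
proof (rule ccontr)
  assume "\<not> ?thesis"
  moreover obtain y where "ev y f \<noteq> 0" using ev_inj f0 by blast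
  ultimately show False using fnz[of y] by (simp add: Gv_def vec_eq_iff ev_simps)
qed

lemma G_wt_ge: "wt_ge w gmin (G j)"
proof (cases "G j = 0")
  case False
  then have "gmin \<le> wmin w (G j)" unfolding gmin_def by (intro Min_le) auto
  then show ?thesis using wmin_wt_ge[OF False] by simp
qed simp

lemma G0_nz: "\<exists>k. G0 k \<noteq> 0"
proof -
  have "gmin \<in> (\<lambda>j. wmin w (G j)) ` {j. G j \<noteq> 0}" unfolding gmin_def by (intro Min_in) (use G_nz in auto)
  then obtain k where "G k \<noteq> 0" "gmin = wmin w (G k)" by auto
  then show ?thesis using wmin_ini[of "G k" w] unfolding G0_def by auto
qed

lemma z0_eq: "z0 j = (if w j = 0 then var j else 0)"
  unfolding z0_def by (rule poly_mapping_eqI) (auto simp: lookup_ini var_def mpoly_monom_def lookup_single when_def wt_single)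

lemma rhom_tz: "rhom tz" unfolding tz_def by (rule rhom_heval[OF rhom_Cst])

text \<open>A monomial of \<open>P\<close> has degree \<open>d\<close> in the \<open>G j\<close>,
  each of weight at least \<open>gmin\<close>, and its other factors have nonnegative weight. So
  \<open>P\<close> vanishes on \<open>Z\<close> exactly when the weight \<open>real d * gmin\<close>
  does not occur in \<open>on_graph P\<close>.\<close>

lemma on_graph_ini:
  assumes "hom d P" shows "wt_ge w (real d * gmin) (on_graph P)" "ini w (real d * gmin) (on_graph P) = tz P"
proof -
  have *: "wt_ge w (real d * gmin) (Cst c * (\<Prod>v\<in>UNIV. (case_sum var G v) ^ lookup m v)) \<and>
     ini w (real d * gmin) (Cst c * (\<Prod>v\<in>UNIV. (case_sum var G v) ^ lookup m v)) = Cst c * (\<Prod>v\<in>UNIV. (case_sum z0 G0 v) ^ lookup m v)"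
    if m: "m \<in> keys P" for m c
  proof -
    have "(\<Sum>j\<in>UNIV. lookup m (Inr j)) = d" using assms m by (simp add: proj_homogeneous_def)
    then have "(\<Sum>j\<in>UNIV. real (lookup m (Inr j))) = real d" by (simp flip: of_nat_sum)
    then have s: "(\<Sum>j\<in>UNIV. real (lookup m (Inr j)) * gmin) = real d * gmin" by (simp flip: sum_distrib_right)
    have 1: "wt_ge w (\<Sum>i\<in>UNIV. real (lookup m (Inl i)) * 0) (\<Prod>i\<in>UNIV. var i ^ lookup m (Inl i)) \<and>
      ini w (\<Sum>i\<in>UNIV. real (lookup m (Inl i)) * 0) (\<Prod>i\<in>UNIV. var i ^ lookup m (Inl i)) = (\<Prod>i\<in>UNIV. ini w (real (lookup m (Inl i)) * 0) (var i ^ lookup m (Inl i)))"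
      by (rule wt_ge_ini_prod) (rule wt_ge_ini_power[OF wt_ge_nonneg[OF w0], THEN conjunct1])
    have 2: "wt_ge w (\<Sum>j\<in>UNIV. real (lookup m (Inr j)) * gmin) (\<Prod>j\<in>UNIV. G j ^ lookup m (Inr j)) \<and>
      ini w (\<Sum>j\<in>UNIV. real (lookup m (Inr j)) * gmin) (\<Prod>j\<in>UNIV. G j ^ lookup m (Inr j)) = (\<Prod>j\<in>UNIV. ini w (real (lookup m (Inr j)) * gmin) (G j ^ lookup m (Inr j)))"
      by (rule wt_ge_ini_prod) (rule wt_ge_ini_power[OF G_wt_ge, THEN conjunct1])
    have 3: "ini w (real k * 0) (var i ^ k) = z0 i ^ k" for i k using wt_ge_ini_power[OF wt_ge_nonneg[of w "var i", OF w0], where k=k] by (simp add: z0_def)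
    have 4: "ini w (real k * gmin) (G j ^ k) = G0 j ^ k" for j k using wt_ge_ini_power[OF G_wt_ge[of j], where k=k] by (simp add: G0_def)
    note f = 1[THEN conjunct1] 2[THEN conjunct1, unfolded s]
    have 5: "wt_ge w (0 + real d * gmin) ((\<Prod>i\<in>UNIV. var i ^ lookup m (Inl i)) * (\<Prod>j\<in>UNIV. G j ^ lookup m (Inr j)))"
      using wt_ge_mult[OF f] by simp
    have 6: "ini w (0 + real d * gmin) ((\<Prod>i\<in>UNIV. var i ^ lookup m (Inl i)) * (\<Prod>j\<in>UNIV. G j ^ lookup m (Inr j))) = (\<Prod>i\<in>UNIV. z0 i ^ lookup m (Inl i)) * (\<Prod>j\<in>UNIV. G0 j ^ lookup m (Inr j))"
      using ini_mult[OF f] 1[THEN conjunct2] 2[THEN conjunct2, unfolded s] by (simp add: 3[simplified] 4)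
    show ?thesis using wt_ge_mult[OF wt_ge_Cst(1) 5] ini_mult[OF wt_ge_Cst(1) 5] 6 by (simp add: UNIV_sum_prod wt_ge_Cst(2))
  qed
  show "wt_ge w (real d * gmin) (on_graph P)" unfolding on_graph_def heval_finite[OF rhom_Cst] by (rule wt_ge_sum) (use * in blast)
  show "ini w (real d * gmin) (on_graph P) = tz P" unfolding on_graph_def tz_def heval_finite[OF rhom_Cst] ini_sum
    by (rule sum.cong) (use * in auto)
qed

lemma ev_tz: "ev a (tz P) = peval (case_sum (\<lambda>j. ev a (z0 j)) (\<lambda>j. ev a (G0 j))) P"
proof -
  have "ev a (tz P) = heval (\<lambda>c. ev a (Cst c)) (\<lambda>v. ev a (case_sum z0 G0 v)) P"
    unfolding tz_def by (rule rhom_heval_comp[OF rhom_ev])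
  also have "(\<lambda>v. ev a (case_sum z0 G0 v)) = case_sum (\<lambda>j. ev a (z0 j)) (\<lambda>j. ev a (G0 j))"
    by (auto split: sum.splits)
  finally show ?thesis by (simp add: peval_heval ev_Cst)
qed

lemma Zs_nonvan: 
  assumes "hom d P" shows "nonvan Zs P \<longleftrightarrow> tz P \<noteq> 0"
proof
  assume "nonvan Zs P"
  then obtain a where a: "(\<chi> j. ev a (G0 j)) \<noteq> 0" "pval P ((\<chi> j. ev a (z0 j)), abs_proj (\<chi> j. ev a (G0 j))) \<noteq> 0"
    unfolding nonvan_def Zs_def by blast
  then have "ev a (tz P) \<noteq> 0" using pval_scale[OF a(1) assms, of "\<chi> j. ev a (z0 j)"] by (auto simp: ev_tz)
  then show "tz P \<noteq> 0" by (auto simp: ev_simps)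
next
  assume "tz P \<noteq> 0"
  obtain k where "G0 k \<noteq> 0" using G0_nz by blast
  then have "tz P * G0 k \<noteq> 0" using \<open>tz P \<noteq> 0\<close> mpoly_no_zero_div by blast
  then obtain a where a: "ev a (tz P * G0 k) \<noteq> 0" using ev_inj by blast
  then have "(\<chi> j. ev a (G0 j)) $ k \<noteq> 0" by (simp add: ev_simps)
  then have n: "(\<chi> j. ev a (G0 j)) \<noteq> 0" by (metis zero_index)
  have "pval P ((\<chi> j. ev a (z0 j)), abs_proj (\<chi> j. ev a (G0 j))) \<noteq> 0"
    using pval_scale[OF n assms, of "\<chi> j. ev a (z0 j)"] a by (auto simp: ev_tz ev_simps)
  then show "nonvan Zs P" unfolding nonvan_def Zs_def using n by blast
qed

lemma Z_nonvan: assumes "hom d P" shows "nonvan Z P \<longleftrightarrow> tz P \<noteq> 0"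
  using zclosure_van_iff[OF assms, of Zs] Zs_nonvan[OF assms] unfolding Z_def nonvan_def by blast

lemma Z_irr: "irreducible_closed Z"
  unfolding Z_def
proof (rule primeset_closure_irreducible, unfold primeset_def, intro conjI allI impI)
  have "nonvan Zs 1" using Zs_nonvan[OF hom_1] by (simp add: rhom_simps[OF rhom_tz])
  then show "Zs \<noteq> {}" unfolding nonvan_def by blast
  fix d e P Q assume h: "hom d P" "hom e Q" "nonvan Zs P" "nonvan Zs Q"
  then have "tz P * tz Q \<noteq> 0" using Zs_nonvan mpoly_no_zero_div by blast
  then show "nonvan Zs (P * Q)" using Zs_nonvan[OF hom_mult[OF h(1,2)]] by (simp add: rhom_simps[OF rhom_tz])
qed

lemma Z_sub: "Z \<subseteq> X"
proof
  fix p assume p: "p \<in> Z"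
  show "p \<in> X"
  proof (rule ccontr)
    assume "p \<notin> X"
    then obtain d P where P: "hom d P" "pval P p \<noteq> 0" "\<And>q. q \<in> X \<Longrightarrow> pval P q = 0"
      using zclosed_separate[OF irreducible_closedD(1)[OF irr]] by blast
    have "\<not> nonvan X P" using P(3) unfolding nonvan_def by blast
    then have "on_graph P = 0" using X_van_iff[OF P(1)] by blast
    then have "tz P = 0" using on_graph_ini(2)[OF P(1)] by simp
    then show False using Z_nonvan[OF P(1)] P(2) p unfolding nonvan_def by blast
  qed
qed

lemma Z_coord: "0 < w j \<Longrightarrow> p \<in> Z \<Longrightarrow> fst p $ j = 0"
proof -
  assume j: "0 < w j" and p: "p \<in> Z"
  have "tz (var (Inl j)) = 0" using j by (simp add: tz_def heval_var[OF rhom_Cst] z0_eq)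
  then have "\<not> nonvan Z (var (Inl j))" using Z_nonvan[OF hom_Inl] by blast
  then have "pval (var (Inl j)) p = 0" using p unfolding nonvan_def by blast
  then show ?thesis by (simp add: pval_simps)
qed

lemma Z_ne: "Z \<noteq> X"
proof
  assume e: "Z = X"
  obtain j where j: "0 < w j" using w1 by blast
  have "\<not> nonvan X (var (Inl j))" unfolding nonvan_def using Z_coord[OF j] e by (auto simp: pval_simps)
  then have "var j = 0" using X_van_iff[OF hom_Inl, of j] by simp
  then have "ev (\<chi> v. 1) (var j) = 0" by (simp only: ev_simps(1))
  then show False by (simp add: ev_var)
qed

text \<open>The valuation ring dominates the local ring along \<open>Z\<close>. In a fraction of
  degree \<open>d\<close> the denominator has weight exactly \<open>real d * gmin\<close>, and the
  numerator has at least this weight, with equality when it does not vanish on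
  \<open>Z\<close>.\<close>

lemma Z_wval:
  assumes r: "r \<in> loc_ring Z" "r \<noteq> 0" shows "0 \<le> wval w r" "r \<in> max_ideal Z \<longleftrightarrow> 0 < wval w r"
proof -
  obtain d P Q where 1: "hom d P" "hom d Q" "nonvan Z Q" "r = hat P / hat Q" using r by (auto elim: loc_ring_E)
  have tQ: "tz Q \<noteq> 0" using Z_nonvan[OF 1(2)] 1(3) by blast
  have nQ: "wmin w (on_graph Q) = real d * gmin" "on_graph Q \<noteq> 0" using wmin_eqI[of w "real d * gmin" "on_graph Q"] on_graph_ini[OF 1(2)] tQ by auto
  have tP: "on_graph P \<noteq> 0" using r(2) 1(4) by (auto simp: hat_def)
  have n: "wval w r = wmin w (on_graph P) - real d * gmin" unfolding 1(4) hat_def by (simp only: wval_frac[OF tP nQ(2)] nQ(1))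
  have ge: "real d * gmin \<le> wmin w (on_graph P)" using wmin_wt_ge[OF tP] on_graph_ini(1)[OF 1(1)] by blast
  then show "0 \<le> wval w r" using n by simp
  have "r \<in> max_ideal Z \<longleftrightarrow> tz P = 0" using max_ideal_iff[OF irreducible_primeset[OF Z_irr] Z_sub 1(1-3)] Z_nonvan[OF 1(1)] 1(4) by blast
  also have "\<dots> \<longleftrightarrow> 0 < wval w r"
  proof
    assume "tz P = 0"
    then have "wmin w (on_graph P) \<noteq> real d * gmin" using wmin_ini[OF tP, of w] on_graph_ini(2)[OF 1(1)] by auto
    then show "0 < wval w r" using n ge by simp
  next
    assume a: "0 < wval w r"
    show "tz P = 0"
    proof (rule ccontr)
      assume "tz P \<noteq> 0"
      then have "wmin w (on_graph P) = real d * gmin" using wmin_eqI[of w "real d * gmin" "on_graph P"] on_graph_ini[OF 1(1)] by auto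
      then show False using n a by simp
    qed
  qed
  finally show "r \<in> max_ideal Z \<longleftrightarrow> 0 < wval w r" .
qed

lemma Z_wval_ge: "r \<in> loc_ring Z \<Longrightarrow> wval_ge w 0 r"
  using Z_wval(1) by (auto simp: wval_ge_def)

lemma Z_has_order:
  assumes "has_order Z k r" "unif Z \<pi>" shows "wval w r = real k * wval w \<pi>" "0 < wval w \<pi>"
proof -
  note pZ = irreducible_primeset[OF Z_irr]
  have \<pi>: "\<pi> \<in> max_ideal Z" "\<pi> \<noteq> 0" "\<And>r. r \<in> max_ideal Z \<Longrightarrow> \<exists>h\<in>loc_ring Z. r = \<pi> * h" using assms(2) by (auto simp: unif_def)
  obtain h where h: "h \<in> loc_ring Z" "h \<notin> max_ideal Z" "r = \<pi> ^ k * h" using has_order_unif[OF pZ Z_sub assms(1) \<pi>] by blast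
  have h0: "h \<noteq> 0" using h(2) max_ideal_0[OF pZ Z_sub] by auto
  have "wval w h = 0" using Z_wval[OF h(1) h0] h(2) by simp
  then show "wval w r = real k * wval w \<pi>" using h(3) h0 \<pi>(2) by (simp add: wval_mult wval_power)
  show "0 < wval w \<pi>" using Z_wval(2)[OF max_ideal_loc_ring'[OF \<pi>(1)] \<pi>(2)] \<pi>(1) by blast
qed

text \<open>The reverse of \<open>K_lower\<close>, from the inverse matrix: differentiating by z_k
  lowers the valuation by at most \<open>w k\<close>, which bounds the determinant of
  \<open>?N\<close> below, and the determinants of \<open>?J\<close> and \<open>?N\<close> are
  inverse to each other.\<close>

lemma Z_K_upper:
  assumes g: "gooddiv X Z" and v: "\<And>k. has_order Z (v k) (coord k)"
  shows "mult_K X Z + 1 \<le> sum v UNIV"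
proof -
  note pZ = irreducible_primeset[OF Z_irr]
  obtain p a j0 \<Delta> where 1: "p \<in> Z" "params_dual p a \<Delta>" "loceq Z p (a j0)" "unif Z (a j0)"
    by (rule gooddiv_unif[OF Z_irr Z_sub Z_ne g]) (rule that)
  let ?\<pi> = "a j0" and ?J = "\<chi> i j. \<Delta> j (coord i)" and ?N = "\<chi> j k. pdK k (a j)"
  let ?\<tau> = "wval w ?\<pi>"
  have JN: "det ?J * det ?N = 1" by (rule dual_det_nz) (use 1(2) in \<open>simp add: params_dual_def\<close>)
  have hK: "has_order Z (mult_K X Z) (det ?J)" by (rule mult_K_eq[OF Z_irr Z_sub Z_ne g 1(1,2)])
  have \<tau>: "0 < ?\<tau>" using Z_has_order(2)[OF hK 1(4)] .
  have aL: "a j \<in> loc_ring Z" for j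
  proof -
    have "a j \<in> loc_ring {p}" using 1(2) max_ideal_loc_ring' by (auto simp: params_dual_def lparams_def)
    then show ?thesis using loc_ring_mono[of "{p}" Z] 1(1) by blast
  qed
  \<comment> \<open>All parameters have nonnegative value, the uniformizer even
    \<open>?\<tau>\<close>; this surplus becomes the 1 in the claim.\<close>
  have aV: "wval_ge w (if j = j0 then ?\<tau> else 0) (a j)" for j using Z_wval_ge[OF aL] by (simp add: wval_ge_def)
  have "wval_ge w ((\<Sum>j\<in>UNIV. if j = j0 then ?\<tau> else 0) - sum w UNIV) (det ?N)"
    by (rule wval_ge_det) (simp add: wval_ge_pdK[OF aV])
  then have "wval_ge w (?\<tau> - sum w UNIV) (det ?N)" by simp
  moreover have nz: "det ?J \<noteq> 0" "det ?N \<noteq> 0" using JN by auto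
  ultimately have "?\<tau> - sum w UNIV \<le> wval w (det ?N)" by (simp add: wval_ge_def)
  moreover have "wval w (det ?J) + wval w (det ?N) = 0" using wval_mult[OF nz, of w] by (simp only: JN wval_1)
  moreover have "wval w (det ?J) = real (mult_K X Z) * ?\<tau>" by (rule Z_has_order(1)[OF hK 1(4)])
  moreover have "w k = real (v k) * ?\<tau>" for k
  proof -
    have "var k \<noteq> (0 :: 'n mpoly)" using mpoly_monom_nz[of "Poly_Mapping.single k 1"] by (simp add: var_def)
    then have "wval w (coord k) = w k" using wmin_monom[of w "Poly_Mapping.single k 1"] by (simp add: coord_def wval_of_mpoly wt_single var_def)
    then show ?thesis using Z_has_order(1)[OF v 1(4)] by simp
  qed
  then have "sum w UNIV = real (sum v UNIV) * ?\<tau>" by (simp add: sum_distrib_right)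
  ultimately have "real (mult_K X Z + 1) * ?\<tau> \<le> real (sum v UNIV) * ?\<tau>" by (simp add: algebra_simps)
  then have "real (mult_K X Z + 1) \<le> real (sum v UNIV)" using \<tau> by (simp only: mult_le_cancel_right_pos)
  then show ?thesis by linarith
qed

end

end

section \<open>Divisors of monomial valuations\<close>

lemma module_mult: "module ((*) :: 'a::comm_ring_1 \<Rightarrow> 'a \<Rightarrow> 'a)"
  by standard (simp_all add: algebra_simps)

lemma ideal_gen_base: "P \<in> S \<Longrightarrow> P \<in> ideal_gen S"
  unfolding ideal_gen_def by (rule module.span_base[OF module_mult])

lemma ideal_gen_add: "P \<in> ideal_gen S \<Longrightarrow> Q \<in> ideal_gen S \<Longrightarrow> P + Q \<in> ideal_gen S"
  unfolding ideal_gen_def by (rule module.span_add[OF module_mult])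

lemma ideal_gen_mult: "P \<in> ideal_gen S \<Longrightarrow> Q * P \<in> ideal_gen S"
  unfolding ideal_gen_def by (rule module.span_scale[OF module_mult])

lemma ideal_gen_0: "0 \<in> ideal_gen S"
  unfolding ideal_gen_def by (rule module.span_zero[OF module_mult])

lemma ideal_gen_sum: "(\<And>k. k \<in> K \<Longrightarrow> P k \<in> ideal_gen S) \<Longrightarrow> sum P K \<in> ideal_gen S"
  unfolding ideal_gen_def by (rule module.span_sum[OF module_mult])

lemma ideal_gen_induct [consumes 1, case_names zero add mult base]:
  assumes "P \<in> ideal_gen S" "R 0" "\<And>P Q. R P \<Longrightarrow> R Q \<Longrightarrow> R (P + Q)" "\<And>P Q. R P \<Longrightarrow> R (Q * P)" "\<And>P. P \<in> S \<Longrightarrow> R P"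
  shows "R P"
proof -
  have "module.subspace (*) {P. R P}" unfolding module.subspace_def[OF module_mult] using assms by blast
  moreover have "S \<subseteq> {P. R P}" using assms by blast
  ultimately have "module.span (*) S \<subseteq> {P. R P}" by (intro module.span_minimal[OF module_mult])
  then show ?thesis using assms(1) unfolding ideal_gen_def by blast
qed

lemma wt_ge_ideal_gen:
  assumes "P \<in> ideal_gen (mpoly_monom ` A)" and w: "\<And>j. 0 \<le> w j" and A: "\<And>\<alpha>. \<alpha> \<in> A \<Longrightarrow> s \<le> wt w \<alpha>"
  shows "wt_ge w s P"
  using assms(1)
proof (induction rule: ideal_gen_induct)
  case (mult P Q)
  then show ?case using wt_ge_mult[OF wt_ge_nonneg[of w Q, OF w] mult] by simp
next
  case (base P)
  then show ?case using A by (auto simp: wt_ge_def mpoly_monom_def)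
qed (auto intro: wt_ge_add)

lemma mpoly_monom_sum: "mpoly_monom (sum e I) = (\<Prod>i\<in>I. mpoly_monom (e i))"
  by (induction I rule: infinite_finite_induct) (auto simp: mpoly_monom_0 mpoly_monom_add)

context bir
begin

lemma separating_germ:
  assumes T: "irreducible_closed T" "T \<subseteq> U" and U: "irreducible_closed U" "U \<subseteq> X" "\<not> U \<subseteq> T" and p: "p \<in> S" "S \<subseteq> T" 
  obtains r where "r \<in> max_ideal T" "r \<in> loc_ring S" "r \<notin> max_ideal U"
proof -
  obtain q where q: "q \<in> U" "q \<notin> T" using U by blast
  obtain d P where P: "hom d P" "pval P q \<noteq> 0" "\<And>p. p \<in> T \<Longrightarrow> pval P p = 0"
    using zclosed_separate[OF irreducible_closedD(1)[OF T(1)] q(2)] by blast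
  obtain k where k: "rep_proj (snd p) $ k \<noteq> 0" using chart_exists by blast
  let ?Q = "var (Inr k) ^ d :: ('n + 'm) mpoly"
  have Q: "hom d ?Q" using hom_power[OF hom_Inr, of d k] by simp
  have n: "nonvan S ?Q" unfolding nonvan_def by (rule bexI[OF _ p(1)]) (use k in \<open>simp add: pval_simps\<close>)
  then have nT: "nonvan T ?Q" and nU: "nonvan U ?Q" using p T unfolding nonvan_def by blast+
  have "\<not> nonvan T P" using P(3) unfolding nonvan_def by blast
  then have "hat P / hat ?Q \<in> max_ideal T" by (rule max_ideal_I[OF P(1) Q nT])
  moreover have "hat P / hat ?Q \<in> loc_ring S" by (rule loc_ring_I[OF P(1) Q n])
  moreover have "nonvan U P" using P(2) q(1) unfolding nonvan_def by blast
  then have "hat P / hat ?Q \<notin> max_ideal U" using max_ideal_iff[OF irreducible_primeset[OF U(1)] U(2) P(1) Q nU] by blast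
  ultimately show thesis by (rule that)
qed

text \<open>The hypothesis says that the residue field of \<open>S\<close> has transcendence degree at least
  \<open>CARD('n) - 1\<close>.\<close>

lemma prime_divisor_criterion:
  fixes y :: "'n \<Rightarrow> 'n ratfun"
  assumes S: "irreducible_closed S" "S \<subseteq> X" "S \<noteq> X" and y: "\<And>j. j \<noteq> j0 \<Longrightarrow> y j \<in> loc_ring S"
    and ind: "\<And>T x. T \<noteq> 0 \<Longrightarrow> novar None T \<Longrightarrow> novar (Some j0) T \<Longrightarrow> (\<And>j. j \<noteq> j0 \<Longrightarrow> x (Some j) = y j) \<Longrightarrow> heval of_const x T \<notin> max_ideal S"
  shows "prime_divisor X S"
  unfolding prime_divisor_def
proof (intro conjI notI)
  show "irreducible_closed S" by (rule S(1))
  show "S \<subset> X" using S by blast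
  assume "\<exists>Z. irreducible_closed Z \<and> S \<subset> Z \<and> Z \<subset> X"
  then obtain T where T: "irreducible_closed T" "S \<subseteq> T" "\<not> T \<subseteq> S" "T \<subseteq> X" "\<not> X \<subseteq> T" by blast
  note pS = irreducible_primeset[OF S(1)] and pT = irreducible_primeset[OF T(1)]
  obtain p where p: "p \<in> S" using irreducible_closedD(2)[OF S(1)] by blast
  \<comment> \<open>\<open>\<psi>\<close> vanishes on \<open>S\<close> but not on \<open>T\<close>,
    and \<open>\<xi>\<close> on \<open>T\<close> but not on \<open>X\<close>. Together with the n -
    1 functions \<open>y j\<close> these are n + 1 elements, hence algebraically dependent.\<close>
  obtain \<psi> where \<psi>: "\<psi> \<in> max_ideal S" "\<psi> \<notin> max_ideal T"
    by (rule separating_germ[OF S(1) T(2,1,4,3) p order_refl]) (rule that)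
  obtain \<xi> where \<xi>: "\<xi> \<in> max_ideal T" "\<xi> \<in> loc_ring S" "\<xi> \<notin> max_ideal X"
    by (rule separating_germ[OF T(1,4) irr order_refl T(5) p T(2)]) (rule that)
  have \<xi>0: "\<xi> \<noteq> 0" using \<xi>(3) max_ideal_X by blast
  define x where "x v = (case v of None \<Rightarrow> \<xi> | Some j \<Rightarrow> if j = j0 then \<psi> else y j)" for v
  have x: "x None = \<xi>" "x (Some j0) = \<psi>" "\<And>j. j \<noteq> j0 \<Longrightarrow> x (Some j) = y j" by (auto simp: x_def)
  have xS: "x v \<in> loc_ring S" for v using \<xi>(2) y max_ideal_loc_ring'[OF \<psi>(1)] by (auto simp: x_def split: option.splits)
  have hS: "heval of_const x P \<in> loc_ring S" for P by (rule loc_ring_heval[OF pS S(2) xS])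
  have hT: "heval of_const x P \<in> loc_ring T" for P using hS loc_ring_mono[OF T(2)] by blast
  note h = rhom_simps[OF rhom_heval[OF rhom_of_const]] rhom_power[OF rhom_heval[OF rhom_of_const]] heval_var[OF rhom_of_const]
  \<comment> \<open>Dividing out \<open>\<xi>\<close> leaves a relation modulo the ideal of
    \<open>T\<close>. There \<open>\<psi>\<close> is a unit and its powers can be cancelled; passing
    to \<open>S\<close> then removes \<open>\<psi>\<close> and leaves a forbidden relation among the
    \<open>y j\<close>.\<close>
  obtain R where R: "R \<noteq> 0" "heval of_const x R = 0" using alg_dependent[of x] by blast
  obtain k R1 R2 where 1: "R = var None ^ k * (R1 + var None * R2)" "R1 \<noteq> 0" "novar None R1"
    using divide_var[OF R(1), of None] by blast
  have "\<xi> ^ k * (heval of_const x R1 + \<xi> * heval of_const x R2) = 0" using R(2) unfolding 1(1) by (simp add: h x)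
  then have "heval of_const x R1 + \<xi> * heval of_const x R2 = 0" using \<xi>0 by simp
  then have "heval of_const x R1 = - (\<xi> * heval of_const x R2)" by (simp add: eq_neg_iff_add_eq_0)
  then have R1: "heval of_const x R1 \<in> max_ideal T" using max_ideal_uminus[OF pT T(4) loc_ring_rules(6)[OF pT T(4) \<xi>(1) hT]] by simp
  obtain l T1 T2 where 2: "R1 = var (Some j0) ^ l * (T1 + var (Some j0) * T2)" "T1 \<noteq> 0" "novar (Some j0) T1" "\<forall>w. w \<noteq> Some j0 \<and> novar w R1 \<longrightarrow> novar w T1"
    using divide_var[OF 1(2), of "Some j0"] by blast
  have \<psi>T: "\<psi> \<in> loc_ring T" using max_ideal_loc_ring'[OF \<psi>(1)] loc_ring_mono[OF T(2)] by blast
  have "\<psi> ^ l * heval of_const x (T1 + var (Some j0) * T2) \<in> max_ideal T" using R1 unfolding 2(1) by (simp add: h x)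
  moreover have "\<psi> ^ l \<notin> max_ideal T" by (rule unit_power[OF pT T(4) \<psi>T \<psi>(2)])
  ultimately have "heval of_const x (T1 + var (Some j0) * T2) \<in> max_ideal T"
    using loc_ring_rules(9)[OF pT T(4) loc_ring_power[OF pT T(4) \<psi>T, of l] hT] by blast
  then have "heval of_const x (T1 + var (Some j0) * T2) \<in> max_ideal S" by (rule max_ideal_mono[OF pS pT T(2,4) hS])
  then have "heval of_const x T1 + \<psi> * heval of_const x T2 \<in> max_ideal S" by (simp add: h x)
  then have "heval of_const x T1 \<in> max_ideal S" using max_ideal_diff[OF pS S(2) _ loc_ring_rules(6)[OF pS S(2) \<psi>(1) hS[of T2]]] by fastforce
  moreover have "novar None T1" using 2(4) 1(3) by blast
  ultimately show False using ind[of T1 x, OF 2(2) _ 2(3) x(3)] by blast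
qed

context
  fixes w :: "'n \<Rightarrow> real"
  assumes w0: "\<And>j. 0 \<le> w j" and w1: "\<exists>j. 0 < w j"
begin

text \<open>Over a common denominator, distinct exponents of \<open>T\<close> become distinct
  monomials by linear independence, all of the same weight by \<open>wt\<close>. Nothing can cancel,
  so the value of the expression is 0 and it does not vanish on \<open>Z\<close>.\<close>

lemma Z_monomials_independent:
  fixes N D :: "'n \<Rightarrow> ('n \<Rightarrow>\<^sub>0 nat)"
  assumes wt: "\<And>j. j \<noteq> j0 \<Longrightarrow> wt w (N j) = wt w (D j)"
    and ind: "\<And>u. (\<Sum>j\<in>UNIV - {j0}. u j *\<^sub>R (exponent_vec (N j) - exponent_vec (D j))) = 0 \<Longrightarrow> (\<forall>j. j \<noteq> j0 \<longrightarrow> u j = 0)"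
    and y: "\<And>j. j \<noteq> j0 \<Longrightarrow> y j = of_mpoly (mpoly_monom (N j)) / of_mpoly (mpoly_monom (D j))"
    and L: "\<And>j. j \<noteq> j0 \<Longrightarrow> y j \<in> loc_ring (Z w)"
    and T: "T \<noteq> 0" "novar None T" "novar (Some j0) T" and x: "\<And>j. j \<noteq> j0 \<Longrightarrow> x (Some j) = y j"
  shows "heval of_const x T \<notin> max_ideal (Z w)"
proof -
  let ?U = "UNIV - {j0}"
  note pZ = irreducible_primeset[OF Z_irr[OF w0 w1]]
  note ZX = Z_sub[OF w0 w1]
  define M where "M = (\<Sum>m\<in>keys T. \<Sum>j\<in>UNIV. lookup m (Some j))"
  have M: "lookup m (Some j) \<le> M" if "m \<in> keys T" for m j
  proof -
    have "lookup m (Some j) \<le> (\<Sum>j\<in>UNIV. lookup m (Some j))" by (rule member_le_sum) auto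
    also have "\<dots> \<le> M" unfolding M_def by (rule member_le_sum) (use that in auto)
    finally show ?thesis .
  qed
  \<comment> \<open>The exponent of the numerator over the denominator with exponent
    \<open>DD\<close>; each \<open>y j\<close> is given \<open>M\<close> denominators regardless of
    its power.\<close>
  define e where "e m = (\<Sum>j\<in>?U. (\<Sum>i<lookup m (Some j). N j) + (\<Sum>i<M - lookup m (Some j). D j))" for m :: "'n option \<Rightarrow>\<^sub>0 nat"
  define DD where "DD = (\<Sum>j\<in>?U. \<Sum>i<M. D j)"
  have le: "lookup (e m) l = (\<Sum>j\<in>?U. lookup m (Some j) * lookup (N j) l + (M - lookup m (Some j)) * lookup (D j) l)" for m l
    by (simp add: e_def lookup_sum lookup_add)
  have wts: "wt w (sum g I) = (\<Sum>i\<in>I. wt w (g i))" for g :: "'i \<Rightarrow> _" and I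
    by (induction I rule: infinite_finite_induct) (auto simp: wt_add)
  have we: "wt w (e m) = wt w DD" if m: "m \<in> keys T" for m
  proof -
    have "real (lookup m (Some j)) * wt w (N j) + real (M - lookup m (Some j)) * wt w (D j) = real M * wt w (D j)" if "j \<in> ?U" for j
      using wt[of j] that M[OF m, of j] by (simp add: of_nat_diff algebra_simps)
    then show ?thesis unfolding e_def DD_def wts wt_add by (intro sum.cong) (simp_all add: wts)
  qed
  have inj: "inj_on e (keys T)"
  proof (rule inj_onI)
    fix m m' assume m: "m \<in> keys T" "m' \<in> keys T" and ee: "e m = e m'"
    let ?u = "\<lambda>j. real (lookup m (Some j)) - real (lookup m' (Some j))"
    have "(\<Sum>j\<in>?U. ?u j *\<^sub>R (exponent_vec (N j) - exponent_vec (D j))) = 0"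
    proof (rule vec_eq_iff[THEN iffD2], rule allI)
      fix l
      have r: "real (lookup (e m) l) = (\<Sum>j\<in>?U. real (lookup m (Some j)) * (real (lookup (N j) l) - real (lookup (D j) l)) + real M * real (lookup (D j) l))" if "m \<in> keys T" for m
        unfolding le of_nat_sum of_nat_add of_nat_mult of_nat_diff[OF M[OF that]] by (rule sum.cong) (simp_all add: algebra_simps)
      have "0 = real (lookup (e m) l) - real (lookup (e m') l)" using ee by simp
      also have "\<dots> = (\<Sum>j\<in>?U. ?u j * (real (lookup (N j) l) - real (lookup (D j) l)))"
        unfolding r[OF m(1)] r[OF m(2)] sum_subtractf[symmetric] by (rule sum.cong) (auto simp: algebra_simps)
      finally show "(\<Sum>j\<in>?U. ?u j *\<^sub>R (exponent_vec (N j) - exponent_vec (D j))) $ l = 0 $ l"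
        by (simp add: sum_component exponent_vec_def)
    qed
    then have u: "\<forall>j. j \<noteq> j0 \<longrightarrow> ?u j = 0" by (rule ind)
    show "m = m'"
    proof (rule poly_mapping_eqI)
      fix v
      have "lookup m None = 0" "lookup m' None = 0" "lookup m (Some j0) = 0" "lookup m' (Some j0) = 0"
        using T(2,3) m unfolding novar_def by blast+
      then show "lookup m v = lookup m' v" using u by (cases v) (auto, metis)
    qed
  qed
  define Q where "Q = (\<Sum>m\<in>keys T. Cst (lookup T m) * mpoly_monom (e m))"
  have lQ: "lookup Q (e m) = lookup T m" if m: "m \<in> keys T" for m
  proof -
    have "lookup Q (e m) = (\<Sum>m'\<in>keys T. if m' = m then lookup T m' else 0)"
      unfolding Q_def lookup_sum
      by (rule sum.cong) (use inj m in \<open>auto simp: Cst_def mpoly_monom_def mult_single lookup_single when_def inj_on_def\<close>)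
    then show ?thesis using m by simp
  qed
  have "keys T \<noteq> {}" using T(1) by (metis keys_eq_empty)
  then obtain m0 where m0: "m0 \<in> keys T" by blast
  have FQ: "wt_ge w (wt w DD) Q" unfolding Q_def
    by (rule wt_ge_sum) (simp add: Cst_def mpoly_monom_def mult_single wt_ge_def we)
  have "lookup (ini w (wt w DD) Q) (e m0) \<noteq> 0" using lQ[OF m0] we[OF m0] m0 by (simp add: lookup_ini in_keys_iff)
  then have iQ: "ini w (wt w DD) Q \<noteq> 0" by auto
  note nQ = wmin_eqI[OF FQ iQ]
  have q: "of_mpoly (mpoly_monom (e m)) = of_mpoly (mpoly_monom DD) * (\<Prod>v\<in>UNIV. x v ^ lookup m v)" if m: "m \<in> keys T" for m
  proof -
    have z: "lookup m None = 0" "lookup m (Some j0) = 0" using T(2,3) m unfolding novar_def by blast+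
    have inv: "of_mpoly (mpoly_monom (N j)) ^ k * of_mpoly (mpoly_monom (D j)) ^ (M - k) = of_mpoly (mpoly_monom (D j)) ^ M * y j ^ k" if "j \<noteq> j0" "k \<le> M" for j k
    proof -
      have "of_mpoly (mpoly_monom (D j)) ^ M = of_mpoly (mpoly_monom (D j)) ^ k * of_mpoly (mpoly_monom (D j)) ^ (M - k)"
        using that by (simp flip: power_add)
      then show ?thesis by (simp add: y[OF that(1)] power_divide)
    qed
    have "(\<Prod>v\<in>UNIV. x v ^ lookup m v) = (\<Prod>v\<in>range Some. x v ^ lookup m v)"
      by (simp add: UNIV_option_conv z)
    also have "\<dots> = (\<Prod>j\<in>UNIV. x (Some j) ^ lookup m (Some j))" by (subst prod.reindex) auto
    also have "\<dots> = (\<Prod>j\<in>?U. x (Some j) ^ lookup m (Some j))"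
      by (rule prod.mono_neutral_right) (auto simp: z)
    finally have xx: "(\<Prod>v\<in>UNIV. x v ^ lookup m v) = (\<Prod>j\<in>?U. y j ^ lookup m (Some j))" using x by simp
    have "of_mpoly (mpoly_monom (e m)) = (\<Prod>j\<in>?U. of_mpoly (mpoly_monom (N j)) ^ lookup m (Some j) * of_mpoly (mpoly_monom (D j)) ^ (M - lookup m (Some j)))"
      unfolding e_def by (simp add: mpoly_monom_sum mpoly_monom_add rhom_prod[OF rhom_of_mpoly])
    also have "\<dots> = (\<Prod>j\<in>?U. of_mpoly (mpoly_monom (D j)) ^ M * y j ^ lookup m (Some j))"
      by (rule prod.cong) (use inv M[OF m] in auto)
    also have "\<dots> = of_mpoly (mpoly_monom DD) * (\<Prod>v\<in>UNIV. x v ^ lookup m v)"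
      unfolding xx DD_def by (simp add: prod.distrib mpoly_monom_sum rhom_prod[OF rhom_of_mpoly])
    finally show ?thesis .
  qed
  have "of_mpoly (mpoly_monom DD) * heval of_const x T = (\<Sum>m\<in>keys T. of_const (lookup T m) * of_mpoly (mpoly_monom (e m)))"
    unfolding heval_finite[OF rhom_of_const] sum_distrib_left by (rule sum.cong) (simp_all add: q)
  then have eq: "of_mpoly (mpoly_monom DD) * heval of_const x T = of_mpoly Q" unfolding Q_def by (simp add: rhom_sum[OF rhom_of_mpoly] of_const_def)
  then have nz: "heval of_const x T \<noteq> 0" using nQ(2) by auto
  have "wt w DD + wval w (heval of_const x T) = wt w DD"
    using wval_mult[of "of_mpoly (mpoly_monom DD)" "heval of_const x T" w] nz nQ by (simp add: eq wval_of_mpoly wmin_monom)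
  then have n0: "wval w (heval of_const x T) = 0" by simp
  \<comment> \<open>\<open>T\<close> does not involve \<open>None\<close> and
    \<open>Some j0\<close>, at which \<open>x\<close> is arbitrary; putting 0 there makes all
    arguments regular along \<open>Z\<close>.\<close>
  have "heval of_const x T = heval of_const (\<lambda>v. case v of None \<Rightarrow> 0 | Some j \<Rightarrow> if j = j0 then 0 else y j) T"
    unfolding heval_def
  proof (rule sum.cong[OF refl], rule arg_cong[where f = "(*) _"], rule prod.cong[OF refl])
    fix m v assume m: "m \<in> keys T" "v \<in> keys m"
    have "lookup m None = 0" "lookup m (Some j0) = 0" using T(2,3) m(1) unfolding novar_def by blast+
    then have "v \<noteq> None" "v \<noteq> Some j0" using m(2) unfolding in_keys_iff by metis+
    then show "x v ^ lookup m v = (case v of None \<Rightarrow> 0 | Some j \<Rightarrow> if j = j0 then 0 else y j) ^ lookup m v"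
      using x by (cases v) auto
  qed
  also have "\<dots> \<in> loc_ring (Z w)"
    by (rule loc_ring_heval[OF pZ ZX]) (auto simp: loc_ring_0[OF pZ ZX] L split: option.splits)
  finally have "heval of_const x T \<in> loc_ring (Z w)" .
  then show ?thesis using Z_wval(2)[OF w0 w1 _ nz] n0 by simp
qed

text \<open>The generator divides the monomial of \<open>\<alpha>0\<close>, of weight
  \<open>s\<close>, and is a combination of elements of weight at least \<open>s\<close>.\<close>

lemma Z_wval_generator:
  assumes A: "\<And>\<alpha>. \<alpha> \<in> A \<Longrightarrow> s \<le> wt w \<alpha>" "\<alpha>0 \<in> A" "wt w \<alpha>0 = s" 
    and d: "\<And>B. B \<in> ideal_gen (mpoly_monom ` A) \<Longrightarrow> \<exists>h\<in>loc_ring (Z w). of_mpoly B = r * h"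
    and r: "r = (\<Sum>k<N::nat. h k * of_mpoly (B k))" "\<And>k. k < N \<Longrightarrow> B k \<in> ideal_gen (mpoly_monom ` A) \<and> h k \<in> loc_ring (Z w)"
  shows "r \<noteq> 0" "wval w r = s"
proof -
  obtain t where t: "t \<in> loc_ring (Z w)" "of_mpoly (mpoly_monom \<alpha>0) = r * t"
    using d[OF ideal_gen_base[of "mpoly_monom \<alpha>0"]] A(2) by blast
  have "r * t \<noteq> 0" using t(2) by (metis of_mpoly_eq_0_iff mpoly_monom_nz)
  then have nz: "r \<noteq> 0" "t \<noteq> 0" by auto
  then show "r \<noteq> 0" by simp
  have "s = wval w r + wval w t" using wval_mult[OF nz, of w] A(3) by (simp add: wval_of_mpoly wmin_monom flip: t(2))
  moreover have "0 \<le> wval w t" by (rule Z_wval(1)[OF w0 w1 t(1) nz(2)])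
  moreover have "wval_ge w s r" unfolding r(1)
  proof (rule wval_ge_sum)
    fix k assume "k \<in> {..<N}"
    then have k: "B k \<in> ideal_gen (mpoly_monom ` A)" "h k \<in> loc_ring (Z w)" using r(2) by auto
    have "wval_ge w s (of_mpoly (B k))" unfolding wval_ge_of_mpoly by (rule wt_ge_ideal_gen[OF k(1) w0 A(1)])
    then show "wval_ge w s (h k * of_mpoly (B k))" using wval_ge_mult[OF Z_wval_ge[OF w0 w1 k(2)], of s "of_mpoly (B k)"] by simp
  qed
  ultimately show "wval w r = s" using nz by (simp add: wval_ge_def)
qed

text \<open>Since the ideal is principal on \<open>X\<close>, each monomial of least weight
  \<open>s\<close> is a unit times the generator, and ratios of such monomials are regular along
  \<open>Z\<close>. The same holds for coordinates of weight 0. By \<open>facet\<close> the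
  exponents of these Laurent monomials span a space of dimension at least n - 1, which supplies the
  functions for \<open>prime_divisor_criterion\<close>.\<close>

lemma Z_prime_divisor:
  assumes A: "\<And>\<alpha>. \<alpha> \<in> A \<Longrightarrow> s \<le> wt w \<alpha>" "\<alpha>0 \<in> A" "wt w \<alpha>0 = s" 
    and gen: "\<And>p. p \<in> X \<Longrightarrow> \<exists>g. generates_pullback X (ideal_gen (mpoly_monom ` A)) p g"
    and facet: "\<And>u :: real ^ 'n. (\<And>j. w j = 0 \<Longrightarrow> u $ j = 0) \<Longrightarrow> 
       (\<And>\<alpha>. \<alpha> \<in> A \<Longrightarrow> wt w \<alpha> = s \<Longrightarrow> u \<bullet> (exponent_vec \<alpha> - exponent_vec \<alpha>0) = 0) \<Longrightarrow> \<exists>c. \<forall>j. u $ j = c * w j"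
  shows "prime_divisor X (Z w)"
proof -
  note pZ = irreducible_primeset[OF Z_irr[OF w0 w1]]
  note ZX = Z_sub[OF w0 w1]
  obtain j0 where "0 < w j0" using w1 by blast
  obtain p where p: "p \<in> Z w" using irreducible_closedD(2)[OF Z_irr[OF w0 w1]] by blast
  then have pX: "p \<in> X" using ZX by blast
  have sub: "loc_ring {p} \<subseteq> loc_ring (Z w)" using p by (intro loc_ring_mono) auto
  obtain g where g: "generates_pullback X (ideal_gen (mpoly_monom ` A)) p g" using gen[OF pX] by blast
  obtain r N B h where 1: "germ p g r" "\<And>B. B \<in> ideal_gen (mpoly_monom ` A) \<Longrightarrow> \<exists>h\<in>loc_ring {p}. of_mpoly B = r * h"
    "\<And>k. k < N \<Longrightarrow> B k \<in> ideal_gen (mpoly_monom ` A) \<and> h k \<in> loc_ring {p}" "r = (\<Sum>k<(N::nat). h k * of_mpoly (B k))"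
    by (rule generatesE[OF g pX]) (rule that)
  have d: "\<exists>h\<in>loc_ring (Z w). of_mpoly B = r * h" if "B \<in> ideal_gen (mpoly_monom ` A)" for B using 1(2)[OF that] sub by blast
  have r': "B k \<in> ideal_gen (mpoly_monom ` A) \<and> h k \<in> loc_ring (Z w)" if "k < N" for k using 1(3)[OF that] sub by blast
  note r = Z_wval_generator[OF A d 1(4) r']
  \<comment> \<open>The cofactor has value \<open>s - s = 0\<close>, so it is a unit along
    \<open>Z\<close>.\<close>
  have un: "\<exists>t. t \<in> loc_ring (Z w) \<and> t \<notin> max_ideal (Z w) \<and> of_mpoly (mpoly_monom \<alpha>) = r * t" if \<alpha>: "\<alpha> \<in> A" "wt w \<alpha> = s" for \<alpha>
  proof -
    obtain t where t: "t \<in> loc_ring (Z w)" "of_mpoly (mpoly_monom \<alpha>) = r * t"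
      using d[OF ideal_gen_base[of "mpoly_monom \<alpha>"]] \<alpha>(1) by blast
    have "r * t \<noteq> 0" using t(2) by (metis of_mpoly_eq_0_iff mpoly_monom_nz)
    then have nz: "r \<noteq> 0" "t \<noteq> 0" by auto
    have "s = wval w r + wval w t" using wval_mult[OF nz, of w] \<alpha>(2) by (simp add: wval_of_mpoly wmin_monom flip: t(2))
    then have "t \<notin> max_ideal (Z w)" using Z_wval(2)[OF w0 w1 t(1) nz(2)] r(2) by simp
    then show ?thesis using t by blast
  qed
  define W where "W = (\<lambda>(N, D). exponent_vec N - exponent_vec D :: real ^ 'n)"
  \<comment> \<open>Laurent monomials of weight 0 that are regular along \<open>Z\<close>, as pairs
    of exponents of numerator and denominator.\<close>
  define Om where "Om = {(N, D). wt w N = wt w D \<and> of_mpoly (mpoly_monom N) / of_mpoly (mpoly_monom D) \<in> loc_ring (Z w)}"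
  have O1: "(Poly_Mapping.single j 1, 0) \<in> Om" if "w j = 0" for j
    using that loc_ring_rules(4)[OF pZ ZX, of j] by (simp add: Om_def wt_single mpoly_monom_0 coord_def var_def)
  have O2: "(\<alpha>, \<alpha>0) \<in> Om" if \<alpha>: "\<alpha> \<in> A" "wt w \<alpha> = s" for \<alpha>
  proof -
    obtain t where t: "t \<in> loc_ring (Z w)" "of_mpoly (mpoly_monom \<alpha>) = r * t" using un[OF \<alpha>] by blast
    obtain t0 where t0: "t0 \<in> loc_ring (Z w)" "t0 \<notin> max_ideal (Z w)" "of_mpoly (mpoly_monom \<alpha>0) = r * t0" using un[OF A(2,3)] by blast
    have "of_mpoly (mpoly_monom \<alpha>) / of_mpoly (mpoly_monom \<alpha>0) = t / t0" using r(1) t(2) t0(3) by simp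
    then show ?thesis using loc_ring_inverse_mult[OF pZ ZX t(1) t0(1,2)] \<alpha>(2) A(3) by (simp add: Om_def)
  qed
  let ?V = "W ` Om"
  define ww where "ww = (\<chi> j. w j)"
  \<comment> \<open>A vector orthogonal to the exponents of weight-0 coordinates and of facet ratios
    satisfies the premises of \<open>facet\<close>. The orthogonal complement is thus at most a
    line.\<close>
  have "{u. \<forall>v\<in>span ?V. orthogonal v u} \<subseteq> span {ww}"
  proof
    fix u assume "u \<in> {u. \<forall>v\<in>span ?V. orthogonal v u}"
    then have u: "u \<bullet> W nd = 0" if "nd \<in> Om" for nd using that span_base[of "W nd" ?V] by (auto simp: orthogonal_def inner_commute)
    have "\<exists>c. \<forall>j. u $ j = c * w j"
    proof (rule facet)
      fix j assume "w j = 0"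
      then have "u \<bullet> W (Poly_Mapping.single j 1, 0) = 0" by (rule u[OF O1])
      moreover have "W (Poly_Mapping.single j 1, 0) = axis j 1"
        by (auto simp: W_def exponent_vec_def vec_eq_iff axis_def lookup_single when_def)
      ultimately show "u $ j = 0" by (simp add: inner_axis)
    next
      fix \<alpha> assume "\<alpha> \<in> A" "wt w \<alpha> = s"
      then show "u \<bullet> (exponent_vec \<alpha> - exponent_vec \<alpha>0) = 0" using u[OF O2] by (simp add: W_def)
    qed
    then obtain c where "\<forall>j. u $ j = c * w j" by blast
    then have "u = c *\<^sub>R ww" by (simp add: vec_eq_iff ww_def)
    then show "u \<in> span {ww}" by (simp add: span_base span_scale)
  qed
  then have "dim {u. \<forall>v\<in>span ?V. orthogonal v u} \<le> dim (span {ww})" by (rule dim_subset)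
  also have "\<dots> \<le> 1" using dim_le_card[of "span {ww}" "{ww}"] by simp
  finally have "dim {u. \<forall>v\<in>span ?V. orthogonal v u} \<le> 1" .
  moreover have "dim {u \<in> UNIV. \<forall>v\<in>span ?V. orthogonal v u} + dim (span ?V) = dim (UNIV :: (real ^ 'n) set)"
    by (rule dim_subspace_orthogonal_to_vectors) auto
  ultimately have dV: "CARD('n) - 1 \<le> dim ?V" by simp
  obtain B where B: "B \<subseteq> ?V" "independent B" "card B = dim ?V" using basis_exists[of ?V] by metis
  have fB: "finite B" using B(2) independent_imp_finite by blast
  have "card (UNIV - {j0}) \<le> card B" using dV B(3) by simp
  then obtain b where b: "b ` (UNIV - {j0}) \<subseteq> B" "inj_on b (UNIV - {j0})" using card_le_inj[of "UNIV - {j0}" B] fB by auto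
  have "\<forall>j\<in>UNIV - {j0}. \<exists>nd. nd \<in> Om \<and> b j = W nd" using b(1) B(1) by blast
  then have "\<exists>nd. \<forall>j\<in>UNIV - {j0}. nd j \<in> Om \<and> b j = W (nd j)" by (rule bchoice)
  then obtain nd where "\<forall>j\<in>UNIV - {j0}. nd j \<in> Om \<and> b j = W (nd j)" by (rule exE)
  then have nd: "nd j \<in> Om \<and> b j = W (nd j)" if "j \<noteq> j0" for j using that by simp
  define N' where "N' j = fst (nd j)" for j
  define D' where "D' j = snd (nd j)" for j
  have ND: "wt w (N' j) = wt w (D' j)" "of_mpoly (mpoly_monom (N' j)) / of_mpoly (mpoly_monom (D' j)) \<in> loc_ring (Z w)" "b j = exponent_vec (N' j) - exponent_vec (D' j)" if "j \<noteq> j0" for j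
    using nd[OF that] by (auto simp: Om_def W_def N'_def D'_def split_beta)
  have ind: "\<forall>j. j \<noteq> j0 \<longrightarrow> u j = 0" if u: "(\<Sum>j\<in>UNIV - {j0}. u j *\<^sub>R (exponent_vec (N' j) - exponent_vec (D' j))) = 0" for u
  proof (intro allI impI)
    fix j assume j: "j \<noteq> j0"
    let ?f = "inv_into (UNIV - {j0}) b"
    have "(\<Sum>x\<in>b ` (UNIV - {j0}). u (?f x) *\<^sub>R x) = (\<Sum>j\<in>UNIV - {j0}. u (?f (b j)) *\<^sub>R b j)"
      by (rule sum.reindex_cong[OF b(2) refl refl])
    also have "\<dots> = (\<Sum>j\<in>UNIV - {j0}. u j *\<^sub>R (exponent_vec (N' j) - exponent_vec (D' j)))"
      by (rule sum.cong) (simp_all only: inv_into_f_f[OF b(2)] Diff_iff ND(3)[symmetric] singleton_iff simp_thms)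
    finally have z: "(\<Sum>x\<in>b ` (UNIV - {j0}). u (?f x) *\<^sub>R x) = 0" using u by simp
    have "u (?f (b j)) = 0"
      by (rule independentD[OF B(2) _ b(1) z]) (use j in auto)
    then show "u j = 0" using inv_into_f_f[OF b(2), of j] j by simp
  qed
  let ?y = "\<lambda>j. of_mpoly (mpoly_monom (N' j)) / of_mpoly (mpoly_monom (D' j))"
  show ?thesis
  proof (rule prime_divisor_criterion[OF Z_irr[OF w0 w1] ZX Z_ne[OF w0 w1], of j0 ?y])
    show "?y j \<in> loc_ring (Z w)" if "j \<noteq> j0" for j by (rule ND(2)[OF that])
    show "heval of_const x T \<notin> max_ideal (Z w)" if T: "T \<noteq> 0" "novar None T" "novar (Some j0) T" and x: "\<And>j. j \<noteq> j0 \<Longrightarrow> x (Some j) = ?y j" for T x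
      by (rule Z_monomials_independent[where N = N' and D = D' and y = ?y and ?j0.0 = j0]) (use ND ind T x in \<open>simp_all\<close>)
  qed
qed

end

end

section \<open>Newton polyhedra\<close>

lemma wt_inner: "wt w \<alpha> = (\<chi> j. w j) \<bullet> exponent_vec \<alpha>"
  by (simp add: wt_def inner_vec_def exponent_vec_def)

lemma newton_polyhedron_mem: "\<alpha> \<in> A \<Longrightarrow> exponent_vec \<alpha> \<in> newton_polyhedron A"
  unfolding newton_polyhedron_def by (rule hull_inc) (force intro: exI[of _ 0])

lemma convex_newton_polyhedron: "convex (newton_polyhedron A)"
  unfolding newton_polyhedron_def by (rule convex_convex_hull)

lemma newton_polyhedron_up:
  assumes "x \<in> newton_polyhedron A" "\<And>j. x $ j \<le> y $ j" shows "y \<in> newton_polyhedron A"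
proof -
  let ?S = "\<Union>m\<in>A. {exponent_vec m + y | y. \<forall>j. 0 \<le> y $ j} :: (real ^ 'a) set"
  let ?t = "y - x"
  have "?S \<subseteq> {q. q + ?t \<in> convex hull ?S}"
  proof
    fix q assume "q \<in> ?S"
    then obtain m r where "m \<in> A" "q = exponent_vec m + r" "\<forall>j. 0 \<le> r $ j" by blast
    then have "m \<in> A" "q + ?t = exponent_vec m + (r + ?t)" "\<forall>j. 0 \<le> (r + ?t) $ j" using assms(2) by (auto simp: algebra_simps add_increasing)
    then have "q + ?t \<in> ?S" by blast
    then show "q \<in> {q. q + ?t \<in> convex hull ?S}" by (simp add: hull_inc)
  qed
  moreover have "convex {q. q + ?t \<in> convex hull ?S}"
  proof (rule convexI)
    fix p q and u v :: real
    assume "p \<in> {q. q + ?t \<in> convex hull ?S}" "q \<in> {q. q + ?t \<in> convex hull ?S}" and uv: "0 \<le> u" "0 \<le> v" "u + v = 1"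
    then have "u *\<^sub>R (p + ?t) + v *\<^sub>R (q + ?t) \<in> convex hull ?S"
      by (intro convexD[OF convex_convex_hull]) simp_all
    moreover have "u *\<^sub>R (p + ?t) + v *\<^sub>R (q + ?t) = (u *\<^sub>R p + v *\<^sub>R q) + (u + v) *\<^sub>R ?t" 
      by (simp add: algebra_simps)
    ultimately show "u *\<^sub>R p + v *\<^sub>R q \<in> {q. q + ?t \<in> convex hull ?S}" by (simp add: uv(3))
  qed
  ultimately have "convex hull ?S \<subseteq> {q. q + ?t \<in> convex hull ?S}" by (rule hull_minimal)
  then show ?thesis using assms(1) unfolding newton_polyhedron_def by auto
qed

lemma newton_polyhedron_ge:
  assumes "x \<in> newton_polyhedron A" "\<And>j. 0 \<le> w $ j" "\<And>\<alpha>. \<alpha> \<in> A \<Longrightarrow> s \<le> w \<bullet> exponent_vec \<alpha>"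
  shows "s \<le> w \<bullet> x"
proof -
  have "(\<Union>m\<in>A. {exponent_vec m + y | y. \<forall>j. 0 \<le> y $ j}) \<subseteq> {q. s \<le> w \<bullet> q}"
  proof
    fix q assume "q \<in> (\<Union>m\<in>A. {exponent_vec m + y | y. \<forall>j. 0 \<le> y $ j})"
    then obtain m r where *: "m \<in> A" "q = exponent_vec m + r" "\<forall>j. 0 \<le> r $ j" by blast
    have "0 \<le> w \<bullet> r" unfolding inner_vec_def using *(3) assms(2) by (simp add: sum_nonneg)
    then show "q \<in> {q. s \<le> w \<bullet> q}" using assms(3)[OF *(1)] *(2) by (simp add: inner_add_right)
  qed
  moreover have "convex {q. s \<le> w \<bullet> q}" by (rule convex_halfspace_ge)
  ultimately have "newton_polyhedron A \<subseteq> {q. s \<le> w \<bullet> q}" unfolding newton_polyhedron_def by (rule hull_minimal)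
  then show ?thesis using assms(1) by blast
qed

text \<open>A hyperplane separates \<open>z\<close> from the interior of \<open>T\<close>, which is
  nonempty as \<open>T\<close> is closed upwards; moving far upwards inside \<open>T\<close> shows
  that the normal has no negative component.\<close>

lemma upclosed_separation:
  fixes T :: "(real ^ 'n) set"
  assumes T: "convex T" "\<And>p q. p \<in> T \<Longrightarrow> (\<And>j. p $ j \<le> q $ j) \<Longrightarrow> q \<in> T" and p0: "p0 \<in> T" and z: "z \<notin> interior T"
  obtains a where "a \<noteq> 0" "\<And>j. 0 \<le> a $ j" "\<And>q. q \<in> T \<Longrightarrow> a \<bullet> z \<le> a \<bullet> q"
proof -
  \<comment> \<open>Each point of \<open>T\<close> is a limit of interior points, so the inequality
    extends from the interior to \<open>T\<close>.\<close>
  have int: "p + e *\<^sub>R 1 \<in> interior T" if p: "p \<in> T" and e: "0 < e" for p e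
  proof (rule interiorI[of "ball (p + e *\<^sub>R 1) e"])
    show "ball (p + e *\<^sub>R 1) e \<subseteq> T"
    proof
      fix q assume "q \<in> ball (p + e *\<^sub>R 1) e"
      then have n: "norm (p + e *\<^sub>R 1 - q) < e" by (simp add: dist_norm)
      show "q \<in> T"
      proof (rule T(2)[OF p])
        fix j
        have "\<bar>(p + e *\<^sub>R 1 - q) $ j\<bar> < e" using component_le_norm_cart[of "p + e *\<^sub>R 1 - q" j] n by linarith
        then show "p $ j \<le> q $ j" by simp
      qed
    qed
  qed (use e in auto)
  have "\<exists>a b. a \<noteq> 0 \<and> (\<forall>x\<in>{z}. a \<bullet> x \<le> b) \<and> (\<forall>x\<in>interior T. b \<le> a \<bullet> x)"
    using separating_hyperplane_sets[of "{z}" "interior T"] z int[OF p0, of 1] T(1) by (auto simp: convex_interior)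
  then obtain a where a: "a \<noteq> 0" "\<And>q. q \<in> interior T \<Longrightarrow> a \<bullet> z \<le> a \<bullet> q" by force
  have 1: "a \<bullet> z \<le> a \<bullet> q" if q: "q \<in> T" for q
  proof (rule field_le_epsilon)
    fix e :: real assume e: "0 < e"
    define d where "d = e / (\<bar>a \<bullet> 1\<bar> + 1)"
    have d: "0 < d" "d * (a \<bullet> 1) \<le> e"
    proof -
      show "0 < d" using e by (simp add: d_def)
      have "d * (a \<bullet> 1) \<le> d * (\<bar>a \<bullet> 1\<bar> + 1)" using \<open>0 < d\<close> by (intro mult_left_mono) auto
      also have "\<dots> = e" by (simp add: d_def)
      finally show "d * (a \<bullet> 1) \<le> e" .
    qed
    show "a \<bullet> z \<le> a \<bullet> q + e" using a(2)[OF int[OF q d(1)]] d(2) by (simp add: inner_add_right)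
  qed
  have "0 \<le> a $ j" for j
  proof (rule ccontr)
    assume n: "\<not> 0 \<le> a $ j"
    \<comment> \<open>Large enough that moving \<open>p0\<close> by \<open>M\<close> along the axis
      \<open>j\<close> would bring the functional below its value at \<open>z\<close>.\<close>
    define M where "M = (\<bar>a \<bullet> p0\<bar> + \<bar>a \<bullet> z\<bar> + 1) / - (a $ j)"
    have M: "0 \<le> M" "M * a $ j = - (\<bar>a \<bullet> p0\<bar> + \<bar>a \<bullet> z\<bar> + 1)" using n by (auto simp: M_def field_simps)
    have "p0 + M *\<^sub>R axis j 1 \<in> T" by (rule T(2)[OF p0]) (use M(1) in \<open>simp add: axis_def\<close>)
    then have "a \<bullet> z \<le> a \<bullet> (p0 + M *\<^sub>R axis j 1)" by (rule 1)
    then show False using M(2) by (simp add: inner_add_right inner_axis)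
  qed
  then show thesis by (rule that[OF a(1) _ 1])
qed

section \<open>Separating weights and facets\<close>

lemma exponent_vec_nonneg [simp]: "0 \<le> exponent_vec \<alpha> $ j" by (simp add: exponent_vec_def)

text \<open>If \<open>z $ i\<close> is positive, a separating normal cannot be supported on
  \<open>i\<close>, as it would vanish on \<open>\<alpha>1\<close> but not on \<open>z\<close>. If
  \<open>z $ i = 0\<close>, one separates \<open>z\<close> from the face inside the hyperplane, and
  then adds a multiple of the axis \<open>i\<close> to reach the exponents off the face.\<close>

lemma separating_weight:
  assumes z: "\<And>j. 0 \<le> z $ j" "z \<notin> interior (newton_polyhedron A)" "z \<notin> newton_face_ri i A"
    and a0: "\<alpha>1 \<in> A" "lookup \<alpha>1 i = 0"
  shows "\<exists>w. (\<forall>j. 0 \<le> w $ j) \<and> (\<exists>j. j \<noteq> i \<and> 0 < w $ j) \<and> (\<forall>\<alpha>\<in>A. w \<bullet> z \<le> w \<bullet> exponent_vec \<alpha>)"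
proof (cases "z $ i = 0")
  case False
  then have zi: "0 < z $ i" using z(1)[of i] by simp
  obtain a where a: "a \<noteq> 0" "\<And>j. 0 \<le> a $ j" "\<And>q. q \<in> newton_polyhedron A \<Longrightarrow> a \<bullet> z \<le> a \<bullet> q"
    by (rule upclosed_separation[OF convex_newton_polyhedron _ newton_polyhedron_mem[OF a0(1)] z(2)])
      (rule newton_polyhedron_up, assumption, assumption, rule that)
  have "\<exists>j. j \<noteq> i \<and> 0 < a $ j"
  proof (rule ccontr)
    assume n: "\<not> ?thesis"
    then have "\<not> 0 < a $ j" if "j \<noteq> i" for j using that by blast
    then have n: "a $ j = 0" if "j \<noteq> i" for j using a(2)[of j] that by (simp add: less_le)
    have e: "a \<bullet> q = a $ i * q $ i" for q
    proof -
      have "a \<bullet> q = (\<Sum>j\<in>{i}. a $ j * q $ j)" unfolding inner_vec_def inner_real_def by (rule sum.mono_neutral_right) (auto simp: n)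
      then show ?thesis by simp
    qed
    have "a $ i \<noteq> 0" using a(1) n by (metis vec_eq_iff zero_index)
    then have "0 < a $ i" using a(2)[of i] by simp
    then have "0 < a \<bullet> z" using zi by (simp add: e)
    also have "a \<bullet> z \<le> a \<bullet> exponent_vec \<alpha>1" by (rule a(3)[OF newton_polyhedron_mem[OF a0(1)]])
    also have "\<dots> = 0" using a0(2) by (simp add: e exponent_vec_def)
    finally show False by simp
  qed
  then show ?thesis using a(2) a(3)[OF newton_polyhedron_mem] by (intro exI[of _ a] conjI) auto
next
  case True
  define pr where "pr q = (\<chi> j. if j = i then 0 else q $ j)" for q :: "real ^ 'a"
  \<comment> \<open>The cylinder over the face; a point of the hyperplane in its interior lies in
    the relative interior of the face.\<close>
  let ?T = "{q. pr q \<in> newton_polyhedron A}"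
  have pl: "pr (u *\<^sub>R p + v *\<^sub>R q) = u *\<^sub>R pr p + v *\<^sub>R pr q" for u v p q by (simp add: pr_def vec_eq_iff)
  have cT: "convex ?T" unfolding convex_def
    using convex_newton_polyhedron[of A] by (auto simp: pl convex_def)
  have uT: "q \<in> ?T" if "p \<in> ?T" "\<And>j. p $ j \<le> q $ j" for p q
  proof -
    have "pr q \<in> newton_polyhedron A" by (rule newton_polyhedron_up[of "pr p"]) (use that in \<open>auto simp: pr_def\<close>)
    then show ?thesis by simp
  qed
  have p1: "exponent_vec \<alpha> \<in> ?T" if "\<alpha> \<in> A" "lookup \<alpha> i = 0" for \<alpha>
  proof -
    have "pr (exponent_vec \<alpha>) = exponent_vec \<alpha>" using that(2) by (auto simp: pr_def exponent_vec_def vec_eq_iff)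
    then show ?thesis using newton_polyhedron_mem[OF that(1)] by simp
  qed
  have zT: "z \<notin> interior ?T"
  proof
    assume "z \<in> interior ?T"
    then obtain e where e: "0 < e" "ball z e \<subseteq> ?T" by (auto simp: mem_interior)
    have "z \<in> newton_face_ri i A"
      unfolding newton_face_ri_def interior_of_def
    proof (rule CollectI, intro exI[of _ "{x. x $ i = 0} \<inter> ball z e"] conjI)
      show "openin (top_of_set {x. x $ i = 0}) ({x. x $ i = 0} \<inter> ball z e)" by (simp add: openin_open_Int)
      show "z \<in> {x. x $ i = 0} \<inter> ball z e" using True e by simp
      show "{x. x $ i = 0} \<inter> ball z e \<subseteq> newton_face i A"
      proof
        fix q assume q: "q \<in> {x. x $ i = 0} \<inter> ball z e"
        then have "pr q = q" by (auto simp: pr_def vec_eq_iff)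
        then show "q \<in> newton_face i A" using q e(2) by (auto simp: newton_face_def)
      qed
    qed
    then show False using z(3) by blast
  qed
  obtain a where a: "a \<noteq> 0" "\<And>j. 0 \<le> a $ j" "\<And>q. q \<in> ?T \<Longrightarrow> a \<bullet> z \<le> a \<bullet> q"
    by (rule upclosed_separation[OF cT _ p1[OF a0] zT]) (rule uT, assumption, assumption, rule that)
  have ai: "a $ i = 0"
  proof (rule ccontr)
    assume "a $ i \<noteq> 0"
    then have pos: "0 < a $ i" using a(2)[of i] by simp
    \<comment> \<open>The cylinder is invariant along the axis \<open>i\<close>. A positive
      \<open>a $ i\<close> would let the functional fall below 0 on it, although it is nonnegative
      at \<open>z\<close>.\<close>
    define M where "M = (\<bar>a \<bullet> exponent_vec \<alpha>1\<bar> + 1) / a $ i"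
    have "pr (exponent_vec \<alpha>1 - M *\<^sub>R axis i 1) = pr (exponent_vec \<alpha>1)" by (simp add: pr_def vec_eq_iff axis_def)
    then have "exponent_vec \<alpha>1 - M *\<^sub>R axis i 1 \<in> ?T" using p1[OF a0] by simp
    then have "a \<bullet> z \<le> a \<bullet> (exponent_vec \<alpha>1 - M *\<^sub>R axis i 1)" by (rule a(3))
    also have "\<dots> = a \<bullet> exponent_vec \<alpha>1 - (\<bar>a \<bullet> exponent_vec \<alpha>1\<bar> + 1)" using pos by (simp add: inner_diff_right inner_axis M_def)
    also have "\<dots> < 0" by linarith
    finally have "a \<bullet> z < 0" .
    moreover have "0 \<le> a \<bullet> z" unfolding inner_vec_def using a(2) z(1) by (simp add: sum_nonneg)
    ultimately show False by simp
  qed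
  have az: "0 \<le> a \<bullet> z" unfolding inner_vec_def using a(2) z(1) by (simp add: sum_nonneg)
  \<comment> \<open>The multiple \<open>a \<bullet> z\<close> suffices: an exponent off the face has
    component \<open>i\<close> at least 1, so this term alone reaches the value at \<open>z\<close>,
    where component \<open>i\<close> is 0.\<close>
  define w where "w = a + (a \<bullet> z) *\<^sub>R axis i 1"
  have wi: "w \<bullet> q = a \<bullet> q + (a \<bullet> z) * q $ i" for q
    unfolding w_def by (simp add: inner_add_left inner_commute[of "axis i 1"] inner_axis)
  show ?thesis
  proof (intro exI[of _ w] conjI allI ballI)
    show "0 \<le> w $ j" for j using a(2) az by (simp add: w_def axis_def)
    obtain j where "a $ j \<noteq> 0" using a(1) by (metis vec_eq_iff zero_index)
    then show "\<exists>j. j \<noteq> i \<and> 0 < w $ j" using ai a(2)[of j] by (intro exI[of _ j]) (auto simp: w_def axis_def)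
    fix \<alpha> assume \<alpha>: "\<alpha> \<in> A"
    have 0: "0 \<le> a \<bullet> exponent_vec \<alpha>" unfolding inner_vec_def using a(2) by (simp add: sum_nonneg)
    show "w \<bullet> z \<le> w \<bullet> exponent_vec \<alpha>"
    proof (cases "lookup \<alpha> i = 0")
      case l: True
      then show ?thesis using a(3)[OF p1[OF \<alpha> l]] True by (simp add: wi exponent_vec_def)
    next
      case False
      then have "1 \<le> exponent_vec \<alpha> $ i" by (simp add: exponent_vec_def)
      then have "a \<bullet> z \<le> (a \<bullet> z) * exponent_vec \<alpha> $ i" using mult_left_mono[of 1 "exponent_vec \<alpha> $ i" "a \<bullet> z"] az by simp
      then show ?thesis using 0 True by (simp add: wi)
    qed
  qed
qed

text \<open>The ratio test of linear programming: move along \<open>u\<close> until the first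
  constraint becomes tight. Those tight before stay tight because \<open>u\<close> is orthogonal to
  them.\<close>

lemma move_to_boundary:
  fixes S :: "'a::real_inner set"
  assumes S: "finite S" "\<And>v. v \<in> S \<Longrightarrow> 0 \<le> v \<bullet> w" "\<And>v. v \<in> S \<Longrightarrow> v \<bullet> w = 0 \<Longrightarrow> v \<bullet> u = 0" and v0: "v0 \<in> S" "v0 \<bullet> u < 0"
  shows "\<exists>t>0. (\<forall>v\<in>S. 0 \<le> v \<bullet> (w + t *\<^sub>R u)) \<and> {v\<in>S. v \<bullet> w = 0} \<subset> {v\<in>S. v \<bullet> (w + t *\<^sub>R u) = 0}"
proof -
  let ?N = "{v\<in>S. v \<bullet> u < 0}" and ?g = "\<lambda>v. (v \<bullet> w) / - (v \<bullet> u)"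
  define t where "t = Min (?g ` ?N)"
  have fN: "finite (?g ` ?N)" "?g ` ?N \<noteq> {}" using S(1) v0 by auto
  have "t \<in> ?g ` ?N" unfolding t_def using fN by (rule Min_in)
  then obtain v1 where v1: "v1 \<in> S" "v1 \<bullet> u < 0" "t = ?g v1" by blast
  have "v1 \<bullet> w \<noteq> 0" using S(3)[OF v1(1)] v1(2) by auto
  then have "0 < v1 \<bullet> w" using S(2)[OF v1(1)] by simp
  then have t: "0 < t" using v1 by (simp add: divide_pos_neg)
  have ge: "0 \<le> v \<bullet> (w + t *\<^sub>R u)" if v: "v \<in> S" for v
  proof (cases "v \<bullet> u < 0")
    case True
    then have "t \<le> ?g v" unfolding t_def using fN v by (intro Min_le) auto
    then have "t * - (v \<bullet> u) \<le> v \<bullet> w" using True by (subst (asm) pos_le_divide_eq) auto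
    then show ?thesis by (simp add: inner_add_right)
  next
    case False
    then show ?thesis using S(2)[OF v] t by (simp add: inner_add_right)
  qed
  have "t * (v1 \<bullet> u) = - (v1 \<bullet> w)" using v1(2) unfolding v1(3) by simp
  then have "v1 \<bullet> (w + t *\<^sub>R u) = 0" by (simp add: inner_add_right)
  then have "{v\<in>S. v \<bullet> w = 0} \<subset> {v\<in>S. v \<bullet> (w + t *\<^sub>R u) = 0}"
    using v1(1) \<open>v1 \<bullet> w \<noteq> 0\<close> S(3) by (auto simp: inner_add_right)
  then show ?thesis using t ge by blast
qed

text \<open>Among the weights with the required properties one takes a weight with the largest number of
  tight constraints; it is an inner normal vector of a facet.\<close>

lemma facet_weight:
  fixes x :: "real ^ 'n"
  assumes fA: "finite A" and c: "0 < c" and x0: "\<And>j. 0 \<le> x $ j" and a1: "\<alpha>1 \<in> A" "lookup \<alpha>1 i = 0"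
    and w: "\<And>j. 0 \<le> w $ j" "j1 \<noteq> i" "0 < w $ j1" "\<forall>\<alpha>\<in>A. w \<bullet> x \<le> c * (w \<bullet> exponent_vec \<alpha>)"
  shows "\<exists>w \<alpha>0. \<alpha>0 \<in> A \<and> (\<forall>j. 0 \<le> w j) \<and> (\<exists>j. j \<noteq> i \<and> 0 < w j) \<and> (\<forall>\<alpha>\<in>A. wt w \<alpha>0 \<le> wt w \<alpha>) \<and>
    (\<Sum>j\<in>UNIV. w j * x $ j) \<le> c * wt w \<alpha>0 \<and> 
    (\<forall>u :: real ^ 'n. (\<forall>j. w j = 0 \<longrightarrow> u $ j = 0) \<longrightarrow>
       (\<forall>\<alpha>\<in>A. wt w \<alpha> = wt w \<alpha>0 \<longrightarrow> u \<bullet> (exponent_vec \<alpha> - exponent_vec \<alpha>0) = 0) \<longrightarrow> (\<exists>c. \<forall>j. u $ j = c * w j))"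
proof -
  let ?U = "UNIV - {i}"
  have "\<exists>\<alpha>0\<in>A. \<forall>\<alpha>\<in>A. w \<bullet> exponent_vec \<alpha>0 \<le> w \<bullet> exponent_vec \<alpha>"
    using arg_min_if_finite[OF fA, of "\<lambda>\<alpha>. w \<bullet> exponent_vec \<alpha>"] a1(1) by (metis empty_iff linorder_not_less)
  then obtain \<alpha>0 where \<alpha>0: "\<alpha>0 \<in> A" "\<And>\<alpha>. \<alpha> \<in> A \<Longrightarrow> w \<bullet> exponent_vec \<alpha>0 \<le> w \<bullet> exponent_vec \<alpha>" by blast
  \<comment> \<open>The constraints on a weight: its components are nonnegative and
    \<open>\<alpha>0\<close> has least weight in \<open>A\<close>.\<close>
  define S where "S = range (\<lambda>j. axis j 1) \<union> (\<lambda>\<alpha>. exponent_vec \<alpha> - exponent_vec \<alpha>0) ` A"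
  have fS: "finite S" using fA by (simp add: S_def)
  define y where "y = x - c *\<^sub>R exponent_vec \<alpha>0"
  \<comment> \<open>The sum over the indices other than \<open>i\<close> is normalised, which keeps
    a positive component there. The inequality \<open>y \<bullet> v \<le> 0\<close>, meaning
    \<open>v \<bullet> x \<le> c * (v \<bullet> exponent_vec \<alpha>0)\<close>, is not counted
    among the tight constraints.\<close>
  define K where "K = {v. (\<forall>s\<in>S. 0 \<le> s \<bullet> v) \<and> (\<Sum>j\<in>?U. v $ j) = 1 \<and> y \<bullet> v \<le> 0}"
  define h where "h v = card {s\<in>S. s \<bullet> v = 0}" for v
  have ax: "axis j 1 \<bullet> v = v $ j" for j and v :: "real ^ 'n" by (simp add: inner_commute[of "axis j 1"] inner_axis)
  have SD: "(\<forall>s\<in>S. 0 \<le> s \<bullet> v) \<longleftrightarrow> (\<forall>j. 0 \<le> v $ j) \<and> (\<forall>\<alpha>\<in>A. v \<bullet> exponent_vec \<alpha>0 \<le> v \<bullet> exponent_vec \<alpha>)" for v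
    unfolding S_def ball_Un ball_simps ax inner_diff_left inner_commute[of v] by auto
  have "\<exists>v. v \<in> K"
  proof -
    define \<sigma> where "\<sigma> = (\<Sum>j\<in>?U. w $ j)"
    have "w $ j1 \<le> \<sigma>" unfolding \<sigma>_def by (rule member_le_sum) (use w in auto)
    then have \<sigma>: "0 < \<sigma>" using w(3) by simp
    have "y \<bullet> w \<le> 0" using w(4)[rule_format, OF \<alpha>0(1)] by (simp add: y_def inner_commute[of _ w] inner_diff_right)
    then have "(1 / \<sigma>) *\<^sub>R w \<in> K" using \<sigma> w(1) \<alpha>0(2)
      by (simp add: K_def SD sum_divide_distrib[symmetric] \<sigma>_def[symmetric] divide_right_mono divide_nonpos_pos)
    then show ?thesis by blast
  qed
  moreover have "\<forall>v. v \<in> K \<longrightarrow> h v < card S + 1" unfolding h_def using card_mono[OF fS] by (simp add: less_Suc_eq_le)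
  ultimately obtain v where v: "v \<in> K" "\<And>v'. v' \<in> K \<Longrightarrow> h v' \<le> h v"
    using ex_has_greatest_nat[of "\<lambda>v. v \<in> K" _ h "card S + 1"] by (metis less_imp_le)
  have vK: "\<And>s. s \<in> S \<Longrightarrow> 0 \<le> s \<bullet> v" "(\<Sum>j\<in>?U. v $ j) = 1" "y \<bullet> v \<le> 0" using v(1) by (auto simp: K_def)
  then have v0: "\<And>j. 0 \<le> v $ j" and vA: "\<And>\<alpha>. \<alpha> \<in> A \<Longrightarrow> v \<bullet> exponent_vec \<alpha>0 \<le> v \<bullet> exponent_vec \<alpha>" using SD[of v] by blast+
  have wv: "wt (\<lambda>j. v $ j) \<alpha> = v \<bullet> exponent_vec \<alpha>" for \<alpha> by (simp add: wt_inner)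
  \<comment> \<open>Moving \<open>v\<close> along such a \<open>u\<close> stays in \<open>K\<close>
    and would gain a tight constraint, contrary to the choice of \<open>v\<close>, provided some
    constraint decreases along \<open>u\<close>; the rest of the proof deals with the case that none
    does.\<close>
  have step: False if u: "u \<noteq> 0" "(\<Sum>j\<in>?U. u $ j) = 0" "\<And>s. s \<in> S \<Longrightarrow> s \<bullet> v = 0 \<Longrightarrow> s \<bullet> u = 0" and le: "y \<bullet> u \<le> 0" for u
  proof -
    have go: False if u: "(\<Sum>j\<in>?U. u $ j) = 0" "\<And>s. s \<in> S \<Longrightarrow> s \<bullet> v = 0 \<Longrightarrow> s \<bullet> u = 0" "y \<bullet> u \<le> 0" "s \<in> S" "s \<bullet> u < 0" for s and u :: "real ^ 'n"
    proof -
      obtain t where t: "0 < t" "\<forall>s\<in>S. 0 \<le> s \<bullet> (v + t *\<^sub>R u)" "{s\<in>S. s \<bullet> v = 0} \<subset> {s\<in>S. s \<bullet> (v + t *\<^sub>R u) = 0}"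
        using move_to_boundary[OF fS vK(1) u(2,4,5)] by blast
      have "t * (y \<bullet> u) \<le> 0" using t(1) u(3) by (simp add: mult_nonneg_nonpos)
      then have "v + t *\<^sub>R u \<in> K" using t(2) vK(2,3) u(1) by (simp add: K_def sum.distrib inner_add_right flip: sum_distrib_left)
      then have "h (v + t *\<^sub>R u) \<le> h v" by (rule v(2))
      moreover have "h v < h (v + t *\<^sub>R u)" unfolding h_def by (rule psubset_card_mono[OF _ t(3)]) (use fS in auto)
      ultimately show False by simp
    qed
    have Sj: "axis j 1 \<in> S" for j by (simp add: S_def)
    have nn: "0 \<le> u $ j" for j
    proof (rule ccontr)
      assume "\<not> 0 \<le> u $ j"
      then show False using go[OF u(2,3) le Sj[of j]] by (simp add: ax)
    qed
    have z: "u $ j = 0" if "j \<noteq> i" for j using sum_nonneg_eq_0_iff[of ?U "\<lambda>j. u $ j"] nn u(2) that by auto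
    then have "u $ i \<noteq> 0" using u(1) by (metis vec_eq_iff zero_index)
    then have ui: "0 < u $ i" using nn[of i] by simp
    have iu: "q \<bullet> u = q $ i * u $ i" for q
    proof -
      have "q \<bullet> u = (\<Sum>j\<in>{i}. q $ j * u $ j)" unfolding inner_vec_def inner_real_def by (rule sum.mono_neutral_right) (auto simp: z)
      then show ?thesis by simp
    qed
    \<comment> \<open>Now \<open>u\<close> is a positive multiple of the axis \<open>i\<close>. If
      \<open>y \<bullet> u = 0\<close>, the opposite direction can be used. Otherwise
      \<open>\<alpha>0\<close> involves z_i while \<open>\<alpha>1\<close> does not, so the
      constraint of \<open>\<alpha>1\<close> decreases along \<open>u\<close>.\<close>
    show False
    proof (cases "y \<bullet> u = 0")
      case True
      show False
      proof (rule go[of "- u", OF _ _ _ Sj[of i]])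
        show "(\<Sum>j\<in>?U. (- u) $ j) = 0" using u(2) by (simp add: sum_negf)
        show "s \<bullet> (- u) = 0" if "s \<in> S" "s \<bullet> v = 0" for s using u(3)[OF that] by simp
      qed (use True ui in \<open>simp_all add: ax\<close>)
    next
      case False
      then have "y \<bullet> u < 0" using le by simp
      then have "y $ i * u $ i < 0" by (simp only: iu)
      then have "y $ i < 0" using ui by (simp add: mult_less_0_iff)
      then have "0 < exponent_vec \<alpha>0 $ i" using x0[of i] c using zero_less_mult_pos[of c "exponent_vec \<alpha>0 $ i"] by (simp add: y_def)
      then have "(exponent_vec \<alpha>1 - exponent_vec \<alpha>0) \<bullet> u < 0" using ui a1(2) by (simp add: iu exponent_vec_def mult_less_0_iff)
      moreover have "exponent_vec \<alpha>1 - exponent_vec \<alpha>0 \<in> S" using a1(1) by (simp add: S_def)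
      ultimately show False using go[OF u(2,3) le] by blast
    qed
  qed
  have facet: "\<exists>c. \<forall>j. u $ j = c * v $ j"
    if u: "\<forall>j. v $ j = 0 \<longrightarrow> u $ j = 0" "\<forall>\<alpha>\<in>A. v \<bullet> exponent_vec \<alpha> = v \<bullet> exponent_vec \<alpha>0 \<longrightarrow> u \<bullet> (exponent_vec \<alpha> - exponent_vec \<alpha>0) = 0" for u
  proof -
    \<comment> \<open>Subtracting this multiple of \<open>v\<close> moves \<open>u\<close> into the
      hyperplane of directions that preserve the normalisation.\<close>
    define \<sigma> where "\<sigma> = (\<Sum>j\<in>?U. u $ j)"
    define u' where "u' = u - \<sigma> *\<^sub>R v"
    have s: "(\<Sum>j\<in>?U. u' $ j) = 0" using vK(2) by (simp add: u'_def sum_subtractf \<sigma>_def flip: sum_distrib_left)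
    have o: "s \<bullet> u' = 0" if "s \<in> S" "s \<bullet> v = 0" for s
    proof -
      have "s \<bullet> u = 0" using that u by (auto simp: S_def ax inner_diff_left inner_diff_right inner_commute[of v] inner_commute[of u])
      then show ?thesis using that by (simp add: u'_def inner_diff_right)
    qed
    have "u' = 0"
    proof (rule ccontr)
      assume nz: "u' \<noteq> 0"
      show False
      proof (cases "y \<bullet> u' \<le> 0")
        case True show False by (rule step[of u', OF nz s o True])
      next
        case False
        have s': "(\<Sum>j\<in>?U. (- u') $ j) = 0" using s by (simp add: sum_negf)
        have o': "s \<bullet> (- u') = 0" if "s \<in> S" "s \<bullet> v = 0" for s using o[OF that] by simp
        have "- u' \<noteq> 0" "y \<bullet> (- u') \<le> 0" using nz False by simp_all
        then show False using step[of "- u'", OF _ s' o'] by blast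
      qed
    qed
    then show ?thesis by (intro exI[of _ \<sigma>]) (simp add: u'_def vec_eq_iff)
  qed
  have "\<exists>j\<in>?U. v $ j \<noteq> 0" using vK(2) by (metis sum.neutral zero_neq_one)
  then have pos: "\<exists>j. j \<noteq> i \<and> 0 < v $ j" using v0 by (auto simp: less_le)
  show ?thesis
  proof (intro exI[of _ "\<lambda>j. v $ j"] exI[of _ \<alpha>0] conjI)
    show "(\<Sum>j\<in>UNIV. v $ j * x $ j) \<le> c * wt (($) v) \<alpha>0"
    proof -
      have "v \<bullet> x \<le> c * (v \<bullet> exponent_vec \<alpha>0)" using vK(3) by (simp add: y_def inner_commute[of _ v] inner_diff_right)
      then show ?thesis by (simp add: wv inner_vec_def)
    qed
    show "\<forall>u :: real ^ 'n. (\<forall>j. v $ j = 0 \<longrightarrow> u $ j = 0) \<longrightarrow>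
       (\<forall>\<alpha>\<in>A. wt (($) v) \<alpha> = wt (($) v) \<alpha>0 \<longrightarrow> u \<bullet> (exponent_vec \<alpha> - exponent_vec \<alpha>0) = 0) \<longrightarrow> (\<exists>c. \<forall>j. u $ j = c * v $ j)"
      unfolding wv using facet by blast
  qed (use \<alpha>0(1) v0 vA pos in \<open>auto simp: wv\<close>)
qed

text \<open>From \<open>z\<close> one can still move a little down along the axis \<open>j\<close>
  inside the polyhedron. In the case of the face this uses \<open>j \<noteq> i\<close>, which keeps
  the motion within the hyperplane.\<close>

lemma interior_weight_gt:
  assumes z: "z \<in> interior (newton_polyhedron A) \<or> z \<in> newton_face_ri i A" and w: "\<And>j. 0 \<le> w $ j" and j: "j \<noteq> i" "0 < w $ j"
    and s: "\<And>\<alpha>. \<alpha> \<in> A \<Longrightarrow> s \<le> w \<bullet> exponent_vec \<alpha>"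
  shows "s < w \<bullet> z"
proof -
  have "\<exists>e>0. z - e *\<^sub>R axis j 1 \<in> newton_polyhedron A"
    using z
  proof
    assume "z \<in> interior (newton_polyhedron A)"
    then obtain e where "0 < e" "ball z e \<subseteq> newton_polyhedron A" by (auto simp: mem_interior)
    then show ?thesis by (intro exI[of _ "e/2"]) (auto simp: dist_norm subset_iff)
  next
    assume "z \<in> newton_face_ri i A"
    then obtain U where U: "openin (top_of_set {x. x $ i = 0}) U" "z \<in> U" "U \<subseteq> newton_face i A"
      unfolding newton_face_ri_def interior_of_def by blast
    then have "\<exists>e>0. ball z e \<inter> {x. x $ i = 0} \<subseteq> U" "z \<in> {x. x $ i = 0}" unfolding openin_contains_ball by blast+
    then obtain e where e: "0 < e" "ball z e \<inter> {x. x $ i = 0} \<subseteq> U" "z $ i = 0" by blast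
    have "z - (e/2) *\<^sub>R axis j 1 \<in> ball z e \<inter> {x. x $ i = 0}" using e j by (simp add: dist_norm) (simp add: axis_def)
    then have "z - (e/2) *\<^sub>R axis j 1 \<in> newton_polyhedron A" using e(2) U(3) unfolding newton_face_def by blast
    then show ?thesis using e(1) by (intro exI[of _ "e/2"]) simp
  qed
  then obtain e where e: "0 < e" "z - e *\<^sub>R axis j 1 \<in> newton_polyhedron A" by blast
  have "s \<le> w \<bullet> (z - e *\<^sub>R axis j 1)" by (rule newton_polyhedron_ge[OF e(2) w s])
  then have "s \<le> w \<bullet> z - e * w $ j" by (simp add: inner_diff_right inner_axis)
  then show ?thesis using e(1) j(2) by (smt (verit) mult_pos_pos)
qed

section \<open>The adjoint ideal\<close>

lemma exists_exponent_0:
  assumes "\<not> ideal_gen (mpoly_monom ` A) \<subseteq> ideal_gen {var i}"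
  shows "\<exists>\<alpha>\<in>A. lookup \<alpha> i = 0"
proof (rule ccontr)
  assume n: "\<not> ?thesis"
  have "P \<in> ideal_gen {var i}" if "P \<in> ideal_gen (mpoly_monom ` A)" for P
    using that
  proof (induction rule: ideal_gen_induct)
    case (base P)
    then obtain \<alpha> where \<alpha>: "\<alpha> \<in> A" "P = mpoly_monom \<alpha>" by blast
    have "lookup \<alpha> i \<noteq> 0" using n \<alpha>(1) by auto
    then have "\<alpha> = (\<alpha> - Poly_Mapping.single i 1) + Poly_Mapping.single i 1"
      by (intro poly_mapping_eqI) (auto simp: lookup_add lookup_minus lookup_single when_def)
    then have "P = mpoly_monom (\<alpha> - Poly_Mapping.single i 1) * var i" unfolding \<alpha>(2) var_def
      by (metis mpoly_monom_add)
    then show ?case using ideal_gen_mult[OF ideal_gen_base[of "var i" "{var i}"]] by simp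
  qed (auto intro: ideal_gen_0 ideal_gen_add ideal_gen_mult)
  then show False using assms by blast
qed

lemma wt_plus_one_tilde:
  "(\<Sum>j\<in>UNIV. w j * (exponent_vec \<beta> + one_tilde i) $ j) = wt w \<beta> + (\<Sum>j\<in>UNIV - {i}. w j)"
proof -
  have "(\<Sum>j\<in>UNIV. w j * one_tilde i $ j) = (\<Sum>j\<in>UNIV - {i}. w j * one_tilde i $ j)"
    by (rule sum.mono_neutral_right) (auto simp: one_tilde_def)
  also have "\<dots> = (\<Sum>j\<in>UNIV - {i}. w j)" by (rule sum.cong) (auto simp: one_tilde_def)
  finally show ?thesis by (simp add: distrib_left sum.distrib wt_def exponent_vec_def)
qed

definition adj_cond :: "'n::finite \<Rightarrow> real \<Rightarrow> ('n \<Rightarrow>\<^sub>0 nat) set \<Rightarrow> ('n \<Rightarrow>\<^sub>0 nat) \<Rightarrow> bool" where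
  "adj_cond i c A \<beta> \<longleftrightarrow> exponent_vec \<beta> + one_tilde i \<in>
     (\<lambda>x. c *\<^sub>R x) ` interior (newton_polyhedron A) \<union> (\<lambda>x. c *\<^sub>R x) ` newton_face_ri i A"

lemma adj_cond_weight:
  assumes "adj_cond i c A \<beta>" "0 < c" and w: "\<And>j. 0 \<le> w j" "j \<noteq> i" "0 < w j" and s: "\<And>\<alpha>. \<alpha> \<in> A \<Longrightarrow> s \<le> wt w \<alpha>"
  shows "c * s < wt w \<beta> + (\<Sum>j\<in>UNIV - {i}. w j)"
proof -
  obtain z where z: "exponent_vec \<beta> + one_tilde i = c *\<^sub>R z" "z \<in> interior (newton_polyhedron A) \<or> z \<in> newton_face_ri i A"
    using assms(1) unfolding adj_cond_def by blast
  have "s < (\<chi> j. w j) \<bullet> z"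
    by (rule interior_weight_gt[OF z(2), where j = j]) (use w s in \<open>auto simp: wt_inner\<close>)
  then have "c * s < c * ((\<chi> j. w j) \<bullet> z)" using assms(2) by simp
  also have "\<dots> = (\<chi> j. w j) \<bullet> (c *\<^sub>R z)" by simp
  also have "\<dots> = (\<Sum>j\<in>UNIV. w j * (exponent_vec \<beta> + one_tilde i) $ j)" unfolding z(1)[symmetric] inner_vec_def by simp
  finally show ?thesis unfolding wt_plus_one_tilde .
qed

lemma not_adj_cond_facet:
  assumes n: "\<not> adj_cond i c A \<beta>" and "finite A" and c: "0 < c" and a1: "\<alpha>1 \<in> A" "lookup \<alpha>1 i = 0"
  obtains w \<alpha>0 j where "\<alpha>0 \<in> A" "\<And>j. 0 \<le> w j" "j \<noteq> i" "0 < w j" "\<And>\<alpha>. \<alpha> \<in> A \<Longrightarrow> wt w \<alpha>0 \<le> wt w \<alpha>"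
    "wt w \<beta> + (\<Sum>j\<in>UNIV - {i}. w j) \<le> c * wt w \<alpha>0"
    "\<forall>u :: real ^ 'n::finite. (\<forall>j. w j = 0 \<longrightarrow> u $ j = 0) \<longrightarrow>
       (\<forall>\<alpha>\<in>A. wt w \<alpha> = wt w \<alpha>0 \<longrightarrow> u \<bullet> (exponent_vec \<alpha> - exponent_vec \<alpha>0) = 0) \<longrightarrow> (\<exists>c. \<forall>j. u $ j = c * w j)"
proof -
  let ?x = "exponent_vec \<beta> + one_tilde i :: real ^ 'n"
  define z where "z = (1 / c) *\<^sub>R ?x"
  have x0: "0 \<le> ?x $ j" for j by (simp add: one_tilde_def)
  have xz: "?x = c *\<^sub>R z" using c by (simp add: z_def)
  have 1: "z \<notin> interior (newton_polyhedron A)" "z \<notin> newton_face_ri i A"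
    using n unfolding adj_cond_def xz by blast+
  have z0: "0 \<le> z $ j" for j using x0[of j] c by (simp add: z_def)
  obtain w where w: "\<forall>j. 0 \<le> w $ j" "\<exists>j. j \<noteq> i \<and> 0 < w $ j" "\<forall>\<alpha>\<in>A. w \<bullet> z \<le> w \<bullet> exponent_vec \<alpha>"
    using separating_weight[OF z0 1 a1] by blast
  obtain j1 where j1: "j1 \<noteq> i" "0 < w $ j1" using w(2) by blast
  have wx: "\<forall>\<alpha>\<in>A. w \<bullet> ?x \<le> c * (w \<bullet> exponent_vec \<alpha>)"
    unfolding xz using w(3) c by simp
  obtain w' \<alpha>0 where 2: "\<alpha>0 \<in> A" "\<forall>j. 0 \<le> w' j" "\<exists>j. j \<noteq> i \<and> 0 < w' j" "\<forall>\<alpha>\<in>A. wt w' \<alpha>0 \<le> wt w' \<alpha>"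
    "(\<Sum>j\<in>UNIV. w' j * ?x $ j) \<le> c * wt w' \<alpha>0"
    "\<forall>u :: real ^ 'n. (\<forall>j. w' j = 0 \<longrightarrow> u $ j = 0) \<longrightarrow>
       (\<forall>\<alpha>\<in>A. wt w' \<alpha> = wt w' \<alpha>0 \<longrightarrow> u \<bullet> (exponent_vec \<alpha> - exponent_vec \<alpha>0) = 0) \<longrightarrow> (\<exists>c. \<forall>j. u $ j = c * w' j)"
    using facet_weight[OF \<open>finite A\<close> c x0 a1 w(1)[rule_format] j1 wx] by (elim exE, elim conjE) (rule that)
  obtain j where j: "j \<noteq> i" "0 < w' j" using 2(3) by blast
  show thesis
  proof (rule that[of \<alpha>0 w' j])
    show "wt w' \<beta> + sum w' (UNIV - {i}) \<le> c * wt w' \<alpha>0" using 2(5) unfolding wt_plus_one_tilde .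
    show "0 \<le> w' j" for j using 2(2) by blast
    show "wt w' \<alpha>0 \<le> wt w' \<alpha>" if "\<alpha> \<in> A" for \<alpha> using 2(4) that by blast
  qed (fact 2(1,6) j)+
qed

lemma wval_coord: "wval w (coord (k :: 'n::finite)) = w k"
proof -
  have "var k \<noteq> (0 :: 'n mpoly)" using mpoly_monom_nz[of "Poly_Mapping.single k 1"] by (simp add: var_def)
  then show ?thesis using wmin_monom[of w "Poly_Mapping.single k 1"] by (simp add: coord_def wval_of_mpoly wt_single var_def)
qed

section \<open>Orders of pulled back polynomials\<close>

context bir
begin

context
  fixes E
  assumes pdv: "prime_divisor X E" and gE: "gooddiv X E"
begin

lemma has_order_pullback:
  assumes "B \<noteq> 0" shows "has_order E (ord_along X E (pullback B)) (of_mpoly B)"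
proof -
  note E = prime_divisorD[OF pdv]
  note pE = irreducible_primeset[OF E(1)]
  obtain p a j0 \<Delta> where 1: "p \<in> E" "params_dual p a \<Delta>" "loceq E p (a j0)" "unif E (a j0)"
    by (rule gooddiv_unif[OF E gE]) (rule that)
  have "of_mpoly B \<noteq> 0" using assms by simp
  then obtain k where k: "has_order E k (of_mpoly B)" using has_order_exists[OF 1(4) loc_ring_of_mpoly[OF pE E(2)]] by blast
  have "p \<in> X" using 1(1) E(2) by blast
  then have "germ p (pullback B) (of_mpoly B)" by (rule germ_pullback)
  then have "ord_along X E (pullback B) = k" by (rule ord_along_eq[OF E gE 1(1) _ k])
  then show ?thesis using k by simp
qed

lemma has_order_coord: "has_order E (ord_along X E (pullback (var k))) (coord k)"
proof -
  have "var k \<noteq> (0 :: 'n mpoly)" using mpoly_monom_nz[of "Poly_Mapping.single k 1"] by (simp add: var_def)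
  then show ?thesis unfolding coord_def by (rule has_order_pullback)
qed

lemma has_order_monom:
  "has_order E (\<Sum>k\<in>UNIV. lookup m k * ord_along X E (pullback (var k))) (of_mpoly (mpoly_monom m))"
proof -
  note E = prime_divisorD[OF pdv]
  note pE = irreducible_primeset[OF E(1)]
  obtain p a j0 \<Delta> where 1: "p \<in> E" "params_dual p a \<Delta>" "loceq E p (a j0)" "unif E (a j0)"
    by (rule gooddiv_unif[OF E gE]) (rule that)
  have "of_mpoly (mpoly_monom m) = (\<Prod>k\<in>UNIV. coord k ^ lookup m k)"
    by (simp add: mpoly_monom_prod rhom_prod[OF rhom_of_mpoly] coord_def)
  then show ?thesis
    using has_order_prod[OF pE E(2) 1(4), of UNIV, OF has_order_power[OF pE E(2) has_order_coord]] by simp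
qed

lemma ord_pullback_monomial:
  assumes "B \<noteq> 0"
  shows "\<exists>\<beta>\<in>keys B. (\<Sum>k\<in>UNIV. lookup \<beta> k * ord_along X E (pullback (var k))) \<le> ord_along X E (pullback B)"
proof -
  note E = prime_divisorD[OF pdv]
  note pE = irreducible_primeset[OF E(1)]
  let ?v = "\<lambda>m. \<Sum>k\<in>UNIV. lookup m k * ord_along X E (pullback (var k))"
  obtain p a j0 \<Delta> where 1: "p \<in> E" "params_dual p a \<Delta>" "loceq E p (a j0)" "unif E (a j0)"
    by (rule gooddiv_unif[OF E gE]) (rule that)
  have ne: "keys B \<noteq> {}" using assms by (metis keys_eq_empty)
  define l where "l = Min (?v ` keys B)"
  have "l \<in> ?v ` keys B" unfolding l_def using ne by (intro Min_in) auto
  then obtain \<beta> where \<beta>: "\<beta> \<in> keys B" "l = ?v \<beta>" by blast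
  have eq: "of_mpoly B = (\<Sum>m\<in>keys B. of_const (lookup B m) * of_mpoly (mpoly_monom m))"
  proof -
    have "of_mpoly B = of_mpoly (\<Sum>m\<in>keys B. Poly_Mapping.single m (lookup B m))" by (simp flip: mpoly_sum_singles)
    also have "\<dots> = (\<Sum>m\<in>keys B. of_mpoly (Cst (lookup B m) * mpoly_monom m))"
      by (simp only: rhom_sum[OF rhom_of_mpoly]) (simp add: Cst_def mpoly_monom_def mult_single)
    finally show ?thesis by (simp add: of_const_def)
  qed
  have "l \<le> ord_along X E (pullback B)"
  proof (rule has_order_sum_ge[OF pE E(2) 1(4)])
    show "has_order E (ord_along X E (pullback B)) (\<Sum>m\<in>keys B. of_const (lookup B m) * of_mpoly (mpoly_monom m))"
      using has_order_pullback[OF assms] by (simp only: eq)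
    fix m assume m: "m \<in> keys B"
    have "of_const (lookup B m) \<notin> max_ideal E" using max_ideal_of_const[OF pE E(2)] m by (simp add: in_keys_iff)
    then have "has_order E 0 (of_const (lookup B m))" by (rule has_order_unit[OF 1(4) loc_ring_rules(3)[OF pE E(2)]])
    then have "has_order E (0 + ?v m) (of_const (lookup B m) * of_mpoly (mpoly_monom m))" by (rule has_order_mult[OF pE E(2) _ has_order_monom])
    moreover have "l \<le> 0 + ?v m" unfolding l_def using m by simp
    ultimately show "of_const (lookup B m) * of_mpoly (mpoly_monom m) = 0 \<or> (\<exists>la\<ge>l. has_order E la (of_const (lookup B m) * of_mpoly (mpoly_monom m)))" by blast
  qed
  then show ?thesis using \<beta> by blast
qed

end

section \<open>Membership in the adjoint ideal\<close>

context
  fixes A :: "('n \<Rightarrow>\<^sub>0 nat) set" and c :: real and i :: 'n and k0 :: 'm and \<alpha>1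
  assumes fA: "finite A" and c: "0 < c" and a1: "\<alpha>1 \<in> A" "lookup \<alpha>1 i = 0" and k0: "restr i (G k0) \<noteq> 0"
    and L: "log_resolution (ideal_gen (mpoly_monom ` A)) i X"
begin

lemma gen: "p \<in> X \<Longrightarrow> \<exists>g. generates_pullback X (ideal_gen (mpoly_monom ` A)) p g"
  using L unfolding log_resolution_def by blast

lemma monom_in: "\<alpha> \<in> A \<Longrightarrow> mpoly_monom \<alpha> \<in> ideal_gen (mpoly_monom ` A)"
  by (rule ideal_gen_base) simp

text \<open>The divisors fall into two classes. If some z_j with \<open>j \<noteq> i\<close>
  vanishes on \<open>E\<close>, the strict inequality of the condition makes up for the defect 1 in
  \<open>K_lower\<close>. Otherwise \<open>F\<close> has coefficient 0 along \<open>E\<close> and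
  the claim concerns only the pair of complex n-space and the hyperplane.\<close>

lemma Adj_I:
  assumes B: "B \<noteq> 0" and k: "\<And>\<beta>. \<beta> \<in> keys B \<Longrightarrow> adj_cond i c A \<beta>"
  shows "B \<in> Adj X (ideal_gen (mpoly_monom ` A)) c i"
  unfolding Adj_def
proof (rule CollectI, intro disjI2 allI impI)
  fix E assume pdv: "prime_divisor X E"
  note E = prime_divisorD[OF pdv]
  note pE = irreducible_primeset[OF E(1)]
  note gE = gooddiv_all[OF L pdv]
  define v where "v k = ord_along X E (pullback (var k))" for k
  let ?F = "mult_F X (ideal_gen (mpoly_monom ` A)) E" and ?K = "mult_K X E"
  have v: "has_order E (v k) (coord k)" for k unfolding v_def by (rule has_order_coord[OF pdv gE])
  have vs: "real (\<Sum>k\<in>UNIV. lookup m k * v k) = wt (\<lambda>k. real (v k)) m" for m by (simp add: wt_def mult.commute)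
  obtain \<beta> where \<beta>: "\<beta> \<in> keys B" "(\<Sum>k\<in>UNIV. lookup \<beta> k * v k) \<le> ord_along X E (pullback B)"
    using ord_pullback_monomial[OF pdv gE B] unfolding v_def by blast
  obtain r where r: "has_order E ?F r" "\<forall>B\<in>ideal_gen (mpoly_monom ` A). \<exists>h\<in>loc_ring E. of_mpoly B = r * h"
    using mult_F_eq[OF E gE monom_in[OF a1(1)] mpoly_monom_nz gen] by blast
  have F: "?F \<le> (\<Sum>k\<in>UNIV. lookup \<alpha> k * v k)" if \<alpha>: "\<alpha> \<in> A" for \<alpha>
  proof -
    obtain h where h: "h \<in> loc_ring E" "of_mpoly (mpoly_monom \<alpha>) = r * h" using r(2) monom_in[OF \<alpha>] by blast
    show ?thesis
      by (rule has_order_le[OF pE E(2) r(1) h(1)]) (use has_order_monom[OF pdv gE, of \<alpha>] in \<open>simp add: h(2) v_def\<close>)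
  qed
  have Fw: "real ?F \<le> wt (\<lambda>k. real (v k)) \<alpha>" if "\<alpha> \<in> A" for \<alpha>
    using F[OF that] by (simp only: vs[symmetric] of_nat_le_iff)
  have K: "sum v UNIV \<le> ?K + 1" by (rule K_lower[OF E gE v])
  have sv: "sum v UNIV = v i + sum v (UNIV - {i})" by (rule sum.remove) auto
  have "0 \<le> int (ord_along X E (pullback B)) + (int ?K - \<lfloor>c * real ?F\<rfloor> - int (v i) + (if E = strict_transform X i then 1 else 0))"
  proof (cases "\<exists>j. j \<noteq> i \<and> 0 < v j")
    case True
    then obtain j where j: "j \<noteq> i" "0 < v j" by blast
    have "c * real ?F < wt (\<lambda>k. real (v k)) \<beta> + (\<Sum>j\<in>UNIV - {i}. real (v j))"
      by (rule adj_cond_weight[OF k[OF \<beta>(1)] c, where j = j]) (use j Fw in simp_all)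
    then have "c * real ?F < of_int (int ((\<Sum>k\<in>UNIV. lookup \<beta> k * v k) + sum v (UNIV - {i})))" by (simp flip: vs)
    \<comment> \<open>Being strictly below an integer, the floor is at most that integer minus 1;
      this pays for the 1 lost in \<open>K\<close>.\<close>
    then have "\<lfloor>c * real ?F\<rfloor> < int ((\<Sum>k\<in>UNIV. lookup \<beta> k * v k) + sum v (UNIV - {i}))" by (simp only: floor_less_iff)
    then have "0 \<le> int (ord_along X E (pullback B)) + (int ?K - \<lfloor>c * real ?F\<rfloor> - int (v i))" using \<beta>(2) K sv by linarith
    moreover have "0 \<le> (if E = strict_transform X i then 1 else 0 :: int)" by simp
    ultimately show ?thesis by linarith
  next
    case False
    then have z: "v j = 0" if "j \<noteq> i" for j using that by auto
    \<comment> \<open>The generator with exponent \<open>\<alpha>1\<close> does not involve z_i and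
      so has order 0 along \<open>E\<close>.\<close>
    have "lookup \<alpha>1 k * v k = 0" for k using z[of k] a1(2) by (cases "k = i") simp_all
    then have "(\<Sum>k\<in>UNIV. lookup \<alpha>1 k * v k) = 0" by simp
    then have F0: "?F = 0" using F[OF a1(1)] by (simp only: le_zero_eq)
    show ?thesis
    proof (cases "v i = 0 \<or> E = strict_transform X i")
      case True
      \<comment> \<open>At the strict transform the summand 1 coming from D' balances the 1 in this
        bound.\<close>
      moreover have "v i \<le> ?K + 1" using K sv by linarith
      ultimately show ?thesis using F0 by auto
    next
      case False
      then have "v i \<le> ?K" by (intro K_plt[OF pdv gE k0 v]) auto
      then show ?thesis using F0 by simp
    qed
  qed
  then show "0 \<le> int (ord_along X E (pullback B)) + (int ?K - \<lfloor>c * real ?F\<rfloor> - int (ord_along X E (pullback (var i))) + (if E = strict_transform X i then 1 else 0))"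
    by (simp only: v_def)
qed

text \<open>Along the centre of the facet weight all orders are values of the valuation divided by
  that of the uniformizer, and \<open>K\<close> is bounded above. Only one monomial
  \<open>\<beta>\<close> of \<open>B\<close> is needed, since the order of \<open>B\<close> is at
  most that of each of its monomials for a monomial valuation.\<close>

lemma Adj_D:
  assumes B: "B \<in> Adj X (ideal_gen (mpoly_monom ` A)) c i" and \<beta>: "\<beta> \<in> keys B"
  shows "adj_cond i c A \<beta>"
proof (rule ccontr)
  assume "\<not> adj_cond i c A \<beta>"
  then obtain w \<alpha>0 j where w: "\<alpha>0 \<in> A" "\<And>j. 0 \<le> w j" "j \<noteq> i" "0 < w j" "\<And>\<alpha>. \<alpha> \<in> A \<Longrightarrow> wt w \<alpha>0 \<le> wt w \<alpha>"
    "wt w \<beta> + (\<Sum>j\<in>UNIV - {i}. w j) \<le> c * wt w \<alpha>0"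
    and facet: "\<forall>u :: real ^ 'n. (\<forall>j. w j = 0 \<longrightarrow> u $ j = 0) \<longrightarrow>
       (\<forall>\<alpha>\<in>A. wt w \<alpha> = wt w \<alpha>0 \<longrightarrow> u \<bullet> (exponent_vec \<alpha> - exponent_vec \<alpha>0) = 0) \<longrightarrow> (\<exists>c. \<forall>j. u $ j = c * w j)"
    by (rule not_adj_cond_facet[OF _ fA c a1]) (rule that)
  have w1: "\<exists>j. 0 < w j" using w(4) by blast
  let ?E = "Z w"
  have facet': "\<exists>c. \<forall>j. u $ j = c * w j" if u: "\<And>j. w j = 0 \<Longrightarrow> u $ j = 0"
     "\<And>\<alpha>. \<alpha> \<in> A \<Longrightarrow> wt w \<alpha> = wt w \<alpha>0 \<Longrightarrow> u \<bullet> (exponent_vec \<alpha> - exponent_vec \<alpha>0) = 0" for u :: "real ^ 'n"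
  proof -
    have "\<forall>j. w j = 0 \<longrightarrow> u $ j = 0" "\<forall>\<alpha>\<in>A. wt w \<alpha> = wt w \<alpha>0 \<longrightarrow> u \<bullet> (exponent_vec \<alpha> - exponent_vec \<alpha>0) = 0"
      using u by simp_all
    then show ?thesis using facet by blast
  qed
  have pdv: "prime_divisor X ?E"
  proof (rule Z_prime_divisor[where A = A and ?\<alpha>0.0 = \<alpha>0 and s = "wt w \<alpha>0"])
    show "0 \<le> w j" for j by (rule w(2))
    show "wt w \<alpha>0 \<le> wt w \<alpha>" if "\<alpha> \<in> A" for \<alpha> by (rule w(5)[OF that])
    show "\<exists>g. generates_pullback X (ideal_gen (mpoly_monom ` A)) p g" if "p \<in> X" for p by (rule gen[OF that])
    show "\<exists>c. \<forall>j. u $ j = c * w j" if "\<And>j. w j = 0 \<Longrightarrow> u $ j = 0"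
     "\<And>\<alpha>. \<alpha> \<in> A \<Longrightarrow> wt w \<alpha> = wt w \<alpha>0 \<Longrightarrow> u \<bullet> (exponent_vec \<alpha> - exponent_vec \<alpha>0) = 0" for u :: "real ^ 'n"
      by (rule facet'[OF that])
  qed (fact w1 w(1) refl)+
  note E = prime_divisorD[OF pdv]
  note pE = irreducible_primeset[OF E(1)]
  note gE = gooddiv_all[OF L pdv]
  let ?I = "ideal_gen (mpoly_monom ` A)"
  let ?F = "mult_F X ?I ?E" and ?K = "mult_K X ?E" and ?N = "ord_along X ?E (pullback B)"
  define v where "v k = ord_along X ?E (pullback (var k))" for k
  have v: "has_order ?E (v k) (coord k)" for k unfolding v_def by (rule has_order_coord[OF pdv gE])
  obtain p a j0 \<Delta> where 1: "p \<in> ?E" "params_dual p a \<Delta>" "loceq ?E p (a j0)" "unif ?E (a j0)"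
    by (rule gooddiv_unif[OF E gE]) (rule that)
  \<comment> \<open>The value of the uniformizer converts between the integral orders along the
    divisor and the real weights.\<close>
  define \<tau> where "\<tau> = wval w (a j0)"
  note Zh = Z_has_order[OF w(2) w1 _ 1(4), folded \<tau>_def]
  have \<tau>: "0 < \<tau>" by (rule Zh(2)[OF v[of i]])
  have wv: "w k = real (v k) * \<tau>" for k using Zh(1)[OF v[of k]] by (simp add: wval_coord)
  have B0: "B \<noteq> 0" using \<beta> by auto
  have "real ?N * \<tau> = wmin w B" using Zh(1)[OF has_order_pullback[OF pdv gE B0]] by (simp add: wval_of_mpoly[OF B0])
  also have "\<dots> \<le> wt w \<beta>" unfolding wmin_def using \<beta> by (intro Min_le) auto
  finally have N: "real ?N * \<tau> \<le> wt w \<beta>" .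
  have F: "real ?F * \<tau> = wt w \<alpha>0"
  proof -
    obtain r N C h where r: "has_order ?E ?F r" "\<forall>B\<in>?I. \<exists>h\<in>loc_ring ?E. of_mpoly B = r * h"
      "\<forall>k<(N::nat). C k \<in> ?I \<and> h k \<in> loc_ring ?E" "r = (\<Sum>k<N. h k * of_mpoly (C k))"
      using mult_F_eq[OF E gE monom_in[OF a1(1)] mpoly_monom_nz gen] by blast
    have "wval w r = wt w \<alpha>0"
      by (rule Z_wval_generator(2)[OF w(2) w1 w(5,1) refl r(2)[rule_format] r(4) r(3)[rule_format]])
    then show ?thesis using Zh(1)[OF r(1)] by simp
  qed
  have K: "?K + 1 \<le> sum v UNIV" by (rule Z_K_upper[OF w(2) w1 gE v])
  have sv: "sum v UNIV = v i + sum v (UNIV - {i})" by (rule sum.remove) auto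
  \<comment> \<open>So the summand 1 of D' is absent for this divisor: z_j vanishes on it, but not
    on the strict transform.\<close>
  have ne: "?E \<noteq> strict_transform X i"
  proof
    assume e: "?E = strict_transform X i"
    obtain q where "q \<in> strict_transform X i" "fst q $ j \<noteq> 0" using strict_transform_notin[OF k0 w(3)] by blast
    then show False using Z_coord[OF w(2) w1 w(4), of q] e by blast
  qed
  have "0 \<le> int ?N + (int ?K - \<lfloor>c * real ?F\<rfloor> - int (v i) + (if ?E = strict_transform X i then 1 else 0))"
    using B B0 pdv unfolding Adj_def v_def by blast
  then have "0 \<le> int ?N + (int ?K - \<lfloor>c * real ?F\<rfloor> - int (v i))" using ne by simp
  then have "\<lfloor>c * real ?F\<rfloor> < int (?N + sum v (UNIV - {i}))" using K sv by linarith
  then have "c * real ?F < real (?N + sum v (UNIV - {i}))" by (simp only: floor_less_iff of_int_of_nat_eq)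
  then have "c * real ?F * \<tau> < real (?N + sum v (UNIV - {i})) * \<tau>" using \<tau> by simp
  also have "\<dots> = real ?N * \<tau> + (\<Sum>j\<in>UNIV - {i}. w j)" by (simp add: wv algebra_simps sum_distrib_left)
  also have "\<dots> \<le> wt w \<beta> + (\<Sum>j\<in>UNIV - {i}. w j)" using N by simp
  also have "\<dots> \<le> c * wt w \<alpha>0" by (rule w(6))
  also have "\<dots> = c * real ?F * \<tau>" by (simp add: F[symmetric])
  finally show False by simp
qed

lemma Adj_mult:
  assumes B: "B \<in> Adj X (ideal_gen (mpoly_monom ` A)) c i" shows "Q * B \<in> Adj X (ideal_gen (mpoly_monom ` A)) c i"
proof (cases "Q * B = 0")
  case True then show ?thesis by (simp add: Adj_def)
next
  case False
  then have nz: "Q \<noteq> 0" "B \<noteq> 0" by auto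
  show ?thesis unfolding Adj_def
  proof (rule CollectI, intro disjI2 allI impI)
    fix E assume pdv: "prime_divisor X E"
    note E = prime_divisorD[OF pdv]
    note pE = irreducible_primeset[OF E(1)]
    note gE = gooddiv_all[OF L pdv]
    have "has_order E (ord_along X E (pullback (Q * B))) (of_mpoly B * of_mpoly Q)"
      using has_order_pullback[OF pdv gE False] by (simp add: mult.commute)
    then have le: "ord_along X E (pullback B) \<le> ord_along X E (pullback (Q * B))"
      by (rule has_order_le[OF pE E(2) has_order_pullback[OF pdv gE nz(2)] loc_ring_of_mpoly[OF pE E(2)]])
    have "0 \<le> int (ord_along X E (pullback B)) + (int (mult_K X E) - \<lfloor>c * real (mult_F X (ideal_gen (mpoly_monom ` A)) E)\<rfloor>
           - int (ord_along X E (pullback (var i))) + (if E = strict_transform X i then 1 else 0))"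
      using B nz(2) pdv unfolding Adj_def by blast
    then show "0 \<le> int (ord_along X E (pullback (Q * B))) + (int (mult_K X E) - \<lfloor>c * real (mult_F X (ideal_gen (mpoly_monom ` A)) E)\<rfloor>
           - int (ord_along X E (pullback (var i))) + (if E = strict_transform X i then 1 else 0))"
      using le by linarith
  qed
qed

lemma keys_monom: "keys (mpoly_monom m) = {m}" by (simp add: mpoly_monom_def)

lemma Adj_monom_iff: "mpoly_monom \<beta> \<in> Adj X (ideal_gen (mpoly_monom ` A)) c i \<longleftrightarrow> adj_cond i c A \<beta>"
  using Adj_I[OF mpoly_monom_nz, of \<beta>] Adj_D[of "mpoly_monom \<beta>" \<beta>] by (auto simp: keys_monom)

text \<open>\<open>Adj_D\<close> and \<open>Adj_I\<close> concern all monomials of a polynomial, so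
  membership is decided monomial by monomial; closure under addition comes for free.\<close>

lemma Adj_eq: "Adj X (ideal_gen (mpoly_monom ` A)) c i = ideal_gen (mpoly_monom ` {\<beta>. adj_cond i c A \<beta>})"
proof (intro equalityI subsetI)
  fix B assume B: "B \<in> Adj X (ideal_gen (mpoly_monom ` A)) c i"
  have "(\<Sum>m\<in>keys B. Cst (lookup B m) * mpoly_monom m) \<in> ideal_gen (mpoly_monom ` {\<beta>. adj_cond i c A \<beta>})"
    by (rule ideal_gen_sum, rule ideal_gen_mult, rule ideal_gen_base) (simp add: Adj_D[OF B])
  moreover have "(\<Sum>m\<in>keys B. Cst (lookup B m) * mpoly_monom m) = B"
  proof -
    have "(\<Sum>m\<in>keys B. Cst (lookup B m) * mpoly_monom m) = (\<Sum>m\<in>keys B. Poly_Mapping.single m (lookup B m))"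
      by (simp add: Cst_def mpoly_monom_def mult_single)
    also have "\<dots> = B" by (rule mpoly_sum_singles[symmetric])
    finally show ?thesis .
  qed
  ultimately show "B \<in> ideal_gen (mpoly_monom ` {\<beta>. adj_cond i c A \<beta>})" by simp
next
  \<comment> \<open>The exponents satisfying the condition are closed under addition of arbitrary
    exponents; this is read off from the adjoint side instead of from the polyhedron.\<close>
  have up: "adj_cond i c A (\<gamma> + \<beta>)" if "adj_cond i c A \<beta>" for \<beta> \<gamma>
    using that Adj_mult[of "mpoly_monom \<beta>" "mpoly_monom \<gamma>"] by (simp add: Adj_monom_iff flip: mpoly_monom_add)
  fix B assume "B \<in> ideal_gen (mpoly_monom ` {\<beta>. adj_cond i c A \<beta>})"
  then have "\<forall>\<beta>\<in>keys B. adj_cond i c A \<beta>"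
  proof (induction rule: ideal_gen_induct)
    case (add P Q)
    then show ?case using Poly_Mapping.keys_add[of P Q] by blast
  next
    case (mult P Q)
    then show ?case using keys_mult[of Q P] up by blast
  next
    case (base P)
    then show ?case by (auto simp: keys_monom)
  qed simp
  then show "B \<in> Adj X (ideal_gen (mpoly_monom ` A)) c i"
    using Adj_I[of B] by (cases "B = 0") (auto simp: Adj_def)
qed

end

end

theorem theoremB:
  fixes A :: "('n::finite \<Rightarrow>\<^sub>0 nat) set"
    and i :: 'n
    and c :: real
    and X :: "('n, 'm::finite) pt set"
  assumes "finite A"
    and "\<not> ideal_gen (mpoly_monom ` A) \<subseteq> ideal_gen {var i}"
    and "c > 0"
    and "log_resolution (ideal_gen (mpoly_monom ` A)) i X"
  shows "monomial_ideal (Adj X (ideal_gen (mpoly_monom ` A)) c i) \<and>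
    (\<forall>\<beta>. mpoly_monom \<beta> \<in> Adj X (ideal_gen (mpoly_monom ` A)) c i \<longleftrightarrow>
       exponent_vec \<beta> + one_tilde i \<in>
         (\<lambda>x. c *\<^sub>R x) ` interior (newton_polyhedron A) \<union>
         (\<lambda>x. c *\<^sub>R x) ` newton_face_ri i A)"
proof -
  obtain \<alpha>1 where a1: "\<alpha>1 \<in> A" "lookup \<alpha>1 i = 0" using exists_exponent_0[OF assms(2)] by blast
  have irr: "irreducible_closed X" and "\<exists>z. iso_over X z" using assms(4) unfolding log_resolution_def by blast+
  then obtain z where z: "iso_over X z" by blast
  \<comment> \<open>The presentation is chosen with the \<open>G j\<close> not all divisible by z_i,
    so that the graph over the hyperplane describes the strict transform.\<close>
  obtain f G k where b: "bir X f G" "restr i (G k) \<noteq> 0" by (rule bir_exists[OF irr z])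
  note h = assms(1,3) a1 b(2) assms(4)
  show ?thesis
    unfolding monomial_ideal_def adj_cond_def[symmetric]
    using bir.Adj_eq[OF b(1) h] bir.Adj_monom_iff[OF b(1) h] by blast
qed

end
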